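(* Let $d,d'$ be positive integers. (a) (Volterra equation.) Let $\mu\in M(\mathbb{R}_+,\mathbb{R}^{d\times d})$, with $\alpha^*,\alpha,n,N,\beta_j,P_j^*,Q_j^*$ defined from $\mu$ as in part (a) of the context, and suppose $\alpha^*<\alpha$. Let $f\in C([0,\infty);\mathbb{R}^d)$ with $\int_0^\infty e^{-\alpha t}|f(t)|\,dt<\infty$ and $\Sigma\in C([0,\infty);\mathbb{R}^{d\times d'})$ with $\int_0^\infty e^{-2\alpha t}\|\Sigma(t)\|^2dt<\infty$. Let $X_0$ be $\mathbb{R}^d$-valued, $\mathcal{F}_0$-measurable with $\mathbb{E}|X_0|^2<\infty$, and let $X$ be the unique continuous adapted solution of $dX(t)=\big(f(t)+\int_{[0,t]}\mu(ds)X(t-s)\big)dt+\Sigma(t)\,dB(t)$, $t\ge0$, $X(0)=X_0$. Then $$\lim_{t\to\infty}\mathbb{E}\left[\Big\|\frac{X(t)}{t^ne^{\alpha t}}-\sum_{j=1}^N\{(Q_j^*X_0+M_{1,j})\sin(\beta_jt)+(P_j^*X_0+M_{2,j})\cos(\beta_jt)\}\Big\|^2\right]=0 .$$ (b) (Finite delay equation.) Let $\tau\ge0$, $\nu\in M([-\tau,0],\mathbb{R}^{d\times d})$, with $\alpha,n,N,\beta_j,P_j^*,Q_j^*$ defined from $\nu$ as in part (b) of the context. Let $f\in C([0,\infty);\mathbb{R}^d)$ with $\int_0^\infty e^{-\alpha t}|f(t)|\,dt<\infty$ and $\Sigma\in C([0,\infty);\mathbb{R}^{d\times d'})$ with $\int_0^\infty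 e^{-2\alpha t}\|\Sigma(t)\|^2dt<\infty$. Let $\phi\in C([-\tau,0],\mathbb{R}^d)$ and let $X$ be the unique adapted strong solution of $dX(t)=\big(f(t)+\int_{[-\tau,0]}\nu(ds)X(t+s)\big)dt+\Sigma(t)\,dB(t)$, $t\ge0$, $X(t)=\phi(t)$ for $t\in[-\tau,0]$. Then $$\lim_{t\to\infty}\mathbb{E}\left[\Big\|\frac{X(t)}{t^ne^{\alpha t}}-\sum_{j=1}^N\{J_{1,j}\sin(\beta_jt)+J_{2,j}\cos(\beta_jt)\}\Big\|^2\right]=0,$$ where $J_{1,j}=Q_j^*\phi(0)+G_{1,j}+M_{1,j}$, $J_{2,j}=P_j^*\phi(0)+G_{2,j}+M_{2,j}$ and $$G_{1,j}=\int_{-\tau}^0\int_{[-\tau,u]}e^{\alpha u}\{Q_j^*\cos(\beta_ju)-P_j^*\sin(\beta_ju)\}\nu(ds)\,\phi(s-u)\,du,$$ $$G_{2,j}=\int_{-\tau}^0\int_{[-\tau,u]}e^{\alpha u}\{P_j^*\cos(\beta_ju)+Q_j^*\sin(\beta_ju)\}\nu(ds)\,\phi(s-u)\,du .$$ In both parts, $$M_{1,j}=\int_0^\infty e^{-\alpha s}\{P_j^*\sin(\beta_js)+Q_j^*\cos(\beta_js)\}\Sigma(s)\,dB(s)+\int_0^\infty e^{-\alpha s}\{P_j^*\sin(\beta_js)+Q_j^*\cos(\beta_js)\}f(s)\,ds,$$ $$M_{2,j}=\int_0^\infty e^{-\alpha s}\{P_j^*\cos(\beta_js)-Q_j^*\sin(\beta_js)\}\Sigma(s)\,dB(s)+\int_0^\infty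 e^{-\alpha s}\{P_j^*\cos(\beta_js)-Q_j^*\sin(\beta_js)\}f(s)\,ds .$$
   Context: $\mathbb{R}_+=[0,\infty)$; $M(J,\mathbb{R}^{d\times d})$ is the space of finite $\mathbb{R}^{d\times d}$-valued Borel measures on $J$, $|\mu|$ the total variation measure; $|\cdot|$, $\|\cdot\|$ are norms on finite-dimensional spaces (Euclidean / Frobenius). $(\Omega,\mathcal{F},P)$ is a complete probability space with filtration $(\mathcal{F}_t)_{t\ge0}$ and $B$ is a standard $d'$-dimensional Brownian motion with respect to it. (a) $\alpha^*=\inf\{a\in\mathbb{R}:\int_{[0,\infty)}e^{-as}|\mu|(ds)<\infty\}$; for $\Re(\lambda)>\alpha^*$ put $\Delta(\lambda)=\lambda I_d-\int_{[0,\infty)}e^{-\lambda s}\mu(ds)$; $\Lambda=\{\lambda:\Re(\lambda)>\alpha^*,\det\Delta(\lambda)=0\}$. (b) For $\lambda\in\mathbb{C}$ put $\Delta(\lambda)=\lambda I_d-\int_{[-\tau,0]}e^{\lambda s}\nu(ds)$; $\Lambda=\{\lambda:\det\Delta(\lambda)=0\}$. In both cases: $\alpha=\sup\{\Re(\lambda):\lambda\in\Lambda\}$; $\Lambda''=\{\lambda\in\Lambda:\Re(\lambda)=\alpha,\Im(\lambda)\ge0\}$ (finite and nonempty under the stated hypotheses). The order of an element of $\Lambda''$ is its order as a pole of $\Delta(\lambda)^{-1}$; $n\ge0$ is the integer such that $n+1$ is the highest order of all elements of $\Lambda''$; $\lambda_1,\dots,\lambda_N$ are the elements of $\Lambda''$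 of order $n+1$; $\beta_j=\Im(\lambda_j)$. Write $\Delta(\lambda)^{-1}=\sum_{m=0}^n m!\,K_{j,m}(\lambda-\lambda_j)^{-(m+1)}+\hat q_j(\lambda)$ with $\hat q_j$ analytic at $\lambda_j$. If $\lambda_j$ is real, $P_j^*=K_{j,n}$ and $Q_j^*=0$; otherwise $P_j^*=2\Re(K_{j,n})$, $Q_j^*=-2\Im(K_{j,n})$ (entrywise). *)

theory Defs
  imports "HOL-Probability.Probability" "HOL-Complex_Analysis.Complex_Analysis"
begin

section \<open>Matrix-valued measures\<close>

text \<open>
  A finite matrix-valued Borel measure on a Borel set \<open>J\<close> of reals is a countably additive
  set function on the Borel subsets of \<open>J\<close>; its values on other sets play no role.
  Since all values are matrices with real entries, such a measure is automatically finite.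
\<close>

definition matrix_measure :: "real set \<Rightarrow> (real set \<Rightarrow> real^'d^'d) \<Rightarrow> bool" where
  "matrix_measure J \<mu> \<longleftrightarrow>
     (\<forall>A. range A \<subseteq> sets (restrict_space borel J) \<longrightarrow> disjoint_family A \<longrightarrow>
        (\<lambda>i::nat. \<mu> (A i)) sums \<mu> (\<Union>i. A i))"

definition total_variation :: "real set \<Rightarrow> (real set \<Rightarrow> real^'d^'d) \<Rightarrow> real measure" where
  "total_variation J \<mu> = measure_of J (sets (restrict_space borel J))
     (\<lambda>E. SUP \<P>\<in>{\<P>. finite \<P> \<and> disjoint \<P> \<and> \<P> \<subseteq> sets (restrict_space borel J) \<and> \<Union>\<P> = E}.
        \<Sum>A\<in>\<P>. ennreal (norm (\<mu> A)))"

text \<open>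
  Integrals with respect to a finite signed measure \<open>m\<close> go through its Jordan decomposition.
  In the positive variation, \<open>ennreal\<close> sends negative numbers to 0, and \<open>m {} = 0\<close>
  contributes to the supremum anyway.
\<close>

definition pos_variation :: "real set \<Rightarrow> (real set \<Rightarrow> real) \<Rightarrow> real measure" where
  "pos_variation J m = measure_of J (sets (restrict_space borel J))
     (\<lambda>E. SUP A\<in>{A \<in> sets (restrict_space borel J). A \<subseteq> E}. ennreal (m A))"

definition signed_integral ::
  "real set \<Rightarrow> (real set \<Rightarrow> real) \<Rightarrow> (real \<Rightarrow> 'b::{banach,second_countable_topology}) \<Rightarrow> 'b" where
  "signed_integral J m g =
     (LINT s|pos_variation J m. g s) - (LINT s|pos_variation J (\<lambda>A. - m A). g s)"

definition scalar_integral ::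
  "real set \<Rightarrow> (real set \<Rightarrow> real^'d^'d) \<Rightarrow> (real \<Rightarrow> complex) \<Rightarrow> complex^'d^'d" where
  "scalar_integral J \<mu> g = (\<chi> i k. signed_integral J (\<lambda>A. \<mu> A $ i $ k) g)"

text \<open>The vector \<open>\<integral> \<mu>(ds) x(s)\<close> over \<open>J\<close>.\<close>

definition vector_integral ::
  "real set \<Rightarrow> (real set \<Rightarrow> real^'d^'d) \<Rightarrow> (real \<Rightarrow> real^'d) \<Rightarrow> real^'d" where
  "vector_integral J \<mu> x = (\<chi> i. \<Sum>k\<in>UNIV. signed_integral J (\<lambda>A. \<mu> A $ i $ k) (\<lambda>s. x s $ k))"


section \<open>Characteristic matrices and their roots\<close>

text \<open>Suprema and infima of real parts are extended reals: \<open>\<alpha>\<^sup>*\<close> may be \<open>-\<infinity>\<close>.\<close>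

definition alpha_star :: "(real set \<Rightarrow> real^'d^'d) \<Rightarrow> ereal" where
  "alpha_star \<mu> =
     (INF a\<in>{a. (\<integral>\<^sup>+s. ennreal (exp (- a * s)) \<partial>total_variation {0..} \<mu>) < \<infinity>}. ereal a)"

definition volterra_char :: "(real set \<Rightarrow> real^'d^'d) \<Rightarrow> complex \<Rightarrow> complex^'d^'d" where
  "volterra_char \<mu> z = mat z - scalar_integral {0..} \<mu> (\<lambda>s. exp (- z * of_real s))"

definition volterra_roots :: "(real set \<Rightarrow> real^'d^'d) \<Rightarrow> complex set" where
  "volterra_roots \<mu> = {z. ereal (Re z) > alpha_star \<mu> \<and> det (volterra_char \<mu> z) = 0}"

definition delay_char :: "real \<Rightarrow> (real set \<Rightarrow> real^'d^'d) \<Rightarrow> complex \<Rightarrow> complex^'d^'d" where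
  "delay_char \<tau> \<nu> z = mat z - scalar_integral {-\<tau>..0} \<nu> (\<lambda>s. exp (z * of_real s))"

definition delay_roots :: "real \<Rightarrow> (real set \<Rightarrow> real^'d^'d) \<Rightarrow> complex set" where
  "delay_roots \<tau> \<nu> = {z. det (delay_char \<tau> \<nu> z) = 0}"

definition root_abscissa :: "complex set \<Rightarrow> ereal" where
  "root_abscissa \<Lambda> = (SUP z\<in>\<Lambda>. ereal (Re z))"

text \<open>The set \<open>\<Lambda>''\<close>.\<close>

definition rightmost_roots :: "complex set \<Rightarrow> complex set" where
  "rightmost_roots \<Lambda> = {z \<in> \<Lambda>. ereal (Re z) = root_abscissa \<Lambda> \<and> Im z \<ge> 0}"

text \<open>
  The order of a pole of a matrix-valued function is the largest order of a pole of its entries.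
\<close>

definition pole_order :: "(complex \<Rightarrow> complex^'d^'d) \<Rightarrow> complex \<Rightarrow> nat" where
  "pole_order G z = (MAX (i, k)\<in>UNIV.
     if is_pole (\<lambda>w. G w $ i $ k) z then nat (- zorder (\<lambda>w. G w $ i $ k) z) else 0)"

text \<open>The integer \<open>n\<close>; all elements of \<open>\<Lambda>''\<close> have order at least 1, so nothing is truncated.\<close>

definition leading_exponent :: "(complex \<Rightarrow> complex^'d^'d) \<Rightarrow> complex set \<Rightarrow> nat" where
  "leading_exponent \<Delta> \<Lambda> =
     (MAX z\<in>rightmost_roots \<Lambda>. pole_order (\<lambda>w. matrix_inv (\<Delta> w)) z) - 1"

text \<open>The set \<open>{\<lambda>\<^sub>1, \<dots>, \<lambda>\<^sub>N}\<close>.\<close>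

definition leading_roots :: "(complex \<Rightarrow> complex^'d^'d) \<Rightarrow> complex set \<Rightarrow> complex set" where
  "leading_roots \<Delta> \<Lambda> = {z \<in> rightmost_roots \<Lambda>.
     pole_order (\<lambda>w. matrix_inv (\<Delta> w)) z = leading_exponent \<Delta> \<Lambda> + 1}"

definition polar_expansion ::
  "(complex \<Rightarrow> complex^'d^'d) \<Rightarrow> complex \<Rightarrow> nat \<Rightarrow> (nat \<Rightarrow> complex^'d^'d) \<Rightarrow> bool" where
  "polar_expansion G z n K \<longleftrightarrow>
     (\<exists>q :: complex \<Rightarrow> complex^'d^'d. \<forall>i k.
        (\<lambda>w. q w $ i $ k) analytic_on {z} \<and>
        (\<forall>\<^sub>F w in at z. G w $ i $ k =
           (\<Sum>m\<le>n. fact m * K m $ i $ k / (w - z) ^ (m + 1)) + q w $ i $ k))"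

text \<open>The matrix \<open>K\<^sub>j\<^sub>,\<^sub>n\<close>; the expansion determines \<open>K 0, \<dots>, K n\<close> uniquely.\<close>

definition leading_coeff_matrix ::
  "(complex \<Rightarrow> complex^'d^'d) \<Rightarrow> complex set \<Rightarrow> complex \<Rightarrow> complex^'d^'d" where
  "leading_coeff_matrix \<Delta> \<Lambda> z =
     (let n = leading_exponent \<Delta> \<Lambda>
      in (SOME K. polar_expansion (\<lambda>w. matrix_inv (\<Delta> w)) z n K) n)"

definition P_star :: "(complex \<Rightarrow> complex^'d^'d) \<Rightarrow> complex set \<Rightarrow> complex \<Rightarrow> real^'d^'d" where
  "P_star \<Delta> \<Lambda> z =
     (if z \<in> \<real> then (\<chi> i k. Re (leading_coeff_matrix \<Delta> \<Lambda> z $ i $ k))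
      else (\<chi> i k. 2 * Re (leading_coeff_matrix \<Delta> \<Lambda> z $ i $ k)))"
  \<comment> \<open>For real \<open>z\<close> the matrix \<open>K\<close> has real entries, so that \<open>Re\<close> only changes its type.\<close>

definition Q_star :: "(complex \<Rightarrow> complex^'d^'d) \<Rightarrow> complex set \<Rightarrow> complex \<Rightarrow> real^'d^'d" where
  "Q_star \<Delta> \<Lambda> z =
     (if z \<in> \<real> then 0
      else (\<chi> i k. - 2 * Im (leading_coeff_matrix \<Delta> \<Lambda> z $ i $ k)))"


section \<open>Brownian motion and the Ito integral\<close>

text \<open>Processes and filtrations are indexed by reals; negative times are ignored.\<close>

definition filtration_on :: "'a measure \<Rightarrow> (real \<Rightarrow> 'a measure) \<Rightarrow> bool" where
  "filtration_on M \<F> \<longleftrightarrow>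
     (\<forall>t\<ge>0. subalgebra M (\<F> t)) \<and> (\<forall>s t. 0 \<le> s \<longrightarrow> s \<le> t \<longrightarrow> sets (\<F> s) \<subseteq> sets (\<F> t))"

definition brownian_motion ::
  "'a measure \<Rightarrow> (real \<Rightarrow> 'a measure) \<Rightarrow> (real \<Rightarrow> 'a \<Rightarrow> real^'e) \<Rightarrow> bool" where
  "brownian_motion M \<F> B \<longleftrightarrow>
     (\<forall>t\<ge>0. B t \<in> borel_measurable (\<F> t)) \<and>
     (AE \<omega> in M. B 0 \<omega> = 0) \<and>
     (AE \<omega> in M. continuous_on {0..} (\<lambda>t. B t \<omega>)) \<and>
     (\<forall>s t. 0 \<le> s \<longrightarrow> s < t \<longrightarrow>
        distributed M lborel (\<lambda>\<omega>. B t \<omega> - B s \<omega>)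
          (\<lambda>x. ennreal (\<Prod>i\<in>UNIV. normal_density 0 (sqrt (t - s)) (x $ i))) \<and>
        prob_space.indep_set M (sets (\<F> s))
          {(\<lambda>\<omega>. B t \<omega> - B s \<omega>) -` A \<inter> space M |A. A \<in> sets borel})"

text \<open>
  Elementary integrands are bounded and given by a partition \<open>p 0 \<le> \<dots> \<le> p m\<close>,
  with an \<open>\<F> (p i)\<close>-measurable value \<open>\<xi> i\<close> on \<open>(p i, p (i + 1)]\<close>.
\<close>

definition elementary ::
  "'a measure \<Rightarrow> (real \<Rightarrow> 'a measure) \<Rightarrow> nat \<Rightarrow> (nat \<Rightarrow> real) \<Rightarrow> (nat \<Rightarrow> 'a \<Rightarrow> real^'e^'d) \<Rightarrow> bool" where
  "elementary M \<F> m p \<xi> \<longleftrightarrow>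
     0 \<le> p 0 \<and> (\<forall>i<m. p i \<le> p (Suc i)) \<and>
     (\<forall>i<m. \<xi> i \<in> borel_measurable (\<F> (p i)) \<and> (\<exists>C. \<forall>\<omega>\<in>space M. norm (\<xi> i \<omega>) \<le> C))"

definition elementary_process ::
  "nat \<Rightarrow> (nat \<Rightarrow> real) \<Rightarrow> (nat \<Rightarrow> 'a \<Rightarrow> real^'e^'d) \<Rightarrow> real \<Rightarrow> 'a \<Rightarrow> real^'e^'d" where
  "elementary_process m p \<xi> s \<omega> = (\<Sum>i<m. indicator {p i<..p (Suc i)} s *\<^sub>R \<xi> i \<omega>)"

definition elementary_integral ::
  "(real \<Rightarrow> 'a \<Rightarrow> real^'e) \<Rightarrow> nat \<Rightarrow> (nat \<Rightarrow> real) \<Rightarrow> (nat \<Rightarrow> 'a \<Rightarrow> real^'e^'d) \<Rightarrow> 'a \<Rightarrow> real^'d" where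
  "elementary_integral B m p \<xi> \<omega> = (\<Sum>i<m. \<xi> i \<omega> *v (B (p (Suc i)) \<omega> - B (p i) \<omega>))"

text \<open>
  \<open>I\<close> is (a version of) the Ito integral of \<open>H\<close> over \<open>[0,\<infinity>)\<close>: the mean-square limit of the
  integrals of elementary integrands that approximate \<open>H\<close> in \<open>L\<^sup>2(dt \<otimes> P)\<close>.
\<close>

definition has_ito_integral ::
  "'a measure \<Rightarrow> (real \<Rightarrow> 'a measure) \<Rightarrow> (real \<Rightarrow> 'a \<Rightarrow> real^'e) \<Rightarrow>
    (real \<Rightarrow> 'a \<Rightarrow> real^'e^'d) \<Rightarrow> ('a \<Rightarrow> real^'d) \<Rightarrow> bool" where
  "has_ito_integral M \<F> B H I \<longleftrightarrow>
     (\<lambda>(s, \<omega>). indicator {0..} s *\<^sub>R H s \<omega>) \<in> borel_measurable (lborel \<Otimes>\<^sub>M M) \<and>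
     I \<in> borel_measurable M \<and>
     (\<exists>m p \<xi>. (\<forall>k::nat. elementary M \<F> (m k) (p k) (\<xi> k)) \<and>
        (\<lambda>k. \<integral>\<^sup>+\<omega>. (\<integral>\<^sup>+s\<in>{0..}.
            ennreal ((norm (H s \<omega> - elementary_process (m k) (p k) (\<xi> k) s \<omega>))\<^sup>2) \<partial>lborel) \<partial>M)
          \<longlonglongrightarrow> 0 \<and>
        (\<lambda>k. \<integral>\<^sup>+\<omega>. ennreal ((norm (I \<omega> - elementary_integral B (m k) (p k) (\<xi> k) \<omega>))\<^sup>2) \<partial>M)
          \<longlonglongrightarrow> 0)"

definition ito_integral ::
  "'a measure \<Rightarrow> (real \<Rightarrow> 'a measure) \<Rightarrow> (real \<Rightarrow> 'a \<Rightarrow> real^'e) \<Rightarrow>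
    (real \<Rightarrow> 'a \<Rightarrow> real^'e^'d) \<Rightarrow> 'a \<Rightarrow> real^'d" where
  "ito_integral M \<F> B H = (SOME I. has_ito_integral M \<F> B H I)"
  \<comment> \<open>Determined up to equality almost everywhere.\<close>


section \<open>Solutions\<close>

definition volterra_solution ::
  "'a measure \<Rightarrow> (real \<Rightarrow> 'a measure) \<Rightarrow> (real \<Rightarrow> 'a \<Rightarrow> real^'e) \<Rightarrow> (real set \<Rightarrow> real^'d^'d) \<Rightarrow>
    (real \<Rightarrow> real^'d) \<Rightarrow> (real \<Rightarrow> real^'e^'d) \<Rightarrow> ('a \<Rightarrow> real^'d) \<Rightarrow> (real \<Rightarrow> 'a \<Rightarrow> real^'d) \<Rightarrow> bool" where
  "volterra_solution M \<F> B \<mu> f \<Sigma> X0 X \<longleftrightarrow>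
     (\<forall>t\<ge>0. X t \<in> borel_measurable (\<F> t)) \<and>
     (AE \<omega> in M. continuous_on {0..} (\<lambda>t. X t \<omega>)) \<and>
     (AE \<omega> in M. X 0 \<omega> = X0 \<omega>) \<and>
     (\<forall>t\<ge>0. AE \<omega> in M. X t \<omega> = X0 \<omega>
        + (LINT s:{0..t}|lborel. f s + vector_integral {0..} \<mu> (\<lambda>u. indicator {0..s} u *\<^sub>R X (s - u) \<omega>))
        + ito_integral M \<F> B (\<lambda>s \<omega>. indicator {0..t} s *\<^sub>R \<Sigma> s) \<omega>)"

definition delay_solution ::
  "'a measure \<Rightarrow> (real \<Rightarrow> 'a measure) \<Rightarrow> (real \<Rightarrow> 'a \<Rightarrow> real^'e) \<Rightarrow> real \<Rightarrow> (real set \<Rightarrow> real^'d^'d) \<Rightarrow>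
    (real \<Rightarrow> real^'d) \<Rightarrow> (real \<Rightarrow> real^'e^'d) \<Rightarrow> (real \<Rightarrow> real^'d) \<Rightarrow> (real \<Rightarrow> 'a \<Rightarrow> real^'d) \<Rightarrow> bool" where
  "delay_solution M \<F> B \<tau> \<nu> f \<Sigma> \<phi> X \<longleftrightarrow>
     (\<forall>t\<ge>0. X t \<in> borel_measurable (\<F> t)) \<and>
     (AE \<omega> in M. continuous_on {-\<tau>..} (\<lambda>t. X t \<omega>)) \<and>
     (AE \<omega> in M. \<forall>t\<in>{-\<tau>..0}. X t \<omega> = \<phi> t) \<and>
     (\<forall>t\<ge>0. AE \<omega> in M. X t \<omega> = \<phi> 0
        + (LINT s:{0..t}|lborel. f s + vector_integral {-\<tau>..0} \<nu> (\<lambda>u. X (s + u) \<omega>))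
        + ito_integral M \<F> B (\<lambda>s \<omega>. indicator {0..t} s *\<^sub>R \<Sigma> s) \<omega>)"


section \<open>Coefficients of the limit\<close>

text \<open>
  Below, \<open>P\<close>, \<open>Q\<close> and \<open>\<beta>\<close> stand for \<open>P\<^sub>j\<^sup>*\<close>, \<open>Q\<^sub>j\<^sup>*\<close> and \<open>\<beta>\<^sub>j\<close>.
\<close>

definition M1 ::
  "'a measure \<Rightarrow> (real \<Rightarrow> 'a measure) \<Rightarrow> (real \<Rightarrow> 'a \<Rightarrow> real^'e) \<Rightarrow> (real \<Rightarrow> real^'d) \<Rightarrow>
    (real \<Rightarrow> real^'e^'d) \<Rightarrow> real \<Rightarrow> real^'d^'d \<Rightarrow> real^'d^'d \<Rightarrow> real \<Rightarrow> 'a \<Rightarrow> real^'d" where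
  "M1 M \<F> B f \<Sigma> \<alpha> P Q \<beta> \<omega> =
     ito_integral M \<F> B
       (\<lambda>s \<omega>. (exp (- \<alpha> * s) *\<^sub>R (sin (\<beta> * s) *\<^sub>R P + cos (\<beta> * s) *\<^sub>R Q)) ** \<Sigma> s) \<omega>
     + (LINT s:{0..}|lborel. (exp (- \<alpha> * s) *\<^sub>R (sin (\<beta> * s) *\<^sub>R P + cos (\<beta> * s) *\<^sub>R Q)) *v f s)"

definition M2 ::
  "'a measure \<Rightarrow> (real \<Rightarrow> 'a measure) \<Rightarrow> (real \<Rightarrow> 'a \<Rightarrow> real^'e) \<Rightarrow> (real \<Rightarrow> real^'d) \<Rightarrow>
    (real \<Rightarrow> real^'e^'d) \<Rightarrow> real \<Rightarrow> real^'d^'d \<Rightarrow> real^'d^'d \<Rightarrow> real \<Rightarrow> 'a \<Rightarrow> real^'d" where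
  "M2 M \<F> B f \<Sigma> \<alpha> P Q \<beta> \<omega> =
     ito_integral M \<F> B
       (\<lambda>s \<omega>. (exp (- \<alpha> * s) *\<^sub>R (cos (\<beta> * s) *\<^sub>R P - sin (\<beta> * s) *\<^sub>R Q)) ** \<Sigma> s) \<omega>
     + (LINT s:{0..}|lborel. (exp (- \<alpha> * s) *\<^sub>R (cos (\<beta> * s) *\<^sub>R P - sin (\<beta> * s) *\<^sub>R Q)) *v f s)"

text \<open>
  The matrix factor in front of \<open>\<nu>(ds)\<close> does not depend on \<open>s\<close> and is applied to the inner integral.
\<close>

definition G1 ::
  "real \<Rightarrow> (real set \<Rightarrow> real^'d^'d) \<Rightarrow> (real \<Rightarrow> real^'d) \<Rightarrow> real \<Rightarrow> real^'d^'d \<Rightarrow> real^'d^'d \<Rightarrow> real \<Rightarrow> real^'d" where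
  "G1 \<tau> \<nu> \<phi> \<alpha> P Q \<beta> =
     (LINT u:{-\<tau>..0}|lborel. (exp (\<alpha> * u) *\<^sub>R (cos (\<beta> * u) *\<^sub>R Q - sin (\<beta> * u) *\<^sub>R P)) *v
        vector_integral {-\<tau>..0} \<nu> (\<lambda>s. indicator {-\<tau>..u} s *\<^sub>R \<phi> (s - u)))"

definition G2 ::
  "real \<Rightarrow> (real set \<Rightarrow> real^'d^'d) \<Rightarrow> (real \<Rightarrow> real^'d) \<Rightarrow> real \<Rightarrow> real^'d^'d \<Rightarrow> real^'d^'d \<Rightarrow> real \<Rightarrow> real^'d" where
  "G2 \<tau> \<nu> \<phi> \<alpha> P Q \<beta> =
     (LINT u:{-\<tau>..0}|lborel. (exp (\<alpha> * u) *\<^sub>R (cos (\<beta> * u) *\<^sub>R P + sin (\<beta> * u) *\<^sub>R Q)) *v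
        vector_integral {-\<tau>..0} \<nu> (\<lambda>s. indicator {-\<tau>..u} s *\<^sub>R \<phi> (s - u)))"

text \<open>
  Mean-square convergence to 0. The nonnegative integral makes the expectation meaningful without
  an integrability assumption; in particular the second moments are eventually finite.
\<close>

definition mean_square_null :: "'a measure \<Rightarrow> (real \<Rightarrow> 'a \<Rightarrow> real^'d) \<Rightarrow> bool" where
  "mean_square_null M Y \<longleftrightarrow> ((\<lambda>t. \<integral>\<^sup>+\<omega>. ennreal ((norm (Y t \<omega>))\<^sup>2) \<partial>M) \<longlongrightarrow> 0) at_top"

end

(*
  Laplace inversion along a vertical line to the left of the rightmost roots turns the expansion
  of \<Delta>(\<lambda>)^-1 into an expansion of the resolvent r: the leading part of r(t) is
  t^n e^(\<alpha> t) times \<Sum>j. P_j^* cos(\<beta>_j t) + Q_j^* sin(\<beta>_j t), and the remainder is of smaller order.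
  Variation of constants, with a stochastic Fubini theorem, writes X as r X_0 plus the convolutions
  of r with the forcing and with \<Sigma> dB. The Ito isometry reduces the mean square of the last term to
  a deterministic integral, and dominated convergence replaces r by its leading part in all terms.
  A delay equation is a Volterra equation whose forcing carries the initial segment.
*)
theory Submission
  imports Defs
begin

text \<open>The inverse of \<Delta> decays only like \<open>1 / z\<close>, so its inversion integral
  does not converge absolutely. Subtracting, besides the principal parts, one simple pole to the
  left of the line leaves decay \<open>1 / z ^ 2\<close>. The function obtained is not known
  beforehand to be the resolvent: it has the right Laplace transform, and uniqueness of the
  transform then gives the resolvent equation. That equation is used only in the integrated form
  \<open>r = I + 1 * \<rho>\<close>, with \<open>*\<close> for convolution, so that \<open>r\<close>
  is never differentiated. Matrix measures are first given densities with respect to one finite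
  measure on the line. This makes Fubini available, and one locale \<open>delay_kernel\<close>
  serves both equations, the delay measure being reflected. Only Ito integrals of deterministic
  integrands are needed. The isometry is proved for finite combinations with matrix coefficients and
  for arbitrary versions of the integrals, so that neither linearity nor the choice of a version
  needs separate care; the stochastic error term is itself such a combination.\<close>

no_notation fps_nth (infixl "$" 75)

abbreviation L2sq :: "'a measure => ('a => 'b::real_normed_vector) => ennreal" where
 "L2sq M f \<equiv> (\<integral>\<^sup>+x. ennreal ((norm (f x))^2) \<partial>M)"

abbreviation "exp_poly m z t \<equiv> complex_of_real t ^ m * exp (z * of_real t)"

abbreviation "exp_sum S n K t \<equiv> \<Sum>z\<in>S. \<Sum>m\<le>n. K z m * exp_poly m z t"

abbreviation "lexp l t \<equiv> exp (- complex_of_real l * of_real t)"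

lemmas bochner_bound = Bochner_Integration.integrable_bound
 and bochner_cong = Bochner_Integration.integral_cong
 and bochner_sum = Bochner_Integration.integral_sum
 and bochner_isum = Bochner_Integration.integrable_sum

section \<open>Variations of vector-valued and signed measures\<close>

text \<open>Superadditivity bounds the sum over finitely many sets, and adding the rest of the union
  as one more set bounds every partial sum of the series. Variations are suprema, for which these
  two inequalities are easier to check than additivity.\<close>

lemma countably_additiveI_bounds:
 fixes V :: "'a set => ennreal"
 assumes sa: "sigma_algebra \<Omega> \<A>" and V0: "V {} = 0"
  and super: "!!E F. E \<in> \<A> ==> F \<in> \<A> ==> E \<inter> F = {} ==> V E + V F <= V (E \<union> F)"
  and sub: "!!E. range E \<subseteq> \<A> ==> disjoint_family E ==> V (\<Union>i. E i) <= (\<Sum>i::nat. V (E i))"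
 shows "countably_additive \<A> V"
 unfolding countably_additive_def
proof (intro allI impI)
 interpret sigma_algebra \<Omega> \<A> by fact
 fix E :: "nat => 'a set" assume E: "range E \<subseteq> \<A>" "disjoint_family E" "\<Union> (range E) \<in> \<A>"
 have Ei: "E i \<in> \<A>" for i using E by auto
 have fin: "(\<Sum>i<n. V (E i)) <= V (\<Union>i<n. E i)" for n
 proof (induction n)
  case (Suc n)
  have "(\<Sum>i<Suc n. V (E i)) <= V (\<Union>i<n. E i) + V (E n)" using Suc by (simp add: add_right_mono)
  also have "... <= V ((\<Union>i<n. E i) \<union> E n)"
  proof (rule super)
   show "(\<Union>i<n. E i) \<inter> E n = {}"
   proof -
    have "E i \<inter> E n = {}" if "i < n" for i
     using E(2) that unfolding disjoint_family_on_def by (metis UNIV_I less_irrefl)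
    then show ?thesis by blast
   qed
  qed (use Ei in auto)
  also have "(\<Union>i<n. E i) \<union> E n = (\<Union>i<Suc n. E i)" by (auto simp: less_Suc_eq)
  finally show ?case .
 qed (simp add: V0)
 have "(\<Sum>i<n. V (E i)) <= V (\<Union>i. E i)" for n
 proof -
  have U: "(\<Union>i<n. E i) \<in> \<A>" using Ei by auto
  have "(\<Sum>i<n. V (E i)) <= V (\<Union>i<n. E i) + V ((\<Union>i. E i) - (\<Union>i<n. E i))"
   using fin[of n] by (rule add_increasing2[rotated]) simp
  also have "... <= V ((\<Union>i<n. E i) \<union> ((\<Union>i. E i) - (\<Union>i<n. E i)))"
   using E(3) U by (intro super) auto
  also have "(\<Union>i<n. E i) \<union> ((\<Union>i. E i) - (\<Union>i<n. E i)) = (\<Union>i. E i)" by auto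
  finally show ?thesis .
 qed
 then have "(\<Sum>i. V (E i)) <= V (\<Union>i. E i)"
  by (intro suminf_le_const) auto
 with sub[OF E(1,2)] show "(\<Sum>i. V (E i)) = V (\<Union> (range E))" by (intro antisym)
qed

text \<open>The condition of \<open>matrix_measure\<close> for values in any normed space, so that
  it applies alike to matrices, to their entries and to the negated entries.\<close>

definition sigma_additive :: "'a set set => ('a set => 'b::real_normed_vector) => bool" where
 "sigma_additive \<A> m \<longleftrightarrow>
  (\<forall>A. range A \<subseteq> \<A> \<longrightarrow> disjoint_family A \<longrightarrow> (%i::nat. m (A i)) sums m (\<Union>i. A i))"

lemma sigma_additiveD:
 assumes "sigma_additive \<A> m" "range A \<subseteq> \<A>" "disjoint_family A"
 shows "(%i::nat. m (A i)) sums m (\<Union>i. A i)"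
 using assms by (auto simp: sigma_additive_def)

context
 fixes \<Omega> :: "'a set" and \<A> :: "'a set set" and m :: "'a set => 'b::real_normed_vector"
 assumes sa: "sigma_algebra \<Omega> \<A>"
  and cadd: "sigma_additive \<A> m"
begin

interpretation sigma_algebra \<Omega> \<A> by (fact sa)

text \<open>A constant sequence of empty sets is disjoint, and a constant series converges only if
  its term is 0.\<close>

lemma vector_measure_empty: "m {} = 0"
proof -
 have "(%i::nat. m {}) sums m {}" using sigma_additiveD[OF cadd, of "%_. {}"] by (auto simp: disjoint_family_on_def)
 then show ?thesis by (metis sums_summable summable_const_iff)
qed

lemma vector_measure_Un:
 assumes "A \<in> \<A>" "B \<in> \<A>" "A \<inter> B = {}"
 shows "m (A \<union> B) = m A + m B"
proof -
 have "disjoint_family (binaryset A B)"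
  using assms(3) by (auto simp: disjoint_family_on_def binaryset_def)
 from sigma_additiveD[OF cadd _ this] have "(%i. m (binaryset A B i)) sums m (A \<union> B)"
  using assms by (simp add: UN_binaryset_eq range_binaryset_eq)
 moreover have "(%i. m (binaryset A B i)) sums (m A + m B)"
  by (rule binaryset_sums) (rule vector_measure_empty)
 ultimately show ?thesis by (rule sums_unique2)
qed

lemma vector_measure_restrict_sums:
 assumes "A \<in> \<A>" "range E \<subseteq> \<A>" "disjoint_family E" "A \<subseteq> (\<Union>i. E i)"
 shows "(%i::nat. m (A \<inter> E i)) sums m A"
proof -
 have "(%i. m (A \<inter> E i)) sums m (\<Union>i. A \<inter> E i)"
  using assms by (intro sigma_additiveD[OF cadd]) (auto simp: disjoint_family_on_def)
 also have "(\<Union>i. A \<inter> E i) = A" using assms by auto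
 finally show ?thesis .
qed

text \<open>Partitions of two disjoint sets unite to a partition of their union, and a partition of
  a countable union is cut by the sets \<open>E i\<close>. Subadditivity then comes from the
  triangle inequality for the convergent series of the values
  \<open>m (A \<inter> E i)\<close>.\<close>

lemma variation_countably_additive:
 shows "countably_additive \<A> (%E. SUP \<P>\<in>{\<P>. finite \<P> & disjoint \<P> & \<P> \<subseteq> \<A> & \<Union>\<P> = E}.
    \<Sum>A\<in>\<P>. ennreal (norm (m A)))" (is "countably_additive _ ?V")
proof (rule countably_additiveI_bounds[OF sa])
 let ?D = "%E. {\<P>. finite \<P> & disjoint \<P> & \<P> \<subseteq> \<A> & \<Union>\<P> = E}"
 have "(\<Sum>A\<in>\<P>. ennreal (norm (m A))) = 0" if "\<P> \<in> ?D {}" for \<P>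
  using that by (intro sum.neutral) (auto simp: vector_measure_empty)
 then have "?V {} <= 0" by (intro SUP_least) simp
 then show "?V {} = 0" by simp
next
 let ?D = "%E. {\<P>. finite \<P> & disjoint \<P> & \<P> \<subseteq> \<A> & \<Union>\<P> = E}"
 fix E F assume EF: "E \<in> \<A>" "F \<in> \<A>" "E \<inter> F = {}"
 have ne: "?D E \<noteq> {}" if "E \<in> \<A>" for E
 proof -
  have "{E} \<in> ?D E" using that by (auto simp: disjoint_def)
  then show ?thesis by blast
 qed
 have "?V E + ?V F = (SUP \<P>\<in>?D E. (\<Sum>A\<in>\<P>. ennreal (norm (m A))) + ?V F)"
  by (rule ennreal_SUP_add_left[symmetric, OF ne[OF EF(1)]])
 also have "... <= ?V (E \<union> F)"
 proof (rule SUP_least)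
  fix \<P> assume P: "\<P> \<in> ?D E"
  have "(\<Sum>A\<in>\<P>. ennreal (norm (m A))) + ?V F = (SUP \<Q>\<in>?D F. (\<Sum>A\<in>\<Q>. ennreal (norm (m A))) + (\<Sum>A\<in>\<P>. ennreal (norm (m A))))"
   by (subst add.commute, rule ennreal_SUP_add_left[symmetric, OF ne[OF EF(2)]])
  also have "... <= ?V (E \<union> F)"
  proof (rule SUP_least)
   fix \<Q> assume Q: "\<Q> \<in> ?D F"
   have "(\<Sum>A\<in>\<Q>. ennreal (norm (m A))) + (\<Sum>A\<in>\<P>. ennreal (norm (m A))) = (\<Sum>A\<in>\<P>\<union>\<Q>. ennreal (norm (m A)))"
   proof (subst sum.union_inter_neutral)
    \<comment> \<open>Partitions may contain the empty set, which is the only set that partitions of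
      disjoint sets can share.\<close>
    show "\<forall>A\<in>\<P>\<inter>\<Q>. ennreal (norm (m A)) = 0"
    proof
     fix A assume "A \<in> \<P> \<inter> \<Q>"
     then have "A \<subseteq> E" "A \<subseteq> F" using P Q by auto
     then have "A = {}" using EF(3) by auto
     then show "ennreal (norm (m A)) = 0" by (simp add: vector_measure_empty)
    qed
   qed (use P Q in \<open>auto simp: add.commute\<close>)
   also have "... <= ?V (E \<union> F)"
   proof (rule SUP_upper)
    have "disjoint (\<P> \<union> \<Q>)" using P Q EF(3) by (intro disjoint_union) auto
    then show "\<P> \<union> \<Q> \<in> ?D (E \<union> F)" using P Q by auto
   qed
   finally show "(\<Sum>A\<in>\<Q>. ennreal (norm (m A))) + (\<Sum>A\<in>\<P>. ennreal (norm (m A))) <= ?V (E \<union> F)" .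
  qed
  finally show "(\<Sum>A\<in>\<P>. ennreal (norm (m A))) + ?V F <= ?V (E \<union> F)" .
 qed
 finally show "?V E + ?V F <= ?V (E \<union> F)" .
next
 let ?D = "%E. {\<P>. finite \<P> & disjoint \<P> & \<P> \<subseteq> \<A> & \<Union>\<P> = E}"
 fix E :: "nat => 'a set" assume E: "range E \<subseteq> \<A>" "disjoint_family E"
 show "?V (\<Union>i. E i) <= (\<Sum>i. ?V (E i))"
 proof (rule SUP_least)
  fix \<P> assume P: "\<P> \<in> ?D (\<Union>i. E i)"
  have "ennreal (norm (m A)) <= (\<Sum>i. ennreal (norm (m (A \<inter> E i))))" if A: "A \<in> \<P>" for A
  proof -
   have s: "(%i. m (A \<inter> E i)) sums m A"
    using A P E by (intro vector_measure_restrict_sums) auto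
   then have l: "(%n. ennreal (norm (\<Sum>i<n. m (A \<inter> E i)))) \<longlonglongrightarrow> ennreal (norm (m A))"
    unfolding sums_def by (intro tendsto_intros)
   show ?thesis
   proof (rule LIMSEQ_le_const2[OF l], intro exI allI impI)
    fix n
    have "ennreal (norm (\<Sum>i<n. m (A \<inter> E i))) <= ennreal (\<Sum>i<n. norm (m (A \<inter> E i)))"
     by (intro ennreal_leI norm_sum)
    also have "... = (\<Sum>i<n. ennreal (norm (m (A \<inter> E i))))" by (simp add: sum_ennreal)
    also have "... <= (\<Sum>i. ennreal (norm (m (A \<inter> E i))))" by (intro sum_le_suminf) auto
    finally show "ennreal (norm (\<Sum>i<n. m (A \<inter> E i))) <= (\<Sum>i. ennreal (norm (m (A \<inter> E i))))" .
   qed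
  qed
  then have "(\<Sum>A\<in>\<P>. ennreal (norm (m A))) <= (\<Sum>A\<in>\<P>. \<Sum>i. ennreal (norm (m (A \<inter> E i))))"
   by (intro sum_mono)
  also have "... = (\<Sum>i. \<Sum>A\<in>\<P>. ennreal (norm (m (A \<inter> E i))))"
   by (rule suminf_sum[symmetric]) auto
  also have "... <= (\<Sum>i. ?V (E i))"
  proof (intro suminf_le)
   fix i
   \<comment> \<open>Two cells can have the same trace on \<open>E i\<close> only if that trace is
     empty, and there the measure vanishes.\<close>
   have "(\<Sum>A\<in>\<P>. ennreal (norm (m (A \<inter> E i)))) = (\<Sum>B\<in>(%A. A \<inter> E i) ` \<P>. ennreal (norm (m B)))"
   proof (subst sum.reindex_nontrivial)
    fix A B assume "A \<in> \<P>" "B \<in> \<P>" "A \<noteq> B" and eq: "A \<inter> E i = B \<inter> E i"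
    then have "A \<inter> B = {}" using P by (auto simp: disjoint_def)
    then have "A \<inter> E i = {}" using eq by auto
    then show "ennreal (norm (m (A \<inter> E i))) = 0" by (simp add: vector_measure_empty)
   qed (use P in auto)
   also have "... <= ?V (E i)"
   proof (rule SUP_upper)
    have "disjoint ((%A. A \<inter> E i) ` \<P>)" using P by (fastforce simp: disjoint_def)
    moreover have "\<Union> ((%A. A \<inter> E i) ` \<P>) = \<Union>\<P> \<inter> E i" by auto
    moreover have "\<Union>\<P> \<inter> E i = E i" using P by auto
    moreover have "(%A. A \<inter> E i) ` \<P> \<subseteq> \<A>" using P E(1) by auto
    ultimately show "(%A. A \<inter> E i) ` \<P> \<in> ?D (E i)" using P by auto
   qed
   finally show "(\<Sum>A\<in>\<P>. ennreal (norm (m (A \<inter> E i)))) <= ?V (E i)" .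
  qed auto
  finally show "(\<Sum>A\<in>\<P>. ennreal (norm (m A))) <= (\<Sum>i. ?V (E i))" .
 qed
qed

end

text \<open>\<open>ennreal\<close> sends negative numbers to 0, so cancellation can only make the
  left side smaller.\<close>

lemma ennreal_add_le: "ennreal (a + b) <= ennreal a + ennreal b"
proof -
 have "ennreal (a + b) <= ennreal (max 0 a + max 0 b)" by (intro ennreal_leI) simp
 also have "... = ennreal (max 0 a) + ennreal (max 0 b)" by (intro ennreal_plus) auto
 finally show ?thesis by (simp add: ennreal_max_0)
qed

lemma ennreal_sum_le: "ennreal (sum f I) <= (\<Sum>i\<in>I. ennreal (f i))"
proof (induction I rule: infinite_finite_induct)
 case (insert x F)
 have "ennreal (sum f (insert x F)) <= ennreal (f x) + ennreal (sum f F)"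
  using insert.hyps by (simp add: ennreal_add_le)
 also have "... <= ennreal (f x) + (\<Sum>i\<in>F. ennreal (f i))" by (intro add_left_mono insert.IH)
 finally show ?case using insert.hyps by simp
qed simp_all

context
 fixes \<Omega> :: "'a set" and \<A> :: "'a set set" and m :: "'a set => real"
 assumes sa: "sigma_algebra \<Omega> \<A>"
  and cadd: "sigma_additive \<A> m"
begin

interpretation sigma_algebra \<Omega> \<A> by (fact sa)

lemma pos_variation_countably_additive:
 shows "countably_additive \<A> (%E. SUP A\<in>{A \<in> \<A>. A \<subseteq> E}. ennreal (m A))" (is "countably_additive _ ?V")
proof (rule countably_additiveI_bounds[OF sa])
 show "?V {} = 0" using vector_measure_empty[OF sa cadd] by (auto simp: bot_ennreal[symmetric])
next
 fix E F assume EF: "E \<in> \<A>" "F \<in> \<A>" "E \<inter> F = {}"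
 let ?D = "%E. {A \<in> \<A>. A \<subseteq> E}"
 have ne: "?D E \<noteq> {}" if "E \<in> \<A>" for E using that by blast
 have "?V E + ?V F = (SUP A\<in>?D E. ennreal (m A) + ?V F)"
  by (rule ennreal_SUP_add_left[symmetric, OF ne[OF EF(1)]])
 also have "... <= ?V (E \<union> F)"
 proof (rule SUP_least)
  fix A assume A: "A \<in> ?D E"
  have "ennreal (m A) + ?V F = (SUP B\<in>?D F. ennreal (m B) + ennreal (m A))"
   by (subst add.commute, rule ennreal_SUP_add_left[symmetric, OF ne[OF EF(2)]])
  also have "... <= ?V (E \<union> F)"
  proof (rule SUP_least)
   fix B assume B: "B \<in> ?D F"
   have AB: "A \<in> ?D (E \<union> F)" "B \<in> ?D (E \<union> F)" "A \<union> B \<in> ?D (E \<union> F)" using A B by auto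
   have m: "m (A \<union> B) = m A + m B"
    using A B EF(3) by (intro vector_measure_Un[OF sa cadd]) auto
   \<comment> \<open>A set of negative measure contributes 0 on the left; the other set alone then
     serves as the witness for the supremum on the right.\<close>
   consider "m A < 0" | "m B < 0" | "m A >= 0" "m B >= 0" by linarith
   then show "ennreal (m B) + ennreal (m A) <= ?V (E \<union> F)"
   proof cases
    case 1 then show ?thesis using SUP_upper[OF AB(2), of "%A. ennreal (m A)"] by (simp add: ennreal_neg)
   next
    case 2 then show ?thesis using SUP_upper[OF AB(1), of "%A. ennreal (m A)"] by (simp add: ennreal_neg)
   next
    case 3 then show ?thesis using SUP_upper[OF AB(3), of "%A. ennreal (m A)"] by (simp add: m add.commute)
   qed
  qed
  finally show "ennreal (m A) + ?V F <= ?V (E \<union> F)" .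
 qed
 finally show "?V E + ?V F <= ?V (E \<union> F)" .
next
 fix E :: "nat => 'a set" assume E: "range E \<subseteq> \<A>" "disjoint_family E"
 show "?V (\<Union>i. E i) <= (\<Sum>i. ?V (E i))"
 proof (rule SUP_least)
  fix A assume A: "A \<in> {A \<in> \<A>. A \<subseteq> (\<Union>i. E i)}"
  have s: "(%i. m (A \<inter> E i)) sums m A"
   using A E by (intro vector_measure_restrict_sums[OF sa cadd]) auto
  then have l: "(%n. ennreal (\<Sum>i<n. m (A \<inter> E i))) \<longlonglongrightarrow> ennreal (m A)"
   unfolding sums_def by (intro tendsto_intros)
  show "ennreal (m A) <= (\<Sum>i. ?V (E i))"
  proof (rule LIMSEQ_le_const2[OF l], intro exI allI impI)
   fix n
   have "ennreal (\<Sum>i<n. m (A \<inter> E i)) <= (\<Sum>i<n. ennreal (m (A \<inter> E i)))" by (rule ennreal_sum_le)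
   also have "... <= (\<Sum>i<n. ?V (E i))"
    using A E(1) by (intro sum_mono SUP_upper) auto
   also have "... <= (\<Sum>i. ?V (E i))" by (intro sum_le_suminf) auto
   finally show "ennreal (\<Sum>i<n. m (A \<inter> E i)) <= (\<Sum>i. ?V (E i))" .
  qed
 qed
qed

text \<open>
 If the supremum over subsets of \<open>E\<close> is infinite, then \<open>E\<close> splits into a piece of measure at least 1
 in absolute value and a piece over which the supremum is still infinite; iterating this contradicts
 the convergence of the series of the measures of the pieces split off.
\<close>

lemma pos_variation_finite:
 shows "(SUP A\<in>{A \<in> \<A>. A \<subseteq> \<Omega>}. ennreal (m A)) < \<infinity>"
proof (rule ccontr)
 let ?V = "%E. SUP A\<in>{A \<in> \<A>. A \<subseteq> E}. ennreal (m A)"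
 assume "\<not> ?V \<Omega> < \<infinity>"
 then have inf: "?V \<Omega> = \<infinity>" by (metis infinity_ennreal_def top.not_eq_extremum)
 have add: "?V (A \<union> B) = ?V A + ?V B" if "A \<in> \<A>" "B \<in> \<A>" "A \<inter> B = {}" for A B
 proof -
  have "disjoint_family (binaryset A B)"
   using that(3) by (auto simp: disjoint_family_on_def binaryset_def)
  moreover have "range (binaryset A B) \<subseteq> \<A>" using that by (simp add: range_binaryset_eq)
  moreover have "\<Union> (range (binaryset A B)) \<in> \<A>" using that(1,2) by (simp only: UN_binaryset_eq Un)
  ultimately have "(\<Sum>i. ?V (binaryset A B i)) = ?V (\<Union> (range (binaryset A B)))"
   using pos_variation_countably_additive unfolding countably_additive_def by blast
  moreover have "(%i. ?V (binaryset A B i)) sums (?V A + ?V B)"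
   using vector_measure_empty[OF sa cadd] by (intro binaryset_sums) (auto simp: bot_ennreal[symmetric])
  ultimately show ?thesis by (simp add: UN_binaryset_eq sums_iff)
 qed
 have step: "\<exists>F. (F \<in> \<A> & ?V F = \<infinity>) & (F \<subseteq> E & \<bar>m (E - F)\<bar> >= 1)" if E: "E \<in> \<A>" "?V E = \<infinity>" for E
 proof -
  \<comment> \<open>The margin \<open>\<bar>m E\<bar> + 1\<close> forces both \<open>m A > 1\<close>
    and \<open>m (E - A) < - 1\<close>. Whichever of the two pieces keeps an infinite supremum, the
    other one may be split off.\<close>
  have "ennreal (\<bar>m E\<bar> + 1) < ?V E" using E(2) by (simp only: infinity_ennreal_def ennreal_less_top)
  then obtain A where A: "A \<in> \<A>" "A \<subseteq> E" "ennreal (\<bar>m E\<bar> + 1) < ennreal (m A)"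
   by (auto simp: less_SUP_iff)
  then have mA: "m A > \<bar>m E\<bar> + 1" by (subst (asm) ennreal_less_iff) auto
  have d: "m E = m A + m (E - A)"
  proof -
   have "m (A \<union> (E - A)) = m A + m (E - A)"
    using A E by (intro vector_measure_Un[OF sa cadd]) auto
   moreover have "A \<union> (E - A) = E" using A by auto
   ultimately show ?thesis by simp
  qed
  have "?V E = ?V A + ?V (E - A)"
  proof -
   have "?V (A \<union> (E - A)) = ?V A + ?V (E - A)" using A E by (intro add) auto
   moreover have "A \<union> (E - A) = E" using A by auto
   ultimately show ?thesis by (simp only:)
  qed
  then have "?V A + ?V (E - A) = top" using E(2) by (simp only: infinity_ennreal_def)
  then have "?V A = \<infinity> \<or> ?V (E - A) = \<infinity>" by (simp only: infinity_ennreal_def ennreal_add_eq_top)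
  then consider "?V A = \<infinity>" | "?V (E - A) = \<infinity>" by (elim disjE)
  then show ?thesis
  proof cases
   case 1
   have "\<bar>m (E - A)\<bar> >= 1" using d mA by linarith
   then show ?thesis using 1 A by blast
  next
   case 2
   have "E - (E - A) = A" using A by auto
   then have "\<bar>m (E - (E - A))\<bar> >= 1" using mA by auto
   moreover have "E - A \<in> \<A>" using A E by auto
   ultimately show ?thesis using 2 by blast
  qed
 qed
 obtain f where f: "!!n. f n \<in> \<A> & ?V (f n) = \<infinity>" "!!n. f (Suc n) \<subseteq> f n & \<bar>m (f n - f (Suc n))\<bar> >= 1"
 proof -
  have "\<exists>f. \<forall>n::nat. (f n \<in> \<A> & ?V (f n) = \<infinity>) & (f (Suc n) \<subseteq> f n & \<bar>m (f n - f (Suc n))\<bar> >= 1)"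
   using inf step by (intro dependent_nat_choice) blast+
  then show thesis using that by blast
 qed
 have dec: "decseq f" using f(2) by (intro decseq_SucI) auto
 define D where "D n = f n - f (Suc n)" for n
 have disj: "disjoint_family D"
  unfolding disjoint_family_on_def
 proof (intro ballI impI)
  have *: "D a \<inter> D b = {}" if "a < b" for a b
  proof -
   have "f b \<subseteq> f (Suc a)" using decseqD[OF dec, of "Suc a" b] that by simp
   then show ?thesis by (auto simp: D_def)
  qed
  fix a b :: nat assume "a \<noteq> b"
  then show "D a \<inter> D b = {}" using *[of a b] *[of b a] by (cases "a < b") auto
 qed
 have "range D \<subseteq> \<A>" using f(1) by (auto simp: D_def)
 from sigma_additiveD[OF cadd this disj] have "(%n. m (D n)) \<longlonglongrightarrow> 0" by (intro summable_LIMSEQ_zero) (auto simp: sums_iff)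
 then have "\<forall>\<^sub>F n in sequentially. \<bar>m (D n)\<bar> < 1"
  by (auto simp: tendsto_iff dist_real_def)
 then obtain n where "\<bar>m (D n)\<bar> < 1" unfolding eventually_sequentially by blast
 then show False using f(2)[of n] by (simp add: D_def)
qed

end

lemma sigma_algebra_restrict_borel:
 "sigma_algebra J (sets (restrict_space borel J))" for J :: "real set"
 using sets.sigma_algebra_axioms[of "restrict_space borel J"] by (simp add: space_restrict_space)

lemma matrix_measure_component:
 fixes \<mu> :: "real set => real^'d^'d"
 assumes "matrix_measure J \<mu>"
 shows "sigma_additive (sets (restrict_space borel J)) (%A. \<mu> A $ j $ k)"
  and "sigma_additive (sets (restrict_space borel J)) (%A. - \<mu> A $ j $ k)"
proof -
 have *: "(%i::nat. \<mu> (A i) $ j $ k) sums (\<mu> (\<Union>i. A i) $ j $ k)"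
  if "range A \<subseteq> sets (restrict_space borel J)" "disjoint_family A" for A
 proof -
  have "(%i. \<mu> (A i)) sums \<mu> (\<Union>i. A i)" using assms that by (auto simp: matrix_measure_def)
  then show ?thesis by (intro bounded_linear.sums[OF bounded_linear_vec_nth])
 qed
 then show "sigma_additive (sets (restrict_space borel J)) (%A. \<mu> A $ j $ k)"
  by (simp add: sigma_additive_def)
 show "sigma_additive (sets (restrict_space borel J)) (%A. - \<mu> A $ j $ k)"
  using sums_minus[OF *] by (simp add: sigma_additive_def)
qed

lemma sets_pos_variation [simp]: "sets (pos_variation J m) = sets (restrict_space borel J)"
 and space_pos_variation [simp]: "space (pos_variation J m) = J"
proof -
 interpret sigma_algebra J "sets (restrict_space borel J)" by (rule sigma_algebra_restrict_borel)
 have P: "sets (restrict_space borel J) \<subseteq> Pow J" by (rule space_closed)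
 show "sets (pos_variation J m) = sets (restrict_space borel J)"
  unfolding pos_variation_def by (simp add: P sigma_sets_eq)
 show "space (pos_variation J m) = J" unfolding pos_variation_def by (simp add: P space_measure_of)
qed

lemma sets_total_variation [simp]: "sets (total_variation J \<mu>) = sets (restrict_space borel J)"
proof -
 interpret sigma_algebra J "sets (restrict_space borel J)" by (rule sigma_algebra_restrict_borel)
 have P: "sets (restrict_space borel J) \<subseteq> Pow J" by (rule space_closed)
 show ?thesis unfolding total_variation_def by (simp add: P sigma_sets_eq)
qed

text \<open>\<open>measure_of\<close> returns the given set function only once this is known to be
  positive and countably additive.\<close>

lemma emeasure_pos_variation:
 assumes "sigma_additive (sets (restrict_space borel J)) m"
  and "E \<in> sets (restrict_space borel J)"
 shows "emeasure (pos_variation J m) E = (SUP A\<in>{A \<in> sets (restrict_space borel J). A \<subseteq> E}. ennreal (m A))"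
 unfolding pos_variation_def
proof (rule emeasure_measure_of_sigma[OF sigma_algebra_restrict_borel _ _ assms(2)])
 show "countably_additive (sets (restrict_space borel J)) (%E. SUP A\<in>{A \<in> sets (restrict_space borel J). A \<subseteq> E}. ennreal (m A))"
  by (rule pos_variation_countably_additive[OF sigma_algebra_restrict_borel assms(1)])
 have "m {} = 0" by (rule vector_measure_empty[OF sigma_algebra_restrict_borel assms(1)])
 then show "positive (sets (restrict_space borel J)) (%E. SUP A\<in>{A \<in> sets (restrict_space borel J). A \<subseteq> E}. ennreal (m A))"
  by (auto simp: positive_def bot_ennreal[symmetric])
qed

lemma finite_measure_pos_variation:
 assumes "sigma_additive (sets (restrict_space borel J)) m"
 shows "finite_measure (pos_variation J m)"
proof
 have J: "J \<in> sets (restrict_space borel J)"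
  by (metis sets.top space_restrict_space space_borel Int_UNIV_right)
 show "emeasure (pos_variation J m) (space (pos_variation J m)) \<noteq> \<infinity>"
  using pos_variation_finite[OF sigma_algebra_restrict_borel assms]
  by (metis emeasure_pos_variation[OF assms J] space_pos_variation infinity_ennreal_def order_less_irrefl)
qed

lemma emeasure_total_variation:
 fixes \<mu> :: "real set => real^'d^'d"
 assumes "matrix_measure J \<mu>" and "E \<in> sets (restrict_space borel J)"
 shows "emeasure (total_variation J \<mu>) E = (SUP \<P>\<in>{\<P>. finite \<P> & disjoint \<P> & \<P> \<subseteq> sets (restrict_space borel J) & \<Union>\<P> = E}.
    \<Sum>A\<in>\<P>. ennreal (norm (\<mu> A)))"
 unfolding total_variation_def
proof (rule emeasure_measure_of_sigma[OF sigma_algebra_restrict_borel _ _ assms(2)])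
 have cadd: "sigma_additive (sets (restrict_space borel J)) \<mu>"
  using assms(1) by (simp add: matrix_measure_def sigma_additive_def)
 show "countably_additive (sets (restrict_space borel J)) (%E. SUP \<P>\<in>{\<P>. finite \<P> & disjoint \<P> & \<P> \<subseteq> sets (restrict_space borel J) & \<Union>\<P> = E}.
    \<Sum>A\<in>\<P>. ennreal (norm (\<mu> A)))"
  by (rule variation_countably_additive[OF sigma_algebra_restrict_borel cadd])
 have m0: "\<mu> {} = 0" by (rule vector_measure_empty[OF sigma_algebra_restrict_borel cadd])
 have "(\<Sum>A\<in>\<P>. ennreal (norm (\<mu> A))) = 0" if "\<Union>\<P> = {}" for \<P>
  using that by (intro sum.neutral) (auto simp: m0)
 then have "(SUP \<P>\<in>{\<P>. finite \<P> & disjoint \<P> & \<P> \<subseteq> sets (restrict_space borel J) & \<Union>\<P> = {}}.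
    \<Sum>A\<in>\<P>. ennreal (norm (\<mu> A))) <= 0" by (intro SUP_least) simp
 then show "positive (sets (restrict_space borel J)) (%E. SUP \<P>\<in>{\<P>. finite \<P> & disjoint \<P> & \<P> \<subseteq> sets (restrict_space borel J) & \<Union>\<P> = E}.
    \<Sum>A\<in>\<P>. ennreal (norm (\<mu> A)))"
  by (simp add: positive_def)
qed

text \<open>A set \<open>A\<close> inside \<open>E\<close> completes to the partition
  \<open>{A, E - A}\<close>, so each term of the first supremum is below a sum in the second.
  Applied to the entries of \<open>\<mu>\<close> and their negatives, this carries the exponential
  moment in \<open>alpha_star\<close> over to the entries.\<close>

lemma pos_variation_le_total_variation:
 fixes \<mu> :: "real set => real^'d^'d"
 assumes mm: "matrix_measure J \<mu>"
  and m: "sigma_additive (sets (restrict_space borel J)) m"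
  and le: "!!A. m A <= norm (\<mu> A)"
 shows "pos_variation J m <= total_variation J \<mu>"
proof (subst le_measure, simp, clarsimp)
 fix E assume E: "E \<in> sets (restrict_space borel J)"
 show "emeasure (pos_variation J m) E <= emeasure (total_variation J \<mu>) E"
  unfolding emeasure_pos_variation[OF m E] emeasure_total_variation[OF mm E]
 proof (rule SUP_least)
  fix A assume A: "A \<in> {A \<in> sets (restrict_space borel J). A \<subseteq> E}"
  have "ennreal (m A) <= ennreal (norm (\<mu> A))" by (intro ennreal_leI le)
  also have "... <= (\<Sum>A\<in>{A, E - A}. ennreal (norm (\<mu> A)))" by (rule member_le_sum) auto
  also have "... <= (SUP \<P>\<in>{\<P>. finite \<P> & disjoint \<P> & \<P> \<subseteq> sets (restrict_space borel J) & \<Union>\<P> = E}.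
    \<Sum>A\<in>\<P>. ennreal (norm (\<mu> A)))"
   by (rule SUP_upper) (use A E in \<open>auto simp: disjoint_def\<close>)
  finally show "ennreal (m A) <= (SUP \<P>\<in>{\<P>. finite \<P> & disjoint \<P> & \<P> \<subseteq> sets (restrict_space borel J) & \<Union>\<P> = E}.
    \<Sum>A\<in>\<P>. ennreal (norm (\<mu> A)))" .
 qed
qed

section \<open>A common dominating measure for the entries of a matrix measure\<close>

text \<open>The sum \<open>L\<close> of the finitely many measures dominates each of them, and
  Radon-Nikodym gives the densities. With a single measure, integrals against a matrix measure
  become ordinary integrals of a matrix function, to which Fubini's theorem applies.\<close>

lemma common_density:
 fixes p :: "'i::finite => 'a measure"
 assumes fin: "!!i. finite_measure (p i)" and sets: "!!i. sets (p i) = sets N"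
 obtains L h where "finite_measure L" "sets L = sets N"
  "!!i. h i \<in> borel_measurable N" "!!i x. (0::real) <= h i x" "!!i. p i = density L (%x. ennreal (h i x))"
proof -
 define L where "L = measure_of (space N) (sets N) (%A. \<Sum>i\<in>UNIV. emeasure (p i) A)"
 have em: "emeasure L A = (\<Sum>i\<in>UNIV. emeasure (p i) A)" if "A \<in> sets N" for A
  unfolding L_def
 proof (rule emeasure_measure_of_sigma[OF sets.sigma_algebra_axioms _ _ that])
  show "countably_additive (sets N) (%A. \<Sum>i\<in>UNIV. emeasure (p i) A)"
   unfolding countably_additive_def
  proof (intro allI impI)
   fix A :: "nat => 'a set" assume A: "range A \<subseteq> sets N" "disjoint_family A"
   have "(\<Sum>i. \<Sum>j\<in>UNIV. emeasure (p j) (A i)) = (\<Sum>j\<in>UNIV. \<Sum>i. emeasure (p j) (A i))"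
    by (rule suminf_sum) auto
   also have "... = (\<Sum>j\<in>UNIV. emeasure (p j) (\<Union>i. A i))"
    using A by (intro sum.cong refl suminf_emeasure) (auto simp: sets)
   finally show "(\<Sum>i. \<Sum>j\<in>UNIV. emeasure (p j) (A i)) = (\<Sum>j\<in>UNIV. emeasure (p j) (\<Union>i. A i))" .
  qed
 qed (simp add: positive_def)
 have setsL: "sets L = sets N" unfolding L_def by simp
 have spaceL: "space L = space N" using setsL by (rule sets_eq_imp_space_eq)
 interpret L: finite_measure L
 proof
  have sp: "space (p i) = space N" for i using sets by (rule sets_eq_imp_space_eq)
  have "emeasure (p i) (space N) \<noteq> \<infinity>" for i
   using finite_measure.emeasure_finite[OF fin[of i]] by simp
  then show "emeasure L (space L) \<noteq> \<infinity>"
   by (auto simp: spaceL em)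
 qed
 have ac: "absolutely_continuous L (p i)" for i
  unfolding absolutely_continuous_def
 proof
  fix A assume "A \<in> null_sets L"
  then have A: "A \<in> sets N" "emeasure L A = 0" by (auto simp: null_sets_def setsL)
  then have "emeasure (p i) A = 0" by (simp add: em)
  then show "A \<in> null_sets (p i)" using A by (simp add: null_sets_def sets)
 qed
 have "\<exists>D. D \<in> borel_measurable N & (\<forall>x. 0 <= D x) & p i = density L (%x. ennreal (D x))" for i
 proof -
  obtain D where D: "D \<in> borel_measurable L" "AE x in L. RN_deriv L (p i) x = ennreal (D x)" "!!x. 0 <= D x"
   by (rule L.real_RN_deriv[OF fin ac]) (auto simp: sets setsL)
  have "p i = density L (RN_deriv L (p i))"
   by (rule L.density_RN_deriv[symmetric, OF ac]) (simp add: sets setsL)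
  also have "... = density L (%x. ennreal (D x))"
   using D by (intro density_cong) auto
  finally have "p i = density L (%x. ennreal (D x))" .
  moreover have "D \<in> borel_measurable N" using D(1) unfolding measurable_cong_sets[OF setsL refl] .
  ultimately show ?thesis using D(3) by (intro exI[of _ D] conjI allI)
 qed
 then have "\<forall>i. \<exists>D. D \<in> borel_measurable N & (\<forall>x. 0 <= D x) & p i = density L (%x. ennreal (D x))" by (rule allI)
 from choice[OF this] obtain h where h: "\<forall>i. h i \<in> borel_measurable N & (\<forall>x. (0::real) <= h i x) & p i = density L (%x. ennreal (h i x))"
  by (rule exE)
 show thesis by (rule that[OF L.finite_measure_axioms setsL, of h]) (use h in auto)
qed

text \<open>The index \<open>b\<close> selects the positive variation of an entry or that of its
  negative. The variations live on \<open>J\<close> and are pushed to the whole line; the densities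
  are multiplied by the indicator of \<open>J\<close>, so that they vanish everywhere outside
  \<open>J\<close> and not merely almost everywhere.\<close>

lemma matrix_measure_density:
 fixes \<mu> :: "real set => real^'d^'d"
 assumes mm: "matrix_measure J \<mu>" and J: "J \<in> sets borel"
 obtains L :: "real measure" and h :: "'d => 'd => bool => real => real"
 where "finite_measure L" "sets L = sets borel" "!!i k b. h i k b \<in> borel_measurable borel"
  "!!i k b x. 0 <= h i k b x" "!!i k b x. x \<notin> J ==> h i k b x = 0"
  "!!i k b. distr (pos_variation J (%A. if b then \<mu> A $ i $ k else - \<mu> A $ i $ k)) borel (%x. x) = density L (%x. ennreal (h i k b x))"
proof -
 define m where "m i k b A = (if b then \<mu> A $ i $ k else - \<mu> A $ i $ k)" for i k b A
 have cadd: "sigma_additive (sets (restrict_space borel J)) (m i k b)" for i k b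
  using matrix_measure_component[OF mm] by (cases b) (simp_all add: m_def[abs_def])
 have meas: "(%x. x) \<in> measurable (pos_variation J (m i k b)) borel" for i k b
  by (subst measurable_cong_sets[OF sets_pos_variation refl]) (simp add: measurable_restrict_space1)
 define p where "p j = (case j of (i, k, b) => distr (pos_variation J (m i k b)) borel (%x. x))" for j
 have fin: "finite_measure (p j)" for j
  unfolding p_def
  by (auto split: prod.split intro!: finite_measure.finite_measure_distr finite_measure_pos_variation cadd meas)
 have sets: "sets (p j) = sets borel" for j by (auto simp: p_def split: prod.split)
 obtain L h where L: "finite_measure L" "sets L = sets (borel :: real measure)"
  and h: "!!j. h j \<in> borel_measurable borel" "!!j x. (0::real) <= h j x" "!!j. p j = density L (%x. ennreal (h j x))"
  by (rule common_density[of p borel, OF fin sets]) (rule that)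
 define h' where "h' i k b x = indicator J x * h (i, k, b) x" for i k b x
 have "p (i, k, b) = density L (%x. ennreal (h' i k b x))" for i k b
 proof -
  have J0: "emeasure (p (i, k, b)) (- J) = 0"
  proof -
   have "emeasure (p (i, k, b)) (- J) = emeasure (pos_variation J (m i k b)) ((%x. x) -` (- J) \<inter> space (pos_variation J (m i k b)))"
    unfolding p_def prod.case using J by (intro emeasure_distr meas) auto
   also have "(%x. x) -` (- J) \<inter> space (pos_variation J (m i k b)) = {}" by auto
   finally show ?thesis by simp
  qed
  have mh[measurable]: "h (i, k, b) \<in> borel_measurable L"
   unfolding measurable_cong_sets[OF L(2) refl] by (rule h(1))
  have Jm: "- J \<in> sets L" using J L(2) by auto
  have "(\<integral>\<^sup>+x. ennreal (h (i, k, b) x) * indicator (- J) x \<partial>L) = 0"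
   using J0 Jm unfolding h(3) by (subst (asm) emeasure_density) auto
  then have "AE x in L. ennreal (h (i, k, b) x) * indicator (- J) x = 0"
   using Jm by (subst (asm) nn_integral_0_iff_AE) auto
  then have "AE x in L. ennreal (h (i, k, b) x) = ennreal (h' i k b x)"
   by eventually_elim (auto simp: h'_def indicator_def split: if_splits)
  then show ?thesis unfolding h(3)
   using J L(2) by (intro density_cong) (auto simp: h'_def intro!: borel_measurable_times borel_measurable_indicator)
 qed
 note dens = this
 show thesis
 proof (rule that[OF L, of h'])
  show "h' i k b \<in> borel_measurable borel" for i k b
   unfolding h'_def[abs_def] using J h(1) by (intro borel_measurable_times borel_measurable_indicator) auto
  show "0 <= h' i k b x" for i k b x using h(2) by (simp add: h'_def)
  show "x \<notin> J ==> h' i k b x = 0" for i k b x by (simp add: h'_def)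
  show "distr (pos_variation J (%A. if b then \<mu> A $ i $ k else - \<mu> A $ i $ k)) borel (%x. x) = density L (%x. ennreal (h' i k b x))" for i k b
   using dens[of i k b] by (simp add: p_def m_def[abs_def])
 qed
qed

section \<open>Laplace transforms: exponential polynomials, uniqueness and inversion\<close>

text \<open>One term of the exponential series is at most the sum. This trades a power of
  \<open>t\<close> for an arbitrarily small exponential rate.\<close>

lemma power_le_fact_exp:
 fixes t d :: real
 assumes "t >= 0" "d > 0"
 shows "t ^ m <= fact m / d ^ m * exp (d * t)"
proof -
 have "(%k. (d*t)^k /\<^sub>R fact k) sums exp (d*t)"
  by (rule exp_converges)
 then have "(\<Sum>k\<in>{m}. (d*t)^k /\<^sub>R fact k) <= exp (d*t)"
  using assms sum_le_suminf[OF sums_summable[OF exp_converges[of "d*t"]], of "{m}"]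
  by (simp add: sums_unique[symmetric])
 then have "(d*t)^m / fact m <= exp (d*t)" by (simp add: divide_inverse mult.commute)
 then show ?thesis using assms by (simp add: field_simps power_mult_distrib)
qed

lemma set_integrable_exp_neg:
 fixes d :: real
 assumes "d > 0"
 shows "set_integrable lborel {0..} (%t. exp (- d * t))"
proof -
 have "(%t. exp (- d * t)) integrable_on {0..}"
  using has_integral_exp_minus_to_infinity[OF assms, of 0] by (auto simp: integrable_on_def)
 then have "(%t. exp (- d * t)) absolutely_integrable_on {0..}"
  by (intro nonnegative_absolutely_integrable_1) auto
 then show ?thesis
  by (simp add: set_integrable_def integrable_completion)
qed

lemma set_integrable_exp_bound:
 fixes f :: "real => 'b::{banach, second_countable_topology}"
 assumes "(%t. indicator {0..} t *\<^sub>R f t) \<in> borel_measurable borel" "d > 0"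
  and "!!t. t >= 0 ==> norm (f t) <= C * exp (- d * t)"
 shows "set_integrable lborel {0..} f"
 unfolding set_integrable_def
proof (rule bochner_bound)
 show "integrable lborel (%t. indicator {0..} t *\<^sub>R (C * exp (- d * t)))"
  using set_integrable_mult_right[of C, OF set_integrable_exp_neg[OF assms(2)]]
  by (simp add: set_integrable_def)
 show "(%t. indicator {0..} t *\<^sub>R f t) \<in> borel_measurable lborel" using assms(1) by simp
 show "AE t in lborel. norm (indicator {0..} t *\<^sub>R f t) <= norm (indicator {0..} t *\<^sub>R (C * exp (- d * t)))"
  using order_trans[OF assms(3) abs_ge_self] by (intro AE_I2) (simp add: indicator_def)
qed

lemma set_integrable_exp_bound_continuous:
 fixes f :: "real => 'b::{banach, second_countable_topology}"
 assumes "continuous_on {0..} f" "d > 0"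
  and "!!t. t >= 0 ==> norm (f t) <= C * exp (- d * t)"
 shows "set_integrable lborel {0..} f"
 by (rule set_integrable_exp_bound[OF borel_measurable_continuous_on_indicator]) (use assms in auto)

text \<open>Induction on \<open>m\<close> by partial integration; exponential decay removes the
  boundary term at infinity.\<close>

lemma laplace_monomial:
 fixes s :: complex
 assumes "Re s > 0"
 shows "set_integrable lborel {0..} (%t. of_real t ^ m * exp (- s * of_real t))"
  and "(LBINT t:{0..}. of_real t ^ m * exp (- s * of_real t)) = fact m / s ^ (m + 1)"
proof -
 define \<sigma> where "\<sigma> = Re s"
 \<comment> \<open>Half of the decay rate \<open>\<sigma>\<close> absorbs the power of
   \<open>t\<close>, the other half remains for integrability.\<close>
 have int: "set_integrable lborel {0..} (%t. of_real t ^ m * exp (- s * of_real t))" for m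
 proof (rule set_integrable_exp_bound_continuous[where d="\<sigma>/2" and C="fact m / (\<sigma>/2)^m"])
  fix t :: real assume t: "t >= 0"
  have "norm (of_real t ^ m * exp (- s * of_real t)) = t ^ m * exp (- \<sigma> * t)"
   using t by (simp add: norm_mult norm_power \<sigma>_def)
  also have "... <= (fact m / (\<sigma>/2) ^ m * exp (\<sigma>/2 * t)) * exp (- \<sigma> * t)"
   using t assms by (intro mult_right_mono power_le_fact_exp) (auto simp: \<sigma>_def)
  also have "... = fact m / (\<sigma>/2) ^ m * exp (- (\<sigma>/2) * t)"
   by (simp add: mult.assoc flip: exp_add)
  finally show "norm (of_real t ^ m * exp (- s * of_real t)) <= fact m / (\<sigma>/2)^m * exp (- (\<sigma>/2) * t)" .
 qed (use assms in \<open>auto simp: \<sigma>_def intro!: continuous_intros\<close>)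
 show "set_integrable lborel {0..} (%t. of_real t ^ m * exp (- s * of_real t))" by (rule int)
 have s0: "s \<noteq> 0" using assms by auto
 have lim: "((%t. of_real t ^ m * exp (- s * of_real t)) \<longlongrightarrow> 0) at_top" for m
 proof (rule Lim_null_comparison)
  show "\<forall>\<^sub>F t in at_top. norm (of_real t ^ m * exp (- s * of_real t)) <= fact m / (\<sigma>/2)^m * exp (- (\<sigma>/2) * t)"
  proof (rule eventually_at_top_linorderI[of 0])
   fix t :: real assume t: "t >= 0"
   have "norm (of_real t ^ m * exp (- s * of_real t)) = t ^ m * exp (- \<sigma> * t)"
    using t by (simp add: norm_mult norm_power \<sigma>_def)
   also have "... <= (fact m / (\<sigma>/2) ^ m * exp (\<sigma>/2 * t)) * exp (- \<sigma> * t)"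
    using t assms by (intro mult_right_mono power_le_fact_exp) (auto simp: \<sigma>_def)
   also have "... = fact m / (\<sigma>/2) ^ m * exp (- (\<sigma>/2) * t)"
    by (simp add: mult.assoc flip: exp_add)
   finally show "norm (of_real t ^ m * exp (- s * of_real t)) <= fact m / (\<sigma>/2)^m * exp (- (\<sigma>/2) * t)" .
  qed
  have "\<sigma> / 2 > 0" using assms by (simp add: \<sigma>_def)
  then have "((%t. exp (- (\<sigma>/2) * t)) \<longlongrightarrow> 0) at_top" by real_asymp
  from tendsto_mult_left[OF this, of "fact m / (\<sigma>/2)^m"]
  show "((%t. fact m / (\<sigma>/2)^m * exp (- (\<sigma>/2) * t)) \<longlongrightarrow> 0) at_top" by (simp only: mult_zero_right)
 qed
 have ftc: "(LBINT t:{0..}. f t) = - F 0"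
  if f: "set_integrable lborel {0..} f" and d: "!!t. (F has_vector_derivative f t) (at t)"
   and c: "continuous_on UNIV f" and l: "(F \<longlongrightarrow> 0) at_top" for f F :: "real => complex"
 proof -
  have "((%y. LBINT x:{0..y}. f x) \<longlongrightarrow> (LBINT x:{0..}. f x)) at_top"
  proof -
   have "((%y. LBINT x. indicator {..y} x *\<^sub>R (indicator {0..} x *\<^sub>R f x)) \<longlongrightarrow> (LBINT x. indicator {0..} x *\<^sub>R f x)) at_top"
    using f by (intro tendsto_integral_at_top) (auto simp: set_integrable_def)
   moreover have "indicator {..y} x *\<^sub>R (indicator {0..} x *\<^sub>R f x) = indicator {0..y} x *\<^sub>R f x" for x y :: real
    by (auto simp: indicator_def)
   ultimately show ?thesis unfolding set_lebesgue_integral_def by (simp only:)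
  qed
  moreover have "\<forall>\<^sub>F y in at_top. (LBINT x:{0..y}. f x) = F y - F 0"
  proof (rule eventually_at_top_linorderI[of 0])
   fix y :: real assume "y >= 0"
   then show "(LBINT x:{0..y}. f x) = F y - F 0"
    unfolding set_lebesgue_integral_def
    by (intro integral_FTC_Icc) (auto intro!: has_vector_derivative_at_within d continuous_on_subset[OF c])
  qed
  ultimately have "((%y. F y - F 0) \<longlongrightarrow> (LBINT x:{0..}. f x)) at_top"
   by (rule Lim_transform_eventually)
  moreover have "((%y. F y - F 0) \<longlongrightarrow> 0 - F 0) at_top" by (intro tendsto_intros l)
  ultimately show ?thesis by (metis diff_0 tendsto_unique trivial_limit_at_top_linorder)
 qed
 have dexp: "((%t. exp (- s * of_real t)) has_vector_derivative (- s * exp (- s * of_real t))) (at t)" for t :: real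
 proof -
  have "((%z. exp (- s * z)) has_field_derivative (- s * exp (- s * of_real t))) (at (of_real t))"
   by (auto intro!: derivative_eq_intros)
  from field_vector_diff_chain_at[OF has_vector_derivative_of_real[OF DERIV_ident] this]
  show ?thesis by (simp add: o_def)
 qed
 show "(LBINT t:{0..}. of_real t ^ m * exp (- s * of_real t)) = fact m / s ^ (m + 1)"
 proof (induction m)
  case 0
  have "(LBINT t:{0..}. exp (- s * of_real t)) = - ((- 1 / s) * exp (- s * of_real 0))"
  proof (rule ftc[where F="%t. (- 1 / s) * exp (- s * of_real t)"])
   show "((%t. (- 1 / s) * exp (- s * of_real t)) has_vector_derivative exp (- s * of_real t)) (at t)" for t :: real
    using has_vector_derivative_mult_right[OF dexp, of "- 1 / s" t] s0 by simp
   show "((%t. (- 1 / s) * exp (- s * of_real t)) \<longlongrightarrow> 0) at_top"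
    using tendsto_mult_left[OF lim[of 0], of "- 1 / s"] by simp
  qed (use int[of 0] in \<open>auto intro!: continuous_intros\<close>)
  then show ?case by simp
 next
  case (Suc m)
  \<comment> \<open>\<open>?f\<close> is the derivative of \<open>?F\<close>, which vanishes at 0
    and at infinity. The vanishing of its integral is the partial integration that reduces
    \<open>Suc m\<close> to \<open>m\<close>.\<close>
  let ?f = "%t. of_real t ^ Suc m * exp (- s * of_real t) - (of_nat (Suc m) / s) * (of_real t ^ m * exp (- s * of_real t))"
  let ?F = "%t. (- 1 / s) * (of_real t ^ Suc m * exp (- s * of_real t))"
  have "(LBINT t:{0..}. ?f t) = - ?F 0"
  proof (rule ftc)
   show "set_integrable lborel {0..} ?f"
    by (intro set_integral_diff set_integrable_mult_right int)
   fix t :: real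
   have "((%t. complex_of_real t ^ Suc m) has_vector_derivative of_nat (Suc m) * of_real t ^ m) (at t)"
   proof -
    have "((%z. z ^ Suc m) has_field_derivative of_nat (Suc m) * of_real t ^ m) (at (complex_of_real t))"
     using DERIV_power[OF DERIV_ident, where n="Suc m" and x="complex_of_real t" and s=UNIV] by simp
    from field_vector_diff_chain_at[OF has_vector_derivative_of_real[OF DERIV_ident] this]
    show ?thesis by (simp add: o_def)
   qed
   from has_vector_derivative_mult_right[OF has_vector_derivative_mult[OF this dexp], of "- 1 / s"]
   show "(?F has_vector_derivative ?f t) (at t)"
    by (rule has_vector_derivative_eq_rhs) (use s0 in \<open>simp add: field_simps\<close>)
  next
   show "(?F \<longlongrightarrow> 0) at_top"
    using tendsto_mult_left[OF lim[of "Suc m"], of "- 1 / s"] by simp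
  qed (intro continuous_intros)
  also have "- ?F 0 = 0" by simp
  finally have "(LBINT t:{0..}. of_real t ^ Suc m * exp (- s * of_real t)) = (of_nat (Suc m) / s) * (LBINT t:{0..}. of_real t ^ m * exp (- s * of_real t))"
   unfolding set_integral_diff(2)[OF int set_integrable_mult_right[OF int]] set_integral_mult_right by simp
  then show ?case unfolding Suc.IH using s0 by (simp add: field_simps)
 qed
qed

text \<open>The substitution \<open>x = exp (- t)\<close> turns the vanishing of the transform at
  equally spaced points into the vanishing of all moments of a continuous function on
  \<open>[0,1]\<close>. By Weierstrass approximation the function is orthogonal to itself.\<close>

lemma lerch:
 fixes g :: "real => real"
 assumes cont: "continuous_on {0..} g" and bd: "!!t. t >= 0 ==> \<bar>g t\<bar> <= C * exp (c * t)"
  and zero: "!!l. l > l0 ==> (LBINT t:{0..}. exp (- l * t) * g t) = 0"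
  and t: "t >= 0"
 shows "g t = 0"
proof -
 \<comment> \<open>With this \<open>k\<close> the function \<open>u\<close> decays like
   \<open>exp (- t)\<close>, so \<open>h\<close> below extends continuously by 0 to the point
   \<open>x = 0\<close>; moreover all points \<open>k + 1 + i\<close> lie beyond
   \<open>l0\<close>.\<close>
 define k where "k = max c l0 + 1"
 define u where "u t = exp (- k * t) * g t" for t
 have C0: "C >= 0" using bd[of 0] by simp
 have ub: "\<bar>u t\<bar> <= C * exp (- t)" if "t >= 0" for t
 proof -
  have "\<bar>u t\<bar> = exp (- k * t) * \<bar>g t\<bar>" by (simp add: u_def abs_mult)
  also have "... <= exp (- k * t) * (C * exp (c * t))" using bd[OF that] by simp
  also have "... = C * exp ((c - k) * t)" by (simp add: algebra_simps flip: exp_add)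
  also have "... <= C * exp (- t)"
  proof -
   have "(c - k) * t <= (-1) * t" using that by (intro mult_right_mono) (auto simp: k_def)
   then show ?thesis using C0 by (simp add: mult_left_mono)
  qed
  finally show ?thesis .
 qed
 have uc: "continuous_on {0..} u" unfolding u_def by (intro continuous_intros cont)
 define h where "h x = (if x <= 0 then 0 else u (- ln x))" for x
 have hexp: "h (exp (- t)) = u t" for t by (simp add: h_def)
 have hb: "\<bar>h x\<bar> <= C * x" if "0 <= x" "x <= 1" for x
  using ub[of "- ln x"] that by (auto simp: h_def)
 have hc: "continuous_on {0..1} h"
 proof (clarsimp simp: continuous_on_eq_continuous_within)
  fix x :: real assume x: "0 <= x" "x <= 1"
  show "continuous (at x within {0..1}) h"
  proof (cases "x = 0")
   case True
   have "(h \<longlongrightarrow> 0) (at 0 within {0..1})"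
   proof (rule Lim_null_comparison)
    show "\<forall>\<^sub>F x in at 0 within {0..1}. norm (h x) <= C * x"
     by (auto simp: eventually_at_filter intro!: always_eventually hb)
    show "((%x. C * x) \<longlongrightarrow> 0) (at 0 within {0..1})"
     by (auto intro!: tendsto_eq_intros)
   qed
   then show ?thesis using True by (simp add: continuous_within h_def)
  next
   case False
   then have x0: "x > 0" using x by simp
   have "continuous_on {0<..1} (%x. u (- ln x))"
    by (rule continuous_on_compose2[OF uc]) (auto intro!: continuous_intros)
   then have "continuous_on {0<..1} h"
    by (rule continuous_on_eq) (auto simp: h_def)
   then have "continuous (at x within {0<..1}) h"
    using x0 x by (auto simp: continuous_on_eq_continuous_within)
   moreover have "at x within {0<..1} = at x within {0..1}"
    by (rule at_within_nhd[of x "{0<..}"]) (use x0 in auto)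
   ultimately show ?thesis by simp
  qed
 qed
 have int0: "set_integrable lborel {0..} (%t. exp (- t) * u t * v t)"
  if "continuous_on {0..} v" "!!t. t >= 0 ==> \<bar>v t\<bar> <= B" for v B
 proof (rule set_integrable_exp_bound_continuous[where d=1 and C="C*B"])
  fix t :: real assume t: "t >= 0"
  have "\<bar>u t\<bar> <= C" using ub[OF t] C0 t
   by (meson dual_order.trans exp_le_one_iff mult_left_le neg_le_0_iff_le)
  then have "exp (-t) * \<bar>u t\<bar> * \<bar>v t\<bar> <= exp (-t) * C * B"
   using that(2)[OF t] C0 by (intro mult_mono) auto
  then show "norm (exp (- t) * u t * v t) <= C * B * exp (- 1 * t)"
   by (simp add: abs_mult mult_ac)
 qed (use that in \<open>auto intro!: continuous_intros uc\<close>)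
 have uB: "\<bar>u t\<bar> <= C" if "t >= 0" for t using ub[OF that] C0 that
   by (meson dual_order.trans exp_le_one_iff mult_left_le neg_le_0_iff_le)
 \<comment> \<open>The monomial of degree \<open>i\<close> in \<open>exp (- t)\<close> produces the
   transform of \<open>g\<close> at the point \<open>k + 1 + i\<close>.\<close>
 have poly0: "(LBINT t:{0..}. exp (-t) * u t * (\<Sum>i\<le>n. a i * exp (-t) ^ i)) = 0" for a :: "nat => real" and n
 proof -
  have i1: "set_integrable lborel {0..} (%t. exp (-t) * u t * (a i * exp (-t)^i))" for i
  proof (rule int0[where B="\<bar>a i\<bar>"])
   show "\<bar>a i * exp (- t) ^ i\<bar> <= \<bar>a i\<bar>" if "t >= 0" for t
    using that by (simp add: abs_mult mult_left_le power_le_one)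
  qed (auto intro!: continuous_intros)
  have z1: "(LBINT t:{0..}. exp (-t) * u t * (a i * exp (-t)^i)) = 0" for i
  proof -
   have "exp (-t) * u t * (a i * exp (-t)^i) = a i * (exp (- (k + 1 + i) * t) * g t)" for t
    by (simp add: u_def algebra_simps exp_add exp_minus exp_diff flip: exp_of_nat_mult)
     (simp add: field_simps flip: exp_add exp_of_nat_mult)?
   then have "(LBINT t:{0..}. exp (-t) * u t * (a i * exp (-t)^i)) = a i * (LBINT t:{0..}. exp (- (k + 1 + i) * t) * g t)"
    by (simp only: set_integral_mult_right)
   also have "... = 0" by (subst zero) (auto simp: k_def)
   finally show ?thesis .
  qed
  have "(LBINT t:{0..}. exp (-t) * u t * (\<Sum>i\<le>n. a i * exp (-t) ^ i)) = (LBINT t:{0..}. (\<Sum>i\<le>n. exp (-t) * u t * (a i * exp (-t)^i)))"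
   by (simp add: sum_distrib_left)
  also have "... = (\<Sum>i\<le>n. (LBINT t:{0..}. exp (-t) * u t * (a i * exp (-t)^i)))"
   using i1 unfolding set_lebesgue_integral_def set_integrable_def scaleR_sum_right
   by (rule bochner_sum)
  also have "... = 0" by (simp only: z1) simp
  finally show ?thesis .
 qed
 define I where "I = (LBINT t:{0..}. exp (-t) * u t * u t)"
 have iu: "set_integrable lborel {0..} (%t. exp (-t) * u t * u t)"
  by (rule int0[OF uc uB])
 \<comment> \<open>Since \<open>u\<close> is orthogonal to polynomials in \<open>exp (- t)\<close>,
   one factor \<open>u\<close> in \<open>I\<close> may be replaced by
   \<open>u - p (exp (- t))\<close>, which is at most \<open>e\<close>.\<close>
 have "I <= e * C" if e: "e > 0" for e
 proof -
  obtain p where p: "real_polynomial_function p" "!!x. x \<in> {0..1} ==> \<bar>h x - p x\<bar> < e"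
   using Stone_Weierstrass_real_polynomial_function[OF compact_Icc hc e] by blast
  then obtain a n where an: "p = (%x. \<Sum>i\<le>n. a i * x^i)"
   using real_polynomial_function_imp_sum by blast
  have pc: "continuous_on {0..} (%t. p (exp (-t)))" unfolding an by (intro continuous_intros)
  have up: "\<bar>u t - p (exp (-t))\<bar> <= e" if "t >= 0" for t
   using p(2)[of "exp (-t)"] that hexp[of t] by auto
  have pB: "\<bar>p (exp (-t))\<bar> <= C + e" if "t >= 0" for t
   using up[OF that] uB[OF that] by linarith
  have ip: "set_integrable lborel {0..} (%t. exp (-t) * u t * p (exp (-t)))"
   by (rule int0[OF pc pB])
  have "I = I - (LBINT t:{0..}. exp (-t) * u t * p (exp (-t)))"
   using poly0[of a n] by (simp add: an)
  also have "... = (LBINT t:{0..}. exp (-t) * u t * u t - exp (-t) * u t * p (exp (-t)))"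
   unfolding I_def by (rule set_integral_diff(2)[symmetric, OF iu ip])
  also have "... <= (LBINT t:{0..}. e * C * exp (- 1 * t))"
  proof (rule set_integral_mono)
   show "set_integrable lborel {0..} (%t. exp (-t) * u t * u t - exp (-t) * u t * p (exp (-t)))"
    by (rule set_integral_diff(1)[OF iu ip])
   show "set_integrable lborel {0..} (%t. e * C * exp (- 1 * t))"
    by (intro set_integrable_mult_right set_integrable_exp_neg) auto
   fix t :: real assume "t \<in> {0..}" then have t: "t >= 0" by simp
   have "u t * (u t - p (exp (-t))) <= \<bar>u t\<bar> * \<bar>u t - p (exp (-t))\<bar>"
    by (metis abs_ge_self abs_mult)
   also have "... <= C * e" using uB[OF t] up[OF t] by (intro mult_mono) (auto simp: C0)
   finally have "exp (-t) * (u t * (u t - p (exp (-t)))) <= exp (-t) * (C * e)" by simp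
   then show "exp (-t) * u t * u t - exp (-t) * u t * p (exp (-t)) <= e * C * exp (- 1 * t)"
    by (simp add: algebra_simps)
  qed
  also have "... = e * C"
   using has_integral_exp_minus_to_infinity[of 1 0] set_borel_integral_eq_integral(2)[OF set_integrable_exp_neg[of 1]]
   by (simp add: integral_unique)
  finally show ?thesis .
 qed
 then have "I <= 0"
 proof -
  have "I <= 0 + e" if "e > 0" for e
  proof -
   have "e / (C + 1) > 0" using that C0 by simp
   from \<open>!!e. e > 0 ==> I <= e * C\<close>[OF this] have "I <= e * (C / (C+1))" by simp
   also have "... <= e * 1" using that C0 by (intro mult_left_mono) auto
   finally show ?thesis by simp
  qed
  then show ?thesis by (rule field_le_epsilon)
 qed
 have nonneg: "0 <= exp (-t) * u t * u t" for t by (simp add: mult.assoc)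
 have "(%t. exp (-t) * u t * u t) integrable_on {0..}" "integral {0..} (%t. exp (-t) * u t * u t) = I"
  using set_borel_integral_eq_integral[OF iu] by (auto simp: I_def)
 then have hi: "((%t. exp (-t) * u t * u t) has_integral I) {0..}"
  by (metis integrable_integral)
 show ?thesis
 proof (rule ccontr)
  assume "g t \<noteq> 0"
  \<comment> \<open>The right end \<open>t + 1\<close> keeps the interval nondegenerate for
    \<open>t = 0\<close>.\<close>
  have sub: "((%s. exp (-s) * u s * u s) has_integral integral {0..t+1} (%s. exp (-s) * u s * u s)) {0..t+1}"
   by (intro integrable_integral integrable_continuous_interval continuous_intros continuous_on_subset[OF uc]) auto
  have "integral {0..t+1} (%s. exp (-s) * u s * u s) <= I"
   by (rule has_integral_subset_le[OF _ sub hi]) (auto simp: nonneg)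
  then have le: "integral {0..t+1} (%s. exp (-s) * u s * u s) <= 0" using \<open>I <= 0\<close> by simp
  then have "((%s. exp (-s) * u s * u s) has_integral 0) (cbox 0 (t+1))"
   using sub integral_nonneg[OF has_integral_integrable[OF sub]] nonneg by auto
  then have "exp (-t) * u t * u t = 0"
   by (rule has_integral_0_cbox_imp_0[rotated 2])
    (use t nonneg in \<open>auto intro!: continuous_intros continuous_on_subset[OF uc]\<close>)
  then show False using \<open>g t \<noteq> 0\<close> by (simp add: u_def)
 qed
qed

text \<open>Cauchy's formula on a rectangle whose left side lies on \<open>Re z = a\<close>. Under
  quadratic decay the other three sides have length of order \<open>L\<close> and integrand of order
  \<open>1 / L ^ 2\<close>, so only the left side survives.\<close>

lemma half_plane_cauchy:
 fixes R :: "complex => complex"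
 assumes hol: "R holomorphic_on {z. Re z > a1}" and a1: "a1 < a"
  and bd: "!!z. Re z >= a ==> norm (R z) <= C / (1 + norm (z - of_real a) ^ 2)"
  and z0: "Re z0 > a"
 shows "integrable lborel (%y. R (Complex a y))"
  and "integrable lborel (%y. R (Complex a y) / (z0 - Complex a y))"
  and "(LBINT y. R (Complex a y) / (z0 - Complex a y)) = 2 * pi * R z0"
proof -
 have C0: "C >= 0" using order_trans[OF norm_ge_zero bd[of "of_real a"]] by simp
 have cont: "continuous_on UNIV (%y. R (Complex a y))"
  by (rule continuous_on_compose2[OF holomorphic_on_imp_continuous_on[OF hol]])
   (use a1 in \<open>auto simp: Complex_eq intro!: continuous_intros\<close>)
 have ne: "z0 - Complex a y \<noteq> 0" for y using z0 by (auto simp: complex_eq_iff)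
 have cont2: "continuous_on UNIV (%y. R (Complex a y) / (z0 - Complex a y))"
  using ne by (intro continuous_intros cont) (auto simp: Complex_eq intro!: continuous_intros)
 have i0: "integrable lborel (%y::real. inverse (1 + y\<^sup>2))"
  using integrable_inverse_1_plus_square by (simp add: set_integrable_def einterval_eq)
 have nR: "norm (R (Complex a y)) <= C * inverse (1 + y\<^sup>2)" for y
 proof -
  have "Complex a y - of_real a = Complex 0 y" by (simp add: complex_eq_iff)
  then show ?thesis using bd[of "Complex a y"] by (simp add: divide_inverse cmod_def)
 qed
 show int: "integrable lborel (%y. R (Complex a y))"
 proof (rule bochner_bound)
  show "integrable lborel (%y. C * inverse (1 + y\<^sup>2))" using i0 by simp
  show "AE y in lborel. norm (R (Complex a y)) <= norm (C * inverse (1 + y\<^sup>2))"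
   using order_trans[OF nR abs_ge_self] by simp
 qed (use borel_measurable_continuous_onI[OF cont] in simp)
 show int2: "integrable lborel (%y. R (Complex a y) / (z0 - Complex a y))"
 proof (rule bochner_bound)
  show "integrable lborel (%y. norm (R (Complex a y)) / (Re z0 - a))"
   using int by simp
  show "AE y in lborel. norm (R (Complex a y) / (z0 - Complex a y)) <= norm (norm (R (Complex a y)) / (Re z0 - a))" (is "AE y in _. ?bd y")
  proof (intro AE_I2)
   fix y
   have "Re z0 - a <= norm (z0 - Complex a y)" using complex_Re_le_cmod[of "z0 - Complex a y"] by simp
   then show "?bd y"
    using z0 by (simp add: norm_divide frac_le)
  qed
 qed (use borel_measurable_continuous_onI[OF cont2] in simp)
 define h where "h y = R (Complex a y) / (z0 - Complex a y)" for y
 \<comment> \<open>The lower bound on \<open>L\<close> puts \<open>z0\<close> inside the rectangle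
   and keeps the three discarded sides at distance at least 1 from it.\<close>
 have est: "norm (2 * pi * R z0 - integral {-L..L} h) <= 4 * L * (C / (1 + L\<^sup>2))"
  if L: "L >= norm (z0 - of_real a) + 1" for L
 proof -
  have L0: "L > 0" using L norm_ge_zero[of "z0 - of_real a"] by linarith
  define f where "f w = R w / (w - z0)" for w
  define S where "S = {z. Re z > a1}"
  let ?p1 = "Complex a (-L)" and ?p2 = "Complex (a+L) (-L)" and ?p3 = "Complex (a+L) L" and ?p4 = "Complex a L"
  have zb: "Re z0 - a < L" "\<bar>Im z0\<bar> < L"
   using L abs_Re_le_cmod[of "z0 - of_real a"] abs_Im_le_cmod[of "z0 - of_real a"] by auto
  have z0box: "z0 \<in> box ?p1 ?p3" using z0 zb by (auto simp: in_box_complex_iff)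
  have pim: "path_image (rectpath ?p1 ?p3) \<subseteq> S - {z0}"
  proof -
   have "path_image (rectpath ?p1 ?p3) = cbox ?p1 ?p3 - box ?p1 ?p3"
    using L0 by (intro path_image_rectpath_cbox_minus_box) auto
   then have eq: "w \<in> cbox ?p1 ?p3 & w \<notin> box ?p1 ?p3" if "w \<in> path_image (rectpath ?p1 ?p3)" for w
    using that by blast
   show ?thesis
   proof
    fix w assume "w \<in> path_image (rectpath ?p1 ?p3)"
    note w = eq[OF this]
    then have "Re w >= a" by (simp add: in_cbox_complex_iff)
    then have "w \<in> S" using a1 by (simp add: S_def)
    moreover have "w \<noteq> z0" using w z0box by blast
    ultimately show "w \<in> S - {z0}" by simp
   qed
  qed
  have "((%w. R w / (w - z0)) has_contour_integral complex_of_real (2 * pi) * \<i> * winding_number (rectpath ?p1 ?p3) z0 * R z0) (rectpath ?p1 ?p3)"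
  proof (rule Cauchy_integral_formula_convex_simple[where S=S])
   show "convex S" unfolding S_def by (rule convex_halfspace_Re_gt)
   have "open S" unfolding S_def by (rule open_halfspace_Re_gt)
   then show "z0 \<in> interior S" using z0 a1 by (simp add: interior_open S_def)
   show "R holomorphic_on S" unfolding S_def by (rule hol)
   show "path_image (rectpath ?p1 ?p3) \<subseteq> S - {z0}" by (rule pim)
  qed simp_all
  then have "contour_integral (rectpath ?p1 ?p3) (%w. R w / (w - z0)) = complex_of_real (2 * pi) * \<i> * winding_number (rectpath ?p1 ?p3) z0 * R z0"
   by (rule contour_integral_unique)
  then have ci: "contour_integral (rectpath ?p1 ?p3) f = 2 * pi * \<i> * R z0"
   by (simp add: winding_number_rectpath[OF z0box] f_def[abs_def])
  have contf: "continuous_on (S - {z0}) f" unfolding f_def S_def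
   by (intro continuous_intros continuous_on_subset[OF holomorphic_on_imp_continuous_on[OF hol]]) auto
  have segs: "closed_segment ?p1 ?p2 \<subseteq> S - {z0}" "closed_segment ?p2 ?p3 \<subseteq> S - {z0}"
   "closed_segment ?p3 ?p4 \<subseteq> S - {z0}" "closed_segment ?p4 ?p1 \<subseteq> S - {z0}"
   using pim by (auto simp: rectpath_def Let_def path_image_join)
  have ints: "f contour_integrable_on linepath ?p1 ?p2" "f contour_integrable_on linepath ?p2 ?p3"
   "f contour_integrable_on linepath ?p3 ?p4" "f contour_integrable_on linepath ?p4 ?p1"
   using segs by (auto intro!: contour_integrable_continuous_linepath intro: continuous_on_subset[OF contf])
  have split: "contour_integral (rectpath ?p1 ?p3) f = contour_integral (linepath ?p1 ?p2) f + (contour_integral (linepath ?p2 ?p3) f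
    + (contour_integral (linepath ?p3 ?p4) f + contour_integral (linepath ?p4 ?p1) f))"
   unfolding rectpath_def Let_def using ints
   by (simp add: contour_integrable_joinI)
  have fb: "norm (f w) <= C / (1 + L\<^sup>2)" if "Re w >= a" "norm (w - of_real a) >= L" for w
  proof -
   have "norm (R w) <= C / (1 + norm (w - of_real a) ^ 2)" by (rule bd) fact
   also have "... <= C / (1 + L\<^sup>2)"
    using that L0 C0 by (intro divide_left_mono add_left_mono power_mono) (auto intro!: mult_pos_pos add_pos_nonneg)
   finally have 1: "norm (R w) <= C / (1 + L\<^sup>2)" .
   have "norm (w - z0) >= norm (w - of_real a) - norm (z0 - of_real a)"
    using norm_triangle_ineq2[of "w - of_real a" "z0 - of_real a"] by simp
   then have 2: "norm (w - z0) >= 1" using that L by linarith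
   have "norm (f w) = norm (R w) / norm (w - z0)" by (simp add: f_def norm_divide)
   also have "... <= norm (R w) / 1" using 2 by (intro divide_left_mono) auto
   finally show ?thesis using 1 by simp
  qed
  have B0: "0 <= C / (1 + L\<^sup>2)" using C0 by simp
  have b1: "norm (contour_integral (linepath ?p1 ?p2) f) <= C / (1 + L\<^sup>2) * L"
  proof -
   have "norm (contour_integral (linepath ?p1 ?p2) f) <= C / (1 + L\<^sup>2) * norm (?p2 - ?p1)"
   proof (rule contour_integral_bound_linepath[OF ints(1) B0], rule fb)
    fix x assume "x \<in> closed_segment ?p1 ?p2"
    then have x: "Im x = - L" "Re x \<in> closed_segment a (a+L)" by (auto simp: closed_segment_same_Im)
    then show "Re x >= a" using L0 by (auto simp: closed_segment_eq_real_ivl)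
    show "L <= norm (x - of_real a)" using abs_Im_le_cmod[of "x - of_real a"] x L0 by simp
   qed
   also have "?p2 - ?p1 = of_real L" by (simp add: complex_eq_iff)
   finally show ?thesis using L0 by simp
  qed
  have b2: "norm (contour_integral (linepath ?p2 ?p3) f) <= C / (1 + L\<^sup>2) * (2 * L)"
  proof -
   have "norm (contour_integral (linepath ?p2 ?p3) f) <= C / (1 + L\<^sup>2) * norm (?p3 - ?p2)"
   proof (rule contour_integral_bound_linepath[OF ints(2) B0], rule fb)
    fix x assume "x \<in> closed_segment ?p2 ?p3"
    then have x: "Re x = a + L" by (auto simp: closed_segment_same_Re)
    then show "Re x >= a" using L0 by auto
    show "L <= norm (x - of_real a)" using abs_Re_le_cmod[of "x - of_real a"] x L0 by simp
   qed
   also have "?p3 - ?p2 = \<i> * of_real (2 * L)" by (simp add: complex_eq_iff)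
   finally show ?thesis using L0 by (simp add: norm_mult)
  qed
  have b3: "norm (contour_integral (linepath ?p3 ?p4) f) <= C / (1 + L\<^sup>2) * L"
  proof -
   have "norm (contour_integral (linepath ?p3 ?p4) f) <= C / (1 + L\<^sup>2) * norm (?p4 - ?p3)"
   proof (rule contour_integral_bound_linepath[OF ints(3) B0], rule fb)
    fix x assume "x \<in> closed_segment ?p3 ?p4"
    then have x: "Im x = L" "Re x \<in> closed_segment (a+L) a" by (auto simp: closed_segment_same_Im)
    then show "Re x >= a" using L0 by (auto simp: closed_segment_eq_real_ivl)
    show "L <= norm (x - of_real a)" using abs_Im_le_cmod[of "x - of_real a"] x L0 by simp
   qed
   also have "?p4 - ?p3 = - of_real L" by (simp add: complex_eq_iff)
   finally show ?thesis using L0 by simp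
  qed
  \<comment> \<open>Two signs cancel: the left side is traversed downwards, and \<open>h\<close> has
    the denominator \<open>z0 - w\<close> where \<open>f\<close> has \<open>w - z0\<close>.\<close>
  have b4: "contour_integral (linepath ?p4 ?p1) f = \<i> * integral {-L..L} h"
  proof -
   have "contour_integral (linepath ?p4 ?p1) f = - contour_integral (linepath ?p1 ?p4) f"
    using segs(4) by (intro contour_integral_reverse_linepath continuous_on_subset[OF contf]) (auto simp: closed_segment_commute)
   also have "contour_integral (linepath ?p1 ?p4) f = \<i> * integral {-L..L} (%y. f (Complex a y))"
    using L0 by (intro contour_integral_linepath_same_Re) auto
   also have "(%y. f (Complex a y)) = (%y. - h y)"
   proof
    fix y
    show "f (Complex a y) = - h y" unfolding f_def h_def
     by (metis minus_diff_eq minus_divide_right)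
   qed
   finally show ?thesis by simp
  qed
  have "\<i> * (2 * pi * R z0 - integral {-L..L} h) = contour_integral (linepath ?p1 ?p2) f + (contour_integral (linepath ?p2 ?p3) f
    + contour_integral (linepath ?p3 ?p4) f)"
   using split[unfolded ci b4] by (simp add: algebra_simps)
  then have "norm (2 * pi * R z0 - integral {-L..L} h) = norm (contour_integral (linepath ?p1 ?p2) f + (contour_integral (linepath ?p2 ?p3) f
    + contour_integral (linepath ?p3 ?p4) f))"
   by (metis mult.left_neutral norm_ii norm_mult)
  also have "... <= C / (1 + L\<^sup>2) * L + (C / (1 + L\<^sup>2) * (2 * L) + C / (1 + L\<^sup>2) * L)"
   by (intro norm_triangle_le add_mono b1 b2 b3 order_refl)
  also have "... = 4 * L * (C / (1 + L\<^sup>2))" by (simp add: algebra_simps)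
  finally show ?thesis .
 qed
 have inth: "integrable lborel h" using int2 by (simp only: h_def[abs_def])
 have lim1: "((%L. integral {-L..L} h) \<longlongrightarrow> (LBINT y. h y)) at_top"
 proof -
  have "((%L. LBINT y. indicator {-L..L} y *\<^sub>R h y) \<longlongrightarrow> (LBINT y. h y)) at_top"
  proof (rule integral_dominated_convergence_at_top[where w="%y. norm (h y)"])
   show "AE y in lborel. ((%L. indicator {-L..L} y *\<^sub>R h y) \<longlongrightarrow> h y) at_top"
   proof (intro AE_I2 tendsto_eventually eventually_at_top_linorderI)
    fix y L :: real assume "\<bar>y\<bar> <= L"
    then have "y \<in> {-L..L}" by (simp add: abs_le_iff)
    then show "indicator {-L..L} y *\<^sub>R h y = h y" by simp
   qed
   show "\<forall>\<^sub>F L in at_top. AE y in lborel. norm (indicator {-L..L} y *\<^sub>R h y) <= norm (h y)"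
    by (intro always_eventually allI AE_I2) (auto simp: indicator_def)
  qed (use inth in auto)
  moreover have "(LBINT y. indicator {-L..L} y *\<^sub>R h y) = integral {-L..L} h" for L
  proof -
   have "set_integrable lborel {-L..L} h"
    using integrable_mult_indicator[OF _ inth] by (simp add: set_integrable_def)
   from set_borel_integral_eq_integral(2)[OF this] show ?thesis by (simp add: set_lebesgue_integral_def)
  qed
  ultimately show ?thesis by simp
 qed
 have lim2: "((%L. 2 * pi * R z0 - integral {-L..L} h) \<longlongrightarrow> 0) at_top"
 proof (rule Lim_null_comparison)
  show "\<forall>\<^sub>F L in at_top. norm (2 * pi * R z0 - integral {-L..L} h) <= 4 * L * (C / (1 + L\<^sup>2))"
   using est by (rule eventually_at_top_linorderI)
  show "((%L. 4 * L * (C / (1 + L\<^sup>2))) \<longlongrightarrow> 0) at_top"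
   by real_asymp
 qed
 have "((%L. 2 * pi * R z0 - integral {-L..L} h) \<longlongrightarrow> 2 * pi * R z0 - (LBINT y. h y)) at_top"
  by (intro tendsto_intros lim1)
 from tendsto_unique[OF _ this lim2]
 show "(LBINT y. R (Complex a y) / (z0 - Complex a y)) = 2 * pi * R z0"
  by (simp add: h_def[symmetric])
qed

lemma pole_term_bigo:
 fixes z :: complex
 shows "(%w. 1 / (w - z)) \<in> O[at_infinity](%w. 1 / w)"
proof (rule bigoI[where c=2])
 show "\<forall>\<^sub>F w in at_infinity. norm (1 / (w - z)) <= 2 * norm (1 / w)"
  unfolding eventually_at_infinity
 proof (intro exI allI impI)
  fix w :: complex assume w: "2 * norm z + 1 <= norm w"
  have "norm w <= norm (w - z) + norm z" by (metis diff_add_cancel norm_triangle_ineq)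
  then have "norm w / 2 <= norm (w - z)" using w by simp
  moreover have "norm w > 0" using w norm_ge_zero[of z] by linarith
  ultimately have "1 / norm (w - z) <= 1 / (norm w / 2)" by (intro frac_le) auto
  then show "norm (1 / (w - z)) <= 2 * norm (1 / w)" by (simp add: norm_divide)
 qed
qed

lemma pole_power_bigo:
 fixes z :: complex
 assumes "m >= 1"
 shows "(%w. 1 / (w - z) ^ (m + 1)) \<in> O[at_infinity](%w. 1 / w ^ 2)"
proof -
 have "(%w. (1 / (w - z)) ^ (m + 1)) \<in> O[at_infinity](%w. (1 / w) ^ (m + 1))"
  by (intro landau_o.big_power pole_term_bigo)
 also have "(%w::complex. (1 / w) ^ (m + 1)) \<in> O[at_infinity](%w. 1 / w ^ 2)"
 proof (rule bigoI[where c=1])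
  show "\<forall>\<^sub>F w::complex in at_infinity. norm ((1 / w) ^ (m + 1)) <= 1 * norm (1 / w ^ 2)"
   unfolding eventually_at_infinity
  proof (intro exI allI impI)
   fix w :: complex assume w: "1 <= norm w"
   have "norm w ^ 2 <= norm w ^ (m + 1)" using w assms by (intro power_increasing) auto
   moreover have "norm w > 0" using w by linarith
   ultimately show "norm ((1 / w) ^ (m + 1)) <= 1 * norm (1 / w ^ 2)"
    using w by (simp add: norm_divide norm_power power_one_over frac_le del: power_Suc)
  qed
 qed
 finally show ?thesis by (simp add: power_one_over)
qed

lemma cmult_bigo:
 fixes c :: complex
 assumes "f \<in> O[F](g)"
 shows "(%w. c * f w) \<in> O[F](g)"
 using assms by (cases "c = 0") auto

text \<open>The difference equals \<open>z / ((w - z) * w)\<close>. Simple poles alone decay too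
  slowly; compared with \<open>1 / w\<close> they gain one order.\<close>

lemma pole_diff_bigo:
 fixes z :: complex
 shows "(%w. 1 / (w - z) - 1 / w) \<in> O[at_infinity](%w. 1 / w ^ 2)"
proof -
 have "(%w. z * (1 / (w - z) * (1 / w))) \<in> O[at_infinity](%w. 1 / w * (1 / w))"
  by (intro cmult_bigo landau_o.big.mult pole_term_bigo landau_o.big_refl)
 moreover have "\<forall>\<^sub>F w in at_infinity. z * (1 / (w - z) * (1 / w)) = 1 / (w - z) - 1 / w"
  unfolding eventually_at_infinity
 proof (intro exI allI impI)
  fix w :: complex assume w: "norm z + 1 <= norm w"
  then have "norm w > norm z" "norm w > 0" using norm_ge_zero[of z] by linarith+
  then have "w \<noteq> z" "w \<noteq> 0" by auto
  then show "z * (1 / (w - z) * (1 / w)) = 1 / (w - z) - 1 / w" by (simp add: divide_simps)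
 qed
 ultimately show ?thesis by (subst (asm) landau_o.big.in_cong) (auto simp: power2_eq_square)
qed

text \<open>Subtracting from \<open>g\<close> its principal parts and one more simple pole leaves a
  function \<open>R\<close> that is holomorphic to the right of \<open>a1\<close> and of order
  \<open>1 / w ^ 2\<close> on \<open>Re w >= a\<close>. Its inverse transform along
  \<open>Re w = a\<close> converges absolutely and grows at most like \<open>exp (a * t)\<close>,
  while the subtracted terms have explicit inverse transforms.\<close>

lemma laplace_representation:
 fixes g :: "complex => complex" and K :: "complex => nat => complex"
 assumes S: "finite S" "!!z. z \<in> S ==> Re z = \<alpha>" and a1: "a1 < a" and a: "a < \<alpha>"
  and hol: "g holomorphic_on {z. Re z > a1} - S"
  and pol: "!!z. z \<in> S ==> \<exists>q. q analytic_on {z} &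
    (\<forall>\<^sub>F w in at z. g w = (\<Sum>m\<le>n. fact m * K z m / (w - z) ^ (m + 1)) + q w)"
  and asy: "!!z. Re z >= a ==> norm z >= L ==> norm (g z - c / z) <= C / norm z ^ 2"
 obtains v D where "continuous_on UNIV v" "!!t. t >= 0 ==> norm (v t) <= D * exp (a * t)"
  "!!l. l > \<alpha> ==> set_integrable lborel {0..} (%t. lexp l t *
    ((exp_sum S n K t) + v t))"
  "!!l. l > \<alpha> ==> (LBINT t:{0..}. lexp l t *
    ((exp_sum S n K t) + v t)) = g (of_real l)"
proof -
 define U where "U = {z. Re z > a1}"
 have openU: "open U" unfolding U_def by (rule open_halfspace_Re_gt)
 \<comment> \<open>The additional pole sits on the boundary of \<open>U\<close>, hence outside the
   domain and left of the line of integration; its inverse transform grows like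
   \<open>exp (a1 * t)\<close> and is absorbed in the bound for \<open>v\<close>.\<close>
 define b where "b = complex_of_real a1"
 \<comment> \<open>\<open>c\<close> is the coefficient of \<open>1 / w\<close> in \<open>g\<close>
   at infinity; \<open>c'\<close> is what remains of it after the simple poles at \<open>S\<close>
   have been subtracted.\<close>
 define c' where "c' = c - (\<Sum>z\<in>S. K z 0)"
 define sing where "sing w = (\<Sum>z\<in>S. \<Sum>m\<le>n. fact m * K z m / (w - z) ^ (m + 1))" for w
 define R0 where "R0 w = g w - sing w - c' / (w - b)" for w
 define R where "R = remove_sings R0"
 have nb: "w - b \<noteq> 0" if "w \<in> U" for w using that by (auto simp: U_def b_def)
 have R0hol: "R0 holomorphic_on U - S"
  unfolding R0_def sing_def by (intro holomorphic_intros hol[folded U_def]) (use nb in auto)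
 have openUS: "open (U - S)" using openU S(1) by (simp add: finite_imp_closed open_Diff)
 have R0an: "R0 analytic_on {w}" if "w \<in> U - S" for w
  using R0hol openUS that analytic_at by blast
 have Reg: "R w = R0 w" if "w \<in> U - S" for w
  unfolding R_def by (rule remove_sings_at_analytic[OF R0an[OF that]])
 have SU: "S \<subseteq> U" using S(2) a1 a by (auto simp: U_def)
 have Ran: "R analytic_on {w}" if w: "w \<in> U" for w
 proof (cases "w \<in> S")
  case False
  then show ?thesis unfolding R_def using remove_sings_analytic_on[OF R0an] w by simp
 next
  case True
  from pol[OF True] obtain q where q: "q analytic_on {w}"
   "\<forall>\<^sub>F u in at w. g u = (\<Sum>m\<le>n. fact m * K w m / (u - w) ^ (m + 1)) + q u" by blast
  \<comment> \<open>Near \<open>w\<close> the principal part at \<open>w\<close> cancels and all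
    other summands are analytic, so \<open>q2\<close> continues \<open>R0\<close> across the
    point.\<close>
  define q2 where "q2 u = q u - (\<Sum>z\<in>S-{w}. \<Sum>m\<le>n. fact m * K z m / (u - z) ^ (m + 1)) - c' / (u - b)" for u
  have "q2 analytic_on {w}" unfolding q2_def
   using nb[OF w] by (intro analytic_intros q(1)) auto
  then have "isCont q2 w" by (simp add: analytic_at_imp_isCont)
  then have lim: "q2 \<midarrow>w\<rightarrow> q2 w" by (simp add: isCont_def)
  have "\<forall>\<^sub>F u in at w. q2 u = R0 u"
   using q(2)
  proof eventually_elim
   case (elim u)
   have "sing u = (\<Sum>m\<le>n. fact m * K w m / (u - w) ^ (m + 1)) + (\<Sum>z\<in>S-{w}. \<Sum>m\<le>n. fact m * K z m / (u - z) ^ (m + 1))"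
    unfolding sing_def by (rule sum.remove[OF S(1) True])
   with elim show ?case by (simp add: q2_def R0_def)
  qed
  then have lim2: "R0 \<midarrow>w\<rightarrow> q2 w" by (rule Lim_transform_eventually[OF lim])
  have "isolated_singularity_at R0 w"
  proof -
   have "open (U - (S - {w}))" using openU S(1) by (simp add: finite_imp_closed open_Diff)
   moreover have "w \<in> U - (S - {w})" using w by auto
   moreover have "U - (S - {w}) - {w} = U - S" using True by auto
   ultimately show ?thesis using R0hol isolated_singularity_at_holomorphic[of R0 "U - (S - {w})" w] by simp
  qed
  then show ?thesis unfolding R_def by (rule remove_sings_analytic_at[OF _ lim2])
 qed
 have Rhol: "R holomorphic_on {z. Re z > a1}"
  using Ran analytic_on_analytic_at[of R U] analytic_imp_holomorphic unfolding U_def by blast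
 obtain C2 L2 where L2: "L2 >= 1" "!!w. Re w >= a ==> norm w >= L2 ==> norm (R w) <= C2 / norm w ^ 2"
 proof -
  \<comment> \<open>\<open>T\<close> is all that is subtracted from \<open>g w - c / w\<close> to
    obtain \<open>R0\<close>. By the choice of \<open>c'\<close>, every simple pole can be written
    as a difference with \<open>1 / w\<close>.\<close>
  define T where "T w = (\<Sum>z\<in>S. K z 0 * (1 / (w - z) - 1 / w)) + (\<Sum>z\<in>S. \<Sum>m\<in>{1..n}. (fact m * K z m) * (1 / (w - z) ^ (m + 1))) + c' * (1 / (w - b) - 1 / w)" for w
  have "T \<in> O[at_infinity](%w. 1 / w ^ 2)"
   unfolding T_def
   by (intro sum_in_bigo big_sum_in_bigo cmult_bigo pole_diff_bigo pole_power_bigo) auto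
  then obtain c2 where c2: "\<forall>\<^sub>F w in at_infinity. norm (T w) <= c2 * norm (1 / w ^ 2)"
   by (auto elim: landau_o.bigE)
  then obtain B where B: "!!w. norm w >= B ==> norm (T w) <= c2 * norm (1 / w ^ 2)"
   by (auto simp: eventually_at_infinity)
  have split: "R0 w = (g w - c / w) - T w" if "w \<noteq> 0" for w
  proof -
   have "(\<Sum>m\<le>n. fact m * K z m / (w - z) ^ (m + 1)) = K z 0 / (w - z) + (\<Sum>m\<in>{1..n}. fact m * K z m / (w - z) ^ (m + 1))" for z
    by (subst atMost_atLeast0, subst sum.atLeast_Suc_atMost) auto
   then have "sing w = (\<Sum>z\<in>S. K z 0 / (w - z)) + (\<Sum>z\<in>S. \<Sum>m\<in>{1..n}. fact m * K z m / (w - z) ^ (m + 1))"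
    by (simp add: sing_def sum.distrib)
   then have "T w = sing w + c' / (w - b) - ((\<Sum>z\<in>S. K z 0) + c') / w"
    unfolding T_def by (simp add: algebra_simps sum_subtractf sum_divide_distrib add_divide_distrib)
   then show ?thesis by (simp add: R0_def c'_def)
  qed
  define L2 where "L2 = max (max 1 L) (max B (\<bar>\<alpha>\<bar> + (\<Sum>z\<in>S. norm z) + 1))"
  show thesis
  proof (rule that[of L2 "C + c2"])
   show "L2 >= 1" by (simp add: L2_def)
   fix w assume w: "Re w >= a" "norm w >= L2"
   have "w \<notin> S"
   proof
    assume "w \<in> S"
    then have "norm w <= (\<Sum>z\<in>S. norm z)" using S(1) by (intro member_le_sum) auto
    then show False using w by (auto simp: L2_def)
   qed
   then have "R w = R0 w" using w a1 by (intro Reg) (auto simp: U_def)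
   also have "... = (g w - c / w) - T w" using w by (intro split) (auto simp: L2_def)
   finally have "norm (R w) <= norm (g w - c / w) + norm (T w)" by (simp add: norm_triangle_ineq4)
   also have "... <= C / norm w ^ 2 + c2 * norm (1 / w ^ 2)"
    using w by (intro add_mono asy B) (auto simp: L2_def)
   also have "... = (C + c2) / norm w ^ 2" by (simp add: norm_divide norm_power add_divide_distrib)
   finally show "norm (R w) <= (C + c2) / norm w ^ 2" .
  qed
 qed
 have contR: "continuous_on {z. Re z > a1} R" by (rule holomorphic_on_imp_continuous_on[OF Rhol])
 obtain C3 where C3: "!!w. Re w >= a ==> norm w <= L2 ==> norm (R w) <= C3" "C3 >= 0"
 proof -
  have "{w. Re w >= a} \<inter> cball 0 L2 = cball 0 L2 \<inter> {w. Re w >= a}" by auto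
  moreover have "compact (cball 0 L2 \<inter> {w. Re w >= a})"
   by (intro compact_Int_closed compact_cball closed_halfspace_Re_ge)
  ultimately have "compact (R ` ({w. Re w >= a} \<inter> cball 0 L2))"
   using a1 by (intro compact_continuous_image continuous_on_subset[OF contR]) auto
  then have "bounded (R ` ({w. Re w >= a} \<inter> cball 0 L2))" by (rule compact_imp_bounded)
  then obtain B where "!!x. x \<in> R ` ({w. Re w >= a} \<inter> cball 0 L2) ==> norm x <= B" unfolding bounded_iff by blast
  then show thesis by (intro that[of "max 0 B"]) (force simp: dist_norm)+
 qed
 \<comment> \<open>One constant for the two regions: the \<open>C2\<close> part covers large
   \<open>norm w\<close>, where decay is available, and the \<open>C3\<close> part the compact rest.
   The decay is recentred at \<open>a\<close>, as \<open>half_plane_cauchy\<close> expects.\<close>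
 define C4 where "C4 = \<bar>C2\<bar> * (3 + 2 * a\<^sup>2) + C3 * (1 + (L2 + \<bar>a\<bar>)^2)"
 have Rbd: "norm (R w) <= C4 / (1 + norm (w - of_real a) ^ 2)" if w: "Re w >= a" for w
 proof (cases "norm w <= L2")
  case True
  have "norm (w - of_real a) <= L2 + \<bar>a\<bar>"
   using norm_triangle_ineq4[of w "of_real a"] True by simp
  then have "norm (w - of_real a) ^ 2 <= (L2 + \<bar>a\<bar>)^2" by (intro power_mono) auto
  then have "norm (R w) * (1 + norm (w - of_real a) ^ 2) <= C3 * (1 + (L2 + \<bar>a\<bar>)^2)"
   using C3(1)[OF w True] C3(2) by (intro mult_mono) auto
  also have "... <= C4" by (simp add: C4_def)
  finally show ?thesis by (simp add: pos_le_divide_eq add_pos_nonneg)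
 next
  case False
  then have lw: "norm w >= L2" and w1: "norm w >= 1" using L2(1) by auto
  have "norm (w - of_real a) <= norm w + \<bar>a\<bar>"
   using norm_triangle_ineq4[of w "of_real a"] by simp
  then have "norm (w - of_real a) ^ 2 <= (norm w + \<bar>a\<bar>)^2" by (intro power_mono) auto
  also have "... <= 2 * norm w ^ 2 + 2 * a\<^sup>2"
   using sum_squares_bound[of "norm w" "\<bar>a\<bar>"] by (simp add: power2_sum)
  finally have "1 + norm (w - of_real a) ^ 2 <= 1 + 2 * norm w ^ 2 + 2 * a\<^sup>2" by simp
  also have "... <= (3 + 2 * a\<^sup>2) * norm w ^ 2"
  proof -
   have "norm w ^ 2 >= 1" using w1 by simp
   then have "(1 + 2 * a\<^sup>2) * 1 <= (1 + 2 * a\<^sup>2) * norm w ^ 2" by (intro mult_left_mono) auto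
   then show ?thesis by (simp add: algebra_simps)
  qed
  finally have 1: "1 + norm (w - of_real a) ^ 2 <= (3 + 2 * a\<^sup>2) * norm w ^ 2" .
  have "norm (R w) * norm w ^ 2 <= C2" using L2(2)[OF w lw] w1 by (subst (asm) pos_le_divide_eq) auto
  then have 2: "norm (R w) * norm w ^ 2 <= \<bar>C2\<bar>" by simp
  have "norm (R w) * (1 + norm (w - of_real a) ^ 2) <= norm (R w) * ((3 + 2 * a\<^sup>2) * norm w ^ 2)"
   using 1 by (intro mult_left_mono) auto
  also have "... = (norm (R w) * norm w ^ 2) * (3 + 2 * a\<^sup>2)" by simp
  also have "... <= \<bar>C2\<bar> * (3 + 2 * a\<^sup>2)" using 2 by (intro mult_right_mono) auto
  also have "... <= C4" using C3(2) by (simp add: C4_def)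
  finally show ?thesis by (simp add: pos_le_divide_eq add_pos_nonneg)
 qed
 have intR: "integrable lborel (%y. R (Complex a y))"
  using half_plane_cauchy(1)[OF Rhol a1 Rbd, of "of_real (a + 1)"] by simp
 \<comment> \<open>The inversion integral of \<open>R\<close> along \<open>Re z = a\<close>; the
   factor \<open>1 / (2 * pi)\<close> is supplied in \<open>v\<close>.\<close>
 define v1 where "v1 t = (LBINT y. exp (Complex a y * of_real t) * R (Complex a y))" for t :: real
 define v where "v t = c' * exp (b * of_real t) + v1 t / (2 * pi)" for t
 define J where "J = (LBINT y. norm (R (Complex a y)))"
 have v1meas: "(%y. exp (Complex a y * of_real t) * R (Complex a y)) \<in> borel_measurable borel" for t
 proof -
  have "(%y. exp (Complex a y * of_real t)) \<in> borel_measurable borel"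
   by (intro borel_measurable_continuous_onI) (auto simp: Complex_eq intro!: continuous_intros)
  moreover have "(%y. R (Complex a y)) \<in> borel_measurable borel"
   using intR by (auto dest: borel_measurable_integrable)
  ultimately show ?thesis by measurable
 qed
 have v1norm: "norm (exp (Complex a y * of_real t) * R (Complex a y)) = exp (a * t) * norm (R (Complex a y))" for y t
  by (simp add: norm_mult)
 have v1int: "integrable lborel (%y. exp (Complex a y * of_real t) * R (Complex a y))" for t
  by (rule bochner_bound[where f="%y. exp (a * t) * norm (R (Complex a y))"])
   (use intR v1meas in \<open>auto simp: v1norm\<close>)
 have v1bd: "norm (v1 t) <= exp (a * t) * J" for t
 proof -
  have "norm (v1 t) <= (LBINT y. norm (exp (Complex a y * of_real t) * R (Complex a y)))"
   unfolding v1_def by (rule integral_norm_bound)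
  then show ?thesis by (simp add: v1norm J_def)
 qed
 have v1cont: "continuous_on UNIV v1"
 proof (clarsimp simp: continuous_on_eq_continuous_at)
  fix t0 :: real
  show "isCont v1 t0"
  proof (rule continuous_at_sequentiallyI)
   fix u :: "nat => real" assume u: "u \<longlonglongrightarrow> t0"
   then have "Bseq u" by (rule convergentI[THEN Cauchy_convergent_iff[THEN iffD2, THEN Cauchy_Bseq]])
   then obtain k where k: "!!i. \<bar>u i\<bar> <= k" by (auto simp: Bseq_def)
   show "(%i. v1 (u i)) \<longlonglongrightarrow> v1 t0"
    unfolding v1_def
   proof (rule integral_dominated_convergence[where w="%y. exp (\<bar>a\<bar> * k) * norm (R (Complex a y))"])
    show "AE y in lborel. (%i. exp (Complex a y * of_real (u i)) * R (Complex a y)) \<longlonglongrightarrow> exp (Complex a y * of_real t0) * R (Complex a y)"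
     by (intro AE_I2 tendsto_intros u)
    show "AE y in lborel. norm (exp (Complex a y * of_real (u i)) * R (Complex a y)) <= exp (\<bar>a\<bar> * k) * norm (R (Complex a y))" (is "AE y in _. ?bd y") for i
    proof (intro AE_I2)
     fix y
     have "a * u i <= \<bar>a\<bar> * \<bar>u i\<bar>" by (metis abs_ge_self abs_mult)
     also have "... <= \<bar>a\<bar> * k" using k by (intro mult_left_mono) auto
     finally show "?bd y"
      unfolding v1norm by (intro mult_right_mono) auto
    qed
   qed (use v1meas intR in auto)
  qed
 qed
 have ba: "Re b < a" using a1 by (simp add: b_def)
 show thesis
 proof (rule that[of v "norm c' + J / (2 * pi)"])
  show "continuous_on UNIV v" unfolding v_def by (intro continuous_intros v1cont) auto
  fix t :: real assume t: "t >= 0"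
  have "norm (v t) <= norm (c' * exp (b * of_real t)) + norm (v1 t / (2 * pi))" unfolding v_def by (rule norm_triangle_ineq)
  also have "norm (c' * exp (b * of_real t)) <= norm c' * exp (a * t)"
   using a1 t by (simp add: norm_mult b_def mult_left_mono mult_right_mono)
  also have "norm (v1 t / (2 * pi)) <= exp (a * t) * J / (2 * pi)"
   using v1bd[of t] by (simp add: norm_divide divide_right_mono norm_mult)
  finally show "norm (v t) <= (norm c' + J / (2 * pi)) * exp (a * t)" by (simp add: algebra_simps)
 next
  fix l :: real assume l: "l > \<alpha>"
  have exp_split: "lexp l t * (k * exp_poly m z t) = k * (of_real t ^ m * exp (- (of_real l - z) * of_real t))"
   for t :: real and z k :: complex and m
  proof -
   have "exp (- (of_real l - z) * of_real t) = lexp l t * exp (z * complex_of_real t)"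
    by (simp add: algebra_simps flip: exp_add)
   then show ?thesis by (simp add: mult_ac)
  qed
  have I1: "set_integrable lborel {0..} (%t. lexp l t * (k * exp_poly m z t))"
    "(LBINT t:{0..}. lexp l t * (k * exp_poly m z t)) = fact m * k / (of_real l - z) ^ (m + 1)"
   if "Re z < l" for k z m
  proof -
   have "Re (of_real l - z) > 0" using that by simp
   note lm = laplace_monomial[OF this, of m]
   show "set_integrable lborel {0..} (%t. lexp l t * (k * exp_poly m z t))"
    unfolding exp_split by (intro set_integrable_mult_right lm)
   show "(LBINT t:{0..}. lexp l t * (k * exp_poly m z t)) = fact m * k / (of_real l - z) ^ (m + 1)"
    unfolding exp_split set_integral_mult_right lm(2) by simp
  qed
  define F where "F t y = indicator {0..} t *\<^sub>R (lexp l t * (exp (Complex a y * of_real t) * R (Complex a y)))" for t y :: real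
  have al: "a < l" using a l by simp
  have nF: "norm (F t y) = (indicator {0..} t *\<^sub>R exp (- (l - a) * t)) * norm (R (Complex a y))" for t y
  proof -
   have "exp (- (l - a) * t) = exp (- l * t) * exp (a * t)" by (simp add: algebra_simps flip: exp_add)
   then show ?thesis by (simp add: F_def norm_mult v1norm)
  qed
  have Fint: "integrable (lborel \<Otimes>\<^sub>M lborel) (%(t, y). F t y)"
  proof (rule lborel_pair.Fubini_integrable)
   have m1: "(%p::real\<times>real. exp (Complex a (snd p) * of_real (fst p))) \<in> borel_measurable (lborel \<Otimes>\<^sub>M lborel)"
    unfolding Complex_eq by measurable
   have [measurable]: "(%y. R (Complex a y)) \<in> borel_measurable borel"
    using intR by (auto dest: borel_measurable_integrable)
   show "(%(t, y). F t y) \<in> borel_measurable (lborel \<Otimes>\<^sub>M lborel)"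
    unfolding F_def split_beta' using m1 by measurable
   have "integrable lborel (%t. indicator {0..} t *\<^sub>R exp (- (l - a) * t))"
    using set_integrable_exp_neg[of "l - a"] al by (simp add: set_integrable_def)
   then show "integrable lborel (%t. LBINT y. norm (case (t, y) of (t, y) => F t y))"
    unfolding prod.case nF by simp
   show "AE t in lborel. integrable lborel (%y. case (t, y) of (t, y) => F t y)"
    unfolding F_def prod.case by (intro AE_I2 integrable_scaleR_right integrable_mult_right v1int)
  qed
  have v1F: "indicator {0..} t *\<^sub>R (lexp l t * v1 t) = (LBINT y. F t y)" for t
   unfolding F_def v1_def by simp
  have I2: "set_integrable lborel {0..} (%t. lexp l t * v1 t)"
   unfolding set_integrable_def v1F using lborel_pair.integrable_fst'[OF Fint] by simp
  \<comment> \<open>After exchanging the integrals the inner one is the transform of a single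
    exponential, and the outer one is Cauchy's formula at the point \<open>l\<close>.\<close>
  have I2': "(LBINT t:{0..}. lexp l t * v1 t) = 2 * pi * R (of_real l)"
  proof -
   have "(LBINT t:{0..}. lexp l t * v1 t) = (LBINT t. LBINT y. F t y)"
    unfolding set_lebesgue_integral_def v1F ..
   also have "... = (LBINT y. LBINT t. F t y)"
    by (rule lborel_pair.Fubini_integral[OF Fint, symmetric])
   also have "... = (LBINT y. R (Complex a y) / (of_real l - Complex a y))"
   proof (rule bochner_cong[OF refl])
    fix y
    have "(LBINT t. F t y) = (LBINT t:{0..}. lexp l t * (R (Complex a y) * exp_poly 0 (Complex a y) t))"
     unfolding set_lebesgue_integral_def F_def by (simp add: mult_ac)
    also have "... = R (Complex a y) / (of_real l - Complex a y)"
     using I1(2)[of "Complex a y" "R (Complex a y)" 0] al by simp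
    finally show "(LBINT t. F t y) = R (Complex a y) / (of_real l - Complex a y)" .
   qed
   also have "... = 2 * pi * R (of_real l)"
    using half_plane_cauchy(3)[OF Rhol a1 Rbd, of "of_real l"] al by simp
   finally show ?thesis .
  qed
  have lS: "Re z < l" if "z \<in> S" for z using S(2)[OF that] l by simp
  have bl: "Re b < l" using ba al by simp
  have eq: "lexp l t * ((exp_sum S n K t) + v t)
   = (\<Sum>z\<in>S. \<Sum>m\<le>n. lexp l t * (K z m * exp_poly m z t))
    + (lexp l t * (c' * exp_poly 0 b t) + (lexp l t * v1 t) / (2 * pi))" for t :: real
   by (simp add: v_def sum_distrib_left algebra_simps)
  have isum: "set_integrable lborel {0..} (%t. \<Sum>z\<in>S. \<Sum>m\<le>n. lexp l t * (K z m * exp_poly m z t))"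
   unfolding set_integrable_def scaleR_sum_right
   by (intro bochner_isum I1(1)[unfolded set_integrable_def] lS)
  have iv: "set_integrable lborel {0..} (%t. lexp l t * (c' * exp_poly 0 b t) + (lexp l t * v1 t) / (2 * pi))"
   by (intro set_integral_add set_integrable_divide I1 I2 bl)
  show "set_integrable lborel {0..} (%t. lexp l t *
    ((exp_sum S n K t) + v t))"
   unfolding eq by (intro set_integral_add isum iv)
  have "(LBINT t:{0..}. lexp l t *
    ((exp_sum S n K t) + v t)) =
   (LBINT t:{0..}. (\<Sum>z\<in>S. \<Sum>m\<le>n. lexp l t * (K z m * exp_poly m z t)))
   + ((LBINT t:{0..}. lexp l t * (c' * exp_poly 0 b t)) + (LBINT t:{0..}. (lexp l t * v1 t) / (2 * pi)))"
   unfolding eq using isum iv I1(1)[OF bl] I2 by (simp only: set_integral_add set_integrable_divide)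
  also have "(LBINT t:{0..}. (\<Sum>z\<in>S. \<Sum>m\<le>n. lexp l t * (K z m * exp_poly m z t))) = sing (of_real l)"
   unfolding set_lebesgue_integral_def scaleR_sum_right sing_def
   by (subst bochner_sum, (intro bochner_isum I1(1)[unfolded set_integrable_def] lS, assumption)[1],
     rule sum.cong[OF refl], subst bochner_sum, (intro I1(1)[unfolded set_integrable_def] lS, assumption)[1],
     rule sum.cong[OF refl], rule I1(2)[unfolded set_lebesgue_integral_def], rule lS)
  also have "(LBINT t:{0..}. lexp l t * (c' * exp_poly 0 b t)) = c' / (of_real l - b)"
   using I1(2)[OF bl, of c' 0] by simp
  also have "(LBINT t:{0..}. (lexp l t * v1 t) / (2 * pi)) = R (of_real l)"
   using I2' by simp
  also have "R (of_real l) = R0 (of_real l)"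
   using lS a a1 l by (intro Reg) (force simp: U_def)
  finally show "(LBINT t:{0..}. lexp l t *
    ((exp_sum S n K t) + v t)) = g (of_real l)"
   by (simp add: R0_def)
 qed
qed

section \<open>Gaussian increments of Brownian motion and their covariances\<close>

text \<open>Lebesgue measure on a Euclidean space is the image of the product measure over the
  basis, for which integrals of products factor. \<open>idx\<close> recovers the coordinate from a
  basis vector.\<close>

lemma lborel_vec_prod:
 fixes f :: "'e::finite => real => real"
 assumes f: "!!i. integrable lborel (f i)"
 shows "has_bochner_integral lborel (%x :: real^'e. \<Prod>i\<in>UNIV. f i (x $ i)) (\<Prod>i\<in>UNIV. integral\<^sup>L lborel (f i))"
proof -
 interpret product_sigma_finite "%_ :: real^'e. lborel :: real measure" ..
 define idx where "idx b = (THE i. b = axis i (1::real))" for b :: "real^'e"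
 have idx: "idx (axis i 1) = i" for i unfolding idx_def by (rule the_equality) (auto simp: axis_eq_axis)
 have Basis: "(Basis :: (real^'e) set) = range (%i. axis i 1)" by (auto simp: Basis_vec_def)
 have inj: "inj (%i. axis i (1::real) :: real^'e)" by (auto simp: inj_on_def axis_eq_axis)
 have nth: "(\<Sum>b\<in>Basis. g b *\<^sub>R b) $ i = g (axis i 1)" for g :: "real^'e => real" and i
  unfolding Basis by (subst sum.reindex[OF inj]) (simp add: axis_def if_distrib cong: if_cong)
 have eq: "(\<Prod>i\<in>UNIV. f i ((\<Sum>b\<in>Basis. g b *\<^sub>R b) $ i)) = (\<Prod>b\<in>Basis. f (idx b) (g b))" for g :: "real^'e => real"
  unfolding nth unfolding Basis by (subst prod.reindex[OF inj]) (simp add: idx)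
 have eq2: "(\<Prod>b\<in>Basis. integral\<^sup>L lborel (f (idx b))) = (\<Prod>i\<in>UNIV. integral\<^sup>L lborel (f i))"
  unfolding Basis by (subst prod.reindex[OF inj]) (simp add: idx)
 have [measurable]: "f i \<in> borel_measurable borel" for i using borel_measurable_integrable[OF f[of i]] by simp
 have meas: "(%x :: real^'e. \<Prod>i\<in>UNIV. f i (x $ i)) \<in> borel_measurable borel" by measurable
 have mb: "(%g. \<Sum>b\<in>Basis. g b *\<^sub>R b) \<in> measurable (\<Pi>\<^sub>M b\<in>(Basis :: (real^'e) set). lborel) borel" by measurable
 have i1: "integrable (\<Pi>\<^sub>M b\<in>(Basis :: (real^'e) set). lborel) (%g. \<Prod>b\<in>Basis. f (idx b) (g b))"
  by (intro product_integrable_prod f) auto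
 have "integrable lborel (%x :: real^'e. \<Prod>i\<in>UNIV. f i (x $ i))"
  by (subst lborel_eq, subst integrable_distr_eq[OF mb meas]) (use i1 in \<open>simp only: eq\<close>)
 moreover have "(LBINT x. (\<Prod>i\<in>UNIV. f i ((x :: real^'e) $ i))) = (\<Prod>i\<in>UNIV. integral\<^sup>L lborel (f i))"
  by (subst lborel_eq, subst integral_distr[OF mb meas], subst eq, subst product_integral_prod)
   (auto intro: f simp: eq2)
 ultimately show ?thesis by (simp add: has_bochner_integral_iff)
qed

text \<open>A coordinate is written as a product over all \<open>i\<close> with factor
  \<open>x $ i\<close> at \<open>i = l\<close> and 1 elsewhere; the moments then reduce to
  one-dimensional ones.\<close>

lemma gaussian_moments:
 fixes s :: real
 assumes s: "s > 0"
 defines "\<phi> \<equiv> %x :: real^'e. \<Prod>i\<in>UNIV. normal_density 0 s (x $ i)"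
 shows "has_bochner_integral lborel (%x. \<phi> x * x $ l) 0"
  and "has_bochner_integral lborel (%x. \<phi> x * (x $ l * x $ m)) (if l = m then s\<^sup>2 else 0)"
proof -
 have I0: "has_bochner_integral lborel (normal_density 0 s) 1"
  using integrable_normal_density[OF s] integral_normal_density[OF s] by (simp add: has_bochner_integral_iff)
 have I1: "has_bochner_integral lborel (%x. normal_density 0 s x * x) 0" by (rule normal_moment_nz_1[OF s])
 have I2: "has_bochner_integral lborel (%x. normal_density 0 s x * (x * x)) (s\<^sup>2)"
  using normal_moment_even[OF s, of 0 1] by (simp add: power2_eq_square field_simps)
 have "has_bochner_integral lborel (%x :: real^'e. \<Prod>i\<in>UNIV. normal_density 0 s (x $ i) * (if i = l then x $ i else 1))
   (\<Prod>i\<in>UNIV. integral\<^sup>L lborel (%x. normal_density 0 s x * (if i = l then x else 1)))"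
 proof (rule lborel_vec_prod[where f="%i x. normal_density 0 s x * (if i = l then x else 1)"])
  show "integrable lborel (%x. normal_density 0 s x * (if i = l then x else 1))" for i
   using I0 I1 by (cases "i = l") (auto simp: has_bochner_integral_iff)
 qed
 moreover have "integral\<^sup>L lborel (%x. normal_density 0 s x * (if i = l then x else 1)) = (if i = l then 0 else 1)" for i
  using I0 I1 by (auto simp: has_bochner_integral_iff)
 moreover have "(\<Prod>i\<in>UNIV. (if i = l then 0 else 1 :: real)) = 0" by simp
 ultimately show "has_bochner_integral lborel (%x. \<phi> x * x $ l) 0"
  by (simp add: prod.distrib \<phi>_def)
 have mono: "normal_density 0 s x * ((if i = l then x else 1) * (if i = m then x else 1)) =
   (if i = l & i = m then normal_density 0 s x * (x * x) else if i = l \<or> i = m then normal_density 0 s x * x else normal_density 0 s x)" for i x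
  by auto
 have "has_bochner_integral lborel (%x :: real^'e. \<Prod>i\<in>UNIV. normal_density 0 s (x $ i) * ((if i = l then x $ i else 1) * (if i = m then x $ i else 1)))
   (\<Prod>i\<in>UNIV. integral\<^sup>L lborel (%x. normal_density 0 s x * ((if i = l then x else 1) * (if i = m then x else 1))))"
 proof (rule lborel_vec_prod[where f="%i x. normal_density 0 s x * ((if i = l then x else 1) * (if i = m then x else 1))"])
  show "integrable lborel (%x. normal_density 0 s x * ((if i = l then x else 1) * (if i = m then x else 1)))" for i
   using I0 I1 I2 by (cases "i = l"; cases "i = m") (auto simp: has_bochner_integral_iff)
 qed
 moreover have "integral\<^sup>L lborel (%x. normal_density 0 s x * ((if i = l then x else 1) * (if i = m then x else 1))) =
   (if i = l & i = m then s\<^sup>2 else if i = l \<or> i = m then 0 else 1)" for i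
  unfolding mono using I0 I1 I2 by (auto simp: has_bochner_integral_iff)
 moreover have "(\<Prod>i\<in>UNIV. (if i = l & i = m then s\<^sup>2 else if i = l \<or> i = m then 0 else 1)) = (if l = m then s\<^sup>2 else 0)"
 proof (cases "l = m")
  case True
  then have "(\<Prod>i\<in>UNIV. (if i = l & i = m then s\<^sup>2 else if i = l \<or> i = m then 0 else 1)) = (\<Prod>i\<in>UNIV. (if i = m then s\<^sup>2 else 1))"
   by (intro prod.cong) auto
  then show ?thesis using True by simp
 next
  case False
  then show ?thesis by (auto intro!: prod_zero bexI[of _ l])
 qed
 ultimately show "has_bochner_integral lborel (%x. \<phi> x * (x $ l * x $ m)) (if l = m then s\<^sup>2 else 0)"
  by (simp add: prod.distrib \<phi>_def mult_ac)
qed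

locale brownian = prob_space M for M :: "'a measure" +
 fixes \<F> :: "real => 'a measure" and B :: "real => 'a => real^'e"
 assumes filtration: "filtration_on M \<F>" and bm: "brownian_motion M \<F> B"
begin

lemma F_measurable: "t >= 0 ==> f \<in> borel_measurable (\<F> t) ==> f \<in> borel_measurable M"
 using filtration unfolding filtration_on_def by (meson measurable_from_subalg)

lemma space_F: "t >= 0 ==> space (\<F> t) = space M"
 using filtration unfolding filtration_on_def subalgebra_def by auto

lemma F_mono: "0 <= s ==> s <= t ==> f \<in> borel_measurable (\<F> s) ==> f \<in> borel_measurable (\<F> t)"
proof -
 assume s: "0 <= s" "s <= t" and f: "f \<in> borel_measurable (\<F> s)"
 have "subalgebra (\<F> t) (\<F> s)"
  using filtration s space_F[of s] space_F[of t] unfolding filtration_on_def subalgebra_def by auto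
 then show "f \<in> borel_measurable (\<F> t)" using f by (rule measurable_from_subalg)
qed

lemma B_F_measurable: "t >= 0 ==> B t \<in> borel_measurable (\<F> t)"
 using bm by (auto simp: brownian_motion_def)

lemma B_measurable: "t >= 0 ==> B t \<in> borel_measurable M"
 using B_F_measurable F_measurable by blast

lemma increment_moments:
 assumes "0 <= s" "s < t"
 shows "has_bochner_integral M (%w. (B t w - B s w) $ l) 0"
  and "has_bochner_integral M (%w. (B t w - B s w) $ l * (B t w - B s w) $ m) (if l = m then t - s else 0)"
proof -
 define \<phi> where "\<phi> = (%x :: real^'e. \<Prod>i\<in>UNIV. normal_density 0 (sqrt (t - s)) (x $ i))"
 have d: "distributed M lborel (%w. B t w - B s w) (%x. ennreal (\<phi> x))"
  using bm assms unfolding brownian_motion_def \<phi>_def by auto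
 have sq: "sqrt (t - s) > 0" using assms by simp
 have \<phi>m: "\<phi> \<in> borel_measurable lborel" unfolding \<phi>_def by measurable
 have \<phi>0: "\<phi> x >= 0" for x unfolding \<phi>_def by (intro prod_nonneg) auto
 have Dm: "(%w. B t w - B s w) \<in> measurable M lborel" using d by (rule distributed_measurable)
 have trans: "has_bochner_integral M (%w. g (B t w - B s w)) c"
  if g: "g \<in> borel_measurable borel" and h: "has_bochner_integral lborel (%x. \<phi> x * g x) c" for g :: "real^'e => real" and c
 proof -
  have "has_bochner_integral (density lborel (%x. ennreal (\<phi> x))) g c"
   using g h \<phi>m \<phi>0 by (intro has_bochner_integral_density) auto
  then have "has_bochner_integral (distr M lborel (%w. B t w - B s w)) g c"
   using d by (simp add: distributed_def)
  then show ?thesis using g Dm by (simp add: has_bochner_integral_iff integrable_distr_eq integral_distr)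
 qed
 show "has_bochner_integral M (%w. (B t w - B s w) $ l) 0"
  using gaussian_moments(1)[OF sq, of l] by (intro trans[of "%x. x $ l"]) (auto simp: \<phi>_def)
 show "has_bochner_integral M (%w. (B t w - B s w) $ l * (B t w - B s w) $ m) (if l = m then t - s else 0)"
  using gaussian_moments(2)[OF sq, of l m] assms by (intro trans[of "%x. x $ l * x $ m"]) (auto simp: \<phi>_def)
qed

text \<open>Preimages under \<open>U\<close> lie in \<open>\<F> s\<close>, and preimages under
  \<open>g\<close> of the increment are among those of the increment, so the independence of set
  systems in \<open>brownian_motion\<close> applies.\<close>

lemma increment_indep:
 assumes st: "0 <= s" "s < t" and U: "U \<in> borel_measurable (\<F> s)" and g: "g \<in> borel_measurable borel"
 shows "indep_var borel (U :: 'a => real) borel (%w. g (B t w - B s w) :: real)"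
proof -
 let ?D = "%w. B t w - B s w"
 have ind: "indep_set (sets (\<F> s)) {?D -` A \<inter> space M |A. A \<in> sets borel}"
  using bm st unfolding brownian_motion_def by auto
 have D[measurable]: "?D \<in> borel_measurable M" using B_measurable st by auto
 have UM: "U \<in> borel_measurable M" using F_measurable st U by blast
 have "indep_set {U -` A \<inter> space M |A. A \<in> sets borel} {(%w. g (?D w)) -` A \<inter> space M |A. A \<in> sets borel}"
  unfolding indep_sets2_eq
 proof (intro conjI ballI subsetI)
  fix a b assume "a \<in> {U -` A \<inter> space M |A. A \<in> sets borel}" "b \<in> {(%w. g (?D w)) -` A \<inter> space M |A. A \<in> sets borel}"
  then obtain A A' where A: "a = U -` A \<inter> space M" "A \<in> sets borel" "b = (%w. g (?D w)) -` A' \<inter> space M" "A' \<in> sets borel" by auto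
  have "a \<in> sets (\<F> s)" using measurable_sets[OF U A(2)] space_F[OF st(1)] A(1) by simp
  moreover have "b = ?D -` (g -` A') \<inter> space M" using A by auto
  moreover have "g -` A' \<in> sets borel" using measurable_sets[OF g A(4)] by simp
  ultimately show "prob (a \<inter> b) = prob a * prob b" by (intro indep_setD[OF ind]) auto
 qed (use UM g in auto)
 then have "indep_set (sigma_sets (space M) {U -` A \<inter> space M |A. A \<in> sets borel}) (sigma_sets (space M) {(%w. g (?D w)) -` A \<inter> space M |A. A \<in> sets borel})"
 proof (rule indep_set_sigma_sets)
  have *: "Int_stable {X -` A \<inter> space M |A. A \<in> sets borel}" for X :: "'a => real"
   unfolding Int_stable_def
  proof (intro ballI)
   fix a b assume "a \<in> {X -` A \<inter> space M |A. A \<in> sets borel}" "b \<in> {X -` A \<inter> space M |A. A \<in> sets borel}"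
   then obtain A A' where A: "a = X -` A \<inter> space M" "A \<in> sets borel" "b = X -` A' \<inter> space M" "A' \<in> sets borel" by auto
   have "a \<inter> b = X -` (A \<inter> A') \<inter> space M" "A \<inter> A' \<in> sets borel" using A by auto
   then show "a \<inter> b \<in> {X -` A \<inter> space M |A. A \<in> sets borel}" by blast
  qed
  show "Int_stable {U -` A \<inter> space M |A. A \<in> sets borel}" "Int_stable {(%w. g (?D w)) -` A \<inter> space M |A. A \<in> sets borel}"
   by (rule *)+
 qed
 then show ?thesis unfolding indep_var_eq using UM g by simp
qed

text \<open>The increment is centred and independent of \<open>U\<close>. Equal times are treated
  apart because the Gaussian law is given only for \<open>s < t\<close>.\<close>

lemma increment_orth:
 assumes st: "0 <= s" "s <= t" and U: "U \<in> borel_measurable (\<F> s)" "integrable M U"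
 shows "has_bochner_integral M (%w. (U w :: real) * (B t w - B s w) $ l) 0"
proof (cases "s = t")
 case False
 then have st': "0 <= s" "s < t" using st by auto
 note i = increment_indep[OF st' U(1), of "%x. x $ l"]
 note m = increment_moments(1)[OF st', of l, unfolded has_bochner_integral_iff]
 show ?thesis
  using indep_var_integrable[OF i U(2)] indep_var_lebesgue_integral[OF i U(2)] m
  by (simp add: has_bochner_integral_iff)
qed (simp add: has_bochner_integral_iff)

lemma increment_square:
 assumes st: "0 <= s" "s <= t" and U: "U \<in> borel_measurable (\<F> s)" "integrable M U"
 shows "has_bochner_integral M (%w. (U w :: real) * ((B t w - B s w) $ l * (B t w - B s w) $ m)) (if l = m then (t - s) * expectation U else 0)"
proof (cases "s = t")
 case False
 then have st': "0 <= s" "s < t" using st by auto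
 note i = increment_indep[OF st' U(1), of "%x. x $ l * x $ m"]
 note m = increment_moments(2)[OF st', of l m, unfolded has_bochner_integral_iff]
 show ?thesis
  using indep_var_integrable[OF i U(2)] indep_var_lebesgue_integral[OF i U(2)] m
  by (simp add: has_bochner_integral_iff)
qed (simp add: has_bochner_integral_iff)

lemma bounded_mult_integrable:
 assumes "U \<in> borel_measurable M" "!!w. w \<in> space M ==> \<bar>U w\<bar> <= C" "integrable M V"
 shows "integrable M (%w. (U w :: real) * V w)"
proof (rule bochner_bound)
 show "integrable M (%w. C * \<bar>V w\<bar>)" using assms(3) by simp
 show "AE w in M. norm (U w * V w) <= norm (C * \<bar>V w\<bar>)" (is "AE w in _. ?bd w")
 proof (rule AE_I2)
  fix w assume "w \<in> space M"
  then have "\<bar>U w\<bar> <= \<bar>C\<bar>" using assms(2) by fastforce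
  then show "?bd w" by (simp add: abs_mult mult_right_mono)
 qed
qed (use assms in auto)

lemma increment_integrable:
 assumes "0 <= s" "s <= t"
 shows "integrable M (%w. (B t w - B s w) $ l)"
proof (cases "s = t")
 case False
 then show ?thesis using increment_moments(1)[of s t l] assms by (simp add: has_bochner_integral_iff)
qed (simp add: has_bochner_integral_iff)

text \<open>The increments are cut at the ends of the overlap of the two intervals. Every product in
  which one increment starts after everything else has expectation 0; only the square over the
  overlap remains.\<close>

lemma increment_covariance_aux:
 assumes \<xi>: "\<xi> \<in> borel_measurable (\<F> a)" "!!y. y \<in> space M ==> \<bar>\<xi> y\<bar> <= C"
  and \<eta>: "\<eta> \<in> borel_measurable (\<F> c)" "!!y. y \<in> space M ==> \<bar>\<eta> y\<bar> <= D"
  and ab: "0 <= a" "a <= b" and cd: "c <= d" and ac: "a <= c"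
 shows "has_bochner_integral M (%y. (\<xi> y * (B b y - B a y) $ l) * (\<eta> y * (B d y - B c y) $ m))
  (if l = m then expectation (%y. \<xi> y * \<eta> y) * max 0 (min b d - max a c) else (0::real))"
proof -
 have c0: "0 <= c" using ab ac by simp
 have \<xi>\<eta>: "(%y. \<xi> y * \<eta> y) \<in> borel_measurable (\<F> c)"
  by (intro borel_measurable_times F_mono[OF ab(1) ac \<xi>(1)] \<eta>(1))
 have \<xi>\<eta>b: "\<bar>\<xi> y * \<eta> y\<bar> <= C * D" if "y \<in> space M" for y
  unfolding abs_mult using \<xi>(2)[OF that] \<eta>(2)[OF that] by (intro mult_mono) auto
 have \<xi>\<eta>M: "(%y. \<xi> y * \<eta> y) \<in> borel_measurable M" using \<xi>\<eta> F_measurable c0 by blast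
 have \<xi>\<eta>i: "integrable M (%y. \<xi> y * \<eta> y)"
  using \<xi>\<eta>M \<xi>\<eta>b by (intro integrable_const_bound[of _ "C * D"]) auto
 have incF: "(%y. (B v y - B u y) $ k) \<in> borel_measurable (\<F> w)" if "0 <= u" "u <= v" "v <= w" for u v w k
 proof -
  have [measurable]: "B v \<in> borel_measurable (\<F> w)" "B u \<in> borel_measurable (\<F> w)"
   using that by (auto intro!: F_mono[OF _ _ B_F_measurable])
  have "(%y. B v y - B u y) \<in> borel_measurable (\<F> w)" by measurable
  from measurable_compose[OF this, of "%x. x $ k" borel] show ?thesis
   by (simp add: borel_measurable_continuous_onI continuous_on_component)
 qed
 have orth: "has_bochner_integral M (%y. (\<xi> y * \<eta> y) * ((B v y - B u y) $ k) * (B t y - B s y) $ k') 0"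
  if "0 <= u" "u <= v" "v <= s" "c <= s" "s <= t" for u v s t k k'
 proof (rule increment_orth)
  show "(%y. (\<xi> y * \<eta> y) * ((B v y - B u y) $ k)) \<in> borel_measurable (\<F> s)"
   using that by (intro borel_measurable_times F_mono[OF c0 _ \<xi>\<eta>] incF) auto
  show "integrable M (%y. (\<xi> y * \<eta> y) * ((B v y - B u y) $ k))"
   using that by (intro bounded_mult_integrable[OF \<xi>\<eta>M \<xi>\<eta>b] increment_integrable)
 qed (use that in auto)
 show ?thesis
 proof (cases "b <= c")
  case True
  have "has_bochner_integral M (%y. (\<xi> y * \<eta> y) * ((B b y - B a y) $ l) * (B d y - B c y) $ m) 0"
   using True ab cd by (intro orth) auto
  then have "has_bochner_integral M (%y. (\<xi> y * (B b y - B a y) $ l) * (\<eta> y * (B d y - B c y) $ m)) 0"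
   by (simp only: mult_ac)
  moreover have "max 0 (min b d - max a c) = 0" using True by auto
  ultimately show ?thesis by (simp only: mult_zero_right if_cancel)
 next
  case False
  \<comment> \<open>The overlap is \<open>[c, e]\<close>. As \<open>e\<close> is \<open>b\<close> or
    \<open>d\<close>, at most one of the increments over \<open>[e, b]\<close> and
    \<open>[e, d]\<close> is nonzero, so their product does not appear in the expansion into
    \<open>T1\<close>, \<open>T3\<close>, \<open>T4\<close> and \<open>T5\<close>.\<close>
  define e where "e = min b d"
  have e: "c <= e" "e <= b" "e <= d" "e = b \<or> e = d" using False cd by (auto simp: e_def)
  let ?I = "%u v k y. (B v y - B u y) $ k"
  have T1: "has_bochner_integral M (%y. (\<xi> y * \<eta> y) * ?I a c l y * ?I c d m y) 0"
   using ab ac cd by (intro orth) auto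
  have T3: "has_bochner_integral M (%y. (\<xi> y * \<eta> y) * (?I c e l y * ?I c e m y)) (if l = m then (e - c) * expectation (%y. \<xi> y * \<eta> y) else 0)"
   using c0 e by (intro increment_square \<xi>\<eta> \<xi>\<eta>i)
  have T4: "has_bochner_integral M (%y. (\<xi> y * \<eta> y) * ?I c e l y * ?I e d m y) 0"
   using c0 e by (intro orth) auto
  have T5: "has_bochner_integral M (%y. (\<xi> y * \<eta> y) * ?I c e m y * ?I e b l y) 0"
   using c0 e by (intro orth) auto
  have "has_bochner_integral M (%y. (\<xi> y * \<eta> y) * ?I a c l y * ?I c d m y + (\<xi> y * \<eta> y) * (?I c e l y * ?I c e m y)
    + ((\<xi> y * \<eta> y) * ?I c e l y * ?I e d m y + (\<xi> y * \<eta> y) * ?I c e m y * ?I e b l y))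
   (0 + (if l = m then (e - c) * expectation (%y. \<xi> y * \<eta> y) else 0) + (0 + 0))"
   by (intro has_bochner_integral_add T1 T3 T4 T5)
  moreover have "(\<xi> y * \<eta> y) * ?I a c l y * ?I c d m y + (\<xi> y * \<eta> y) * (?I c e l y * ?I c e m y)
    + ((\<xi> y * \<eta> y) * ?I c e l y * ?I e d m y + (\<xi> y * \<eta> y) * ?I c e m y * ?I e b l y)
   = (\<xi> y * ?I a b l y) * (\<eta> y * ?I c d m y)" for y
   using e(4) by (auto simp: algebra_simps)
  moreover have "max 0 (min b d - max a c) = e - c" using e ac by (auto simp: e_def)
  ultimately show ?thesis by (simp only: add_0_left add_0_right mult.commute[of "e - c"])
 qed
qed

lemma increment_covariance:
 assumes \<xi>: "\<xi> \<in> borel_measurable (\<F> a)" "!!w. w \<in> space M ==> \<bar>\<xi> w\<bar> <= C"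
  and \<eta>: "\<eta> \<in> borel_measurable (\<F> c)" "!!w. w \<in> space M ==> \<bar>\<eta> w\<bar> <= D"
  and ab: "0 <= a" "a <= b" and cd: "0 <= c" "c <= d"
 shows "has_bochner_integral M (%w. (\<xi> w * (B b w - B a w) $ l) * (\<eta> w * (B d w - B c w) $ m))
  (if l = m then expectation (%w. \<xi> w * \<eta> w) * max 0 (min b d - max a c) else (0::real))"
proof (cases "a <= c")
 case True
 then show ?thesis using assms by (intro increment_covariance_aux[where C=C and D=D]) auto
next
 case False
 then have "has_bochner_integral M (%w. (\<eta> w * (B d w - B c w) $ m) * (\<xi> w * (B b w - B a w) $ l))
  (if m = l then expectation (%w. \<eta> w * \<xi> w) * max 0 (min d b - max c a) else (0::real))"
  using assms by (intro increment_covariance_aux[where C=D and D=C]) auto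
 then show ?thesis by (simp add: mult.commute min.commute max.commute eq_commute[of m l] cong: if_cong)
qed

end

section \<open>Ito isometry and existence of Ito integrals of deterministic functions\<close>

lemma (in pair_sigma_finite) has_bochner_integral_times:
 fixes f :: "'a => real" and g :: "'b => real"
 assumes f: "has_bochner_integral M1 f a" and g: "has_bochner_integral M2 g b"
 shows "has_bochner_integral (M1 \<Otimes>\<^sub>M M2) (%(x, y). f x * g y) (a * b)"
proof -
 have fi: "integrable M1 f" "integral\<^sup>L M1 f = a" and gi: "integrable M2 g" "integral\<^sup>L M2 g = b"
  using f g by (auto simp: has_bochner_integral_iff)
 have [measurable]: "f \<in> borel_measurable M1" "g \<in> borel_measurable M2" using fi gi by auto
 have int: "integrable (M1 \<Otimes>\<^sub>M M2) (%(x, y). f x * g y)"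
 proof (rule Fubini_integrable)
  show "integrable M1 (%x. LINT y|M2. norm (case (x, y) of (x, y) => f x * g y))"
   using fi gi by (simp add: abs_mult)
 qed (use gi in auto)
 have "integral\<^sup>L (M1 \<Otimes>\<^sub>M M2) (%(x, y). f x * g y) = (LINT x|M1. LINT y|M2. f x * g y)"
  using integral_fst'[OF int] by simp
 also have "... = a * b" using fi gi by simp
 finally show ?thesis using int by (simp add: has_bochner_integral_iff)
qed

lemma bounded_bilinear_matrix_vector_mult:
 "bounded_bilinear ((*v) :: real^'n^'m => real^'n => real^'m)"
 by (subst bilinear_conv_bounded_bilinear[symmetric])
  (auto simp: bilinear_def linear_iff vec_eq_iff matrix_vector_mult_def algebra_simps sum.distrib sum_distrib_left)

lemma bounded_bilinear_matrix_mult: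
 "bounded_bilinear ((**) :: real^'n^'m => real^'p^'n => real^'p^'m)"
 by (subst bilinear_conv_bounded_bilinear[symmetric])
  (auto simp: bilinear_def linear_iff vec_eq_iff matrix_matrix_mult_def algebra_simps sum.distrib sum_distrib_left)

lemma bounded_bilinear_complex_matrix_mult:
 "bounded_bilinear ((**) :: complex^'n^'m => complex^'p^'n => complex^'p^'m)"
 by (subst bilinear_conv_bounded_bilinear[symmetric])
  (auto simp: bilinear_def linear_iff vec_eq_iff matrix_matrix_mult_def algebra_simps sum.distrib scaleR_sum_right)

lemma bounded_bilinear_complex_matrix_vector_mult:
 "bounded_bilinear ((*v) :: complex^'n^'m => complex^'n => complex^'m)"
 by (subst bilinear_conv_bounded_bilinear[symmetric])
  (auto simp: bilinear_def linear_iff vec_eq_iff matrix_vector_mult_def algebra_simps sum.distrib scaleR_sum_right)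

lemma matrix_component_le_norm: "norm (A $ i $ k) <= norm (A :: 'a::real_normed_vector^'n^'m)"
 using Finite_Cartesian_Product.norm_nth_le[of A i] Finite_Cartesian_Product.norm_nth_le[of "A $ i" k] by linarith

lemma matrix_norm_le_sum: "norm (A :: 'a::real_normed_vector^'n^'m) <= (\<Sum>i\<in>UNIV. \<Sum>k\<in>UNIV. norm (A $ i $ k))"
proof -
 have 1: "norm x <= (\<Sum>k\<in>UNIV. norm (x $ k))" for x :: "'a^'n"
  unfolding norm_vec_def by (rule L2_set_le_sum) auto
 have "norm A <= (\<Sum>i\<in>UNIV. norm (A $ i))"
  unfolding norm_vec_def[of A] by (rule L2_set_le_sum) auto
 also have "... <= (\<Sum>i\<in>UNIV. \<Sum>k\<in>UNIV. norm (A $ i $ k))" by (intro sum_mono 1)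
 finally show ?thesis .
qed

text \<open>A triangle inequality for squares with weights \<open>1 + e\<close> and
  \<open>1 + 1 / e\<close> allows the passage to the limit within nonnegative integrals, finite or
  not; afterwards \<open>e\<close> tends to 0.\<close>

lemma L2_limit_le:
 fixes u :: "'a => 'b::{real_normed_vector, second_countable_topology}" and v :: "'c => 'd::{real_normed_vector, second_countable_topology}"
 assumes m: "!!n. un n \<in> borel_measurable M" "u \<in> borel_measurable M" "!!n. vn n \<in> borel_measurable N" "v \<in> borel_measurable N"
  and le: "!!n. (L2sq M (un n)) <= (L2sq N (vn n))"
  and u: "(%n. L2sq M (%x. un n x - u x)) \<longlonglongrightarrow> 0"
  and v: "(%n. L2sq N (%x. vn n x - v x)) \<longlonglongrightarrow> 0"
 shows "(L2sq M u) <= (L2sq N v)"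
proof -
 have split: "(L2sq R f) <= ennreal (1 + e) * (L2sq R g) + ennreal (1 + 1 / e) * (L2sq R (%x. f x - g x))"
  if [measurable]: "f \<in> borel_measurable R" "g \<in> borel_measurable R" and e: "e > 0"
  for f g :: "'e => 'f::{real_normed_vector, second_countable_topology}" and R e
 proof -
  have "(norm x)\<^sup>2 <= (1 + e) * (norm y)^2 + (1 + 1 / e) * (norm (x - y))^2" for x y :: 'f
  proof -
   have "(norm x)\<^sup>2 <= (norm y + norm (x - y))^2" by (intro power_mono norm_triangle_sub) auto
   \<comment> \<open>Completing the square: the weighted bound exceeds the square of the sum by
     exactly the last term.\<close>
   also have "... = (1 + e) * (norm y)^2 + (1 + 1 / e) * (norm (x - y))^2 - (e * norm y - norm (x - y))\<^sup>2 / e"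
    using e by (simp add: power2_eq_square field_simps)
   finally show ?thesis using divide_nonneg_pos[OF zero_le_power2 e, of "e * norm y - norm (x - y)"] by linarith
  qed
  then have "(L2sq R f) <= (\<integral>\<^sup>+x. ennreal (1 + e) * ennreal ((norm (g x))^2) + ennreal (1 + 1 / e) * ennreal ((norm (f x - g x))^2) \<partial>R)"
   using e by (intro nn_integral_mono) (simp add: ennreal_mult[symmetric] ennreal_plus[symmetric] del: ennreal_plus)
  then show ?thesis by (simp add: nn_integral_add nn_integral_cmult)
 qed
 let ?U = "L2sq M u" and ?V = "L2sq N v"
 have "?U <= ennreal (1 + e) * (ennreal (1 + e) * ?V)" if e: "e > 0" for e
 proof (rule LIMSEQ_le_const)
  let ?d = "%n. L2sq M (%x. un n x - u x)" and ?d' = "%n. L2sq N (%x. vn n x - v x)"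
  have "?U <= ennreal (1 + e) * (ennreal (1 + e) * ?V + ennreal (1 + 1 / e) * ?d' n) + ennreal (1 + 1 / e) * ?d n" for n
  proof -
   have "?U <= ennreal (1 + e) * (L2sq M (un n)) + ennreal (1 + 1 / e) * ?d n"
    using split[OF m(2) m(1)[of n] e] by (simp add: norm_minus_commute)
   also have "... <= ennreal (1 + e) * (ennreal (1 + e) * ?V + ennreal (1 + 1 / e) * ?d' n) + ennreal (1 + 1 / e) * ?d n"
    by (intro add_right_mono mult_left_mono order_trans[OF le[of n] split[OF m(3)[of n] m(4) e]]) auto
   finally show ?thesis .
  qed
  then show "\<exists>n0. \<forall>n\<ge>n0. ?U <= ennreal (1 + e) * (ennreal (1 + e) * ?V + ennreal (1 + 1 / e) * ?d' n) + ennreal (1 + 1 / e) * ?d n" by blast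
  have "(%n. ennreal (1 + e) * (ennreal (1 + e) * ?V + ennreal (1 + 1 / e) * ?d' n) + ennreal (1 + 1 / e) * ?d n)
   \<longlonglongrightarrow> ennreal (1 + e) * (ennreal (1 + e) * ?V + ennreal (1 + 1 / e) * 0) + ennreal (1 + 1 / e) * 0"
   by (intro tendsto_add ennreal_tendsto_cmult tendsto_const u v) auto
  then show "(%n. ennreal (1 + e) * (ennreal (1 + e) * ?V + ennreal (1 + 1 / e) * ?d' n) + ennreal (1 + 1 / e) * ?d n)
   \<longlonglongrightarrow> ennreal (1 + e) * (ennreal (1 + e) * ?V)" by simp
 qed
 then have le: "?U <= ennreal (1 + 1 / real (Suc n)) * (ennreal (1 + 1 / real (Suc n)) * ?V)" for n by simp
 have "(%n. 1 + 1 / real (Suc n)) \<longlonglongrightarrow> 1" by real_asymp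
 from tendsto_ennrealI[OF this]
 have l: "(%n. ennreal (1 + 1 / real (Suc n))) \<longlonglongrightarrow> 1" by simp
 have "(%n. ennreal (1 + 1 / real (Suc n)) * (ennreal (1 + 1 / real (Suc n)) * ?V)) \<longlonglongrightarrow> 1 * (1 * ?V)"
  by (intro tendsto_mult_ennreal l tendsto_const) auto
 from LIMSEQ_le_const[OF this] le show ?thesis by simp
qed

text \<open>The square of a sum of \<open>card A\<close> terms is at most \<open>card A\<close>
  times the sum of the squares, which gives the constants in \<open>?b\<close>.\<close>

lemma L2_combination_null:
 fixes g :: "'i => nat => 'a => real"
 assumes A: "finite A" and gm: "!!a n. a \<in> A ==> g a n \<in> borel_measurable N" and c: "!!a. 0 <= c a"
  and F: "!!n x. x \<in> space N ==> 0 <= F n x" "!!n x. x \<in> space N ==> F n x <= (\<Sum>a\<in>A. c a * g a n x)"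
  and lim: "!!a. a \<in> A ==> (%n. \<integral>\<^sup>+x. ennreal ((g a n x)^2) \<partial>N) \<longlonglongrightarrow> 0"
 shows "(%n. \<integral>\<^sup>+x. ennreal ((F n x)^2) \<partial>N) \<longlonglongrightarrow> 0"
proof (rule tendsto_sandwich[OF _ _ tendsto_const])
 let ?b = "%n. \<Sum>a\<in>A. ennreal (real (card A) * (c a)^2) * (\<integral>\<^sup>+x. ennreal ((g a n x)^2) \<partial>N)"
 have "(\<integral>\<^sup>+x. ennreal ((F n x)^2) \<partial>N) <= ?b n" for n
 proof -
  have "(\<integral>\<^sup>+x. ennreal ((F n x)^2) \<partial>N) <= (\<integral>\<^sup>+x. (\<Sum>a\<in>A. ennreal (real (card A) * (c a)^2) * ennreal ((g a n x)^2)) \<partial>N)"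
  proof (intro nn_integral_mono)
   fix x assume x: "x \<in> space N"
   have "(F n x)\<^sup>2 <= (\<Sum>a\<in>A. c a * g a n x)^2" using F[OF x] by (intro power_mono)
   also have "... <= (\<Sum>a\<in>A. (c a * g a n x)\<^sup>2) * card A" by (rule sum_squared_le_sum_of_squares)
   also have "... = (\<Sum>a\<in>A. (real (card A) * (c a)^2) * (g a n x)^2)"
    by (simp add: sum_distrib_left power_mult_distrib mult_ac)
   finally have "ennreal ((F n x)^2) <= ennreal (\<Sum>a\<in>A. (real (card A) * (c a)^2) * (g a n x)^2)" by (rule ennreal_leI)
   then show "ennreal ((F n x)^2) <= (\<Sum>a\<in>A. ennreal (real (card A) * (c a)^2) * ennreal ((g a n x)^2))"
    by (simp add: ennreal_mult[symmetric] sum_ennreal)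
  qed
  also have "... = ?b n" using gm by (subst nn_integral_sum) (auto intro!: sum.cong nn_integral_cmult)
  finally show ?thesis .
 qed
 then show "\<forall>\<^sub>F n in sequentially. (\<integral>\<^sup>+x. ennreal ((F n x)^2) \<partial>N) <= ?b n" by simp
 have "?b \<longlonglongrightarrow> (\<Sum>a\<in>A. ennreal (real (card A) * (c a)^2) * 0)"
  by (intro tendsto_sum ennreal_tendsto_cmult lim) auto
 then show "?b \<longlonglongrightarrow> 0" by simp
qed simp

context brownian
begin

lemma elementary_nonneg:
 assumes "elementary M \<F> m p \<xi>" "i <= m"
 shows "0 <= p i"
 using assms(2)
proof (induction i)
 case (Suc i)
 then have "0 <= p i" "p i <= p (Suc i)" using assms(1) by (auto simp: elementary_def)
 then show ?case by simp
qed (use assms in \<open>auto simp: elementary_def\<close>)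

lemma elementary_coeff:
 fixes \<xi> :: "nat => 'a => real^'f^'z"
 assumes "elementary M \<F> m p \<xi>" "j < m"
 obtains C where "(%w. \<xi> j w $ i $ l) \<in> borel_measurable (\<F> (p j))" "!!w. w \<in> space M ==> \<bar>\<xi> j w $ i $ l\<bar> <= C"
proof -
 have "\<exists>C. \<forall>w\<in>space M. norm (\<xi> j w) <= C" and m: "\<xi> j \<in> borel_measurable (\<F> (p j))"
  using assms unfolding elementary_def by blast+
 then obtain C where C: "!!w. w \<in> space M ==> norm (\<xi> j w) <= C" by blast
 have c: "continuous_on UNIV (%x :: real^'f^'z. x $ i $ l)" for i l
  by (intro continuous_on_component continuous_on_id)
 show thesis
 proof
  show "(%w. \<xi> j w $ i $ l) \<in> borel_measurable (\<F> (p j))"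
   using measurable_compose[OF m borel_measurable_continuous_onI[OF c[of i l]]] .
  show "\<bar>\<xi> j w $ i $ l\<bar> <= C" if "w \<in> space M" for w
   using C[OF that] component_le_norm_cart[of "\<xi> j w $ i" l] Finite_Cartesian_Product.norm_nth_le[of "\<xi> j w" i] by linarith
 qed
qed

lemma elementary_integral_nth:
 "elementary_integral B m p \<xi> w $ i = (\<Sum>j<m. \<Sum>l\<in>UNIV. \<xi> j w $ i $ l * (B (p (Suc j)) w - B (p j) w) $ l)"
 by (simp add: elementary_integral_def matrix_vector_mult_def)

lemma elementary_process_nth:
 "elementary_process m p \<xi> s w $ i $ l = (\<Sum>j<m. indicator {p j<..p (Suc j)} s * \<xi> j w $ i $ l)"
 by (simp add: elementary_process_def)

text \<open>This is the polarized isometry for elementary integrands. The common value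
  \<open>c\<close> arises because the overlap \<open>len j j'\<close> of two cells is the covariance
  of the increments on one side and the Lebesgue measure of the intersection on the other. Different
  partitions are compared directly, without a common refinement.\<close>

lemma elementary_covariance:
 assumes e: "elementary M \<F> m p \<xi>" and e': "elementary M \<F> m' p' \<xi>'"
 obtains c where "has_bochner_integral M (%w. elementary_integral B m p \<xi> w $ i * elementary_integral B m' p' \<xi>' w $ k) c"
  and "has_bochner_integral (lborel \<Otimes>\<^sub>M M) (%(s, w). \<Sum>l\<in>UNIV. elementary_process m p \<xi> s w $ i $ l * elementary_process m' p' \<xi>' s w $ k $ l) c"
proof -
 interpret pair_sigma_finite lborel M
  by (intro pair_sigma_finite.intro sigma_finite_lborel sigma_finite_measure_axioms)
 define len where "len j j' = max 0 (min (p (Suc j)) (p' (Suc j')) - max (p j) (p' j'))" for j j'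
 define E where "E j j' l l' = expectation (%w. \<xi> j w $ i $ l * \<xi>' j' w $ k $ l')" for j j' l l'
 define c where "c = (\<Sum>j<m. \<Sum>l\<in>UNIV. \<Sum>j'<m'. \<Sum>l'\<in>UNIV. if l = l' then E j j' l l' * len j j' else 0)"
 have pp: "0 <= p j" "p j <= p (Suc j)" if "j < m" for j
  using elementary_nonneg[OF e, of j] e that by (auto simp: elementary_def)
 have pp': "0 <= p' j" "p' j <= p' (Suc j)" if "j < m'" for j
  using elementary_nonneg[OF e', of j] e' that by (auto simp: elementary_def)
 have 1: "has_bochner_integral M (%w. (\<xi> j w $ i $ l * (B (p (Suc j)) w - B (p j) w) $ l) * (\<xi>' j' w $ k $ l' * (B (p' (Suc j')) w - B (p' j') w) $ l'))
   (if l = l' then E j j' l l' * len j j' else 0)" if j: "j < m" "j' < m'" for j j' l l'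
 proof -
  obtain C where C: "(%w. \<xi> j w $ i $ l) \<in> borel_measurable (\<F> (p j))" "!!w. w \<in> space M ==> \<bar>\<xi> j w $ i $ l\<bar> <= C"
   by (rule elementary_coeff[OF e j(1)]) blast
  obtain D where D: "(%w. \<xi>' j' w $ k $ l') \<in> borel_measurable (\<F> (p' j'))" "!!w. w \<in> space M ==> \<bar>\<xi>' j' w $ k $ l'\<bar> <= D"
   by (rule elementary_coeff[OF e' j(2)]) blast
  show ?thesis unfolding E_def len_def
   by (rule increment_covariance[OF C D pp[OF j(1)] pp'[OF j(2)]])
 qed
 have 2: "has_bochner_integral (lborel \<Otimes>\<^sub>M M) (%(s, w). (indicator {p j<..p (Suc j)} s * \<xi> j w $ i $ l) * (indicator {p' j'<..p' (Suc j')} s * \<xi>' j' w $ k $ l))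
   (E j j' l l * len j j')" if j: "j < m" "j' < m'" for j j' l
 proof -
  obtain C where C: "(%w. \<xi> j w $ i $ l) \<in> borel_measurable (\<F> (p j))" "!!w. w \<in> space M ==> \<bar>\<xi> j w $ i $ l\<bar> <= C"
   by (rule elementary_coeff[OF e j(1)]) blast
  obtain D where D: "(%w. \<xi>' j' w $ k $ l) \<in> borel_measurable (\<F> (p' j'))" "!!w. w \<in> space M ==> \<bar>\<xi>' j' w $ k $ l\<bar> <= D"
   by (rule elementary_coeff[OF e' j(2)]) blast
  have CM: "(%w. \<xi> j w $ i $ l) \<in> borel_measurable M" using F_measurable C(1) pp j by blast
  have DM: "(%w. \<xi>' j' w $ k $ l) \<in> borel_measurable M" using F_measurable D(1) pp' j by blast
  have "has_bochner_integral lborel (indicator {max (p j) (p' j')<..min (p (Suc j)) (p' (Suc j'))} :: real => real) (measure lborel {max (p j) (p' j')<..min (p (Suc j)) (p' (Suc j'))})"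
  proof (rule has_bochner_integral_real_indicator)
   have "bounded {max (p j) (p' j')<..min (p (Suc j)) (p' (Suc j'))}"
    by (rule bounded_subset[OF bounded_closed_interval[of "max (p j) (p' j')" "min (p (Suc j)) (p' (Suc j'))"]]) auto
   then show "emeasure lborel {max (p j) (p' j')<..min (p (Suc j)) (p' (Suc j'))} < \<infinity>" by (rule emeasure_bounded_finite)
  qed simp
  moreover have "measure lborel {max (p j) (p' j')<..min (p (Suc j)) (p' (Suc j'))} = len j j'"
   by (cases "max (p j) (p' j') <= min (p (Suc j)) (p' (Suc j'))") (auto simp: len_def measure_def emeasure_lborel_Ioc)
  ultimately have i: "has_bochner_integral lborel (indicator {max (p j) (p' j')<..min (p (Suc j)) (p' (Suc j'))} :: real => real) (len j j')"
   by (simp only:)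
  have "integrable M (%w. \<xi> j w $ i $ l * \<xi>' j' w $ k $ l)"
  proof (rule bounded_mult_integrable[OF CM C(2)])
   show "integrable M (%w. \<xi>' j' w $ k $ l)" using DM D(2) by (intro integrable_const_bound[of _ D]) auto
  qed
  then have g: "has_bochner_integral M (%w. \<xi> j w $ i $ l * \<xi>' j' w $ k $ l) (E j j' l l)"
   by (simp add: has_bochner_integral_iff E_def)
  have "has_bochner_integral (lborel \<Otimes>\<^sub>M M) (%(s, w). indicator {max (p j) (p' j')<..min (p (Suc j)) (p' (Suc j'))} s * (\<xi> j w $ i $ l * \<xi>' j' w $ k $ l)) (len j j' * E j j' l l)"
   by (rule has_bochner_integral_times[OF i g])
  moreover have "indicator {max (p j) (p' j')<..min (p (Suc j)) (p' (Suc j'))} s * (\<xi> j w $ i $ l * \<xi>' j' w $ k $ l)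
    = (indicator {p j<..p (Suc j)} s * \<xi> j w $ i $ l) * (indicator {p' j'<..p' (Suc j')} s * \<xi>' j' w $ k $ l)" for s w
   by (auto simp: indicator_def)
  ultimately show ?thesis by (simp only: mult.commute[of "len j j'"])
 qed
 show thesis
 proof (rule that[of c])
  have "has_bochner_integral M (%w. \<Sum>j<m. \<Sum>l\<in>UNIV. \<Sum>j'<m'. \<Sum>l'\<in>UNIV. (\<xi> j w $ i $ l * (B (p (Suc j)) w - B (p j) w) $ l) * (\<xi>' j' w $ k $ l' * (B (p' (Suc j')) w - B (p' j') w) $ l')) c"
   unfolding c_def by (intro has_bochner_integral_sum 1) auto
  then show "has_bochner_integral M (%w. elementary_integral B m p \<xi> w $ i * elementary_integral B m' p' \<xi>' w $ k) c"
   unfolding elementary_integral_nth sum_distrib_right unfolding sum_distrib_left .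
  have "has_bochner_integral (lborel \<Otimes>\<^sub>M M) (%x. \<Sum>l\<in>UNIV. \<Sum>j<m. \<Sum>j'<m'. (case x of (s, w) => (indicator {p j<..p (Suc j)} s * \<xi> j w $ i $ l) * (indicator {p' j'<..p' (Suc j')} s * \<xi>' j' w $ k $ l)))
    (\<Sum>l\<in>UNIV. \<Sum>j<m. \<Sum>j'<m'. E j j' l l * len j j')"
   by (intro has_bochner_integral_sum 2) auto
  also have "(\<Sum>l\<in>UNIV. \<Sum>j<m. \<Sum>j'<m'. E j j' l l * len j j') = c"
   unfolding c_def by (subst sum.swap) (simp add: sum.delta')
  finally show "has_bochner_integral (lborel \<Otimes>\<^sub>M M) (%(s, w). \<Sum>l\<in>UNIV. elementary_process m p \<xi> s w $ i $ l * elementary_process m' p' \<xi>' s w $ k $ l) c"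
   unfolding elementary_process_nth sum_distrib_right unfolding sum_distrib_left by (simp add: split_beta')
 qed
qed

lemma elementary_process_measurable:
 assumes e: "elementary M \<F> m p \<xi>"
 shows "(%(s, w). elementary_process m p \<xi> s w) \<in> borel_measurable (lborel \<Otimes>\<^sub>M M)"
proof -
 have [measurable]: "\<xi> j \<in> borel_measurable M" if "j < m" for j
  using e that elementary_nonneg[OF e, of j] by (auto simp: elementary_def intro!: F_measurable)
 show ?thesis unfolding elementary_process_def split_beta' by measurable
qed

lemma elementary_integral_measurable:
 assumes e: "elementary M \<F> m p \<xi>"
 shows "elementary_integral B m p \<xi> \<in> borel_measurable M"
proof -
 have "(%w. elementary_integral B m p \<xi> w $ i) \<in> borel_measurable M" for i
  unfolding elementary_integral_nth
 proof (intro borel_measurable_sum borel_measurable_times)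
  fix j l assume j: "j \<in> {..<m}"
  then obtain C where C: "(%w. \<xi> j w $ i $ l) \<in> borel_measurable (\<F> (p j))"
   by (elim lessThan_iff[THEN iffD1, THEN elementary_coeff[OF e]])
  show "(%w. \<xi> j w $ i $ l) \<in> borel_measurable M"
   using C j elementary_nonneg[OF e, of j] by (auto intro: F_measurable)
  have [measurable]: "B (p (Suc j)) \<in> borel_measurable M" "B (p j) \<in> borel_measurable M"
   using j elementary_nonneg[OF e, of j] elementary_nonneg[OF e, of "Suc j"] by (auto intro!: B_measurable)
  have "(%w. B (p (Suc j)) w - B (p j) w) \<in> borel_measurable M" by measurable
  from measurable_compose[OF this, of "%x. x $ l" borel]
  show "(%w. (B (p (Suc j)) w - B (p j) w) $ l) \<in> borel_measurable M"
   by (simp add: borel_measurable_continuous_onI continuous_on_component)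
 qed
 then show ?thesis by (subst borel_measurable_euclidean_space) (auto simp: Basis_vec_def inner_axis)
qed

end

context brownian
begin

lemma ito_measurable:
 "has_ito_integral M \<F> B H I ==> I \<in> borel_measurable M"
 by (simp add: has_ito_integral_def)

text \<open>Both squared norms expand into the same sum \<open>?S\<close> over pairs of integrands
  and pairs of coordinates, and the corresponding terms agree by
  \<open>elementary_covariance\<close>.\<close>

lemma elementary_isometry:
 fixes \<xi> :: "'i => nat => 'a => real^'e^'z" and C :: "'i => real^'z^'y"
 assumes A: "finite A" and e: "!!a. a \<in> A ==> elementary M \<F> (m a) (p a) (\<xi> a)"
 shows "(L2sq M (%w. \<Sum>a\<in>A. C a *v elementary_integral B (m a) (p a) (\<xi> a) w)) =
  (L2sq (lborel \<Otimes>\<^sub>M M) (%x. \<Sum>a\<in>A. C a ** elementary_process (m a) (p a) (\<xi> a) (fst x) (snd x)))"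
proof -
 define I where "I a = elementary_integral B (m a) (p a) (\<xi> a)" for a
 define h where "h a x = elementary_process (m a) (p a) (\<xi> a) (fst x) (snd x)" for a x
 define c where "c a b k k' = (LINT w|M. I a w $ k * I b w $ k')" for a b k k'
 have c: "has_bochner_integral M (%w. I a w $ k * I b w $ k') (c a b k k')"
  "has_bochner_integral (lborel \<Otimes>\<^sub>M M) (%x. \<Sum>l\<in>UNIV. h a x $ k $ l * h b x $ k' $ l) (c a b k k')"
  if ab: "a \<in> A" "b \<in> A" for a b k k'
 proof -
  obtain c0 where c0: "has_bochner_integral M (%w. I a w $ k * I b w $ k') c0"
   "has_bochner_integral (lborel \<Otimes>\<^sub>M M) (%x. \<Sum>l\<in>UNIV. h a x $ k $ l * h b x $ k' $ l) c0"
   using elementary_covariance[OF e[OF ab(1)] e[OF ab(2)], of k k'] unfolding I_def h_def split_beta' by blast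
  have "c a b k k' = c0" unfolding c_def using c0(1) by (rule has_bochner_integral_integral_eq)
  then show "has_bochner_integral M (%w. I a w $ k * I b w $ k') (c a b k k')"
  "has_bochner_integral (lborel \<Otimes>\<^sub>M M) (%x. \<Sum>l\<in>UNIV. h a x $ k $ l * h b x $ k' $ l) (c a b k k')"
   using c0 by simp_all
 qed
 let ?S = "%f. \<Sum>i\<in>UNIV. \<Sum>a\<in>A. \<Sum>k\<in>UNIV. \<Sum>b\<in>A. \<Sum>k'\<in>UNIV. (C a $ i $ k * C b $ i $ k') * f a b k k'"
 have "(norm (\<Sum>a\<in>A. C a *v I a w))\<^sup>2 = ?S (%a b k k'. I a w $ k * I b w $ k')" for w
 proof -
  have "(norm (\<Sum>a\<in>A. C a *v I a w))\<^sup>2 = (\<Sum>i\<in>UNIV. (\<Sum>a\<in>A. \<Sum>k\<in>UNIV. C a $ i $ k * I a w $ k) * (\<Sum>b\<in>A. \<Sum>k'\<in>UNIV. C b $ i $ k' * I b w $ k'))"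
   unfolding power2_norm_eq_inner inner_vec_def by (simp add: matrix_vector_mult_def)
  then show ?thesis unfolding sum_distrib_right unfolding sum_distrib_left by (simp add: mult_ac)
 qed
 then have 1: "has_bochner_integral M (%w. (norm (\<Sum>a\<in>A. C a *v I a w))\<^sup>2) (?S c)"
  by (simp only:) (intro has_bochner_integral_sum has_bochner_integral_mult_right c)
 have "(norm (\<Sum>a\<in>A. C a ** h a x))\<^sup>2 = ?S (%a b k k'. \<Sum>l\<in>UNIV. h a x $ k $ l * h b x $ k' $ l)" for x
 proof -
  have "(norm (\<Sum>a\<in>A. C a ** h a x))\<^sup>2 = (\<Sum>i\<in>UNIV. \<Sum>l\<in>UNIV. (\<Sum>a\<in>A. \<Sum>k\<in>UNIV. C a $ i $ k * h a x $ k $ l) * (\<Sum>b\<in>A. \<Sum>k'\<in>UNIV. C b $ i $ k' * h b x $ k' $ l))"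
   unfolding power2_norm_eq_inner inner_vec_def by (simp add: matrix_matrix_mult_def)
  also have "... = (\<Sum>i\<in>UNIV. \<Sum>l\<in>UNIV. \<Sum>a\<in>A. \<Sum>k\<in>UNIV. \<Sum>b\<in>A. \<Sum>k'\<in>UNIV. (C a $ i $ k * C b $ i $ k') * (h a x $ k $ l * h b x $ k' $ l))"
   unfolding sum_distrib_right unfolding sum_distrib_left by (simp add: mult_ac)
  also have "... = ?S (%a b k k'. \<Sum>l\<in>UNIV. h a x $ k $ l * h b x $ k' $ l)"
   unfolding sum_distrib_left
   by (subst sum.swap[of _ A], rule sum.cong[OF refl], rule sum.cong[OF refl],
     subst sum.swap, rule sum.cong[OF refl], subst sum.swap, rule sum.cong[OF refl], subst sum.swap, rule refl)
  finally show ?thesis .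
 qed
 then have 2: "has_bochner_integral (lborel \<Otimes>\<^sub>M M) (%x. (norm (\<Sum>a\<in>A. C a ** h a x))\<^sup>2) (?S c)"
  by (simp only:) (intro has_bochner_integral_sum has_bochner_integral_mult_right c)
 show ?thesis
  unfolding I_def[symmetric] h_def[symmetric]
  by (subst (1 2) nn_integral_eq_integral) (use 1 2 in \<open>auto simp: has_bochner_integral_iff\<close>)
qed

text \<open>Approximation by elementary integrands; equality is obtained from
  \<open>L2_limit_le\<close> in both directions. Working with a whole combination of arbitrary
  versions \<open>I a\<close> replaces linearity of the integral. For deterministic \<open>h\<close>
  the expectation on the right disappears.\<close>

lemma ito_isometry:
 fixes h :: "'i => real => real^'e^'z" and C :: "'i => real^'z^'y"
 assumes A: "finite A" and H: "!!a. a \<in> A ==> has_ito_integral M \<F> B (%s w. h a s) (I a)"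
 shows "(L2sq M (%w. \<Sum>a\<in>A. C a *v I a w)) =
    (\<integral>\<^sup>+s\<in>{0..}. ennreal ((norm (\<Sum>a\<in>A. C a ** h a s))^2) \<partial>lborel)"
proof -
 interpret P: pair_sigma_finite lborel M
  by (intro pair_sigma_finite.intro sigma_finite_lborel sigma_finite_measure_axioms)
 obtain KV where KV: "KV > 0" "!!(A :: real^'z^'y) (x :: real^'z). norm (A *v x) <= norm A * norm x * KV"
  using bounded_bilinear.pos_bounded[OF bounded_bilinear_matrix_vector_mult] by blast
 obtain KM where KM: "KM > 0" "!!(A :: real^'z^'y) (Y :: real^'e^'z). norm (A ** Y) <= norm A * norm Y * KM"
  using bounded_bilinear.pos_bounded[OF bounded_bilinear_matrix_mult] by blast
 define Q where "Q a m p \<xi> \<longleftrightarrow> (\<forall>k::nat. elementary M \<F> (m k) (p k) (\<xi> k)) &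
    (%k. \<integral>\<^sup>+w. (\<integral>\<^sup>+s\<in>{0..}. ennreal ((norm (h a s - elementary_process (m k) (p k) (\<xi> k) s w))^2) \<partial>lborel) \<partial>M) \<longlonglongrightarrow> 0 &
    (%k. L2sq M (%w. I a w - elementary_integral B (m k) (p k) (\<xi> k) w)) \<longlonglongrightarrow> 0" for a m p \<xi>
 have "\<forall>a. \<exists>m p \<xi>. a \<in> A \<longrightarrow> Q a m p \<xi>" using H unfolding has_ito_integral_def Q_def by blast
 then obtain m p \<xi> where Q: "\<forall>a. a \<in> A \<longrightarrow> Q a (m a) (p a) (\<xi> a)" unfolding choice_iff by blast
 have e: "elementary M \<F> (m a k) (p a k) (\<xi> a k)" if "a \<in> A" for a k using Q that unfolding Q_def by blast
 define J where "J k a = elementary_integral B (m a k) (p a k) (\<xi> a k)" for k a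
 define E where "E k a x = elementary_process (m a k) (p a k) (\<xi> a k) (fst x) (snd x)" for k a x
 define H' where "H' a x = (indicator {0..} (fst x) *\<^sub>R h a (fst x) :: real^'e^'z)" for a and x :: "real \<times> 'a"
 have Im: "I a \<in> borel_measurable M" and H'm: "H' a \<in> borel_measurable (lborel \<Otimes>\<^sub>M M)"
  and Jm: "J k a \<in> borel_measurable M" and Em: "E k a \<in> borel_measurable (lborel \<Otimes>\<^sub>M M)" if "a \<in> A" for a k
  using H[OF that] elementary_integral_measurable[OF e[OF that, of k]] elementary_process_measurable[OF e[OF that, of k]]
  by (simp_all add: has_ito_integral_def H'_def[abs_def] J_def E_def[abs_def] split_beta')
 define U where "U k w = (\<Sum>a\<in>A. C a *v J k a w)" for k w
 define V where "V k x = (\<Sum>a\<in>A. C a ** E k a x)" for k x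
 define u where "u w = (\<Sum>a\<in>A. C a *v I a w)" for w
 define v where "v x = (\<Sum>a\<in>A. C a ** H' a x)" for x
 have mv: "(%x. c *v f x) \<in> borel_measurable N" if "f \<in> borel_measurable N" for c :: "real^'z^'y" and f and N :: "'n measure"
  by (rule measurable_compose[OF that borel_measurable_continuous_onI])
   (intro bounded_bilinear.continuous_on[OF bounded_bilinear_matrix_vector_mult] continuous_intros)
 have mm: "(%x. c ** f x) \<in> borel_measurable N" if "f \<in> borel_measurable N" for c :: "real^'z^'y" and f :: "'n => real^'e^'z" and N
  by (rule measurable_compose[OF that borel_measurable_continuous_onI])
   (intro bounded_bilinear.continuous_on[OF bounded_bilinear_matrix_mult] continuous_intros)
 have meas: "U k \<in> borel_measurable M" "u \<in> borel_measurable M" "V k \<in> borel_measurable (lborel \<Otimes>\<^sub>M M)" "v \<in> borel_measurable (lborel \<Otimes>\<^sub>M M)" for k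
  unfolding U_def[abs_def] u_def[abs_def] V_def[abs_def] v_def[abs_def]
  by (auto intro!: borel_measurable_sum mv mm Im H'm Jm Em)
 have eq: "(L2sq M (U k)) = (L2sq (lborel \<Otimes>\<^sub>M M) (V k))" for k
  unfolding U_def V_def J_def E_def by (rule elementary_isometry[OF A e])
 have limU: "(%k. L2sq M (%x. U k x - u x)) \<longlonglongrightarrow> 0"
 proof (rule L2_combination_null[OF A, where c="%a. norm (C a) * KV" and g="%a k w. norm (J k a w - I a w)"])
  show "norm (U k w - u w) <= (\<Sum>a\<in>A. norm (C a) * KV * norm (J k a w - I a w))" for k w
   unfolding U_def u_def sum_subtractf[symmetric] bounded_bilinear.diff_right[OF bounded_bilinear_matrix_vector_mult, symmetric]
  proof (intro order_trans[OF norm_sum] sum_mono)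
   show "norm (C a *v (J k a w - I a w)) <= norm (C a) * KV * norm (J k a w - I a w)" for a
    using KV(2)[of "C a" "J k a w - I a w"] by (simp add: mult_ac)
  qed
  show "(%k. L2sq M (%w. J k a w - I a w)) \<longlonglongrightarrow> 0" if "a \<in> A" for a
   using Q that unfolding Q_def J_def by (simp add: norm_minus_commute)
  show "(%w. norm (J k a w - I a w)) \<in> borel_measurable M" if "a \<in> A" for a k using Im[OF that] Jm[OF that, of k] by measurable
 qed (use KV(1) in auto)
 \<comment> \<open>Partition points are nonnegative, so elementary processes vanish at negative
   times and the restriction to \<open>{0..}\<close> loses nothing.\<close>
 have EH: "norm (E k a x - H' a x) = indicator {0..} (fst x) * norm (h a (fst x) - elementary_process (m a k) (p a k) (\<xi> a k) (fst x) (snd x))"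
  if a: "a \<in> A" for a k x
 proof (cases "fst x >= 0")
  case False
  then have "elementary_process (m a k) (p a k) (\<xi> a k) (fst x) (snd x) = 0"
   unfolding elementary_process_def
  proof (intro sum.neutral ballI)
   fix i assume "i \<in> {..<m a k}"
   then have "0 <= p a k i" using elementary_nonneg[OF e[OF a, of k]] by simp
   then show "indicator {p a k i<..p a k (Suc i)} (fst x) *\<^sub>R \<xi> a k i (snd x) = 0" using False by simp
  qed
  then show ?thesis using False by (simp add: H'_def E_def)
 qed (simp add: H'_def E_def norm_minus_commute)
 have limV: "(%k. L2sq (lborel \<Otimes>\<^sub>M M) (%x. V k x - v x)) \<longlonglongrightarrow> 0"
 proof (rule L2_combination_null[OF A, where c="%a. norm (C a) * KM" and g="%a k x. norm (E k a x - H' a x)"])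
  show "norm (V k x - v x) <= (\<Sum>a\<in>A. norm (C a) * KM * norm (E k a x - H' a x))" for k x
   unfolding V_def v_def sum_subtractf[symmetric] bounded_bilinear.diff_right[OF bounded_bilinear_matrix_mult, symmetric]
  proof (intro order_trans[OF norm_sum] sum_mono)
   show "norm (C a ** (E k a x - H' a x)) <= norm (C a) * KM * norm (E k a x - H' a x)" for a
    using KM(2)[of "C a" "E k a x - H' a x"] by (simp add: mult_ac)
  qed
  show m: "(%x. norm (E k a x - H' a x)) \<in> borel_measurable (lborel \<Otimes>\<^sub>M M)" if "a \<in> A" for a k using H'm[OF that] Em[OF that, of k] by measurable
  fix a assume a: "a \<in> A"
  have "(L2sq (lborel \<Otimes>\<^sub>M M) (%x. E k a x - H' a x)) =
   (\<integral>\<^sup>+w. (\<integral>\<^sup>+s\<in>{0..}. ennreal ((norm (h a s - elementary_process (m a k) (p a k) (\<xi> a k) s w))^2) \<partial>lborel) \<partial>M)" for k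
  proof -
   have "(L2sq (lborel \<Otimes>\<^sub>M M) (%x. E k a x - H' a x)) = (\<integral>\<^sup>+w. (L2sq lborel (%s. E k a (s, w) - H' a (s, w))) \<partial>M)"
    using m[OF a, of k] by (subst P.nn_integral_snd[symmetric]) auto
   then show ?thesis unfolding EH[OF a] by (auto intro!: nn_integral_cong simp: indicator_def)
  qed
  then show "(%k. L2sq (lborel \<Otimes>\<^sub>M M) (%x. E k a x - H' a x)) \<longlonglongrightarrow> 0"
   using Q a unfolding Q_def by simp
 qed (use KM(1) in auto)
 have "(L2sq M u) = (L2sq (lborel \<Otimes>\<^sub>M M) v)"
  by (intro antisym L2_limit_le[OF meas(1,2,3,4) _ limU limV] L2_limit_le[OF meas(3,4,1,2) _ limV limU]) (simp_all add: eq)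
 also have "... = (\<integral>\<^sup>+s. (L2sq M (%w. v (s, w))) \<partial>lborel)"
  using meas(4) by (subst nn_integral_fst) auto
 also have "... = (\<integral>\<^sup>+s\<in>{0..}. ennreal ((norm (\<Sum>a\<in>A. C a ** h a s))^2) \<partial>lborel)"
  by (intro nn_integral_cong) (auto simp: v_def H'_def emeasure_space_1 indicator_def)
 finally show ?thesis unfolding u_def .
qed

lemma ito_isometry_diff:
 fixes h h' :: "real => real^'e^'z"
 assumes H: "has_ito_integral M \<F> B (%s w. h s) I" and H': "has_ito_integral M \<F> B (%s w. h' s) I'"
 shows "(L2sq M (%w. I w - I' w)) = (\<integral>\<^sup>+s\<in>{0..}. ennreal ((norm (h s - h' s))^2) \<partial>lborel)"
proof -
 have "(- A) *v x = - (A *v x)" "(- A) ** Y = - (A ** Y)" for A :: "real^'z^'z" and x and Y :: "real^'e^'z"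
  by (simp_all add: vec_eq_iff matrix_vector_mult_def matrix_matrix_mult_def sum_negf)
 then have neg: "(- mat 1 :: real^'z^'z) *v x = - x" "(- mat 1 :: real^'z^'z) ** Y = - Y" for x and Y :: "real^'e^'z"
  by simp_all
 have *: "has_ito_integral M \<F> B (%s w. (if a then h else h') s) (if a then I else I')" for a using H H' by auto
 show ?thesis
  using ito_isometry[of "UNIV :: bool set" "%a. if a then h else h'" "%a. if a then I else I'" "%a. if a then mat 1 else - mat 1 :: real^'z^'z", OF finite *]
  by (simp add: UNIV_bool neg)
qed

lemma elementary_has_ito:
 fixes \<xi> :: "nat => 'a => real^'e^'z"
 assumes e: "elementary M \<F> m p \<xi>"
 shows "has_ito_integral M \<F> B (elementary_process m p \<xi>) (elementary_integral B m p \<xi>)"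
 unfolding has_ito_integral_def
proof (intro conjI exI[of _ "%_. m"] exI[of _ "%_. p"] exI[of _ "%_. \<xi>"] allI)
 have "(%(s, w). elementary_process m p \<xi> s w) \<in> borel_measurable (lborel \<Otimes>\<^sub>M M)"
  by (rule elementary_process_measurable[OF e])
 then show "(%(s, w). indicator {0..} s *\<^sub>R elementary_process m p \<xi> s w) \<in> borel_measurable (lborel \<Otimes>\<^sub>M M)"
  unfolding split_beta' by measurable
qed (use e elementary_integral_measurable in auto)

text \<open>The rate \<open>(1/4) ^ n\<close> for squares gives, by Cauchy-Schwarz on a probability
  space, first moments of at most \<open>(1/2) ^ n\<close> for the consecutive differences. These
  are summable, whence convergence almost everywhere; Fatou's lemma transfers the mean-square bound
  to the limit.\<close>

lemma L2_Cauchy_complete: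
 fixes f :: "nat => 'a => real^'z"
 assumes fm[measurable]: "!!n. f n \<in> borel_measurable M"
  and cauchy: "!!n m. n <= m ==> (L2sq M (%w. f n w - f m w)) <= ennreal ((1/4) ^ n)"
 obtains I where "I \<in> borel_measurable M" "(%n. L2sq M (%w. I w - f n w)) \<longlonglongrightarrow> 0"
proof -
 have L1: "(\<integral>\<^sup>+w. ennreal (norm (f (Suc n) w - f n w)) \<partial>M) <= ennreal ((1/2) ^ n)" for n
 proof -
  have "(\<integral>\<^sup>+w. ennreal (norm (f (Suc n) w - f n w)) * 1 \<partial>M)\<^sup>2 <= (\<integral>\<^sup>+w. (ennreal (norm (f (Suc n) w - f n w)))\<^sup>2 \<partial>M) * (\<integral>\<^sup>+w. 1\<^sup>2 \<partial>M)"
   by (rule Cauchy_Schwarz_nn_integral) auto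
  also have "... = (L2sq M (%w. f n w - f (Suc n) w))"
   by (simp add: emeasure_space_1 ennreal_power norm_minus_commute)
  also have "... <= ennreal ((1/4) ^ n)" by (rule cauchy) simp
  also have "(1/4 :: real) ^ n = (1/2) ^ n * (1/2) ^ n" by (simp flip: power_mult_distrib)
  also have "ennreal ((1/2) ^ n * (1/2) ^ n) = (ennreal ((1/2)^n))^2" by (simp add: ennreal_mult power2_eq_square)
  finally have le: "(\<integral>\<^sup>+w. ennreal (norm (f (Suc n) w - f n w)) \<partial>M)\<^sup>2 <= (ennreal ((1/2)^n))^2" by simp
  show ?thesis
  proof (cases "\<integral>\<^sup>+w. ennreal (norm (f (Suc n) w - f n w)) \<partial>M" rule: ennreal_cases)
   case (real r)
   have "r\<^sup>2 <= ((1/2)^n)^2" using le real(1) unfolding real(2) by (simp add: ennreal_power)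
   then have "r <= (1/2)^n" by (rule power2_le_imp_le) simp
   then show ?thesis unfolding real(2) by (rule ennreal_leI)
  next
   case top
   then show ?thesis using le by (simp add: ennreal_power top_unique)
  qed
 qed
 have "(\<integral>\<^sup>+w. (\<Sum>n. ennreal (norm (f (Suc n) w - f n w))) \<partial>M) = (\<Sum>n. \<integral>\<^sup>+w. ennreal (norm (f (Suc n) w - f n w)) \<partial>M)"
  by (rule nn_integral_suminf) auto
 also have "... <= (\<Sum>n. ennreal ((1/2) ^ n))" by (intro suminf_le L1) auto
 also have "... = ennreal (\<Sum>n. (1/2) ^ n)" by (rule suminf_ennreal2) (auto intro: summable_geometric)
 also have "... < \<infinity>" by simp
 finally have "(\<integral>\<^sup>+w. (\<Sum>n. ennreal (norm (f (Suc n) w - f n w))) \<partial>M) < \<infinity>" .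
 then have "AE w in M. (\<Sum>n. ennreal (norm (f (Suc n) w - f n w))) \<noteq> \<infinity>"
  by (intro nn_integral_PInf_AE) auto
 then have conv: "AE w in M. (%n. f n w) \<longlonglongrightarrow> lim (%n. f n w)"
 proof eventually_elim
  case (elim w)
  then have "summable (%n. norm (f (Suc n) w - f n w))" by (intro summable_suminf_not_top) auto
  then have "summable (%n. f (Suc n) w - f n w)" by (rule summable_norm_cancel)
  then have "convergent (%n. f n w)"
   unfolding summable_iff_convergent sum_lessThan_telescope[of "%n. f n w"] convergent_diff_const_right_iff .
  then show ?case by (simp add: convergent_LIMSEQ_iff)
 qed
 define I where "I w = lim (%n. f n w)" for w
 have Im[measurable]: "I \<in> borel_measurable M" unfolding I_def by measurable
 have bd: "(L2sq M (%w. I w - f n w)) <= ennreal ((1/4) ^ n)" for n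
 proof -
  have "(L2sq M (%w. I w - f n w)) = (\<integral>\<^sup>+w. liminf (%m. ennreal ((norm (f m w - f n w))^2)) \<partial>M)"
  proof (rule nn_integral_cong_AE)
   show "AE w in M. ennreal ((norm (I w - f n w))^2) = liminf (%m. ennreal ((norm (f m w - f n w))^2))"
    using conv
   proof eventually_elim
    case (elim w)
    then have "(%m. ennreal ((norm (f m w - f n w))^2)) \<longlonglongrightarrow> ennreal ((norm (I w - f n w))^2)"
     unfolding I_def by (intro tendsto_intros)
    then show ?case by (intro lim_imp_Liminf[symmetric]) auto
   qed
  qed
  also have "... <= liminf (%m. L2sq M (%w. f m w - f n w))"
   by (rule nn_integral_liminf) auto
  also have "... <= liminf (%m. ennreal ((1/4) ^ n))"
  proof (rule Liminf_mono, rule eventually_sequentiallyI[of n])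
   fix m assume "n <= m"
   then show "(L2sq M (%w. f m w - f n w)) <= ennreal ((1/4) ^ n)"
    using cauchy[of n m] by (simp add: norm_minus_commute)
  qed
  also have "... = ennreal ((1/4) ^ n)" by (intro lim_imp_Liminf) auto
  finally show ?thesis .
 qed
 show thesis
 proof (rule that[OF Im], rule tendsto_sandwich[OF _ _ tendsto_const])
  show "\<forall>\<^sub>F n in sequentially. (L2sq M (%w. I w - f n w)) <= ennreal ((1/4) ^ n)"
   using bd by simp
  have "(%n. ennreal ((1/4) ^ n)) \<longlonglongrightarrow> ennreal 0" by (intro tendsto_intros LIMSEQ_power_zero) auto
  then show "(%n. ennreal ((1/4) ^ n)) \<longlonglongrightarrow> 0" by simp
 qed simp
qed

text \<open>Uniform continuity on \<open>[0, T]\<close> makes the step function with left endpoint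
  values accurate there, and the tail is small by hypothesis. The coefficients are constants, so
  they are measurable with respect to every \<open>\<F> (p i)\<close>.\<close>

lemma step_approximation:
 fixes h :: "real => real^'e^'z"
 assumes hm: "(%s. indicator {0..} s *\<^sub>R h s) \<in> borel_measurable borel"
  and T: "T >= 0" and c: "continuous_on {0..T} h" and e: "e > 0"
  and tail: "(\<integral>\<^sup>+s\<in>{T<..}. ennreal ((norm (h s))^2) \<partial>lborel) <= ennreal e"
 obtains m p \<xi> where "elementary M \<F> m p (%j w. \<xi> j)"
  "(\<integral>\<^sup>+s\<in>{0..}. ennreal ((norm (h s - (\<Sum>i<m. indicator {p i<..p (Suc i)} s *\<^sub>R \<xi> i)))^2) \<partial>lborel) <= ennreal (2 * e)"
proof -
 \<comment> \<open>Chosen so that the error \<open>\<epsilon>\<close> on \<open>[0, T]\<close>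
   contributes at most \<open>e\<close> to the squared integral; \<open>T + 1\<close> avoids a
   division by 0 when \<open>T = 0\<close>.\<close>
 define \<epsilon> where "\<epsilon> = sqrt (e / (T + 1))"
 have \<epsilon>: "\<epsilon> > 0" using e T by (simp add: \<epsilon>_def)
 have "uniformly_continuous_on {0..T} h" using c by (intro compact_uniformly_continuous) auto
 then obtain \<delta> where \<delta>: "\<delta> > 0" "!!x y. x \<in> {0..T} ==> y \<in> {0..T} ==> dist y x < \<delta> ==> dist (h y) (h x) < \<epsilon>"
  using \<epsilon> unfolding uniformly_continuous_on_def by metis
 obtain m :: nat where m: "m > 0" "T / m < \<delta>"
 proof -
  obtain m :: nat where "T / \<delta> < real m" using reals_Archimedean2 by blast
  then have "T / \<delta> < real (Suc m)" by simp
  then have "T / real (Suc m) < \<delta>" using \<delta>(1) by (simp add: field_simps)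
  then show thesis by (intro that[of "Suc m"]) auto
 qed
 define p where "p i = real i * (T / m)" for i
 have mono: "p i <= p j" if "i <= j" for i j using that T by (simp add: p_def mult_right_mono divide_right_mono)
 have pm: "p m = T" using m by (simp add: p_def)
 have el: "elementary M \<F> m p (%j w. h (p j))"
  unfolding elementary_def
 proof (intro conjI allI impI)
  show "0 <= p 0" by (simp add: p_def)
  show "p i <= p (Suc i)" for i by (rule mono) simp
 qed auto
 define S where "S s = (\<Sum>i<m. indicator {p i<..p (Suc i)} s *\<^sub>R h (p i))" for s
 have S0: "S s = 0" if "s > T \<or> s <= 0" for s
  unfolding S_def
 proof (rule sum.neutral, rule ballI)
  fix i assume "i \<in> {..<m}"
  then have "p (Suc i) <= T" "0 <= p i" using mono[of "Suc i" m] pm T by (auto simp: p_def)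
  then show "indicat_real {p i<..p (Suc i)} s *\<^sub>R h (p i) = 0" using that by auto
 qed
 have S1: "norm (h s - S s) < \<epsilon>" if s: "0 < s" "s <= T" for s
 proof -
  have ex: "\<exists>i. s <= p (Suc i)" using s pm m by (metis Suc_pred)
  define i where "i = (LEAST i. s <= p (Suc i))"
  have i1: "s <= p (Suc i)" unfolding i_def using ex by (rule LeastI_ex)
  have i2: "p i < s"
  proof (cases i)
   case 0 then show ?thesis using s by (simp add: p_def)
  next
   case (Suc j)
   then have "\<not> s <= p (Suc j)" unfolding i_def by (metis i_def lessI not_less_Least)
   then show ?thesis using Suc by simp
  qed
  have im: "i < m" using i2 s pm mono[of m i] by (meson leD le_trans less_le_trans linorder_not_less)
  have "S s = (\<Sum>j<m. if j = i then h (p i) else 0)"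
   unfolding S_def
  proof (rule sum.cong[OF refl])
   fix j
   have "p (Suc j) <= p i" if "j < i" using that by (intro mono) simp
   moreover have "p (Suc i) <= p j" if "j > i" using that by (intro mono) simp
   ultimately show "indicat_real {p j<..p (Suc j)} s *\<^sub>R h (p j) = (if j = i then h (p i) else 0)"
    using i1 i2 by (cases "j < i"; cases "j = i") (auto simp: indicator_def not_less)
  qed
  then have S: "S s = h (p i)" using im by simp
  have "p (Suc i) - p i = T / m" by (simp add: p_def algebra_simps add_divide_distrib)
  then have "dist s (p i) < \<delta>" using i1 i2 m by (simp add: dist_real_def)
  moreover have "p i \<in> {0..T}" using i2 s T by (auto simp: p_def)
  ultimately have "dist (h s) (h (p i)) < \<epsilon>" using s by (intro \<delta>(2)) auto
  then show ?thesis by (simp add: S dist_norm)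
 qed
 \<comment> \<open>The point 0 is excluded because the cells are open on the left and
   \<open>S 0 = 0\<close>; it is a null set.\<close>
 have bdT: "ennreal ((norm (h s - S s))^2) * indicator {0..} s <= ennreal (\<epsilon>\<^sup>2) * indicator {0..T} s + ennreal ((norm (h s))^2) * indicator {T<..} s"
  if "s \<noteq> 0" for s
 proof -
  consider "s < 0" | "0 < s" "s <= T" | "s > T" "s > 0" using \<open>s \<noteq> 0\<close> T by linarith
  then show ?thesis
  proof cases
   case 2
   then have "(norm (h s - S s))\<^sup>2 <= \<epsilon>\<^sup>2" using S1[of s] by (intro power_mono) auto
   then show ?thesis using 2 by (auto intro!: ennreal_leI)
  qed (auto simp: S0)
 qed
 have "(\<integral>\<^sup>+s\<in>{0..}. ennreal ((norm (h s - S s))^2) \<partial>lborel)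
  <= (\<integral>\<^sup>+s. ennreal (\<epsilon>\<^sup>2) * indicator {0..T} s + ennreal ((norm (h s))^2) * indicator {T<..} s \<partial>lborel)"
  by (rule nn_integral_mono_AE, rule AE_mp[OF AE_lborel_singleton[of 0]]) (use bdT in auto)
 also have "... = (\<integral>\<^sup>+s. ennreal (\<epsilon>\<^sup>2) * indicator {0..T} s \<partial>lborel) + (\<integral>\<^sup>+s\<in>{T<..}. ennreal ((norm (h s))^2) \<partial>lborel)"
 proof (rule nn_integral_add)
  have "(%s. ennreal ((norm (indicator {0..} s *\<^sub>R h s))^2) * indicator {T<..} s) \<in> borel_measurable borel"
   using hm by measurable
  moreover have "ennreal ((norm (indicator {0..} s *\<^sub>R h s))^2) * indicator {T<..} s = ennreal ((norm (h s))^2) * indicator {T<..} s" for s :: real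
   using T by (auto simp: indicator_def)
  ultimately show "(%s. ennreal ((norm (h s))^2) * indicator {T<..} s) \<in> borel_measurable lborel" by simp
 qed simp
 also have "... <= ennreal e + ennreal e"
 proof (intro add_mono tail)
  have "(\<integral>\<^sup>+s. ennreal (\<epsilon>\<^sup>2) * indicator {0..T} s \<partial>lborel) = ennreal (\<epsilon>\<^sup>2) * ennreal T"
   using T by (simp add: nn_integral_cmult)
  also have "... = ennreal (\<epsilon>\<^sup>2 * T)" using T by (simp add: ennreal_mult)
  also have "... <= ennreal e"
  proof (rule ennreal_leI)
   have "\<epsilon>\<^sup>2 * T = e * (T / (T + 1))" using e T by (simp add: \<epsilon>_def)
   also have "... <= e * 1" using e T by (intro mult_left_mono) auto
   finally show "\<epsilon>\<^sup>2 * T <= e" by simp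
  qed
  finally show "(\<integral>\<^sup>+s. ennreal (\<epsilon>\<^sup>2) * indicator {0..T} s \<partial>lborel) <= ennreal e" .
 qed
 also have "... = ennreal (2 * e)" using e by (simp flip: ennreal_plus)
 finally show thesis by (intro that[OF el]) (simp add: S_def)
qed

text \<open>The hypothesis on \<open>h\<close> is shaped to cover both uses: functions truncated to
  \<open>[0, t]\<close>, which may jump at \<open>t\<close> but have no tail, and continuous
  functions that are square integrable on the half-line.\<close>

lemma ito_exists:
 fixes h :: "real => real^'e^'z"
 assumes hm: "(%s. indicator {0..} s *\<^sub>R h s) \<in> borel_measurable borel"
  and approx: "!!e. e > 0 ==> \<exists>T\<ge>0. continuous_on {0..T} h & (\<integral>\<^sup>+s\<in>{T<..}. ennreal ((norm (h s))^2) \<partial>lborel) <= ennreal e"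
 obtains I where "has_ito_integral M \<F> B (%s w. h s) I"
proof -
 \<comment> \<open>The bounds \<open>2 * e n\<close> of the approximations, doubled when two of them
   are compared, give \<open>4 * e n + 4 * e k\<close>, which for \<open>n <= k\<close> is at most
   \<open>8 * e n = (1/4) ^ n\<close>.\<close>
 define e where "e n = (1/4 :: real) ^ n / 8" for n
 have "\<exists>m p \<xi>. elementary M \<F> m p (%j w. \<xi> j) &
  (\<integral>\<^sup>+s\<in>{0..}. ennreal ((norm (h s - (\<Sum>i<m. indicator {p i<..p (Suc i)} s *\<^sub>R \<xi> i)))^2) \<partial>lborel) <= ennreal (2 * e n)" for n
 proof -
  have "e n > 0" by (simp add: e_def)
  then obtain T where "T >= 0" "continuous_on {0..T} h" "(\<integral>\<^sup>+s\<in>{T<..}. ennreal ((norm (h s))^2) \<partial>lborel) <= ennreal (e n)"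
   using approx by blast
  then show ?thesis by (elim step_approximation[OF hm _ _ \<open>e n > 0\<close>]) blast+
 qed
 then have "\<forall>n. \<exists>m p \<xi>. elementary M \<F> m p (%j w. \<xi> j) &
  (\<integral>\<^sup>+s\<in>{0..}. ennreal ((norm (h s - (\<Sum>i<m. indicator {p i<..p (Suc i)} s *\<^sub>R \<xi> i)))^2) \<partial>lborel) <= ennreal (2 * e n)" by blast
 then obtain m p \<xi> where el: "!!n. elementary M \<F> (m n) (p n) (%j w. \<xi> n j)"
  and ap: "!!n. (\<integral>\<^sup>+s\<in>{0..}. ennreal ((norm (h s - (\<Sum>i<m n. indicator {p n i<..p n (Suc i)} s *\<^sub>R \<xi> n i)))^2) \<partial>lborel) <= ennreal (2 * e n)"
  unfolding choice_iff by blast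
 define S where "S n s = (\<Sum>i<m n. indicator {p n i<..p n (Suc i)} s *\<^sub>R \<xi> n i)" for n s
 have S: "elementary_process (m n) (p n) (%j w. \<xi> n j) = (%s w. S n s)" for n
  by (simp add: elementary_process_def S_def fun_eq_iff)
 have Sm[measurable]: "S n \<in> borel_measurable borel" for n unfolding S_def[abs_def] by measurable
 define J where "J n = elementary_integral B (m n) (p n) (%j w. \<xi> n j)" for n
 have J: "has_ito_integral M \<F> B (%s w. S n s) (J n)" for n
  using elementary_has_ito[OF el[of n]] by (simp add: S J_def)
 have cauchy: "(L2sq M (%w. J n w - J k w)) <= ennreal ((1/4) ^ n)" if "n <= k" for n k
 proof -
  have hm'[measurable]: "(%s. ennreal ((norm (h s - S n s))^2) * indicator {0..} s) \<in> borel_measurable borel" for n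
  proof -
   have "(%s. ennreal ((norm (indicator {0..} s *\<^sub>R h s - S n s))^2) * indicator {0..} s) \<in> borel_measurable borel"
    using hm by measurable
   moreover have "ennreal ((norm (indicator {0..} s *\<^sub>R h s - S n s))^2) * indicator {0..} s = ennreal ((norm (h s - S n s))^2) * indicator {0..} s" for s :: real
    by (auto simp: indicator_def)
   ultimately show ?thesis by simp
  qed
  have "(L2sq M (%w. J n w - J k w)) = (\<integral>\<^sup>+s\<in>{0..}. ennreal ((norm (S n s - S k s))^2) \<partial>lborel)"
   by (rule ito_isometry_diff[OF J J])
  also have "... <= (\<integral>\<^sup>+s. 2 * (ennreal ((norm (h s - S n s))^2) * indicator {0..} s) + 2 * (ennreal ((norm (h s - S k s))^2) * indicator {0..} s) \<partial>lborel)"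
  proof (intro nn_integral_mono)
   fix s :: real
   have "norm (S n s - S k s) <= norm (h s - S n s) + norm (h s - S k s)"
    using norm_triangle_ineq4[of "h s - S k s" "h s - S n s"] by simp
   then have "(norm (S n s - S k s))\<^sup>2 <= (norm (h s - S n s) + norm (h s - S k s))^2" by (intro power_mono) auto
   also have "... <= 2 * (norm (h s - S n s))^2 + 2 * (norm (h s - S k s))^2"
    using sum_squares_bound[of "norm (h s - S n s)" "norm (h s - S k s)"] by (simp add: power2_sum)
   finally have "ennreal ((norm (S n s - S k s))^2) <= ennreal (2 * (norm (h s - S n s))^2 + 2 * (norm (h s - S k s))^2)"
    by (rule ennreal_leI)
   also have "... = 2 * ennreal ((norm (h s - S n s))^2) + 2 * ennreal ((norm (h s - S k s))^2)"
    by (simp add: ennreal_mult)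
   finally show "ennreal ((norm (S n s - S k s))^2) * indicator {0..} s <= 2 * (ennreal ((norm (h s - S n s))^2) * indicator {0..} s) + 2 * (ennreal ((norm (h s - S k s))^2) * indicator {0..} s)"
    by (auto simp: indicator_def)
  qed
  also have "... = 2 * (\<integral>\<^sup>+s\<in>{0..}. ennreal ((norm (h s - S n s))^2) \<partial>lborel) + 2 * (\<integral>\<^sup>+s\<in>{0..}. ennreal ((norm (h s - S k s))^2) \<partial>lborel)"
   by (subst nn_integral_add) (auto simp: nn_integral_cmult)
  also have "... <= 2 * ennreal (2 * e n) + 2 * ennreal (2 * e k)"
   using ap[of n] ap[of k] by (intro add_mono mult_left_mono) (auto simp: S_def)
  also have "... = ennreal (2 * (2 * e n) + 2 * (2 * e k))"
  proof -
   have "ennreal (2 * a + 2 * b) = 2 * ennreal a + 2 * ennreal b" if "a >= 0" "b >= 0" for a b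
    using that by (simp add: ennreal_mult)
   from this[of "2 * e n" "2 * e k"] show ?thesis by (simp add: e_def)
  qed
  also have "... <= ennreal ((1/4) ^ n)"
  proof (rule ennreal_leI)
   have "(1/4 :: real) ^ k <= (1/4) ^ n" using that by (intro power_decreasing) auto
   then show "2 * (2 * e n) + 2 * (2 * e k) <= (1/4) ^ n" unfolding e_def by linarith
  qed
  finally show ?thesis .
 qed
 obtain I where I: "I \<in> borel_measurable M" "(%n. L2sq M (%w. I w - J n w)) \<longlonglongrightarrow> 0"
  using L2_Cauchy_complete[of J, OF ito_measurable[OF J] cauchy] by blast
 have "has_ito_integral M \<F> B (%s w. h s) I"
  unfolding has_ito_integral_def
 proof (intro conjI exI[of _ m] exI[of _ p] exI[of _ "%n j w. \<xi> n j"] allI)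
  show "(%(s, w). indicator {0..} s *\<^sub>R h s) \<in> borel_measurable (lborel \<Otimes>\<^sub>M M)"
   using measurable_compose[OF measurable_fst hm[folded measurable_lborel1], of M] by (simp add: split_beta')
  show "(%n. \<integral>\<^sup>+w. (\<integral>\<^sup>+s\<in>{0..}. ennreal ((norm (h s - elementary_process (m n) (p n) (%j w. \<xi> n j) s w))^2) \<partial>lborel) \<partial>M) \<longlonglongrightarrow> 0"
  proof (rule tendsto_sandwich[OF _ _ tendsto_const])
   show "\<forall>\<^sub>F n in sequentially. (\<integral>\<^sup>+w. (\<integral>\<^sup>+s\<in>{0..}. ennreal ((norm (h s - elementary_process (m n) (p n) (%j w. \<xi> n j) s w))^2) \<partial>lborel) \<partial>M) <= ennreal (2 * e n)"
    using ap by (simp add: S S_def emeasure_space_1)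
   have "(%n. ennreal (2 * ((1/4) ^ n / 8))) \<longlonglongrightarrow> ennreal (2 * (0 / 8))" by (intro tendsto_intros LIMSEQ_power_zero) auto
   then show "(%n. ennreal (2 * e n)) \<longlonglongrightarrow> 0" by (simp add: e_def)
  qed simp
  show "(%n. L2sq M (%w. I w - elementary_integral B (m n) (p n) (%j w. \<xi> n j) w)) \<longlonglongrightarrow> 0"
   using I(2) by (simp add: J_def)
 qed (use el I in auto)
 then show thesis by (rule that)
qed

text \<open>\<open>ito_integral\<close> is a choice, so it has the defining property only where some
  version exists.\<close>

lemma ito_integral_exists:
 fixes h :: "real => real^'e^'z"
 assumes hm: "(%s. indicator {0..} s *\<^sub>R h s) \<in> borel_measurable borel"
  and approx: "!!e. e > 0 ==> \<exists>T\<ge>0. continuous_on {0..T} h & (\<integral>\<^sup>+s\<in>{T<..}. ennreal ((norm (h s))^2) \<partial>lborel) <= ennreal e"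
 shows "has_ito_integral M \<F> B (%s w. h s) (ito_integral M \<F> B (%s w. h s))"
 using ito_exists[OF assms] unfolding ito_integral_def by (metis someI_ex)

lemma ito_integral_truncated:
 fixes h :: "real => real^'e^'z"
 assumes T: "T >= 0" and c: "continuous_on {0..T} h"
 shows "has_ito_integral M \<F> B (%s w. indicator {0..T} s *\<^sub>R h s) (ito_integral M \<F> B (%s w. indicator {0..T} s *\<^sub>R h s))"
proof (rule ito_integral_exists)
 have "(%s. indicator {0..T} s *\<^sub>R h s) \<in> borel_measurable borel"
  using c by (intro borel_measurable_continuous_on_indicator) auto
 moreover have "indicator {0..} s *\<^sub>R (indicator {0..T} s *\<^sub>R h s) = indicator {0..T} s *\<^sub>R h s" for s :: real
  by (auto simp: indicator_def)
 ultimately show "(%s. indicator {0..} s *\<^sub>R (indicator {0..T} s *\<^sub>R h s)) \<in> borel_measurable borel" by (simp only:)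
 fix e :: real assume "e > 0"
 have "(\<integral>\<^sup>+s\<in>{T<..}. ennreal ((norm (indicator {0..T} s *\<^sub>R h s))^2) \<partial>lborel) = (\<integral>\<^sup>+s. 0 \<partial>(lborel :: real measure))"
  by (intro nn_integral_cong) (auto simp: indicator_def)
 then have "(\<integral>\<^sup>+s\<in>{T<..}. ennreal ((norm (indicator {0..T} s *\<^sub>R h s))^2) \<partial>lborel) <= ennreal e" by simp
 moreover have "continuous_on {0..T} (%s. indicator {0..T} s *\<^sub>R h s)"
  by (rule continuous_on_eq[OF c]) auto
 ultimately show "\<exists>T'\<ge>0. continuous_on {0..T'} (%s. indicator {0..T} s *\<^sub>R h s) & (\<integral>\<^sup>+s\<in>{T'<..}. ennreal ((norm (indicator {0..T} s *\<^sub>R h s))^2) \<partial>lborel) <= ennreal e"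
  using T by blast
qed

lemma ito_integral_half_line:
 fixes h :: "real => real^'e^'z"
 assumes c: "continuous_on {0..} h" and i: "set_integrable lborel {0..} (%s. (norm (h s))\<^sup>2)"
 shows "has_ito_integral M \<F> B (%s w. h s) (ito_integral M \<F> B (%s w. h s))"
proof (rule ito_integral_exists)
 show "(%s. indicator {0..} s *\<^sub>R h s) \<in> borel_measurable borel"
  using c by (intro borel_measurable_continuous_on_indicator) auto
 fix e :: real assume e: "e > 0"
 define f where "f s = indicator {0..} s *\<^sub>R (norm (h s))\<^sup>2" for s :: real
 have f: "integrable lborel f" using i by (simp add: set_integrable_def f_def[abs_def])
 have "((%T. LBINT s. indicator {..T} s *\<^sub>R f s) \<longlongrightarrow> (LBINT s. f s)) at_top"
  by (rule tendsto_integral_at_top[OF _ f]) simp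
 then have "\<forall>\<^sub>F T in at_top. (LBINT s. f s) - e < (LBINT s. indicator {..T} s *\<^sub>R f s)"
  using e by (intro order_tendstoD) auto
 then obtain T0 where T0: "!!T. T >= T0 ==> (LBINT s. f s) - e < (LBINT s. indicator {..T} s *\<^sub>R f s)"
  by (auto simp: eventually_at_top_linorder)
 define T where "T = max 0 T0"
 have i1: "integrable lborel (%s. indicator {..T} s *\<^sub>R f s)" by (intro integrable_mult_indicator f) simp
 have i2: "integrable lborel (%s. indicator {T<..} s *\<^sub>R f s)" by (intro integrable_mult_indicator f) simp
 have "(LBINT s. f s) = (LBINT s. indicator {..T} s *\<^sub>R f s + indicator {T<..} s *\<^sub>R f s)"
  by (intro bochner_cong refl) (auto simp: indicator_def)
 then have "(LBINT s. indicator {T<..} s *\<^sub>R f s) <= e"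
  using T0[of T] i1 i2 by (simp add: T_def)
 moreover have "(\<integral>\<^sup>+s\<in>{T<..}. ennreal ((norm (h s))^2) \<partial>lborel) = (\<integral>\<^sup>+s. ennreal (indicator {T<..} s *\<^sub>R f s) \<partial>lborel)"
  by (intro nn_integral_cong) (auto simp: indicator_def f_def T_def)
 moreover have "(\<integral>\<^sup>+s. ennreal (indicator {T<..} s *\<^sub>R f s) \<partial>lborel) = ennreal (LBINT s. indicator {T<..} s *\<^sub>R f s)"
  by (rule nn_integral_eq_integral[OF i2]) (auto simp: f_def)
 ultimately have "(\<integral>\<^sup>+s\<in>{T<..}. ennreal ((norm (h s))^2) \<partial>lborel) <= ennreal e" by (simp add: ennreal_leI)
 moreover have "T >= 0" "continuous_on {0..T} h" using continuous_on_subset[OF c] by (auto simp: T_def)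
 ultimately show "\<exists>T\<ge>0. continuous_on {0..T} h & (\<integral>\<^sup>+s\<in>{T<..}. ennreal ((norm (h s))^2) \<partial>lborel) <= ennreal e" by blast
qed

end

section \<open>The characteristic matrix of a kernel and its inverse near infinity\<close>

text \<open>The common setting of both equations: a matrix kernel of density \<open>w\<close> on the
  half-line, with an exponential moment at \<open>a\<close>. The number \<open>a\<close> fixes a
  half-plane in which the transform converges absolutely.\<close>

locale delay_kernel = finite_measure L for L :: "real measure" +
 fixes w :: "real => real^'d^'d" and a :: real
 assumes sets_L: "sets L = sets borel" and w_meas: "w \<in> borel_measurable borel"
  and w_neg: "!!x. x < 0 ==> w x = 0"
  and w_int: "integrable L (%x. norm (w x))"
  and w_exp: "integrable L (%x. exp (- a * x) * norm (w x))"
begin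

definition lap :: "complex => complex^'d^'d" where
 "lap z = (\<chi> i k. LINT x|L. exp (- z * of_real x) * of_real (w x $ i $ k))"

definition charm :: "complex => complex^'d^'d" where
 "charm z = mat z - lap z"

lemma borel_L: "borel_measurable L = borel_measurable borel"
 using measurable_cong_sets[OF sets_L refl] by auto

lemma w_comp_meas [measurable]: "(%x. w x $ i $ k) \<in> borel_measurable borel"
 by (rule measurable_compose[OF w_meas]) (intro borel_measurable_continuous_onI continuous_on_component continuous_on_id)

lemma norm_lap_integrand:
 assumes "Re z >= a"
 shows "norm (exp (- z * of_real x) * of_real (w x $ i $ k)) <= exp (- a * x) * norm (w x)"
proof (cases "x < 0")
 case False
 have "norm (exp (- z * of_real x) * of_real (w x $ i $ k)) = exp (- (Re z * x)) * \<bar>w x $ i $ k\<bar>"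
  by (simp add: norm_mult)
 also have "... <= exp (- a * x) * norm (w x)"
  using assms False matrix_component_le_norm[of "w x" i k] by (intro mult_mono) (auto simp: mult_right_mono)
 finally show ?thesis .
qed (simp add: w_neg)

lemma lap_integrable:
 assumes "Re z >= a"
 shows "integrable L (%x. exp (- z * of_real x) * of_real (w x $ i $ k))"
proof (rule bochner_bound[OF w_exp])
 show "(%x. exp (- z * of_real x) * of_real (w x $ i $ k)) \<in> borel_measurable L"
  unfolding borel_L by measurable
 show "AE x in L. norm (exp (- z * of_real x) * of_real (w x $ i $ k)) <= norm (exp (- a * x) * norm (w x))"
  using norm_lap_integrand[OF assms] by (intro AE_I2) simp
qed

definition W :: real where "W = (LINT x|L. exp (- a * x) * norm (w x))"

lemma W_nonneg: "W >= 0" unfolding W_def by simp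

lemma lap_bound:
 assumes "Re z >= a"
 shows "norm (lap z $ i $ k) <= W"
proof -
 have "norm (lap z $ i $ k) <= (LINT x|L. norm (exp (- z * of_real x) * of_real (w x $ i $ k)))"
  unfolding lap_def by simp
 also have "... <= W"
  unfolding W_def using norm_lap_integrand[OF assms] lap_integrable[OF assms] w_exp by (intro integral_mono) auto
 finally show ?thesis .
qed

lemma lap_norm_bound:
 assumes "Re z >= a"
 shows "norm (lap z) <= real CARD('d) ^ 2 * W"
proof -
 have "norm (lap z) <= (\<Sum>i\<in>UNIV. \<Sum>k\<in>UNIV. norm (lap z $ i $ k))" by (rule matrix_norm_le_sum)
 also have "... <= (\<Sum>i\<in>(UNIV::'d set). \<Sum>k\<in>(UNIV::'d set). W)" by (intro sum_mono lap_bound assms)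
 finally show ?thesis by (simp add: power2_eq_square mult.assoc)
qed

text \<open>The kernel is real. This is why roots come in conjugate pairs and only those with
  \<open>Im z >= 0\<close> have to be listed.\<close>

lemma lap_cnj: "lap (cnj z) $ i $ k = cnj (lap z $ i $ k)"
proof -
 have "cnj (exp (- z * of_real x) * of_real (w x $ i $ k)) = exp (- cnj z * of_real x) * of_real (w x $ i $ k)" for x :: real
  by (simp add: exp_cnj)
 then have "(LINT x|L. exp (- cnj z * of_real x) * of_real (w x $ i $ k)) = cnj (LINT x|L. exp (- z * of_real x) * of_real (w x $ i $ k))"
  by (simp only: Bochner_Integration.integral_cnj[symmetric])
 then show ?thesis unfolding lap_def by simp
qed

text \<open>Differentiation under the integral: the difference quotient differs from the derivative
  of the integrand by at most \<open>norm h\<close> times a fixed multiple of the integrable weight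
  at \<open>a\<close>.\<close>

lemma lap_holomorphic: "(%z. lap z $ i $ k) holomorphic_on {z. Re z > a}"
proof (rule holomorphic_onI)
 fix z assume "z \<in> {z. Re z > a}"
 then have z: "Re z > a" by simp
 \<comment> \<open>Two factors \<open>exp (\<delta> * x)\<close> occur, one from the Taylor
   remainder and one from \<open>x ^ 2\<close>; together they use up exactly the distance from
   \<open>Re z\<close> to \<open>a\<close>.\<close>
 define \<delta> where "\<delta> = (Re z - a) / 2"
 have \<delta>: "\<delta> > 0" using z by (simp add: \<delta>_def)
 define F where "F u x = exp (- u * of_real x) * of_real (w x $ i $ k)" for u :: complex and x :: real
 define D where "D x = - of_real x * F z x" for x
 have Fm: "F u \<in> borel_measurable L" for u unfolding F_def[abs_def] borel_L by measurable
 have Dm: "D \<in> borel_measurable L" unfolding D_def[abs_def] using Fm[of z] unfolding borel_L by measurable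
 define C where "C = fact 2 / \<delta> ^ 2"
 have quot: "norm ((F (z + h) x - F z x) / h - D x) <= norm h * (C * (exp (- a * x) * norm (w x)))"
  if h: "h \<noteq> 0" "norm h < \<delta>" for h x
 proof (cases "x < 0")
  case True then show ?thesis by (simp add: F_def D_def w_neg)
 next
  case False
  have e: "norm (exp u - (1 + u)) <= exp (norm u) * (norm u)^2" for u :: complex
  proof -
   have "norm (exp u - (\<Sum>i\<le>1. u ^ i / fact i)) <= exp \<bar>Re u\<bar> * (norm u ^ Suc 1) / fact 1"
    by (rule Taylor_exp)
   also have "... <= exp (norm u) * (norm u)^2"
    using abs_Re_le_cmod[of u] by (simp add: power2_eq_square mult_right_mono)
   finally show ?thesis by (simp add: numeral_2_eq_2)
  qed
  have "F (z + h) x - F z x - h * D x = (exp (- h * of_real x) - (1 + (- h * of_real x))) * F z x"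
   by (simp add: F_def D_def algebra_simps exp_add exp_diff exp_minus field_simps)
  then have "norm (F (z + h) x - F z x - h * D x) <= (exp (norm h * x) * (norm h * x)^2) * norm (F z x)"
   using e[of "- h * of_real x"] False by (simp add: norm_mult mult_right_mono)
  also have "... <= (exp (\<delta> * x) * ((norm h)^2 * (C * exp (\<delta> * x)))) * (exp (- (Re z * x)) * norm (w x))"
  proof (intro mult_mono)
   show "exp (norm h * x) <= exp (\<delta> * x)" using h False by (simp add: mult_right_mono)
   have "x ^ 2 <= C * exp (\<delta> * x)" unfolding C_def using False \<delta> by (intro power_le_fact_exp) auto
   then show "(norm h * x)\<^sup>2 <= (norm h)^2 * (C * exp (\<delta> * x))" by (simp add: power_mult_distrib mult_left_mono)
   show "norm (F z x) <= exp (- (Re z * x)) * norm (w x)"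
    using matrix_component_le_norm[of "w x" i k] by (simp add: F_def norm_mult)
  qed (auto simp: C_def)
  also have "... = (norm h)^2 * (C * ((exp (\<delta> * x) * exp (\<delta> * x) * exp (- (Re z * x))) * norm (w x)))" by (simp add: mult_ac)
  also have "exp (\<delta> * x) * exp (\<delta> * x) * exp (- (Re z * x)) = exp (- a * x)"
   by (simp add: \<delta>_def algebra_simps flip: exp_add) (simp add: field_simps)?
  finally have n: "norm (F (z + h) x - F z x - h * D x) <= (norm h)^2 * (C * (exp (- a * x) * norm (w x)))" by simp
  have "(F (z + h) x - F z x) / h - D x = (F (z + h) x - F z x - h * D x) / h" using h by (simp add: diff_divide_distrib)
  then have "norm ((F (z + h) x - F z x) / h - D x) <= (norm h)^2 * (C * (exp (- a * x) * norm (w x))) / norm h"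
   using n by (simp add: norm_divide divide_right_mono)
  then show ?thesis using h by (simp add: power2_eq_square)
 qed
 have Fi: "integrable L (F u)" if "Re u >= a" for u unfolding F_def[abs_def] by (rule lap_integrable[OF that])
 \<comment> \<open>The derivative is compared with one difference quotient, that for the fixed step
   \<open>\<delta> / 2\<close>, whose terms are integrable.\<close>
 have Di: "integrable L D"
 proof (rule bochner_bound[OF _ Dm])
  have hz: "Re (z + of_real (\<delta>/2)) >= a" using z \<delta> by simp
  show "integrable L (%x. norm (F (z + of_real (\<delta>/2)) x) / (\<delta>/2) + norm (F z x) / (\<delta>/2) + (\<delta>/2) * (C * (exp (- a * x) * norm (w x))))"
   using Fi[OF hz] Fi[of z] z w_exp by (intro Bochner_Integration.integrable_add) auto
  show "AE x in L. norm (D x) <= norm (norm (F (z + of_real (\<delta>/2)) x) / (\<delta>/2) + norm (F z x) / (\<delta>/2) + (\<delta>/2) * (C * (exp (- a * x) * norm (w x))))" (is "AE x in _. ?bd x")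
  proof (intro AE_I2)
   fix x
   have h: "complex_of_real (\<delta>/2) \<noteq> 0" "norm (complex_of_real (\<delta>/2)) < \<delta>" using \<delta> by (auto simp: norm_of_real simp del: of_real_divide)
   have "norm (D x) <= norm ((F (z + of_real (\<delta>/2)) x - F z x) / of_real (\<delta>/2)) + norm ((F (z + of_real (\<delta>/2)) x - F z x) / of_real (\<delta>/2) - D x)"
    by (metis diff_add_cancel norm_minus_commute norm_triangle_sub add.commute)
   also have "... <= (norm (F (z + of_real (\<delta>/2)) x) / (\<delta>/2) + norm (F z x) / (\<delta>/2)) + norm (complex_of_real (\<delta>/2)) * (C * (exp (- a * x) * norm (w x)))"
   proof (intro add_mono quot h)
    have "norm ((F (z + of_real (\<delta>/2)) x - F z x) / of_real (\<delta>/2)) = norm (F (z + of_real (\<delta>/2)) x - F z x) / (\<delta>/2)"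
     using \<delta> by (simp add: norm_divide del: of_real_divide)
    also have "... <= (norm (F (z + of_real (\<delta>/2)) x) + norm (F z x)) / (\<delta>/2)"
     using \<delta> by (intro divide_right_mono norm_triangle_ineq4) auto
    finally show "norm ((F (z + of_real (\<delta>/2)) x - F z x) / of_real (\<delta>/2)) <= norm (F (z + of_real (\<delta>/2)) x) / (\<delta>/2) + norm (F z x) / (\<delta>/2)"
     by (simp add: add_divide_distrib)
   qed
   finally show "?bd x"
    using \<delta> by (simp del: of_real_divide)
  qed
 qed
 have "((%h. ((LINT x|L. F (z + h) x) - (LINT x|L. F z x)) / h - (LINT x|L. D x)) \<longlongrightarrow> 0) (at 0)"
 proof (rule Lim_null_comparison)
  show "\<forall>\<^sub>F h in at 0. norm (((LINT x|L. F (z + h) x) - (LINT x|L. F z x)) / h - (LINT x|L. D x)) <= norm h * (C * W)"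
   unfolding eventually_at
  proof (intro exI[of _ \<delta>] conjI ballI impI \<delta>)
   fix h :: complex assume "h \<noteq> 0 & dist h 0 < \<delta>"
   then have h: "h \<noteq> 0" "norm h < \<delta>" by auto
   have "Re (z + h) >= a" using abs_Re_le_cmod[of h] h z by (simp add: \<delta>_def)
   note i = Fi[OF this] Fi[of z] Di
   have "((LINT x|L. F (z + h) x) - (LINT x|L. F z x)) / h - (LINT x|L. D x) = (LINT x|L. (F (z + h) x - F z x) / h - D x)"
    using i z by simp
   also have "norm ... <= (LINT x|L. norm ((F (z + h) x - F z x) / h - D x))" by (rule integral_norm_bound)
   also have "... <= (LINT x|L. norm h * (C * (exp (- a * x) * norm (w x))))"
    using i z w_exp by (intro integral_mono quot h) auto
   also have "... = norm h * (C * W)" by (simp add: W_def)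
   finally show "norm (((LINT x|L. F (z + h) x) - (LINT x|L. F z x)) / h - (LINT x|L. D x)) <= norm h * (C * W)" .
  qed
  show "((%h. norm h * (C * W)) \<longlongrightarrow> 0) (at (0::complex))" by (auto intro!: tendsto_eq_intros)
 qed
 then have "((%h. ((LINT x|L. F (z + h) x) - (LINT x|L. F z x)) / h) \<longlongrightarrow> (LINT x|L. D x)) (at 0)"
  by (rule LIM_zero_cancel)
 then have "((%u. lap u $ i $ k) has_field_derivative (LINT x|L. D x)) (at z)"
  unfolding DERIV_def lap_def by (simp add: F_def)
 then show "(%z. lap z $ i $ k) field_differentiable at z within {z. Re z > a}"
  by (meson field_differentiable_at_within field_differentiable_def)
qed

lemma charm_component: "charm z $ i $ k = (if i = k then z else 0) - lap z $ i $ k"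
 by (simp add: charm_def mat_def)

lemma charm_cnj: "charm (cnj z) $ i $ k = cnj (charm z $ i $ k)"
 by (simp add: charm_component lap_cnj)

lemma charm_holomorphic: "(%z. charm z $ i $ k) holomorphic_on {z. Re z > a}"
 unfolding charm_component by (cases "i = k") (auto intro!: holomorphic_intros lap_holomorphic)

lemma det_holomorphic:
 assumes "!!i k. (%z. A z $ i $ k) holomorphic_on S"
 shows "(%z. det (A z :: complex^'n^'n)) holomorphic_on S"
 unfolding det_def by (intro holomorphic_intros assms)

lemma det_charm_holomorphic: "(%z. det (charm z)) holomorphic_on {z. Re z > a}"
 by (rule det_holomorphic charm_holomorphic)+

lemma det_cnj: "(!!i k. A' $ i $ k = cnj (A $ i $ k)) ==> det (A' :: complex^'n^'n) = cnj (det A)"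
 unfolding det_def by (simp add: cnj_sum cnj_prod)

lemma det_charm_cnj: "det (charm (cnj z)) = cnj (det (charm z))"
 by (rule det_cnj) (rule charm_cnj)

lemma matrix_inv_det:
 fixes A :: "complex^'n^'n"
 assumes "det A \<noteq> 0"
 shows "A ** matrix_inv A = mat 1" "matrix_inv A ** A = mat 1"
proof -
 have "invertible A" using assms by (simp add: invertible_det_nz)
 then have "\<exists>A'. A ** A' = mat 1 & A' ** A = mat 1" unfolding invertible_def .
 from someI_ex[OF this] show "A ** matrix_inv A = mat 1" "matrix_inv A ** A = mat 1"
  unfolding matrix_inv_def by blast+
qed

text \<open>Cramer's rule. It exhibits the entries of the inverse as quotients of determinants,
  hence of holomorphic functions if the entries of \<open>A\<close> are holomorphic.\<close>

lemma matrix_inv_component: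
 fixes A :: "complex^'n^'n"
 assumes "det A \<noteq> 0"
 shows "matrix_inv A $ i $ k = det (\<chi> p q. if q = i then (if p = k then 1 else 0) else A $ p $ q) / det A"
proof -
 define x where "x = column k (matrix_inv A)"
 have "A *v x = axis k 1"
 proof -
  have "A *v x = column k (A ** matrix_inv A)"
   by (simp add: x_def column_def matrix_vector_mult_def matrix_matrix_mult_def vec_eq_iff)
  then show ?thesis unfolding matrix_inv_det(1)[OF assms] by (simp add: column_def mat_def axis_def vec_eq_iff)
 qed
 then have "x = (\<chi> i. det (\<chi> p q. if q = i then axis k 1 $ p else A $ p $ q) / det A)"
  using cramer[OF assms] by blast
 then have "x $ i = det (\<chi> p q. if q = i then axis k 1 $ p else A $ p $ q) / det A" by simp
 then show ?thesis by (simp add: x_def column_def axis_def cong: if_cong)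
qed

text \<open>With \<open>G\<close> the inverse, \<open>z G = I + lap z ** G\<close>, where
  \<open>lap\<close> is bounded on the closed half-plane. For large \<open>z\<close> this first
  gives \<open>norm G\<close> of order \<open>1 / norm z\<close>, and inserting that bound into the
  same identity gives the second order.\<close>

lemma inv_charm_decay:
 obtains R0 C where "R0 > 0" "!!z. Re z >= a ==> norm z >= R0 ==> det (charm z) \<noteq> 0"
  "!!z i k. Re z >= a ==> norm z >= R0 ==> norm (matrix_inv (charm z) $ i $ k - (if i = k then 1 else 0) / z) <= C / norm z ^ 2"
proof -
 obtain K where K: "K > 0" "!!(A :: complex^'d^'d) (B :: complex^'d^'d). norm (A ** B) <= norm A * norm B * K"
  using bounded_bilinear.pos_bounded[OF bounded_bilinear_complex_matrix_mult] by blast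
 obtain K' where K': "K' > 0" "!!(A :: complex^'d^'d) (x :: complex^'d). norm (A *v x) <= norm A * norm x * K'"
  using bounded_bilinear.pos_bounded[OF bounded_bilinear_complex_matrix_vector_mult] by blast
 define W1 where "W1 = real CARD('d) ^ 2 * W"
 have W1: "W1 >= 0" using W_nonneg by (simp add: W1_def)
 \<comment> \<open>The summand \<open>W1 * K'\<close> excludes kernel vectors of
   \<open>charm z\<close>; twice \<open>W1 * K\<close> lets the \<open>lap\<close> term be absorbed
   by half of \<open>norm z * norm G\<close>.\<close>
 define R0 where "R0 = 2 * (W1 * K) + W1 * K' + 1"
 have R0: "R0 > 0" using W1 K(1) K'(1) by (simp add: R0_def add_nonneg_pos)
 have lapn: "norm (lap z) <= W1" if "Re z >= a" for z using lap_norm_bound[OF that] by (simp add: W1_def)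
 have det: "det (charm z) \<noteq> 0" if z: "Re z >= a" "norm z >= R0" for z
 proof -
  have "x = 0" if x: "charm z *v x = 0" for x
  proof (rule ccontr)
   assume "x \<noteq> 0"
   have "charm z *v x = mat z *v x - lap z *v x" unfolding charm_def by (rule matrix_vector_mult_diff_rdistrib)
   moreover have "mat z *v x = z *s x" by (simp add: vec_eq_iff matrix_vector_mult_def mat_def if_distrib if_distribR sum.delta' cong: if_cong)
   ultimately have "z *s x = lap z *v x" using x by simp
   moreover have "norm (z *s x) = norm z * norm x"
    unfolding norm_vec_def by (simp add: norm_mult L2_set_right_distrib)
   ultimately have "norm z * norm x <= norm (lap z) * norm x * K'" using K'(2)[of "lap z" x] by simp
   also have "... <= W1 * norm x * K'" using lapn[OF z(1)] K'(1) by (intro mult_right_mono) auto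
   finally have "norm z <= W1 * K'" using \<open>x \<noteq> 0\<close> by (simp add: mult.commute mult.left_commute)
   then show False using z(2) W1 K(1) by (simp add: R0_def) (smt (verit) mult_nonneg_nonneg)
  qed
  then have "\<exists>B. B ** charm z = mat 1" by (simp add: matrix_left_invertible_ker)
  then show ?thesis by (metis invertible_def invertible_det_nz matrix_left_right_inverse)
 qed
 show thesis
 proof (rule that[OF R0 det])
  fix z i k assume z: "Re z >= a" "norm z >= R0"
  define G where "G = matrix_inv (charm z)"
  have z0: "z \<noteq> 0" using z(2) R0 by auto
  have "charm z ** G = mat 1" unfolding G_def by (rule matrix_inv_det(1)[OF det[OF z]])
  then have eq: "mat z ** G = mat 1 + lap z ** G"
   unfolding charm_def by (simp add: vec_eq_iff matrix_matrix_mult_def algebra_simps sum_subtractf)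
  have zG: "(mat z ** G) $ i $ k = z * G $ i $ k" for i k
   by (simp add: matrix_matrix_mult_def mat_def if_distrib if_distribR sum.delta' cong: if_cong)
  have "norm (mat z ** G) = norm z * norm G"
   unfolding norm_vec_def by (simp add: zG norm_mult L2_set_right_distrib)
  then have "norm z * norm G <= norm (mat 1 :: complex^'d^'d) + norm (lap z ** G)"
   using norm_triangle_ineq[of "mat 1" "lap z ** G"] by (simp add: eq)
  also have "norm (lap z ** G) <= norm (lap z) * norm G * K" by (rule K(2))
  also have "norm (lap z) * norm G * K <= W1 * norm G * K"
   using lapn[OF z(1)] K(1) by (intro mult_right_mono) auto
  finally have 1: "norm z * norm G <= norm (mat 1 :: complex^'d^'d) + W1 * K * norm G" by (simp add: mult_ac)
  have "W1 * K <= norm z / 2"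
   using z(2) W1 K'(1) by (simp add: R0_def) (smt (verit) mult_nonneg_nonneg)
  then have "W1 * K * norm G <= norm z / 2 * norm G" by (intro mult_right_mono) auto
  then have "norm z * norm G <= 2 * norm (mat 1 :: complex^'d^'d)" using 1 by linarith
  then have Gb: "norm G <= 2 * norm (mat 1 :: complex^'d^'d) / norm z" using z0 by (simp add: field_simps)
  have "z * G $ i $ k = (if i = k then 1 else 0) + (lap z ** G) $ i $ k"
   using arg_cong[OF eq, of "%A. A $ i $ k"] unfolding zG by (simp add: mat_def)
  then have "G $ i $ k - (if i = k then 1 else 0) / z = (lap z ** G) $ i $ k / z"
   using z0 by (simp add: field_simps)
  then have "norm (G $ i $ k - (if i = k then 1 else 0) / z) = norm ((lap z ** G) $ i $ k) / norm z" by (simp only: norm_divide)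
  also have "... <= (W1 * (2 * norm (mat 1 :: complex^'d^'d) / norm z) * K) / norm z"
  proof (intro divide_right_mono)
   have "norm ((lap z ** G) $ i $ k) <= norm (lap z) * norm G * K"
    using matrix_component_le_norm[of "lap z ** G" i k] K(2)[of "lap z" G] by linarith
   also have "... <= W1 * (2 * norm (mat 1 :: complex^'d^'d) / norm z) * K"
    using lapn[OF z(1)] Gb K(1) W1 by (intro mult_right_mono mult_mono) auto
   finally show "norm ((lap z ** G) $ i $ k) <= W1 * (2 * norm (mat 1 :: complex^'d^'d) / norm z) * K" .
  qed simp
  finally show "norm (matrix_inv (charm z) $ i $ k - (if i = k then 1 else 0) / z) <= (W1 * 2 * norm (mat 1 :: complex^'d^'d) * K) / norm z ^ 2"
   by (simp add: G_def power2_eq_square)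
 qed
qed

end

section \<open>Convolutions and their Laplace transforms\<close>

lemma integrable_const_Icc: "integrable lborel (%s. c * indicator {a..b} s)" for a b c :: real
 by (intro integrable_mult_right integrable_real_indicator)
  (use emeasure_compact_finite[OF compact_Icc[of a b]] in auto)

lemma set_integrable_bounded:
 fixes f :: "real => 'b::{banach, second_countable_topology}"
 assumes "f \<in> borel_measurable borel" "!!s. s \<in> {a..b} ==> norm (f s) <= C"
 shows "set_integrable lborel {a..b} f"
 unfolding set_integrable_def
proof (rule bochner_bound)
 show "integrable lborel (%s. C * indicator {a..b} s)"
  by (rule integrable_const_Icc)
 show "(%s. indicator {a..b} s *\<^sub>R f s) \<in> borel_measurable lborel" using assms(1) by measurable
 show "AE s in lborel. norm (indicator {a..b} s *\<^sub>R f s) <= norm (C * indicator {a..b} s)"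
  using assms(2) by (intro AE_I2) (auto simp: indicator_def intro: order_trans[OF _ abs_ge_self])
qed

lemma set_lborel_reflect:
 fixes f :: "real => 'b::{banach, second_countable_topology}"
 shows "(LBINT s:{u..t}. f (t - s)) = (LBINT s:{0..t-u}. f s)"
proof -
 have "(LBINT s. indicator {u..t} s *\<^sub>R f (t - s)) = (LBINT s. indicator {u..t} (t + - 1 * s) *\<^sub>R f (t - (t + - 1 * s)))"
  using lborel_integral_real_affine[of "- 1" "%s. indicator {u..t} s *\<^sub>R f (t - s)" t] by simp
 also have "... = (LBINT s. indicator {0..t-u} s *\<^sub>R f s)"
  by (intro bochner_cong refl) (auto simp: indicator_def)
 finally show ?thesis by (simp add: set_lebesgue_integral_def)
qed

text \<open>With \<open>*\<close> for convolution this reads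
  \<open>p * (1 * u) = (1 * p) * u\<close>. It is Fubini's theorem on the triangle
  \<open>0 <= s <= \<tau> <= t\<close>.\<close>

lemma conv_assoc:
 fixes p u :: "real => real"
 assumes pm[measurable]: "p \<in> borel_measurable borel" and pb: "!!s. s \<in> {0..t} ==> \<bar>p s\<bar> <= C"
  and u: "set_integrable lborel {0..t} u"
 shows "(LBINT \<tau>:{0..t}. p (t - \<tau>) * (LBINT s:{0..\<tau>}. u s)) = (LBINT s:{0..t}. (LBINT \<tau>:{0..t-s}. p \<tau>) * u s)"
proof -
 define u' where "u' s = indicator {0..t} s * u s" for s
 have u'i: "integrable lborel u'" using u by (simp add: u'_def[abs_def] set_integrable_def)
 have [measurable]: "u' \<in> borel_measurable borel" using borel_measurable_integrable[OF u'i] by simp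
 define F where "F \<tau> s = (if 0 <= \<tau> & \<tau> <= t & 0 <= s & s <= \<tau> then 1 else 0) * p (t - \<tau>) * u' s" for \<tau> s
 have Fi: "integrable (lborel \<Otimes>\<^sub>M lborel) (%(\<tau>, s). F \<tau> s)"
 proof (rule bochner_bound)
  have "has_bochner_integral (lborel \<Otimes>\<^sub>M lborel) (%(\<tau>, s). (\<bar>C\<bar> * indicator {0..t} \<tau>) * \<bar>u' s\<bar>) ((LBINT \<tau>. \<bar>C\<bar> * indicator {0..t} \<tau>) * (LBINT s. \<bar>u' s\<bar>))"
  proof (intro lborel_pair.has_bochner_integral_times)
   have "integrable lborel (%\<tau>. \<bar>C\<bar> * indicator {0..t} \<tau>)"
    by (rule integrable_const_Icc)
   then show "has_bochner_integral lborel (%\<tau>. \<bar>C\<bar> * indicator {0..t} \<tau>) (LBINT \<tau>. \<bar>C\<bar> * indicator {0..t} \<tau>)"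
    by (simp add: has_bochner_integral_iff)
  qed (use u'i in \<open>simp add: has_bochner_integral_iff\<close>)
  then show "integrable (lborel \<Otimes>\<^sub>M lborel) (%(\<tau>, s). (\<bar>C\<bar> * indicator {0..t} \<tau>) * \<bar>u' s\<bar>)" by (simp add: has_bochner_integral_iff)
  show "(%(\<tau>, s). F \<tau> s) \<in> borel_measurable (lborel \<Otimes>\<^sub>M lborel)" unfolding F_def split_beta' by measurable
  show "AE x in lborel \<Otimes>\<^sub>M lborel. norm (case x of (\<tau>, s) => F \<tau> s) <= norm (case x of (\<tau>, s) => (\<bar>C\<bar> * indicator {0..t} \<tau>) * \<bar>u' s\<bar>)" (is "AE x in _. ?bd x")
  proof (intro AE_I2)
   fix x :: "real \<times> real"
   obtain \<tau> s where x: "x = (\<tau>, s)" by force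
   show "?bd x"
   proof (cases "0 <= \<tau> & \<tau> <= t")
    case True
    then have "\<bar>p (t - \<tau>)\<bar> <= \<bar>C\<bar>" using pb[of "t - \<tau>"] by auto
    then show ?thesis using True by (auto simp: x F_def abs_mult intro!: mult_right_mono)
   qed (auto simp: x F_def)
  qed
 qed
 have "(LBINT \<tau>:{0..t}. p (t - \<tau>) * (LBINT s:{0..\<tau>}. u s)) = (LBINT \<tau>. LBINT s. F \<tau> s)"
  unfolding set_lebesgue_integral_def
 proof (intro bochner_cong refl)
  fix \<tau>
  have "indicator {0..t} \<tau> *\<^sub>R (p (t - \<tau>) * (LBINT s. indicator {0..\<tau>} s *\<^sub>R u s)) = (LBINT s. indicator {0..t} \<tau> * p (t - \<tau>) * (indicator {0..\<tau>} s *\<^sub>R u s))"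
   by simp
  also have "... = (LBINT s. F \<tau> s)"
   by (intro bochner_cong refl) (auto simp: F_def u'_def indicator_def)
  finally show "indicator {0..t} \<tau> *\<^sub>R (p (t - \<tau>) * (LBINT s. indicator {0..\<tau>} s *\<^sub>R u s)) = (LBINT s. F \<tau> s)" .
 qed
 also have "... = (LBINT s. LBINT \<tau>. F \<tau> s)" by (rule lborel_pair.Fubini_integral[OF Fi, symmetric])
 also have "... = (LBINT s:{0..t}. (LBINT \<tau>:{0..t-s}. p \<tau>) * u s)"
  unfolding set_lebesgue_integral_def
 proof (intro bochner_cong refl)
  fix s
  have "(LBINT \<tau>. F \<tau> s) = (LBINT \<tau>. (indicator {0..t} s * u s) * (indicator {s..t} \<tau> * p (t - \<tau>)))"
   by (intro bochner_cong refl) (auto simp: F_def u'_def indicator_def)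
  also have "... = (indicator {0..t} s * u s) * (LBINT \<tau>:{s..t}. p (t - \<tau>))" by (simp add: set_lebesgue_integral_def)
  also have "... = indicator {0..t} s *\<^sub>R ((LBINT \<tau>. indicator {0..t-s} \<tau> *\<^sub>R p \<tau>) * u s)"
   unfolding set_lborel_reflect by (simp add: set_lebesgue_integral_def)
  finally show "(LBINT \<tau>. F \<tau> s) = indicator {0..t} s *\<^sub>R ((LBINT \<tau>. indicator {0..t-s} \<tau> *\<^sub>R p \<tau>) * u s)" .
 qed
 finally show ?thesis .
qed

text \<open>Fubini's theorem on \<open>0 <= s <= t\<close>: the inner integral of
  \<open>exp (- l * t)\<close> from \<open>s\<close> on supplies the factor
  \<open>1 / l\<close>.\<close>

lemma laplace_of_integral:
 fixes g :: "real => real"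
 assumes gm[measurable]: "g \<in> borel_measurable borel" and gb: "!!t. t >= 0 ==> \<bar>g t\<bar> <= C * exp (c * t)"
  and l: "l > c" "l > 0"
 shows "(LBINT t:{0..}. exp (- l * t) * (LBINT s:{0..t}. g s)) = (LBINT s:{0..}. exp (- l * s) * g s) / l"
proof -
 have C0: "C >= 0" using gb[of 0] by simp
 \<comment> \<open>An exponent strictly between \<open>max c 0\<close> and \<open>l\<close>
   distributes the decay over both variables: as \<open>s <= t\<close> and \<open>c' > 0\<close>,
   the integrand is dominated by a product of two integrable exponentials.\<close>
 define c' where "c' = (max c 0 + l) / 2"
 have c': "c' > c" "c' > 0" "l > c'" using l by (auto simp: c'_def)
 define F where "F t s = (if 0 <= s & s <= t then 1 else 0) * (exp (- l * t) * g s)" for t s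
 have Fi: "integrable (lborel \<Otimes>\<^sub>M lborel) (%(t, s). F t s)"
 proof (rule bochner_bound)
  have e: "integrable lborel (%t. indicator {0..} t * exp (- d * t))" if "d > 0" for d :: real
   using set_integrable_exp_neg[OF that] by (simp add: set_integrable_def)
  have "has_bochner_integral (lborel \<Otimes>\<^sub>M lborel) (%(t, s). (indicator {0..} t * exp (- (l - c') * t)) * (C * (indicator {0..} s * exp (- (c' - c) * s))))
   ((LBINT t. indicator {0..} t * exp (- (l - c') * t)) * (LBINT s. C * (indicator {0..} s * exp (- (c' - c) * s))))"
   using e[of "l - c'"] e[of "c' - c"] c' by (intro lborel_pair.has_bochner_integral_times) (auto simp: has_bochner_integral_iff)
  then show "integrable (lborel \<Otimes>\<^sub>M lborel) (%(t, s). (indicator {0..} t * exp (- (l - c') * t)) * (C * (indicator {0..} s * exp (- (c' - c) * s))))"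
   by (simp add: has_bochner_integral_iff)
  show "(%(t, s). F t s) \<in> borel_measurable (lborel \<Otimes>\<^sub>M lborel)" unfolding F_def split_beta' by measurable
  show "AE x in lborel \<Otimes>\<^sub>M lborel. norm (case x of (t, s) => F t s) <= norm (case x of (t, s) => (indicator {0..} t * exp (- (l - c') * t)) * (C * (indicator {0..} s * exp (- (c' - c) * s))))" (is "AE x in _. ?bd x")
  proof (intro AE_I2)
   fix x :: "real \<times> real"
   obtain t s where x: "x = (t, s)" by force
   show "?bd x"
   proof (cases "0 <= s & s <= t")
    case True
    have "exp (- l * t) * \<bar>g s\<bar> <= exp (- l * t) * (C * exp (c * s))" using gb[of s] True by (intro mult_left_mono) auto
    also have "... = C * exp (- l * t + c * s)" by (simp only: exp_add mult.left_commute)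
    also have "... <= C * exp (- (l - c') * t + - (c' - c) * s)"
    proof (intro mult_left_mono C0)
     have "c' * s <= c' * t" using True c' by (intro mult_left_mono) auto
     then show "exp (- l * t + c * s) <= exp (- (l - c') * t + - (c' - c) * s)" by (simp add: algebra_simps)
    qed
    finally show ?thesis using True C0 by (simp add: x F_def abs_mult exp_add mult_ac)
   qed (auto simp: x F_def)
  qed
 qed
 have "(LBINT t:{0..}. exp (- l * t) * (LBINT s:{0..t}. g s)) = (LBINT t. LBINT s. F t s)"
  unfolding set_lebesgue_integral_def
 proof (intro bochner_cong refl)
  fix t :: real
  have "indicator {0..} t *\<^sub>R (exp (- l * t) * (LBINT s. indicator {0..t} s *\<^sub>R g s)) = (LBINT s. (indicator {0..} t * exp (- l * t)) * (indicator {0..t} s *\<^sub>R g s))"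
   by simp
  also have "... = (LBINT s. F t s)"
   by (intro bochner_cong refl) (auto simp: F_def indicator_def)
  finally show "indicator {0..} t *\<^sub>R (exp (- l * t) * (LBINT s. indicator {0..t} s *\<^sub>R g s)) = (LBINT s. F t s)" .
 qed
 also have "... = (LBINT s. LBINT t. F t s)" by (rule lborel_pair.Fubini_integral[OF Fi, symmetric])
 also have "... = (LBINT s. (indicator {0..} s *\<^sub>R (exp (- l * s) * g s)) / l)"
 proof (intro bochner_cong refl)
  fix s :: real
  have "set_integrable lborel {s..} (%t. exp (- l * t))" if "s >= 0"
   using set_integrable_exp_neg[OF l(2)] by (rule set_integrable_subset) (use that in auto)
  from set_borel_integral_eq_integral(2)[OF this] have E: "(LBINT t:{s..}. exp (- l * t)) = exp (- l * s) / l" if "s >= 0"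
   using has_integral_exp_minus_to_infinity[OF l(2), of s] that by (simp add: integral_unique)
  have "(LBINT t. F t s) = (LBINT t. (indicator {0..} s * g s) * (indicator {s..} t * exp (- l * t)))"
   by (intro bochner_cong refl) (auto simp: F_def indicator_def)
  also have "... = (indicator {0..} s * g s) * (LBINT t:{s..}. exp (- l * t))" by (simp add: set_lebesgue_integral_def)
  also have "... = (indicator {0..} s *\<^sub>R (exp (- l * s) * g s)) / l" using E by (cases "s >= 0") auto
  finally show "(LBINT t. F t s) = (indicator {0..} s *\<^sub>R (exp (- l * s) * g s)) / l" .
 qed
 finally show ?thesis by (simp add: set_lebesgue_integral_def)
qed

lemma continuous_indefinite_integral:
 fixes g :: "real => real"
 assumes g: "!!t. set_integrable lborel {0..t} g"
 shows "continuous_on {0..} (%t. LBINT s:{0..t}. g s)"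
proof (clarsimp simp: continuous_on_eq_continuous_within)
 fix t :: real assume t: "0 <= t"
 have eq: "(LBINT s:{0..x}. g s) = integral {0..x} g" for x
  by (rule set_borel_integral_eq_integral(2)[OF g])
 have "continuous_on {0..t+1} (%x. integral {0..x} g)"
  by (rule indefinite_integral_continuous_1) (rule set_borel_integral_eq_integral(1)[OF g])
 then have "continuous (at t within {0..t+1}) (%x. LBINT s:{0..x}. g s)"
  using t unfolding eq by (simp add: continuous_on_eq_continuous_within)
 moreover have "at t within {0..t+1} = at t within {0..}"
  by (rule at_within_nhd[of t "{..<t+1}"]) (use t in auto)
 ultimately show "continuous (at t within {0..}) (%x. LBINT s:{0..x}. g s)" by simp
qed

context delay_kernel
begin

lemma pair_L: "pair_sigma_finite lborel L"
 by (intro pair_sigma_finite.intro sigma_finite_lborel sigma_finite_measure_axioms)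

lemma lborel_L_measurable: "borel_measurable (lborel \<Otimes>\<^sub>M L) = borel_measurable (borel \<Otimes>\<^sub>M borel)"
 by (rule measurable_cong_sets) (auto intro!: sets_pair_measure_cong simp: sets_L)

text \<open>Convolution of the entry \<open>(j, k)\<close> of the kernel with a scalar function over
  \<open>[0, t]\<close>: the cut-off keeps values of \<open>f\<close> at negative times out, and
  \<open>w\<close> vanishes at negative arguments.\<close>

definition kconv :: "(real => real) => 'd => 'd => real => real" where
 "kconv f j k t = (LINT x|L. indicator {..t} x * (f (t - x) * w x $ j $ k))"

lemma kconv_measurable:
 assumes [measurable]: "f \<in> borel_measurable borel"
 shows "kconv f j k \<in> borel_measurable borel"
proof -
 have "(%(t, x). (if x <= t then 1 else 0) * (f (t - x) * w x $ j $ k)) \<in> borel_measurable (borel \<Otimes>\<^sub>M borel)"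
  by measurable
 then have "(%(t, x). indicator {..t} x * (f (t - x) * w x $ j $ k)) \<in> borel_measurable (borel \<Otimes>\<^sub>M L)"
 proof -
  assume *: "(%(t, x). (if x <= t then 1 else 0) * (f (t - x) * w x $ j $ k)) \<in> borel_measurable (borel \<Otimes>\<^sub>M borel)"
  have "borel_measurable (borel \<Otimes>\<^sub>M L) = (borel_measurable (borel \<Otimes>\<^sub>M borel) :: (real \<times> real => real) set)"
   by (rule measurable_cong_sets) (auto intro!: sets_pair_measure_cong simp: sets_L)
  moreover have "(%(t, x). indicator {..t} x * (f (t - x) * w x $ j $ k)) = (%(t, x). (if x <= t then 1 else 0) * (f (t - x) * w x $ j $ k))"
   by (auto simp: indicator_def fun_eq_iff)
  ultimately show ?thesis using * by simp
 qed
 from borel_measurable_lebesgue_integral[OF this] show ?thesis by (simp add: kconv_def[abs_def])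
qed

lemma kconv_bound:
 assumes fm[measurable]: "f \<in> borel_measurable borel" and fb: "!!s. 0 <= s ==> s <= t ==> \<bar>f s\<bar> <= C * exp (c * s)" and c: "c >= a"
 shows "integrable L (%x. indicator {..t} x * (f (t - x) * w x $ j $ k))" "\<bar>kconv f j k t\<bar> <= \<bar>C\<bar> * exp (c * t) * W"
proof -
 have le: "norm (indicator {..t} x * (f (t - x) * w x $ j $ k)) <= (\<bar>C\<bar> * exp (c * t)) * (exp (- a * x) * norm (w x))" for x
 proof (cases "0 <= x & x <= t")
  case True
  have "\<bar>f (t - x)\<bar> <= \<bar>C\<bar> * exp (c * (t - x))"
   using fb[of "t - x"] True by (smt (verit) exp_gt_zero mult_right_mono abs_ge_self)
  also have "... = \<bar>C\<bar> * (exp (c * t) * exp (- c * x))" by (simp add: algebra_simps flip: exp_add)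
  also have "... <= \<bar>C\<bar> * (exp (c * t) * exp (- a * x))" using True c by (intro mult_left_mono) (auto simp: mult_right_mono)
  finally have "\<bar>f (t - x)\<bar> * \<bar>w x $ j $ k\<bar> <= (\<bar>C\<bar> * (exp (c * t) * exp (- a * x))) * norm (w x)"
   using matrix_component_le_norm[of "w x" j k] by (intro mult_mono) auto
  then show ?thesis using True by (simp add: abs_mult mult_ac)
 qed (auto simp: w_neg indicator_def)
 have i: "integrable L (%x. (\<bar>C\<bar> * exp (c * t)) * (exp (- a * x) * norm (w x)))" using w_exp by simp
 show int: "integrable L (%x. indicator {..t} x * (f (t - x) * w x $ j $ k))"
 proof (rule bochner_bound[OF i])
  show "(%x. indicator {..t} x * (f (t - x) * w x $ j $ k)) \<in> borel_measurable L" unfolding borel_L by measurable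
  show "AE x in L. norm (indicator {..t} x * (f (t - x) * w x $ j $ k)) <= norm ((\<bar>C\<bar> * exp (c * t)) * (exp (- a * x) * norm (w x)))"
   using order_trans[OF le abs_ge_self] by (intro AE_I2) simp
 qed
 have "\<bar>kconv f j k t\<bar> <= (LINT x|L. norm (indicator {..t} x * (f (t - x) * w x $ j $ k)))"
  unfolding kconv_def real_norm_def[symmetric] by (rule integral_norm_bound)
 also have "... <= (LINT x|L. (\<bar>C\<bar> * exp (c * t)) * (exp (- a * x) * norm (w x)))"
  by (rule integral_mono) (use int i le in auto)
 also have "... = \<bar>C\<bar> * exp (c * t) * W" by (simp add: W_def)
 finally show "\<bar>kconv f j k t\<bar> <= \<bar>C\<bar> * exp (c * t) * W" .
qed

definition lapR :: "real => 'd => 'd => real" where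
 "lapR l j k = (LINT x|L. exp (- l * x) * w x $ j $ k)"

lemma lap_of_real:
 "lap (of_real l) $ j $ k = of_real (lapR l j k)"
 unfolding lap_def lapR_def integral_complex_of_real[symmetric] by (simp flip: exp_of_real)

text \<open>The convolution theorem, by Fubini and the shift of \<open>t\<close> by
  \<open>x\<close>. The growth rate satisfies \<open>c >= a\<close> so that the exponential moment
  of the kernel dominates.\<close>

lemma laplace_kconv:
 assumes fm[measurable]: "f \<in> borel_measurable borel" and fb: "!!s. 0 <= s ==> \<bar>f s\<bar> <= C * exp (c * s)" and c: "c >= a" and l: "l > c"
 shows "(LBINT t:{0..}. exp (- l * t) * kconv f j k t) = (LBINT t:{0..}. exp (- l * t) * f t) * lapR l j k"
proof -
 interpret P: pair_sigma_finite lborel L by (rule pair_L)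
 have C0: "C >= 0" using fb[of 0] by simp
 define F where "F t x = (if 0 <= x & x <= t then 1 else 0) * (exp (- l * t) * (f (t - x) * w x $ j $ k))" for t x
 have Fi: "integrable (lborel \<Otimes>\<^sub>M L) (%(t, x). F t x)"
 proof (rule bochner_bound)
  have e: "integrable lborel (%t. indicator {0..} t * exp (- (l - c) * t))"
   using set_integrable_exp_neg[of "l - c"] l by (simp add: set_integrable_def)
  have "has_bochner_integral (lborel \<Otimes>\<^sub>M L) (%(t, x). (indicator {0..} t * exp (- (l - c) * t)) * (C * (exp (- a * x) * norm (w x))))
   ((LBINT t. indicator {0..} t * exp (- (l - c) * t)) * (LINT x|L. C * (exp (- a * x) * norm (w x))))"
   using e w_exp by (intro P.has_bochner_integral_times) (auto simp: has_bochner_integral_iff)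
  then show "integrable (lborel \<Otimes>\<^sub>M L) (%(t, x). (indicator {0..} t * exp (- (l - c) * t)) * (C * (exp (- a * x) * norm (w x))))"
   by (simp add: has_bochner_integral_iff)
  show "(%(t, x). F t x) \<in> borel_measurable (lborel \<Otimes>\<^sub>M L)" unfolding lborel_L_measurable F_def split_beta' by measurable
  show "AE y in lborel \<Otimes>\<^sub>M L. norm (case y of (t, x) => F t x) <= norm (case y of (t, x) => (indicator {0..} t * exp (- (l - c) * t)) * (C * (exp (- a * x) * norm (w x))))" (is "AE y in _. ?bd y")
  proof (intro AE_I2)
   fix y :: "real \<times> real"
   obtain t x where y: "y = (t, x)" by force
   show "?bd y"
   proof (cases "0 <= x & x <= t")
    case True
    have "\<bar>f (t - x)\<bar> <= C * exp (c * (t - x))" using fb[of "t - x"] True by simp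
    also have "... = C * (exp (c * t) * exp (- c * x))" by (simp add: algebra_simps flip: exp_add)
    also have "... <= C * (exp (c * t) * exp (- a * x))" using True c C0 by (intro mult_left_mono) (auto simp: mult_right_mono)
    finally have "\<bar>f (t - x)\<bar> * \<bar>w x $ j $ k\<bar> <= (C * (exp (c * t) * exp (- a * x))) * norm (w x)"
     using matrix_component_le_norm[of "w x" j k] C0 by (intro mult_mono) auto
    then have "exp (- l * t) * (\<bar>f (t - x)\<bar> * \<bar>w x $ j $ k\<bar>) <= exp (- l * t) * ((C * (exp (c * t) * exp (- a * x))) * norm (w x))"
     by (intro mult_left_mono) auto
    also have "... = exp (- (l - c) * t) * (C * (exp (- a * x) * norm (w x)))" by (simp add: algebra_simps exp_diff exp_minus field_simps)
    finally show ?thesis using True C0 by (simp add: y F_def abs_mult mult_ac)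
   qed (auto simp: y F_def)
  qed
 qed
 have "(LBINT t:{0..}. exp (- l * t) * kconv f j k t) = (LBINT t. LINT x|L. F t x)"
  unfolding set_lebesgue_integral_def
 proof (intro bochner_cong refl)
  fix t :: real
  have "indicator {0..} t *\<^sub>R (exp (- l * t) * kconv f j k t) = (LINT x|L. (indicator {0..} t * exp (- l * t)) * (indicator {..t} x * (f (t - x) * w x $ j $ k)))"
   by (simp add: kconv_def)
  also have "... = (LINT x|L. F t x)"
   by (intro bochner_cong refl) (auto simp: F_def indicator_def w_neg not_le)
  finally show "indicator {0..} t *\<^sub>R (exp (- l * t) * kconv f j k t) = (LINT x|L. F t x)" .
 qed
 also have "... = (LINT x|L. LINT t|lborel. F t x)" by (rule P.Fubini_integral[OF Fi, symmetric])
 also have "... = (LINT x|L. (LBINT t:{0..}. exp (- l * t) * f t) * (exp (- l * x) * w x $ j $ k))"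
 proof (intro bochner_cong refl)
  fix x :: real
  show "(LBINT t. F t x) = (LBINT t:{0..}. exp (- l * t) * f t) * (exp (- l * x) * w x $ j $ k)"
  proof (cases "x < 0")
   case False
   have "(LBINT t. F t x) = (LBINT t. F (x + 1 * t) x)"
    using lborel_integral_real_affine[of 1 "%t. F t x" x] by simp
   also have "... = (LBINT t. (indicator {0..} t *\<^sub>R (exp (- l * t) * f t)) * (exp (- l * x) * w x $ j $ k))"
    using False by (intro bochner_cong refl) (auto simp: F_def indicator_def algebra_simps exp_diff exp_minus field_simps)
   finally show ?thesis by (simp add: set_lebesgue_integral_def)
  qed (simp add: F_def w_neg)
 qed
 finally show ?thesis by (simp add: lapR_def)
qed

text \<open>The scalar kernel may be moved from one factor of a convolution to the other.
  \<open>F\<close> is the integrand on the left, and shifting \<open>s\<close> by \<open>x\<close>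
  turns it into \<open>G\<close>, the integrand on the right.\<close>

lemma kconv_swap:
 assumes fm[measurable]: "f \<in> borel_measurable borel" and fb: "!!s. 0 <= s ==> s <= t ==> \<bar>f s\<bar> <= C"
  and Xm[measurable]: "X \<in> borel_measurable borel" and Xb: "!!s. 0 <= s ==> s <= t ==> \<bar>X s\<bar> <= D"
 shows "(LBINT s:{0..t}. f (t - s) * kconv X j k s) = (LBINT s:{0..t}. kconv f j k (t - s) * X s)"
proof -
 interpret P: pair_sigma_finite lborel L by (rule pair_L)
 define F where "F s x = (if 0 <= x & x <= s & s <= t then 1 else 0) * (f (t - s) * (X (s - x) * w x $ j $ k))" for s x
 define G where "G s x = (if 0 <= x & 0 <= s & s + x <= t then 1 else 0) * (f (t - s - x) * (X s * w x $ j $ k))" for s x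
 have dom: "integrable (lborel \<Otimes>\<^sub>M L) (%(s, x). (\<bar>C\<bar> * \<bar>D\<bar> * indicator {0..t} s) * norm (w x))"
 proof -
  have "integrable lborel (%s. \<bar>C\<bar> * \<bar>D\<bar> * indicator {0..t} s)"
   by (rule integrable_const_Icc)
  then have "has_bochner_integral (lborel \<Otimes>\<^sub>M L) (%(s, x). (\<bar>C\<bar> * \<bar>D\<bar> * indicator {0..t} s) * norm (w x)) ((LBINT s. \<bar>C\<bar> * \<bar>D\<bar> * indicator {0..t} s) * (LINT x|L. norm (w x)))"
   using w_int by (intro P.has_bochner_integral_times) (auto simp: has_bochner_integral_iff)
  then show ?thesis by (simp add: has_bochner_integral_iff)
 qed
 have ptw: "\<bar>f p * (X q * w x $ j $ k)\<bar> <= \<bar>C\<bar> * \<bar>D\<bar> * norm (w x)" if "0 <= p" "p <= t" "0 <= q" "q <= t" for p q x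
 proof -
  have "\<bar>f p\<bar> * (\<bar>X q\<bar> * \<bar>w x $ j $ k\<bar>) <= \<bar>C\<bar> * (\<bar>D\<bar> * norm (w x))"
   using fb[of p] Xb[of q] that matrix_component_le_norm[of "w x" j k] by (intro mult_mono) auto
  then show ?thesis by (simp add: abs_mult mult_ac)
 qed
 have Fi: "integrable (lborel \<Otimes>\<^sub>M L) (%(s, x). F s x)"
 proof (rule bochner_bound[OF dom])
  show "(%(t, x). F t x) \<in> borel_measurable (lborel \<Otimes>\<^sub>M L)" unfolding lborel_L_measurable F_def split_beta' by measurable
  show "AE y in lborel \<Otimes>\<^sub>M L. norm (case y of (s, x) => F s x) <= norm (case y of (s, x) => (\<bar>C\<bar> * \<bar>D\<bar> * indicator {0..t} s) * norm (w x))"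
   using ptw by (intro AE_I2) (auto simp: F_def)
 qed
 have Gi: "integrable (lborel \<Otimes>\<^sub>M L) (%(s, x). G s x)"
 proof (rule bochner_bound[OF dom])
  show "(%(t, x). G t x) \<in> borel_measurable (lborel \<Otimes>\<^sub>M L)" unfolding lborel_L_measurable G_def split_beta' by measurable
  show "AE y in lborel \<Otimes>\<^sub>M L. norm (case y of (s, x) => G s x) <= norm (case y of (s, x) => (\<bar>C\<bar> * \<bar>D\<bar> * indicator {0..t} s) * norm (w x))"
   using ptw by (intro AE_I2) (auto simp: G_def)
 qed
 have "(LBINT s:{0..t}. f (t - s) * kconv X j k s) = (LBINT s. LINT x|L. F s x)"
  unfolding set_lebesgue_integral_def
 proof (intro bochner_cong refl)
  fix s :: real
  have "indicator {0..t} s *\<^sub>R (f (t - s) * kconv X j k s) = (LINT x|L. (indicator {0..t} s * f (t - s)) * (indicator {..s} x * (X (s - x) * w x $ j $ k)))"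
   by (simp add: kconv_def)
  also have "... = (LINT x|L. F s x)"
   by (intro bochner_cong refl) (auto simp: F_def indicator_def w_neg not_le)
  finally show "indicator {0..t} s *\<^sub>R (f (t - s) * kconv X j k s) = (LINT x|L. F s x)" .
 qed
 also have "... = (LINT x|L. LINT s|lborel. F s x)" by (rule P.Fubini_integral[OF Fi, symmetric])
 also have "... = (LINT x|L. LINT s|lborel. G s x)"
 proof (rule bochner_cong[OF refl])
  fix x :: real
  have "(LBINT s. F s x) = (LBINT s. F (x + 1 * s) x)"
   using lborel_integral_real_affine[of 1 "%s. F s x" x] by simp
  also have "... = (LBINT s. G s x)"
   by (intro bochner_cong refl) (auto simp: F_def G_def algebra_simps)
  finally show "(LBINT s. F s x) = (LBINT s. G s x)" .
 qed
 also have "... = (LBINT s. LINT x|L. G s x)" by (rule P.Fubini_integral[OF Gi])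
 also have "... = (LBINT s:{0..t}. kconv f j k (t - s) * X s)"
  unfolding set_lebesgue_integral_def
 proof (intro bochner_cong refl)
  fix s :: real
  have "indicator {0..t} s *\<^sub>R (kconv f j k (t - s) * X s) = (LINT x|L. (indicator {0..t} s * X s) * (indicator {..t-s} x * (f (t - s - x) * w x $ j $ k)))"
   by (simp add: kconv_def mult_ac)
  also have "... = (LINT x|L. G s x)"
   by (intro bochner_cong refl) (auto simp: G_def indicator_def w_neg not_le)
  finally show "(LINT x|L. G s x) = indicator {0..t} s *\<^sub>R (kconv f j k (t - s) * X s)" by simp
 qed
 finally show ?thesis .
qed

end

section \<open>A stochastic Fubini theorem\<close>

lemma continuous_on_Icc_bounded:
 fixes h :: "real => 'b::real_normed_vector"
 assumes "continuous_on {0..t} h"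
 shows "\<exists>C. \<forall>s. 0 <= s \<longrightarrow> s <= t \<longrightarrow> norm (h s) <= C"
 using compact_imp_bounded[OF compact_continuous_image[OF assms compact_Icc]] unfolding bounded_iff by fastforce

lemma borel_measurable_matrix_vector_mult:
 fixes A :: "'a => real^'n^'m" and x :: "'a => real^'n"
 assumes "A \<in> borel_measurable M" "x \<in> borel_measurable M"
 shows "(%s. A s *v x s) \<in> borel_measurable M"
 by (rule borel_measurable_continuous_Pair[OF assms])
  (intro bounded_bilinear.continuous_on[OF bounded_bilinear_matrix_vector_mult] continuous_intros)

lemma scaled_matrix_mult:
 fixes A :: "real^'n^'m"
 shows "(c *\<^sub>R A) *v x = c *\<^sub>R (A *v x)" "(c *\<^sub>R A) ** Y = c *\<^sub>R (A ** Y)"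
  "A *v (c *\<^sub>R x) = c *\<^sub>R (A *v x)" "A ** (c *\<^sub>R Y) = c *\<^sub>R (A ** Y)"
 using bounded_bilinear.scaleR_left[OF bounded_bilinear_matrix_vector_mult]
  bounded_bilinear.scaleR_left[OF bounded_bilinear_matrix_mult]
  bounded_bilinear.scaleR_right[OF bounded_bilinear_matrix_vector_mult]
  bounded_bilinear.scaleR_right[OF bounded_bilinear_matrix_mult] by blast+

text \<open>The index of the cell is the integer part of \<open>s * (n + 1) / t\<close>.\<close>

lemma equidistant_cell:
 fixes s t :: real
 assumes "0 <= s" "s < t"
 obtains m where "m < Suc n" "!!j. t * real j / real (Suc n) <= s & s < t * real (Suc j) / real (Suc n) \<longleftrightarrow> j = m"
proof
 define y where "y = s * real (Suc n) / t"
 have "s * real (Suc n) < t * real (Suc n)" using assms by (intro mult_strict_right_mono) auto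
 then have y: "0 <= y" "y < real (Suc n)"
  using assms by (simp_all only: y_def pos_divide_less_eq mult.commute[of t]) auto
 show "nat \<lfloor>y\<rfloor> < Suc n" using y by linarith
 fix j
 have "t * real j / real (Suc n) <= s \<longleftrightarrow> real j <= y" "s < t * real (Suc j) / real (Suc n) \<longleftrightarrow> y < real (Suc j)"
  using assms by (simp_all add: y_def field_simps)
 then show "t * real j / real (Suc n) <= s & s < t * real (Suc j) / real (Suc n) \<longleftrightarrow> j = nat \<lfloor>y\<rfloor>"
  using y(1) by (simp only:) linarith
qed

context brownian
begin

text \<open>
 Riemann sums \<open>S n\<close> of the left-hand side, taken with respect to \<open>\<rho> (t - s) ds\<close>, are linear in
 values of \<open>Y\<close>, hence Ito integrals. They converge to the left-hand side along every continuous
 path and to the right-hand side in mean square.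
\<close>

lemma stochastic_fubini:
 fixes \<Sigma> :: "real => real^'e^'d" and \<rho> k :: "real => real^'d^'d" and Y :: "real => 'a => real^'d"
 assumes t: "t >= 0" and \<Sigma>c: "continuous_on {0..t} \<Sigma>"
  and \<rho>m: "\<rho> \<in> borel_measurable borel" and \<rho>b: "!!s. norm (\<rho> s) <= C"
  and Yc: "AE r in M. continuous_on {0..t} (%s. Y s r)"
  and Yito: "!!s. 0 <= s ==> s <= t ==> AE r in M. Y s r = ito_integral M \<F> B (%u r. indicator {0..s} u *\<^sub>R \<Sigma> u) r"
  and k: "!!u. 0 <= u ==> u <= t ==> k u = mat 1 + (LBINT s:{u..t}. \<rho> (t - s))"
  and kc: "continuous_on {0..t} k"
 shows "AE r in M. Y t r + (LBINT s:{0..t}. \<rho> (t - s) *v Y s r) = ito_integral M \<F> B (%u r. indicator {0..t} u *\<^sub>R (k u ** \<Sigma> u)) r"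
proof -
 obtain KV where KV: "KV > 0" "!!(A :: real^'d^'d) (x :: real^'d). norm (A *v x) <= norm A * norm x * KV"
  using bounded_bilinear.pos_bounded[OF bounded_bilinear_matrix_vector_mult] by blast
 obtain KM where KM: "KM > 0" "!!(A :: real^'d^'d) (Y :: real^'e^'d). norm (A ** Y) <= norm A * norm Y * KM"
  using bounded_bilinear.pos_bounded[OF bounded_bilinear_matrix_mult] by blast
 have C0: "C >= 0" using order_trans[OF norm_ge_zero \<rho>b] .
 have \<rho>m'[measurable]: "(%s. \<rho> (t - s)) \<in> borel_measurable borel" using \<rho>m by measurable
 have \<rho>i: "integrable lborel (%s. c s *\<^sub>R \<rho> (t - s))"
  if [measurable]: "c \<in> borel_measurable borel" and "!!s. \<bar>c s\<bar> <= indicator {x..y} s" for c and x y :: real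
  using that(2) by (intro bochner_bound[OF integrable_const_Icc[of C x y]] AE_I2)
   (auto simp: C0 mult.commute[of C] intro!: mult_mono \<rho>b)
 define p where "p n j = t * real j / real (Suc n)" for n j
 have p: "0 <= p n j" for n j using t by (simp add: p_def)
 have pt: "p n (Suc j) <= t" if "j < Suc n" for n j
 proof -
  have "t * real (Suc j) <= t * real (Suc n)" using that t by (intro mult_left_mono) auto
  then show ?thesis by (simp add: p_def field_simps)
 qed
 have pS: "p n (Suc j) = p n j + t / real (Suc n)" for n j by (simp add: p_def distrib_left add_divide_distrib)
 define e where "e n j s = (indicator {p n j..<p n (Suc j)} s :: real)" for n j s
 have [measurable]: "e n j \<in> borel_measurable borel" for n j unfolding e_def[abs_def] by measurable
 have cell: "\<exists>m<Suc n. (\<forall>j. e n j s = (if j = m then 1 else 0)) & p n m <= s & s < p n (Suc m)" if s: "0 <= s" "s < t" for n s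
 proof -
  obtain m where m: "m < Suc n" "!!j. p n j <= s & s < p n (Suc j) \<longleftrightarrow> j = m"
   unfolding p_def by (rule equidistant_cell[OF s]) blast
  have "e n j s = (if p n j <= s & s < p n (Suc j) then 1 else 0)" for j by (simp add: e_def)
  then show ?thesis unfolding m(2) using m by blast
 qed
 have e0: "e n j s = 0" if "\<not> (0 <= s & s < t)" "j < Suc n" for n j s
  using p[of n j] pt[OF that(2)] that(1) by (auto simp: e_def)
 have eb: "\<bar>e n j s\<bar> <= indicator {0..t} s" if "j < Suc n" for n j s
  using e0[OF _ that, of s] by (cases "0 <= s & s < t") (auto simp: e_def indicator_def)
 \<comment> \<open>\<open>a n j\<close> is the mass that \<open>\<rho> (t - s) ds\<close> gives to
   the cell \<open>j\<close>; it weights the value of \<open>Y\<close> at the right end of that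
   cell.\<close>
 define a where "a n j = (LBINT s. e n j s *\<^sub>R \<rho> (t - s))" for n j
 define I where "I s = ito_integral M \<F> B (%u r. indicator {0..s} u *\<^sub>R \<Sigma> u)" for s
 define J where "J = ito_integral M \<F> B (%u r. indicator {0..t} u *\<^sub>R (k u ** \<Sigma> u))"
 have I: "has_ito_integral M \<F> B (%u r. indicator {0..s} u *\<^sub>R \<Sigma> u) (I s)" if "0 <= s" "s <= t" for s
  unfolding I_def using that by (intro ito_integral_truncated continuous_on_subset[OF \<Sigma>c]) auto
 have J: "has_ito_integral M \<F> B (%u r. indicator {0..t} u *\<^sub>R (k u ** \<Sigma> u)) J"
  unfolding J_def by (intro ito_integral_truncated t bounded_bilinear.continuous_on[OF bounded_bilinear_matrix_mult] kc \<Sigma>c)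
 define S where "S n r = (\<Sum>j<Suc n. a n j *v I (p n (Suc j)) r) + I t r" for n r
 have pathwise: "AE r in M. (%n. S n r) \<longlonglongrightarrow> Y t r + (LBINT s:{0..t}. \<rho> (t - s) *v Y s r)"
 proof -
  \<comment> \<open>Each identification of \<open>Y s\<close> with an Ito integral holds only up to
    a null set that depends on \<open>s\<close>; the partition points of all \<open>n\<close>
    together are countably many.\<close>
  have "AE r in M. \<forall>n. \<forall>j\<in>{..<Suc n}. Y (p n (Suc j)) r = I (p n (Suc j)) r"
   unfolding I_def using p pt by (intro AE_all_countable[THEN iffD2] allI AE_finite_allI Yito) auto
  moreover have "AE r in M. Y t r = I t r" unfolding I_def by (rule Yito[OF t order_refl])
  ultimately show ?thesis using Yc
  proof eventually_elim
   case (elim r)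
   define y where "y s = Y s r" for s
   have yc: "continuous_on {0..t} y" using elim(3) by (simp add: y_def[abs_def])
   then obtain Cy where Cy: "!!s. 0 <= s ==> s <= t ==> norm (y s) <= Cy" using continuous_on_Icc_bounded by blast
   define z where "z n s = (\<Sum>j<Suc n. e n j s *\<^sub>R y (p n (Suc j)))" for n s
   have zm[measurable]: "z n \<in> borel_measurable borel" for n unfolding z_def[abs_def] by measurable
   have ym: "(%s. indicator {0..t} s *\<^sub>R y s) \<in> borel_measurable borel"
    by (rule borel_measurable_continuous_on_indicator[OF _ yc]) simp
   have zc: "\<exists>x. z n s = y x & 0 <= x & x <= t & \<bar>x - s\<bar> <= t / real (Suc n)" if s: "0 <= s" "s < t" for n s
   proof -
    obtain m where m: "m < Suc n" "!!j. e n j s = (if j = m then 1 else 0)" "p n m <= s" "s < p n (Suc m)"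
     using cell[OF s] by blast
    have "z n s = (\<Sum>j<Suc n. if j = m then y (p n (Suc j)) else 0)" unfolding z_def m(2) by (intro sum.cong) auto
    then have "z n s = y (p n (Suc m))" using m(1) by simp
    then show ?thesis using p pt[OF m(1)] m(3,4) pS[of n m] by (intro exI[of _ "p n (Suc m)"]) auto
   qed
   have z0: "z n s = 0" if "\<not> (0 <= s & s < t)" for n s unfolding z_def using e0[OF that] by (intro sum.neutral) auto
   have sum: "(\<Sum>j<Suc n. a n j *v y (p n (Suc j))) = (LBINT s. \<rho> (t - s) *v z n s)" for n
   proof -
    have b: "bounded_linear (%A :: real^'d^'d. A *v x)" for x
     by (rule bounded_bilinear.bounded_linear_left[OF bounded_bilinear_matrix_vector_mult])
    have ei: "integrable lborel (%s. e n j s *\<^sub>R \<rho> (t - s))" if "j < Suc n" for j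
     by (rule \<rho>i[OF _ eb[OF that]]) measurable
    have "(LBINT s. \<rho> (t - s) *v z n s) = (LBINT s. (\<Sum>j<Suc n. (e n j s *\<^sub>R \<rho> (t - s)) *v y (p n (Suc j))))"
     unfolding z_def bounded_bilinear.sum_right[OF bounded_bilinear_matrix_vector_mult] scaled_matrix_mult ..
    also have "... = (\<Sum>j<Suc n. LBINT s. (e n j s *\<^sub>R \<rho> (t - s)) *v y (p n (Suc j)))"
     by (intro bochner_sum integrable_bounded_linear[OF b] ei) auto
    also have "... = (\<Sum>j<Suc n. a n j *v y (p n (Suc j)))"
     unfolding a_def by (intro sum.cong refl integral_bounded_linear[OF b] ei) auto
    finally show ?thesis by simp
   qed
   have "(%n. LBINT s. \<rho> (t - s) *v z n s) \<longlonglongrightarrow> (LBINT s. \<rho> (t - s) *v (indicator {0..t} s *\<^sub>R y s))"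
   proof (rule integral_dominated_convergence[where w="%s. (C * Cy * KV) * indicator {0..t} s"])
    show "(%s. \<rho> (t - s) *v (indicator {0..t} s *\<^sub>R y s)) \<in> borel_measurable lborel" "(%s. \<rho> (t - s) *v z n s) \<in> borel_measurable lborel" for n
     using borel_measurable_matrix_vector_mult[OF \<rho>m' ym] borel_measurable_matrix_vector_mult[OF \<rho>m' zm[of n]] by simp_all
    show "AE s in lborel. (%n. \<rho> (t - s) *v z n s) \<longlonglongrightarrow> \<rho> (t - s) *v (indicator {0..t} s *\<^sub>R y s)"
     using AE_lborel_singleton[of t]
    proof eventually_elim
     case (elim s)
     have "(%n. z n s) \<longlonglongrightarrow> indicator {0..t} s *\<^sub>R y s"
     proof (cases "0 <= s & s < t")
      case True
      then obtain x where x: "!!n. z n s = y (x n)" "!!n. 0 <= x n & x n <= t" "!!n. \<bar>x n - s\<bar> <= t / real (Suc n)"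
       using zc[of s] by metis
      have "(%n. x n - s) \<longlonglongrightarrow> 0"
       by (rule Lim_null_comparison[OF always_eventually[OF allI[OF x(3)[folded real_norm_def]]] LIMSEQ_Suc[OF lim_const_over_n]])
      then have "x \<longlonglongrightarrow> s" by (simp add: LIM_zero_iff)
      then have "(%n. y (x n)) \<longlonglongrightarrow> y s" using x(2) True by (intro continuous_on_tendsto_compose[OF yc]) auto
      then show ?thesis using True by (simp add: x(1))
     qed (use elim z0 in \<open>auto simp: indicator_def\<close>)
     then show ?case by (intro bounded_bilinear.tendsto[OF bounded_bilinear_matrix_vector_mult] tendsto_const)
    qed
    fix n
    show "AE s in lborel. norm (\<rho> (t - s) *v z n s) <= (C * Cy * KV) * indicator {0..t} s" (is "AE s in _. ?bd s")
    proof (intro AE_I2)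
     fix s
     show "?bd s"
     proof (cases "0 <= s & s < t")
      case True
      then have "norm (z n s) <= Cy" using zc[of s n] Cy by auto
      then have "norm (\<rho> (t - s)) * norm (z n s) * KV <= C * Cy * KV" using \<rho>b KV(1) C0 by (intro mult_right_mono mult_mono) auto
      then show ?thesis using KV(2)[of "\<rho> (t - s)" "z n s"] True by simp
     next
      case False
      then show ?thesis using z0[OF False] order_trans[OF norm_ge_zero Cy[of 0]] t C0 KV(1) by simp
     qed
    qed
   qed (rule integrable_const_Icc)
   then have "(%n. (\<Sum>j<Suc n. a n j *v y (p n (Suc j))) + y t) \<longlonglongrightarrow> (LBINT s:{0..t}. \<rho> (t - s) *v y s) + y t"
    unfolding sum set_lebesgue_integral_def by (intro tendsto_intros) (simp add: scaled_matrix_mult)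
   then show ?case using elim(1,2) by (simp add: S_def y_def add.commute)
  qed
 qed
 obtain C\<Sigma> where C\<Sigma>: "!!s. 0 <= s ==> s <= t ==> norm (\<Sigma> s) <= C\<Sigma>" using continuous_on_Icc_bounded[OF \<Sigma>c] by blast
 \<comment> \<open>The weights of all cells whose right end is at least \<open>u\<close> add up to
   an integral that starts at the left end of the cell of \<open>u\<close>, whereas
   \<open>k u\<close> starts at \<open>u\<close>. The difference involves less than one
   cell.\<close>
 have kdiff: "norm ((\<Sum>j<Suc n. indicator {0..p n (Suc j)} u *\<^sub>R a n j) + mat 1 - k u) <= C * (t / real (Suc n))"
  if u: "0 <= u" "u <= t" for n u
 proof -
  define q where "q j = (indicator {0..p n (Suc j)} u :: real)" for j
  define b where "b s = (\<Sum>j<Suc n. q j * e n j s) - indicator {u..t} s" for s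
  have ei: "integrable lborel (%s. e n j s *\<^sub>R \<rho> (t - s))" if "j < Suc n" for j
   by (rule \<rho>i[OF _ eb[OF that]]) measurable
  have ui: "integrable lborel (%s. indicator {u..t} s *\<^sub>R \<rho> (t - s))" by (rule \<rho>i[of _ u t]) auto
  have sm: "integrable lborel (%s. \<Sum>j<Suc n. q j *\<^sub>R (e n j s *\<^sub>R \<rho> (t - s)))"
   by (intro bochner_isum integrable_scaleR_right ei) auto
  have beq: "(\<Sum>j<Suc n. q j *\<^sub>R (e n j s *\<^sub>R \<rho> (t - s))) - indicator {u..t} s *\<^sub>R \<rho> (t - s) = b s *\<^sub>R \<rho> (t - s)" for s
   by (simp add: b_def scaleR_left_diff_distrib scaleR_sum_left del: sum.lessThan_Suc)
  have "(\<Sum>j<Suc n. indicator {0..p n (Suc j)} u *\<^sub>R a n j) + mat 1 - k u = (LBINT s. (\<Sum>j<Suc n. q j *\<^sub>R (e n j s *\<^sub>R \<rho> (t - s))) - indicator {u..t} s *\<^sub>R \<rho> (t - s))"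
  proof -
   have "(LBINT s. (\<Sum>j<Suc n. q j *\<^sub>R (e n j s *\<^sub>R \<rho> (t - s)))) = (\<Sum>j<Suc n. q j *\<^sub>R a n j)"
    unfolding a_def by (subst bochner_sum) (auto intro: ei simp del: scaleR_scaleR sum.lessThan_Suc)
   then show ?thesis unfolding Bochner_Integration.integral_diff[OF sm ui] k[OF u] set_lebesgue_integral_def q_def[symmetric] by simp
  qed
  also have "... = (LBINT s. b s *\<^sub>R \<rho> (t - s))" unfolding beq ..
  also have "norm ... <= (LBINT s. norm (b s *\<^sub>R \<rho> (t - s)))" by (rule integral_norm_bound)
  also have "... <= (LBINT s. C * indicator {u - t / real (Suc n)..u} s)"
  proof (rule integral_mono_AE)
   show "integrable lborel (%s. norm (b s *\<^sub>R \<rho> (t - s)))"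
    using Bochner_Integration.integrable_diff[OF sm ui] unfolding beq by (rule integrable_norm)
   show "AE s in lborel. norm (b s *\<^sub>R \<rho> (t - s)) <= C * indicator {u - t / real (Suc n)..u} s"
    using AE_lborel_singleton[of t]
   proof eventually_elim
    case (elim s)
    have "\<bar>b s\<bar> <= indicator {u - t / real (Suc n)..u} s"
    proof (cases "0 <= s & s < t")
     case True
     then obtain m where m: "m < Suc n" "!!j. e n j s = (if j = m then 1 else 0)" "p n m <= s" "s < p n (Suc m)"
      using cell[of s n] by blast
     have "b s = indicator {0..p n (Suc m)} u - indicator {u..t} s"
      unfolding b_def m(2) q_def[symmetric] using m(1) by (simp add: if_distrib del: sum.lessThan_Suc cong: if_cong)
     then show ?thesis using True u m(3,4) pS[of n m] by (auto simp: indicator_def)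
    next
     case False
     have "(\<Sum>j<Suc n. q j * e n j s) = 0" using e0[OF False] by (intro sum.neutral) auto
     then show ?thesis using False elim u by (auto simp: b_def)
    qed
    then have "\<bar>b s\<bar> * norm (\<rho> (t - s)) <= indicator {u - t / real (Suc n)..u} s * C" by (intro mult_mono \<rho>b) auto
    then show ?case by (simp add: mult.commute)
   qed
  qed (rule integrable_const_Icc)
  also have "... = C * (t / real (Suc n))" using t by simp
  finally show ?thesis .
 qed
 have meansq: "(L2sq M (%r. S n r - J r)) <= ennreal ((C * C\<Sigma> * KM * t)^2 * t / (real (Suc n))\<^sup>2)" for n
 proof -
  \<comment> \<open>The difference \<open>S n - J\<close> as one combination of \<open>n + 3\<close>
    Ito integrals: one for each cell, then \<open>I t\<close> with coefficient \<open>mat 1\<close>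
    and \<open>J\<close> with coefficient \<open>- mat 1\<close>. The isometry reduces it to
    \<open>kdiff\<close>.\<close>
  define h where "h i u = (if i < Suc n then indicator {0..p n (Suc i)} u *\<^sub>R \<Sigma> u else if i = Suc n then indicator {0..t} u *\<^sub>R \<Sigma> u else indicator {0..t} u *\<^sub>R (k u ** \<Sigma> u))" for i u
  define H where "H i = (if i < Suc n then I (p n (Suc i)) else if i = Suc n then I t else J)" for i
  define c where "c i = (if i < Suc n then a n i else if i = Suc n then mat 1 else - mat 1)" for i
  have H: "has_ito_integral M \<F> B (%s r. h i s) (H i)" for i
   using I[OF p pt] I[OF t order_refl] J by (auto simp: h_def H_def)
  have "(\<Sum>i<Suc (Suc (Suc n)). c i *v H i r) = S n r - J r" for r
   unfolding sum.lessThan_Suc[of _ "Suc (Suc n)"] sum.lessThan_Suc[of _ "Suc n"]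
   by (simp add: c_def H_def S_def bounded_bilinear.minus_left[OF bounded_bilinear_matrix_vector_mult] del: sum.lessThan_Suc)
  then have "(L2sq M (%r. S n r - J r)) = (\<integral>\<^sup>+u\<in>{0..}. ennreal ((norm (\<Sum>i<Suc (Suc (Suc n)). c i ** h i u))^2) \<partial>lborel)"
   using ito_isometry[of "{..<Suc (Suc (Suc n))}" h H c, OF finite_lessThan H] by (simp only:)
  also have "... <= (\<integral>\<^sup>+u. ennreal ((C * C\<Sigma> * KM * t / real (Suc n))^2) * indicator {0..t} u \<partial>lborel)"
  proof (intro nn_integral_mono)
   fix u :: real
   have eq: "(\<Sum>i<Suc (Suc (Suc n)). c i ** h i u) = indicator {0..t} u *\<^sub>R (((\<Sum>j<Suc n. indicator {0..p n (Suc j)} u *\<^sub>R a n j) + mat 1 - k u) ** \<Sigma> u)"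
   proof -
    define A where "A = (\<Sum>j<Suc n. indicator {0..p n (Suc j)} u *\<^sub>R a n j)"
    have "(\<Sum>j<Suc n. c j ** h j u) = indicator {0..t} u *\<^sub>R (A ** \<Sigma> u)"
     unfolding A_def bounded_bilinear.sum_left[OF bounded_bilinear_matrix_mult] scaleR_sum_right
     by (intro sum.cong refl) (auto simp: c_def h_def scaled_matrix_mult indicator_def intro: order_trans[OF _ pt])
    then show ?thesis
     unfolding sum.lessThan_Suc[of _ "Suc (Suc n)"] sum.lessThan_Suc[of _ "Suc n"] A_def[symmetric]
     by (simp add: c_def h_def scaled_matrix_mult bounded_bilinear.minus_left[OF bounded_bilinear_matrix_mult] bounded_bilinear.diff_left[OF bounded_bilinear_matrix_mult]
      bounded_bilinear.add_left[OF bounded_bilinear_matrix_mult] algebra_simps del: sum.lessThan_Suc)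
   qed
   show "ennreal ((norm (\<Sum>i<Suc (Suc (Suc n)). c i ** h i u))^2) * indicator {0..} u <= ennreal ((C * C\<Sigma> * KM * t / real (Suc n))^2) * indicator {0..t} u"
   proof (cases "u \<in> {0..t}")
    case True
    let ?A = "(\<Sum>j<Suc n. indicator {0..p n (Suc j)} u *\<^sub>R a n j) + mat 1 - k u"
    have "norm (?A ** \<Sigma> u) <= norm ?A * norm (\<Sigma> u) * KM" by (rule KM(2))
    also have "... <= (C * (t / real (Suc n))) * C\<Sigma> * KM"
     using True KM(1) C0 t kdiff[of u n] C\<Sigma>[of u] by (intro mult_right_mono mult_mono) auto
    finally have "(norm (?A ** \<Sigma> u))\<^sup>2 <= (C * C\<Sigma> * KM * t / real (Suc n))^2" by (intro power_mono) (simp_all add: mult_ac)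
    then show ?thesis unfolding eq using True by (simp add: ennreal_leI)
   qed (simp add: eq del: sum.lessThan_Suc)
  qed
  also have "... = ennreal ((C * C\<Sigma> * KM * t)^2 * t / (real (Suc n))\<^sup>2)"
   using t by (simp add: nn_integral_cmult ennreal_mult[symmetric] power_divide)
  finally show ?thesis .
 qed
 have Sm: "(%r. ennreal ((norm (S n r - J r))^2)) \<in> borel_measurable M" for n
 proof -
  have [measurable]: "I (p n (Suc j)) \<in> borel_measurable M" if "j < Suc n" for j using ito_measurable[OF I[OF p pt[OF that]]] .
  have [measurable]: "I t \<in> borel_measurable M" "J \<in> borel_measurable M" using ito_measurable[OF I[OF t order_refl]] ito_measurable[OF J] .
  have "(%r. \<Sum>j<Suc n. a n j *v I (p n (Suc j)) r) \<in> borel_measurable M"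
   by (intro borel_measurable_sum borel_measurable_matrix_vector_mult borel_measurable_const) (use ito_measurable[OF I[OF p pt]] in auto)
  then show ?thesis unfolding S_def by measurable
 qed
 \<comment> \<open>Fatou's lemma shows that the lower limit of the squared distances vanishes almost
   everywhere. On paths along which \<open>S n\<close> converges, this already identifies the limit
   with \<open>J\<close>.\<close>
 have "(\<integral>\<^sup>+r. liminf (%n. ennreal ((norm (S n r - J r))^2)) \<partial>M) <= liminf (%n. L2sq M (%r. S n r - J r))"
  by (rule nn_integral_liminf[OF Sm])
 also have "... <= liminf (%n. ennreal ((C * C\<Sigma> * KM * t)^2 * t / (real (Suc n))\<^sup>2))"
  by (intro Liminf_mono always_eventually allI meansq)
 also have "... = ennreal 0"
  by (intro lim_imp_Liminf tendsto_ennrealI) (simp, real_asymp)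
 finally have "AE r in M. liminf (%n. ennreal ((norm (S n r - J r))^2)) = 0"
  using nn_integral_0_iff_AE[OF borel_measurable_liminf[OF Sm]] by simp
 then show ?thesis using pathwise
 proof eventually_elim
  case (elim r)
  let ?V = "Y t r + (LBINT s:{0..t}. \<rho> (t - s) *v Y s r)"
  have "(%n. ennreal ((norm (S n r - J r))^2)) \<longlonglongrightarrow> ennreal ((norm (?V - J r))^2)"
   by (intro tendsto_ennrealI tendsto_intros elim(2))
  from lim_imp_Liminf[OF sequentially_bot this] have "ennreal ((norm (?V - J r))^2) = 0" unfolding elim(1) by simp
  then show ?case unfolding J_def[symmetric] by simp
 qed
qed

end

section \<open>The resolvent: existence and variation of constants\<close>

lemma (in delay_kernel) kconv_bound_Icc:
 assumes fm: "f \<in> borel_measurable borel" and fb: "!!s. 0 <= s ==> s <= t ==> \<bar>f s\<bar> <= C" and s: "0 <= s" "s <= t"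
 shows "\<bar>kconv f j k s\<bar> <= \<bar>C\<bar> * exp (\<bar>a\<bar> * t) * W"
proof -
 have "\<bar>f x\<bar> <= \<bar>C\<bar> * exp (\<bar>a\<bar> * x)" if "0 <= x" "x <= t" for x
 proof -
  have "\<bar>f x\<bar> <= \<bar>C\<bar> * 1" using fb[OF that] by simp
  also have "... <= \<bar>C\<bar> * exp (\<bar>a\<bar> * x)" using that by (intro mult_left_mono) auto
  finally show ?thesis .
 qed
 then have "\<bar>kconv f j k s\<bar> <= \<bar>\<bar>C\<bar>\<bar> * exp (\<bar>a\<bar> * s) * W" using s by (intro kconv_bound(2) fm) auto
 also have "... <= \<bar>C\<bar> * exp (\<bar>a\<bar> * t) * W"
  using s W_nonneg by (intro mult_right_mono) (auto intro!: mult_left_mono)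
 finally show ?thesis .
qed

lemma set_integral_bound_Icc:
 fixes g :: "real => real"
 assumes gm: "g \<in> borel_measurable borel" and b: "!!s. s \<in> {0..t} ==> \<bar>g s\<bar> <= C" and t: "t >= 0"
 shows "\<bar>LBINT s:{0..t}. g s\<bar> <= C * t"
proof -
 have i: "set_integrable lborel {0..t} g" by (rule set_integrable_bounded[OF gm, of 0 t C]) (use b in simp)
 have "\<bar>LBINT s:{0..t}. g s\<bar> <= (LBINT s. norm (indicator {0..t} s *\<^sub>R g s))"
  unfolding set_lebesgue_integral_def real_norm_def[symmetric] by (rule integral_norm_bound)
 also have "... <= (LBINT s. C * indicator {0..t} s)"
  using i b by (intro integral_mono integrable_const_Icc) (auto simp: set_integrable_def indicator_def)
 also have "... = C * t" using t by simp
 finally show ?thesis .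
qed

context delay_kernel
begin

lemma inv_charm_holomorphic:
 assumes "open U" "U \<subseteq> {z. Re z > a}" "!!z. z \<in> U ==> det (charm z) \<noteq> 0"
 shows "(%z. matrix_inv (charm z) $ i $ k) holomorphic_on U"
proof (rule holomorphic_transform)
 show "(%z. det (\<chi> p q. if q = i then (if p = k then 1 else 0) else charm z $ p $ q) / det (charm z)) holomorphic_on U"
 proof (rule holomorphic_on_divide)
  show "(%z. det (\<chi> p q. if q = i then (if p = k then 1 else 0) else charm z $ p $ q)) holomorphic_on U"
  proof (rule det_holomorphic)
   fix p q
   show "(%z. (\<chi> p q. if q = i then (if p = k then 1 else 0) else charm z $ p $ q) $ p $ q) holomorphic_on U"
    using holomorphic_on_subset[OF charm_holomorphic assms(2)] by (cases "q = i"; cases "p = k") simp_all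
  qed
  show "(%z. det (charm z)) holomorphic_on U" by (rule holomorphic_on_subset[OF det_charm_holomorphic assms(2)])
 qed (use assms in auto)
 show "det (\<chi> p q. if q = i then (if p = k then 1 else 0) else charm z $ p $ q) / det (charm z) = matrix_inv (charm z) $ i $ k" if "z \<in> U" for z
  using matrix_inv_component[OF assms(3)[OF that]] by simp
qed

text \<open>The equation \<open>r' = r * w\<close> with \<open>r 0 = mat 1\<close>, the kernel
  acting from the right, in integrated form. It asks for no derivative of \<open>r\<close> and
  displays \<open>r - mat 1\<close> as the integral of a density, which the stochastic Fubini
  theorem requires.\<close>

definition resolvent :: "(real => real^'d^'d) => bool" where
 "resolvent r \<longleftrightarrow> continuous_on UNIV r &
  (\<forall>t\<ge>0. \<forall>i k. r t $ i $ k = (if i = k then 1 else 0) +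
    (LBINT s:{0..t}. \<Sum>j\<in>UNIV. kconv (%s. r s $ i $ j) j k s))"

text \<open>The function \<open>r\<close> is defined by the inversion formula, so its asymptotic
  form comes for free. The defect \<open>H\<close> in the resolvent equation has a vanishing
  transform for all large \<open>l\<close>, because the transform of \<open>r\<close> inverts
  \<open>charm\<close>, and \<open>lerch\<close> gives \<open>H = 0\<close>.\<close>

lemma resolvent_exists:
 fixes K :: "'d => 'd => complex => nat => complex"
 assumes a1: "a < a1" "a1 < \<alpha>" and S: "finite S" "!!z. z \<in> S ==> Re z = \<alpha>"
  and roots: "!!z. Re z > a1 ==> det (charm z) = 0 ==> z \<in> S"
  and pol: "!!z i k. z \<in> S ==> \<exists>q. q analytic_on {z} &
    (\<forall>\<^sub>F u in at z. matrix_inv (charm u) $ i $ k = (\<Sum>m\<le>n. fact m * K i k z m / (u - z) ^ (m + 1)) + q u)"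
 obtains r v D a2 where "a2 < \<alpha>" "resolvent r"
  "!!t i k. r t $ i $ k = Re (exp_sum S n (K i k) t) + v i k t"
  "!!t i k. t >= 0 ==> \<bar>v i k t\<bar> <= D * exp (a2 * t)"
proof -
 \<comment> \<open>The line of inversion, strictly between \<open>a1\<close>, beyond which all roots
   lie in \<open>S\<close>, and the roots themselves.\<close>
 define a2 where "a2 = (a1 + \<alpha>) / 2"
 have a2: "a1 < a2" "a2 < \<alpha>" using a1 by (auto simp: a2_def)
 obtain R0 C where RC: "!!z i k. Re z >= a ==> norm z >= R0 ==> norm (matrix_inv (charm z) $ i $ k - (if i = k then 1 else 0) / z) <= C / norm z ^ 2"
  by (rule inv_charm_decay) blast
 have openU: "open ({z. Re z > a1} - S)"
  using S(1) by (intro open_Diff open_halfspace_Re_gt finite_imp_closed)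
 have hol: "(%z. matrix_inv (charm z) $ i $ k) holomorphic_on {z. Re z > a1} - S" for i k
  by (rule inv_charm_holomorphic[OF openU]) (use a1 roots in auto)
 define Q0 where "Q0 i k t = (exp_sum S n (K i k) t)" for i k t
 have ex: "\<exists>v D. continuous_on UNIV v & (\<forall>t\<ge>0. norm (v t) <= D * exp (a2 * t)) &
  (\<forall>l>\<alpha>. set_integrable lborel {0..} (%t. lexp l t * (Q0 i k t + v t)) &
  (LBINT t:{0..}. lexp l t * (Q0 i k t + v t)) = matrix_inv (charm (of_real l)) $ i $ k)" for i k
 proof -
  have asy: "norm (matrix_inv (charm z) $ i $ k - (if i = k then 1 else 0) / z) <= C / norm z ^ 2" if "Re z >= a2" "norm z >= R0" for z
   using RC[of z i k] that a1 a2 by simp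
  obtain v D where vD: "continuous_on UNIV v" "!!t. t >= 0 ==> norm (v t) <= D * exp (a2 * t)"
   "!!l. l > \<alpha> ==> set_integrable lborel {0..} (%t. lexp l t * (Q0 i k t + v t))"
   "!!l. l > \<alpha> ==> (LBINT t:{0..}. lexp l t * (Q0 i k t + v t)) = matrix_inv (charm (of_real l)) $ i $ k"
   unfolding Q0_def
   by (rule laplace_representation[where S=S and \<alpha>=\<alpha> and ?a1.0=a1 and a=a2 and g="%z. matrix_inv (charm z) $ i $ k" and n=n and K="K i k" and L=R0 and c="if i = k then 1 else 0" and C=C, OF S a2 hol pol asy]) auto
  then show ?thesis by blast
 qed
 define P where "P i k v D \<longleftrightarrow> continuous_on UNIV v & (\<forall>t\<ge>0. norm (v t) <= D * exp (a2 * t)) &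
  (\<forall>l>\<alpha>. set_integrable lborel {0..} (%t. lexp l t * (Q0 i k t + v t)) &
  (LBINT t:{0..}. lexp l t * (Q0 i k t + v t)) = matrix_inv (charm (of_real l)) $ i $ k)" for i k v D
 have "\<forall>i k. \<exists>v D. P i k v D" using ex unfolding P_def by blast
 then obtain V DD where "\<forall>i k. P i k (V i k) (DD i k)" unfolding choice_iff by blast
 then have V: "continuous_on UNIV (V i k)" "!!t. t >= 0 ==> norm (V i k t) <= DD i k * exp (a2 * t)"
  "!!l. l > \<alpha> ==> set_integrable lborel {0..} (%t. lexp l t * (Q0 i k t + V i k t))"
  "!!l. l > \<alpha> ==> (LBINT t:{0..}. lexp l t * (Q0 i k t + V i k t)) = matrix_inv (charm (of_real l)) $ i $ k" for i k
  unfolding P_def by blast+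
 define r where "r t = (\<chi> i k. Re (Q0 i k t + V i k t))" for t
 define v where "v i k t = Re (V i k t)" for i k t
 define D where "D = (\<Sum>i\<in>UNIV. \<Sum>k\<in>UNIV. \<bar>DD i k\<bar>)"
 have DDle: "DD i k <= D" for i k
 proof -
  have "DD i k <= \<bar>DD i k\<bar>" by simp
  also have "... <= (\<Sum>k\<in>UNIV. \<bar>DD i k\<bar>)" by (rule member_le_sum) auto
  also have "... <= D" unfolding D_def by (rule member_le_sum[of i UNIV "%i. \<Sum>k\<in>UNIV. \<bar>DD i k\<bar>"]) (auto intro: sum_nonneg)
  finally show ?thesis .
 qed
 have vb: "\<bar>v i k t\<bar> <= D * exp (a2 * t)" if "t >= 0" for i k t
 proof -
  have "\<bar>v i k t\<bar> <= norm (V i k t)" unfolding v_def by (rule abs_Re_le_cmod)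
  also have "... <= DD i k * exp (a2 * t)" by (rule V(2)[OF that])
  also have "... <= D * exp (a2 * t)" using DDle by (intro mult_right_mono) auto
  finally show ?thesis .
 qed
 have rc: "continuous_on UNIV r"
  unfolding r_def Q0_def by (intro continuous_on_vec_lambda continuous_intros V(1))
 have rcomp: "continuous_on UNIV (%t. r t $ i $ k)" for i k by (intro continuous_on_component rc)
 have rm[measurable]: "(%t. r t $ i $ k) \<in> borel_measurable borel" for i k
  by (rule borel_measurable_continuous_onI[OF rcomp])
 \<comment> \<open>A single growth exponent: the 1 added to \<open>\<alpha>\<close> absorbs the
   powers of \<open>t\<close>, \<open>c >= a\<close> is needed for convolutions with the kernel, and
   \<open>c > 0\<close> helps with integrals.\<close>
 define c where "c = max \<alpha> (max a 0) + 1"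
 have c: "c > 0" "c >= a" "c >= \<alpha> + 1" "c >= a2" using a2 by (auto simp: c_def)
 define Cr where "Cr = (\<Sum>i\<in>UNIV. \<Sum>k\<in>UNIV. \<Sum>z\<in>S. \<Sum>m\<le>n. norm (K i k z m) * fact m) + D"
 have rb: "\<bar>r t $ i $ k\<bar> <= Cr * exp (c * t)" if t: "t >= 0" for t i k
 proof -
  have "norm (Q0 i k t) <= (\<Sum>z\<in>S. \<Sum>m\<le>n. norm (K i k z m) * fact m * exp (c * t))"
   unfolding Q0_def
  proof (intro order_trans[OF norm_sum] sum_mono)
   fix z m assume z: "z \<in> S"
   have "t ^ m <= fact m / 1 ^ m * exp (1 * t)" by (rule power_le_fact_exp) (use t in auto)
   then have "t ^ m * exp (\<alpha> * t) <= (fact m * exp t) * exp (\<alpha> * t)" by (intro mult_right_mono) auto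
   also have "... = fact m * exp ((\<alpha> + 1) * t)" by (simp add: algebra_simps exp_add)
   also have "... <= fact m * exp (c * t)" using c t by (intro mult_left_mono) (auto intro: mult_right_mono)
   finally have "t ^ m * exp (\<alpha> * t) <= fact m * exp (c * t)" .
   then have "norm (K i k z m) * (t ^ m * exp (\<alpha> * t)) <= norm (K i k z m) * (fact m * exp (c * t))" by (intro mult_left_mono) auto
   then show "norm (K i k z m * exp_poly m z t) <= norm (K i k z m) * fact m * exp (c * t)"
    using t S(2)[OF z] by (simp add: norm_mult norm_power mult.assoc)
  qed
  also have "... = (\<Sum>z\<in>S. \<Sum>m\<le>n. norm (K i k z m) * fact m) * exp (c * t)" by (simp add: sum_distrib_right)
  finally have 1: "norm (Q0 i k t) <= (\<Sum>z\<in>S. \<Sum>m\<le>n. norm (K i k z m) * fact m) * exp (c * t)" .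
  have "(\<Sum>z\<in>S. \<Sum>m\<le>n. norm (K i k z m) * fact m) <= (\<Sum>k\<in>UNIV. \<Sum>z\<in>S. \<Sum>m\<le>n. norm (K i k z m) * fact m)"
   by (rule member_le_sum[of k UNIV "%k. \<Sum>z\<in>S. \<Sum>m\<le>n. norm (K i k z m) * fact m"]) (auto intro!: sum_nonneg)
  also have "... <= (\<Sum>i\<in>UNIV. \<Sum>k\<in>UNIV. \<Sum>z\<in>S. \<Sum>m\<le>n. norm (K i k z m) * fact m)"
   by (rule member_le_sum[of i UNIV "%i. \<Sum>k\<in>UNIV. \<Sum>z\<in>S. \<Sum>m\<le>n. norm (K i k z m) * fact m"]) (auto intro!: sum_nonneg)
  finally have "(\<Sum>z\<in>S. \<Sum>m\<le>n. norm (K i k z m) * fact m) * exp (c * t) <= (\<Sum>i\<in>UNIV. \<Sum>k\<in>UNIV. \<Sum>z\<in>S. \<Sum>m\<le>n. norm (K i k z m) * fact m) * exp (c * t)"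
   by (intro mult_right_mono) auto
  moreover have "\<bar>v i k t\<bar> <= D * exp (c * t)"
  proof -
   have "D >= 0" unfolding D_def by (intro sum_nonneg) auto
   then have "D * exp (a2 * t) <= D * exp (c * t)" using c t by (intro mult_left_mono) (auto intro: mult_right_mono)
   then show ?thesis using vb[OF t, of i k] by linarith
  qed
  moreover have "\<bar>r t $ i $ k\<bar> <= norm (Q0 i k t) + \<bar>v i k t\<bar>"
   using abs_Re_le_cmod[of "Q0 i k t"] by (simp add: r_def v_def)
  ultimately show ?thesis using 1 unfolding Cr_def distrib_right by linarith
 qed
 have Cr0: "Cr >= 0" using order_trans[OF abs_ge_zero rb[of 0]] by simp
 define \<rho> where "\<rho> i k s = (\<Sum>j\<in>UNIV. kconv (%s. r s $ i $ j) j k s)" for i k s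
 have \<rho>m[measurable]: "\<rho> i k \<in> borel_measurable borel" for i k
  unfolding \<rho>_def[abs_def] by (intro borel_measurable_sum kconv_measurable rm)
 define C\<rho> where "C\<rho> = real CARD('d) * (Cr * W)"
 have C\<rho>0: "C\<rho> >= 0" using Cr0 W_nonneg by (simp add: C\<rho>_def)
 have \<rho>b: "\<bar>\<rho> i k s\<bar> <= C\<rho> * exp (c * s)" if "s >= 0" for i k s
 proof -
  have "\<bar>\<rho> i k s\<bar> <= (\<Sum>j\<in>UNIV. \<bar>kconv (%s. r s $ i $ j) j k s\<bar>)" unfolding \<rho>_def by (rule sum_abs)
  also have "... <= (\<Sum>j\<in>(UNIV::'d set). \<bar>Cr\<bar> * exp (c * s) * W)"
   by (intro sum_mono kconv_bound(2) rm rb c)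
  also have "... = C\<rho> * exp (c * s)" using Cr0 by (simp add: C\<rho>_def)
  finally show ?thesis .
 qed
 have \<rho>int: "set_integrable lborel {0..t} (\<rho> i k)" for i k t
 proof (rule set_integrable_bounded[OF \<rho>m])
  fix s assume s: "s \<in> {0..t}"
  have "C\<rho> * exp (c * s) <= C\<rho> * exp (c * t)" using s c C\<rho>0 by (intro mult_left_mono) auto
  then show "norm (\<rho> i k s) <= C\<rho> * exp (c * t)" using \<rho>b[of s i k] s by simp
 qed
 have main: "r t $ i $ k = (if i = k then 1 else 0) + (LBINT s:{0..t}. \<rho> i k s)" if t: "t >= 0" for t i k
 proof -
  define H where "H t = r t $ i $ k - (if i = k then 1 else 0) - (LBINT s:{0..t}. \<rho> i k s)" for t
  have Ib: "\<bar>LBINT s:{0..t}. \<rho> i k s\<bar> <= C\<rho> * exp ((c + 1) * t)" if t: "t >= 0" for t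
  proof -
   have "\<bar>LBINT s:{0..t}. \<rho> i k s\<bar> <= C\<rho> * exp (c * t) * t"
   proof (rule set_integral_bound_Icc[OF \<rho>m _ t])
    fix s assume s: "s \<in> {0..t}"
    have "C\<rho> * exp (c * s) <= C\<rho> * exp (c * t)" using s c C\<rho>0 by (intro mult_left_mono) auto
    then show "\<bar>\<rho> i k s\<bar> <= C\<rho> * exp (c * t)" using \<rho>b[of s i k] s by simp
   qed
   also have "... <= C\<rho> * exp (c * t) * exp t"
   proof (intro mult_left_mono)
    show "t <= exp t" using exp_ge_add_one_self[of t] by linarith
   qed (use C\<rho>0 in simp)
   also have "... = C\<rho> * exp ((c + 1) * t)" by (simp add: algebra_simps exp_add)
   finally show ?thesis .
  qed
  have "H t = 0"
  \<comment> \<open>The exponent is \<open>c + 1\<close> because the integral of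
    \<open>\<rho>\<close> costs a factor \<open>t\<close>, which is at most
    \<open>exp t\<close>.\<close>
  proof (rule lerch[of H "Cr + 1 + C\<rho>" "c + 1" "c + 1", OF _ _ _ t])
   show "continuous_on {0..} H" unfolding H_def
    by (intro continuous_intros continuous_on_subset[OF rcomp] continuous_indefinite_integral \<rho>int) auto
   fix t :: real assume t: "t >= 0"
   have e: "exp (c * t) <= exp ((c + 1) * t)" "1 <= exp ((c + 1) * t)" using t c by (auto intro: mult_right_mono)
   have "\<bar>H t\<bar> <= \<bar>r t $ i $ k\<bar> + 1 + \<bar>LBINT s:{0..t}. \<rho> i k s\<bar>" by (simp add: H_def) linarith
   also have "... <= Cr * exp ((c + 1) * t) + exp ((c + 1) * t) + C\<rho> * exp ((c + 1) * t)"
    using order_trans[OF rb[OF t, of i k] mult_left_mono[OF e(1) Cr0]] e(2) Ib[OF t] by (intro add_mono)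
   finally show "\<bar>H t\<bar> <= (Cr + 1 + C\<rho>) * exp ((c + 1) * t)" by (simp add: distrib_right)
  next
   fix l :: real assume l: "l > c + 1"
   have l\<alpha>: "l > \<alpha>" and lc: "l > c" and l0: "l > 0" using l c by auto
   define rh where "rh i j = (LBINT t:{0..}. exp (- l * t) * r t $ i $ j)" for i j
   have re: "exp (- l * t) * r t $ i $ j = Re (lexp l t * (Q0 i j t + V i j t))" for t i j
   proof -
    have "exp (- of_real l * of_real t :: complex) = of_real (exp (- l * t))" by (simp flip: exp_of_real)
    then show ?thesis by (simp add: r_def)
   qed
   have ri: "set_integrable lborel {0..} (%t. exp (- l * t) * r t $ i $ j)" for i j
    using integrable_Re[OF V(3)[OF l\<alpha>, of i j, unfolded set_integrable_def]] unfolding re set_integrable_def by simp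
   have rh: "rh i j = Re (matrix_inv (charm (of_real l)) $ i $ j)" for i j
    using integral_Re[OF V(3)[OF l\<alpha>, of i j, unfolded set_integrable_def]] V(4)[OF l\<alpha>, of i j]
    unfolding rh_def re set_lebesgue_integral_def by simp
   have det: "det (charm (of_real l)) \<noteq> 0"
    using roots[of "of_real l"] S(2)[of "of_real l"] l\<alpha> a1 by fastforce
   \<comment> \<open>Only the real parts of the inverse are transforms of \<open>r\<close>. As
     \<open>charm\<close> has real entries at the real point \<open>l\<close>, taking real parts in
     the product of the inverse with \<open>charm\<close> loses nothing.\<close>
   have id: "l * rh i k - (\<Sum>j\<in>UNIV. rh i j * lapR l j k) = (if i = k then 1 else 0)"
   proof -
    have "(matrix_inv (charm (of_real l)) ** charm (of_real l)) $ i $ k = (if i = k then 1 else 0)"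
     unfolding matrix_inv_det(2)[OF det] by (simp add: mat_def)
    then have "(\<Sum>j\<in>UNIV. matrix_inv (charm (of_real l)) $ i $ j * of_real ((if j = k then l else 0) - lapR l j k)) = (if i = k then 1 else 0)"
    proof -
     have "of_real ((if j = k then l else 0) - lapR l j k) = charm (of_real l) $ j $ k" for j
      by (simp add: charm_component lap_of_real)
     then show ?thesis using \<open>_ = (if i = k then 1 else 0)\<close> by (simp only: matrix_matrix_mult_def vec_lambda_beta)
    qed
    from arg_cong[OF this, of Re]
    have "(\<Sum>j\<in>UNIV. rh i j * ((if j = k then l else 0) - lapR l j k)) = (if i = k then 1 else 0)"
     by (simp add: rh)
    moreover have "(\<Sum>j\<in>UNIV. rh i j * (if j = k then l else 0)) = l * rh i k"
     by (subst sum.mono_neutral_cong_right[of UNIV "{k}"]) (auto simp: mult.commute)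
    ultimately show ?thesis by (simp only: right_diff_distrib sum_subtractf)
   qed
   have \<rho>bd: "set_integrable lborel {0..} (%t. exp (- l * t) * kconv (%s. r s $ i $ j) j k t)" for j
   proof (rule set_integrable_exp_bound[where d="l - c" and C="\<bar>Cr\<bar> * W"])
    have [measurable]: "kconv (%s. r s $ i $ j) j k \<in> borel_measurable borel" by (rule kconv_measurable[OF rm])
    show "(%t. indicator {0..} t *\<^sub>R (exp (- l * t) * kconv (%s. r s $ i $ j) j k t)) \<in> borel_measurable borel" by measurable
    fix t :: real assume t: "t >= 0"
    have "\<bar>kconv (%s. r s $ i $ j) j k t\<bar> <= \<bar>Cr\<bar> * exp (c * t) * W" by (intro kconv_bound(2) rm rb c)
    then have "exp (- l * t) * \<bar>kconv (%s. r s $ i $ j) j k t\<bar> <= exp (- l * t) * (\<bar>Cr\<bar> * exp (c * t) * W)" by (intro mult_left_mono) auto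
    also have "... = \<bar>Cr\<bar> * W * exp (- (l - c) * t)" by (simp add: algebra_simps exp_diff exp_minus field_simps)
    finally show "norm (exp (- l * t) * kconv (%s. r s $ i $ j) j k t) <= \<bar>Cr\<bar> * W * exp (- (l - c) * t)" by (simp add: abs_mult)
   qed (use lc in auto)
   have \<rho>l: "(LBINT s:{0..}. exp (- l * s) * \<rho> i k s) = (\<Sum>j\<in>UNIV. rh i j * lapR l j k)"
   proof -
    have "(LBINT s:{0..}. exp (- l * s) * \<rho> i k s) = (LBINT s. (\<Sum>j\<in>UNIV. indicator {0..} s *\<^sub>R (exp (- l * s) * kconv (%s. r s $ i $ j) j k s)))"
     by (simp add: set_lebesgue_integral_def \<rho>_def sum_distrib_left)
    also have "... = (\<Sum>j\<in>UNIV. LBINT s:{0..}. exp (- l * s) * kconv (%s. r s $ i $ j) j k s)"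
     unfolding set_lebesgue_integral_def using \<rho>bd[unfolded set_integrable_def] by (rule bochner_sum)
    also have "... = (\<Sum>j\<in>UNIV. rh i j * lapR l j k)"
     unfolding rh_def by (intro sum.cong refl laplace_kconv[where c=c and C=Cr] rm rb c lc)
    finally show ?thesis .
   qed
   have \<rho>I: "(LBINT t:{0..}. exp (- l * t) * (LBINT s:{0..t}. \<rho> i k s)) = (\<Sum>j\<in>UNIV. rh i j * lapR l j k) / l"
    using laplace_of_integral[OF \<rho>m \<rho>b lc l0, of i k] unfolding \<rho>l .
   have \<rho>i: "set_integrable lborel {0..} (%t. exp (- l * t) * (LBINT s:{0..t}. \<rho> i k s))"
   proof (rule set_integrable_exp_bound_continuous[where d="l - (c + 1)" and C=C\<rho>])
    show "continuous_on {0..} (%t. exp (- l * t) * (LBINT s:{0..t}. \<rho> i k s))"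
     by (intro continuous_intros continuous_indefinite_integral \<rho>int)
    fix t :: real assume t: "t >= 0"
    have "exp (- l * t) * \<bar>LBINT s:{0..t}. \<rho> i k s\<bar> <= exp (- l * t) * (C\<rho> * exp ((c + 1) * t))"
     using Ib[OF t] by (intro mult_left_mono) auto
    also have "... = C\<rho> * exp (- (l - (c + 1)) * t)" by (simp add: algebra_simps exp_diff exp_minus exp_add field_simps)
    finally show "norm (exp (- l * t) * (LBINT s:{0..t}. \<rho> i k s)) <= C\<rho> * exp (- (l - (c + 1)) * t)" by (simp add: abs_mult)
   qed (use l in auto)
   have ei: "set_integrable lborel {0..} (%t. exp (- l * t) * (if i = k then 1 else 0))"
    using set_integrable_exp_neg[OF l0] by (intro set_integrable_mult_left) auto
   have ev: "(LBINT t:{0..}. exp (- l * t) * (if i = k then 1 else 0)) = (if i = k then 1 else 0) / l"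
    using has_integral_exp_minus_to_infinity[OF l0, of 0] set_borel_integral_eq_integral(2)[OF set_integrable_exp_neg[OF l0]]
    by (simp add: integral_unique)
   have "(LBINT t:{0..}. exp (- l * t) * H t) = (LBINT t:{0..}. exp (- l * t) * r t $ i $ k - exp (- l * t) * (if i = k then 1 else 0) - exp (- l * t) * (LBINT s:{0..t}. \<rho> i k s))"
    unfolding H_def by (simp add: right_diff_distrib)
   also have "... = rh i k - (if i = k then 1 else 0) / l - (\<Sum>j\<in>UNIV. rh i j * lapR l j k) / l"
    unfolding rh_def[of i k] ev[symmetric] \<rho>I[symmetric]
    by (simp only: set_integral_diff ri ei \<rho>i)
   also have "... = 0" using id l0 by (simp add: field_simps)
   finally show "(LBINT t:{0..}. exp (- l * t) * H t) = 0" .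
  qed
  then show ?thesis by (simp add: H_def)
 qed
 show thesis
 proof (rule that[OF a2(2), of r v D])
  show "resolvent r" unfolding resolvent_def using rc main by (simp add: \<rho>_def)
  show "r t $ i $ k = Re (exp_sum S n (K i k) t) + v i k t" for t i k
   by (simp add: r_def v_def Q0_def)
 qed (rule vb)
qed

text \<open>
 With \<open>*\<close> for convolution on \<open>[0,t]\<close> and \<open>u\<close> for the convolution of the kernel with \<open>X\<close>, one has
 \<open>r * u = \<rho> * X\<close> by Fubini and \<open>r * u = 1 * u + \<rho> * (1 * u)\<close> since \<open>r = I + 1 * \<rho>\<close>;
 as \<open>1 * u = X - G\<close>, subtracting gives \<open>X = G + \<rho> * G\<close>.
\<close>

lemma variation_of_constants:
 assumes r: "resolvent r" and t: "t >= 0"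
  and Xm: "!!k. (%s. X s $ k) \<in> borel_measurable borel" and Xb: "!!s k. 0 <= s ==> s <= t ==> \<bar>X s $ k\<bar> <= CX"
  and Gm: "!!k. (%s. G s $ k) \<in> borel_measurable borel" and Gb: "!!s k. 0 <= s ==> s <= t ==> \<bar>G s $ k\<bar> <= CG"
  and eq: "!!s i. 0 <= s ==> s <= t ==> X s $ i = G s $ i + (LBINT \<tau>:{0..s}. \<Sum>k\<in>UNIV. kconv (%s. X s $ k) i k \<tau>)"
 shows "X t $ i = G t $ i + (LBINT s:{0..t}. \<Sum>j\<in>UNIV. (\<Sum>l\<in>UNIV. kconv (%s. r s $ i $ l) l j (t - s)) * G s $ j)"
proof -
 have rc: "continuous_on UNIV (%s. r s $ i $ j)" for i j
  using r by (auto simp: resolvent_def intro!: continuous_on_component)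
 have rm[measurable]: "(%s. r s $ i $ j) \<in> borel_measurable borel" for i j by (rule borel_measurable_continuous_onI[OF rc])
 obtain Cr where rb: "!!s i j. 0 <= s ==> s <= t ==> \<bar>r s $ i $ j\<bar> <= Cr"
 proof -
  have "continuous_on {0..t} r" using r by (auto simp: resolvent_def intro: continuous_on_subset)
  then obtain C where C: "!!s. 0 <= s ==> s <= t ==> norm (r s) <= C" using continuous_on_Icc_bounded by blast
  have "\<bar>r s $ i $ j\<bar> <= C" if "0 <= s" "s <= t" for s i j
   using matrix_component_le_norm[of "r s" i j] C[OF that] by simp
  then show thesis by (rule that)
 qed
 define \<rho> where "\<rho> j s = (\<Sum>l\<in>UNIV. kconv (%s. r s $ i $ l) l j s)" for j s
 have \<rho>m[measurable]: "\<rho> j \<in> borel_measurable borel" for j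
  unfolding \<rho>_def[abs_def] by (intro borel_measurable_sum kconv_measurable rm)
 define C\<rho> where "C\<rho> = real CARD('d) * (\<bar>Cr\<bar> * exp (\<bar>a\<bar> * t) * W)"
 have \<rho>b: "\<bar>\<rho> j s\<bar> <= C\<rho>" if s: "0 <= s" "s <= t" for j s
 proof -
  have "\<bar>\<rho> j s\<bar> <= (\<Sum>l\<in>UNIV. \<bar>kconv (%s. r s $ i $ l) l j s\<bar>)" unfolding \<rho>_def by (rule sum_abs)
  also have "... <= (\<Sum>l\<in>(UNIV::'d set). \<bar>Cr\<bar> * exp (\<bar>a\<bar> * t) * W)"
   by (intro sum_mono kconv_bound_Icc rm rb s)
  finally show ?thesis by (simp add: C\<rho>_def)
 qed
 define u where "u j s = (\<Sum>k\<in>UNIV. kconv (%s. X s $ k) j k s)" for j s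
 have um[measurable]: "u j \<in> borel_measurable borel" for j
  unfolding u_def[abs_def] by (intro borel_measurable_sum kconv_measurable Xm)
 define Cu where "Cu = real CARD('d) * (\<bar>CX\<bar> * exp (\<bar>a\<bar> * t) * W)"
 have ub: "\<bar>u j s\<bar> <= Cu" if s: "0 <= s" "s <= t" for j s
 proof -
  have "\<bar>u j s\<bar> <= (\<Sum>k\<in>UNIV. \<bar>kconv (%s. X s $ k) j k s\<bar>)" unfolding u_def by (rule sum_abs)
  also have "... <= (\<Sum>k\<in>(UNIV::'d set). \<bar>CX\<bar> * exp (\<bar>a\<bar> * t) * W)"
   by (intro sum_mono kconv_bound_Icc Xm Xb s)
  finally show ?thesis by (simp add: Cu_def)
 qed
 have prod_int: "set_integrable lborel {0..t} (%s. f (t - s) * g s)"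
  if [measurable]: "f \<in> borel_measurable borel" "g \<in> borel_measurable borel" and "!!s. 0 <= s ==> s <= t ==> \<bar>f s\<bar> <= A" "!!s. 0 <= s ==> s <= t ==> \<bar>g s\<bar> <= B" for f g :: "real => real" and A B
 proof (rule set_integrable_bounded[where C="\<bar>A\<bar> * \<bar>B\<bar>"])
  fix s assume "s \<in> {0..t}"
  then have "\<bar>f (t - s)\<bar> * \<bar>g s\<bar> <= \<bar>A\<bar> * \<bar>B\<bar>"
   using that(3)[of "t - s"] that(4)[of s] by (intro mult_mono) auto
  then show "norm (f (t - s) * g s) <= \<bar>A\<bar> * \<bar>B\<bar>" by (simp add: abs_mult)
 qed measurable
 have kXm[measurable]: "kconv (%s. X s $ k) j k \<in> borel_measurable borel" for j k by (rule kconv_measurable[OF Xm])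
 have krm[measurable]: "kconv (%s. r s $ i $ j) j k \<in> borel_measurable borel" for j k by (rule kconv_measurable[OF rm])
 have sum_swap: "(\<Sum>x\<in>A. LBINT s:{0..t}. f x s) = (LBINT s:{0..t}. \<Sum>x\<in>A. f x s)"
  if "!!x. x \<in> A ==> set_integrable lborel {0..t} (f x)" for A and f :: "'d => real => real"
  using that unfolding set_lebesgue_integral_def set_integrable_def scaleR_sum_right
  by (intro bochner_sum[symmetric])
 have 1: "(\<Sum>j\<in>UNIV. LBINT s:{0..t}. r (t - s) $ i $ j * u j s) = (\<Sum>k\<in>UNIV. LBINT s:{0..t}. \<rho> k (t - s) * X s $ k)"
 proof -
  have "(LBINT s:{0..t}. r (t - s) $ i $ j * u j s) = (\<Sum>k\<in>UNIV. LBINT s:{0..t}. r (t - s) $ i $ j * kconv (%s. X s $ k) j k s)" for j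
   unfolding u_def sum_distrib_left by (intro sum_swap[symmetric] prod_int[where A=Cr and B="\<bar>CX\<bar> * exp (\<bar>a\<bar> * t) * W"] rm kXm rb kconv_bound_Icc Xm Xb)
  also have "... j = (\<Sum>k\<in>UNIV. LBINT s:{0..t}. kconv (%s. r s $ i $ j) j k (t - s) * X s $ k)" for j
   by (intro sum.cong refl kconv_swap[where C=Cr and D=CX] rm rb Xm Xb)
  finally have "(\<Sum>j\<in>UNIV. LBINT s:{0..t}. r (t - s) $ i $ j * u j s) = (\<Sum>k\<in>UNIV. \<Sum>j\<in>UNIV. LBINT s:{0..t}. kconv (%s. r s $ i $ j) j k (t - s) * X s $ k)"
   by (subst sum.swap) simp
  also have "... = (\<Sum>k\<in>UNIV. LBINT s:{0..t}. \<rho> k (t - s) * X s $ k)"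
   unfolding \<rho>_def sum_distrib_right
   by (intro sum.cong refl sum_swap prod_int[where A="\<bar>Cr\<bar> * exp (\<bar>a\<bar> * t) * W" and B=CX] krm kconv_bound_Icc rm rb Xm Xb)
  finally show ?thesis .
 qed
 have ui: "set_integrable lborel {0..t} (u j)" for j
  by (rule set_integrable_bounded[OF um]) (use ub in auto)
 have XG: "(LBINT \<tau>:{0..s}. u j \<tau>) = X s $ j - G s $ j" if "0 <= s" "s <= t" for s j
  using eq[OF that, of j] by (simp add: u_def)
 have 2: "(LBINT s:{0..t}. r (t - s) $ i $ j * u j s) = (if i = j then X t $ j - G t $ j else 0) + (LBINT s:{0..t}. \<rho> j (t - s) * X s $ j) - (LBINT s:{0..t}. \<rho> j (t - s) * G s $ j)" for j
 proof -
  have rr: "r (t - s) $ i $ j = (if i = j then 1 else 0) + (LBINT \<tau>:{0..t-s}. \<rho> j \<tau>)" if "s \<in> {0..t}" for s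
   using r that unfolding resolvent_def \<rho>_def by auto
  have i1: "set_integrable lborel {0..t} (%s. (if i = j then 1 else 0) * u j s)" using ui by (intro set_integrable_mult_right) auto
  have i3: "set_integrable lborel {0..t} (%s. r (t - s) $ i $ j * u j s)" by (intro prod_int[where A=Cr and B=Cu] rm um rb ub)
  have i2: "set_integrable lborel {0..t} (%s. (LBINT \<tau>:{0..t-s}. \<rho> j \<tau>) * u j s)"
  proof -
   have "set_integrable lborel {0..t} (%s. r (t - s) $ i $ j * u j s - (if i = j then 1 else 0) * u j s)"
    by (rule set_integral_diff(1)[OF i3 i1])
   then show ?thesis
    by (rule set_integrable_cong[THEN iffD1, rotated -1]) (auto simp: rr left_diff_distrib[symmetric])
  qed
  have "(LBINT s:{0..t}. r (t - s) $ i $ j * u j s) = (LBINT s:{0..t}. (if i = j then 1 else 0) * u j s + (LBINT \<tau>:{0..t-s}. \<rho> j \<tau>) * u j s)"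
   by (rule set_lebesgue_integral_cong) (auto simp: rr distrib_right)
  also have "... = (LBINT s:{0..t}. (if i = j then 1 else 0) * u j s) + (LBINT s:{0..t}. (LBINT \<tau>:{0..t-s}. \<rho> j \<tau>) * u j s)"
   by (rule set_integral_add(2)[OF i1 i2])
  also have "(LBINT s:{0..t}. (if i = j then 1 else 0) * u j s) = (if i = j then X t $ j - G t $ j else 0)"
   using XG[OF t order_refl, of j] by (cases "i = j") auto
  also have "(LBINT s:{0..t}. (LBINT \<tau>:{0..t-s}. \<rho> j \<tau>) * u j s) = (LBINT \<tau>:{0..t}. \<rho> j (t - \<tau>) * (LBINT s:{0..\<tau>}. u j s))"
   by (rule conv_assoc[OF \<rho>m _ ui, symmetric]) (use \<rho>b in auto)
  also have "... = (LBINT \<tau>:{0..t}. \<rho> j (t - \<tau>) * X \<tau> $ j - \<rho> j (t - \<tau>) * G \<tau> $ j)"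
   by (rule set_lebesgue_integral_cong) (auto simp: XG right_diff_distrib)
  also have "... = (LBINT s:{0..t}. \<rho> j (t - s) * X s $ j) - (LBINT s:{0..t}. \<rho> j (t - s) * G s $ j)"
   by (intro set_integral_diff(2) prod_int[where A=C\<rho> and B=CX] prod_int[where A=C\<rho> and B=CG] \<rho>m \<rho>b Xm Xb Gm Gb)
  finally show ?thesis by simp
 qed
 have "X t $ i - G t $ i = (\<Sum>j\<in>UNIV. LBINT s:{0..t}. \<rho> j (t - s) * G s $ j)"
  using 1 unfolding 2 by (simp add: sum.distrib sum_subtractf)
 also have "... = (LBINT s:{0..t}. \<Sum>j\<in>UNIV. \<rho> j (t - s) * G s $ j)"
  by (intro sum_swap prod_int[where A=C\<rho> and B=CG] \<rho>m \<rho>b Gm Gb)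
 finally show ?thesis by (simp add: \<rho>_def)
qed

end

section \<open>Poles and principal parts\<close>

text \<open>Taylor's formula with an analytic remainder, by splitting off \<open>q z\<close> and
  dividing by \<open>w - z\<close> at each step; \<open>q'\<close> fills the removable singularity
  with the derivative.\<close>

lemma analytic_taylor_split:
 fixes h :: "complex => complex"
 assumes "h analytic_on {z}"
 shows "\<exists>c q. q analytic_on {z} & (\<forall>w. h w = (\<Sum>j<N. c j * (w - z) ^ j) + (w - z) ^ N * q w)"
proof (induction N)
 case 0
 show ?case using assms by auto
next
 case (Suc N)
 then obtain c q where q: "q analytic_on {z}" and h: "!!w. h w = (\<Sum>j<N. c j * (w - z) ^ j) + (w - z) ^ N * q w"
  by blast
 define q' where "q' w = (if w = z then deriv q z else (q w - q z) / (w - z))" for w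
 have "q' analytic_on {z}"
  using q pole_lemma_open[of q _ z] unfolding analytic_at q'_def by blast
 moreover have "h w = (\<Sum>j<Suc N. (c(N := q z)) j * (w - z) ^ j) + (w - z) ^ Suc N * q' w" for w
 proof -
  have "q w = q z + (w - z) * q' w" by (simp add: q'_def)
  then have "(w - z) ^ N * q w = (w - z) ^ N * (q z + (w - z) * q' w)" by (rule arg_cong)
  also have "... = q z * (w - z) ^ N + (w - z) ^ Suc N * q' w" by (simp only: power_Suc2 distrib_left mult.assoc mult.commute[of "q z"])
  finally have "(w - z) ^ N * q w = q z * (w - z) ^ N + (w - z) ^ Suc N * q' w" .
  moreover have "(\<Sum>j<N. (c(N := q z)) j * (w - z) ^ j) = (\<Sum>j<N. c j * (w - z) ^ j)" by (intro sum.cong) auto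
  ultimately show ?thesis by (simp add: h)
 qed
 ultimately show ?case by blast
qed

lemma principal_part_exists:
 fixes g h :: "complex => complex"
 assumes h: "h analytic_on {z}" and g: "\<forall>\<^sub>F w in at z. g w = h w / (w - z) ^ (n + 1)"
 shows "\<exists>K q. q analytic_on {z} & (\<forall>\<^sub>F w in at z. g w = (\<Sum>m\<le>n. fact m * K m / (w - z) ^ (m + 1)) + q w)"
proof -
 obtain c q where q: "q analytic_on {z}" and hq: "!!w. h w = (\<Sum>j<n+1. c j * (w - z) ^ j) + (w - z) ^ (n + 1) * q w"
  using analytic_taylor_split[OF h, of "n + 1"] by blast
 \<comment> \<open>Dividing the Taylor polynomial by \<open>(w - z) ^ (n + 1)\<close> sends the
   coefficient of index \<open>n - m\<close> to the pole term of order \<open>m + 1\<close>; the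
   factorial is the normalization in \<open>polar_expansion\<close>.\<close>
 define K where "K m = c (n - m) / fact m" for m
 have "\<forall>\<^sub>F w in at z. g w = (\<Sum>m\<le>n. fact m * K m / (w - z) ^ (m + 1)) + q w"
  using g eventually_neq_at_within[of z]
 proof eventually_elim
  case (elim w)
  have "g w = (\<Sum>j<n+1. c j * (w - z) ^ j) / (w - z) ^ (n + 1) + q w"
   using elim by (simp add: hq add_divide_distrib)
  also have "(\<Sum>j<n+1. c j * (w - z) ^ j) / (w - z) ^ (n + 1) = (\<Sum>j<n+1. c j * (w - z) ^ j / (w - z) ^ (n + 1))"
   by (rule sum_divide_distrib)
  also have "... = (\<Sum>m<n+1. c (n + 1 - Suc m) * (w - z) ^ (n + 1 - Suc m) / (w - z) ^ (n + 1))"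
   by (rule sum.nat_diff_reindex[symmetric])
  also have "... = (\<Sum>m<n+1. fact m * K m / (w - z) ^ (m + 1))"
  proof (intro sum.cong refl)
   fix m assume "m \<in> {..<n+1}"
   then have "(w - z) ^ (n + 1) = (w - z) ^ (n - m) * (w - z) ^ (m + 1)" by (simp flip: power_add)
   then show "c (n + 1 - Suc m) * (w - z) ^ (n + 1 - Suc m) / (w - z) ^ (n + 1) = fact m * K m / (w - z) ^ (m + 1)"
    using elim by (simp add: K_def)
  qed
  also have "{..<n+1} = {..n}" by auto
  finally show ?case .
 qed
 then show ?thesis using q by blast
qed

text \<open>\<open>pole_order\<close> is a maximum over the entries, so an entry with a pole has
  order at most \<open>p\<close> and the missing powers are put into \<open>h\<close>. An entry
  without a pole, not being essential, has a removable singularity.\<close>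

lemma pole_order_bound:
 fixes G :: "complex => complex^'d^'d"
 assumes iso: "isolated_singularity_at (%w. G w $ i $ k) z" and ness: "not_essential (%w. G w $ i $ k) z"
  and p: "pole_order G z <= p"
 shows "\<exists>h. h analytic_on {z} & (\<forall>\<^sub>F w in at z. G w $ i $ k = h w / (w - z) ^ p)"
proof (cases "is_pole (%w. G w $ i $ k) z")
 case True
 define f where "f w = G w $ i $ k" for w
 define ord where "ord j l = (if is_pole (%w. G w $ j $ l) z then nat (- zorder (%w. G w $ j $ l) z) else 0)" for j l
 have "ord i k <= (MAX (j, l)\<in>UNIV. ord j l)"
  by (rule Max_ge) (auto simp: image_iff)
 also have "... <= p" using p unfolding pole_order_def ord_def .
 finally have ord: "nat (- zorder f z) <= p"
  using True unfolding ord_def f_def by simp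
 obtain r where "r > 0" "f analytic_on ball z r - {z}" using iso unfolding isolated_singularity_at_def f_def by blast
 then have fh: "f holomorphic_on ball z r - {z}" by (simp add: analytic_imp_holomorphic)
 obtain s where s: "s > 0" "zor_poly f z holomorphic_on cball z s"
  "!!w. w \<in> cball z s - {z} ==> f w = zor_poly f z w / (w - z) ^ nat (- zorder f z)"
  using zorder_exist_pole[OF fh open_ball centre_in_ball[THEN iffD2, OF \<open>r > 0\<close>]] True unfolding f_def by blast
 define h where "h w = zor_poly f z w * (w - z) ^ (p - nat (- zorder f z))" for w
 have "h holomorphic_on ball z s" unfolding h_def
  by (intro holomorphic_intros holomorphic_on_subset[OF s(2)]) auto
 then have "h analytic_on {z}" using s(1) unfolding analytic_at by (intro exI[of _ "ball z s"]) auto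
 moreover have "\<forall>\<^sub>F w in at z. f w = h w / (w - z) ^ p"
  unfolding eventually_at
 proof (intro exI[of _ s] conjI ballI impI s(1))
  fix w assume "w \<noteq> z & dist w z < s"
  then have w: "w \<in> cball z s - {z}" "w - z \<noteq> 0" by (auto simp: dist_commute)
  have "(w - z) ^ p = (w - z) ^ (p - nat (- zorder f z)) * (w - z) ^ nat (- zorder f z)"
   using ord by (simp flip: power_add)
  then show "f w = h w / (w - z) ^ p" using s(3)[OF w(1)] w(2) by (simp add: h_def)
 qed
 ultimately show ?thesis unfolding f_def by blast
next
 case False
 then obtain c where "(%w. G w $ i $ k) \<midarrow>z\<rightarrow> c" using ness unfolding not_essential_def by blast
 then have an: "(%w. if w = z then c else G w $ i $ k) analytic_on {z}" by (rule removable_singularity'[OF iso])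
 define h where "h w = (if w = z then c else G w $ i $ k) * (w - z) ^ p" for w
 have "h analytic_on {z}" unfolding h_def by (intro analytic_intros an)
 moreover have "\<forall>\<^sub>F w in at z. G w $ i $ k = h w / (w - z) ^ p"
  using eventually_neq_at_within[of z] by eventually_elim (simp add: h_def)
 ultimately show ?thesis by blast
qed

lemma polar_expansion_exists:
 fixes G :: "complex => complex^'d^'d"
 assumes iso: "!!i k. isolated_singularity_at (%w. G w $ i $ k) z" and ness: "!!i k. not_essential (%w. G w $ i $ k) z"
  and p: "pole_order G z <= n + 1"
 shows "\<exists>K. polar_expansion G z n K"
proof -
 define P where "P i k K q \<longleftrightarrow> q analytic_on {z} & (\<forall>\<^sub>F w in at z. G w $ i $ k = (\<Sum>m\<le>n. fact m * K m / (w - z) ^ (m + 1)) + q w)" for i k K q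
 have "\<exists>K q. P i k K q" for i k
  using pole_order_bound[OF iso ness p, of i k] principal_part_exists[of _ z "%w. G w $ i $ k" n] unfolding P_def by blast
 then have "\<forall>i k. \<exists>K q. P i k K q" by blast
 then obtain K q where "\<forall>i k. P i k (K i k) (q i k)" unfolding choice_iff by blast
 then have "polar_expansion G z n (%m. \<chi> i k. K i k m)"
  unfolding polar_expansion_def P_def by (intro exI[of _ "%w. \<chi> i k. q i k w"]) simp
 then show ?thesis by blast
qed

text \<open>Multiplication by the highest power suppresses all other terms. In particular
  \<open>K n\<close> does not depend on which expansion is chosen.\<close>

lemma polar_expansion_limit:
 assumes "polar_expansion G z n K"
 shows "((%w. (w - z) ^ (n + 1) * G w $ i $ k) \<longlongrightarrow> fact n * K n $ i $ k) (at z)"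
proof -
 obtain q where q: "q analytic_on {z}"
  and G: "\<forall>\<^sub>F w in at z. G w $ i $ k = (\<Sum>m\<le>n. fact m * K m $ i $ k / (w - z) ^ (m + 1)) + q w"
  using assms unfolding polar_expansion_def by blast
 define f where "f w = (\<Sum>m\<le>n. fact m * K m $ i $ k * (w - z) ^ (n - m)) + (w - z) ^ (n + 1) * q w" for w
 have "isCont q z" using q by (simp add: analytic_at_imp_isCont)
 then have "isCont f z" unfolding f_def by (intro continuous_intros)
 then have lim: "(f \<longlongrightarrow> f z) (at z)" by (simp add: isCont_def)
 have "f z = (\<Sum>m\<in>{n}. fact m * K m $ i $ k)"
  unfolding f_def by (subst sum.mono_neutral_cong_right[of "{..n}" "{n}" _ "%m. fact m * K m $ i $ k"]) auto
 then have fz: "f z = fact n * K n $ i $ k" by simp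
 have "\<forall>\<^sub>F w in at z. f w = (w - z) ^ (n + 1) * G w $ i $ k"
  using G eventually_neq_at_within[of z]
 proof eventually_elim
  case (elim w)
  have "(w - z) ^ (n + 1) * (\<Sum>m\<le>n. fact m * K m $ i $ k / (w - z) ^ (m + 1)) = (\<Sum>m\<le>n. fact m * K m $ i $ k * (w - z) ^ (n - m))"
   unfolding sum_distrib_left
  proof (intro sum.cong refl)
   fix m assume "m \<in> {..n}"
   then have "(w - z) ^ (n + 1) = (w - z) ^ (n - m) * (w - z) ^ (m + 1)" by (simp flip: power_add)
   then show "(w - z) ^ (n + 1) * (fact m * K m $ i $ k / (w - z) ^ (m + 1)) = fact m * K m $ i $ k * (w - z) ^ (n - m)"
    using elim by simp
  qed
  then show ?case unfolding elim(1) f_def by (simp add: distrib_left)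
 qed
 from tendsto_cong[OF this] lim show ?thesis unfolding fz by simp
qed

text \<open>At a pole of order at most \<open>n\<close> the limit of
  \<open>polar_expansion_limit\<close> is 0. Hence rightmost roots outside
  \<open>leading_roots\<close> contribute nothing to the term with \<open>t ^ n\<close>.\<close>

lemma polar_expansion_lower_order:
 fixes G :: "complex => complex^'d^'d"
 assumes K: "polar_expansion G z n K"
  and iso: "!!i k. isolated_singularity_at (%w. G w $ i $ k) z" and ness: "!!i k. not_essential (%w. G w $ i $ k) z"
  and p: "pole_order G z <= n"
 shows "K n = 0"
proof -
 have "K n $ i $ k = 0" for i k
 proof -
  obtain h where h: "h analytic_on {z}" and G: "\<forall>\<^sub>F w in at z. G w $ i $ k = h w / (w - z) ^ n"
   using pole_order_bound[OF iso ness p, of i k] by blast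
  have "isCont h z" using h by (simp add: analytic_at_imp_isCont)
  then have "isCont (%w. (w - z) * h w) z" by (intro continuous_intros)
  then have "((%w. (w - z) * h w) \<longlongrightarrow> 0) (at z)" by (simp add: isCont_def)
  moreover have "\<forall>\<^sub>F w in at z. (w - z) * h w = (w - z) ^ (n + 1) * G w $ i $ k"
   using G eventually_neq_at_within[of z] by eventually_elim simp
  ultimately have "((%w. (w - z) ^ (n + 1) * G w $ i $ k) \<longlongrightarrow> 0) (at z)" using tendsto_cong by fast
  then have "fact n * K n $ i $ k = 0"
   using polar_expansion_limit[OF K, of i k] tendsto_unique[OF at_neq_bot] by blast
  then show ?thesis by simp
 qed
 then show ?thesis by (simp add: vec_eq_iff)
qed

section \<open>Roots of the characteristic determinant and asymptotics of the resolvent\<close>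

context delay_kernel
begin

text \<open>For large modulus the matrix is invertible, so these roots lie in a compact subset of
  the half-plane, where a nonconstant holomorphic function has only finitely many zeros. A constant
  determinant has none, being nonzero far to the right.\<close>

lemma finite_roots:
 assumes b: "a < b"
 shows "finite {z. Re z >= b & det (charm z) = 0}"
proof -
 obtain R0 where R0: "R0 > 0" "!!z. Re z >= a ==> norm z >= R0 ==> det (charm z) \<noteq> 0"
  using inv_charm_decay by metis
 define KK where "KK = {z. Re z >= b} \<inter> cball 0 R0"
 have sub: "{z. Re z >= b & det (charm z) = 0} \<subseteq> {z \<in> KK. det (charm z) = 0}"
  using R0(2) b unfolding KK_def by (auto simp: not_le less_imp_le) (meson linear order.strict_implies_order order_trans)
 show ?thesis
 proof (cases "(%z. det (charm z)) constant_on {z. Re z > a}")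
  case True
  define x where "x = complex_of_real (max (a + 1) R0)"
  have "det (charm x) \<noteq> 0" by (rule R0(2)) (auto simp: x_def)
  moreover have "x \<in> {z. Re z > a}" by (simp add: x_def)
  ultimately have "det (charm z) \<noteq> 0" if "Re z > a" for z
   using True that unfolding constant_on_def by force
  then have "{z. Re z >= b & det (charm z) = 0} = {}" using b by force
  then show ?thesis by (simp only: finite.emptyI)
 next
  case False
  have "compact KK" unfolding KK_def by (intro closed_Int_compact closed_halfspace_Re_ge compact_cball)
  moreover have "KK \<subseteq> {z. Re z > a}" using b by (auto simp: KK_def)
  ultimately have "finite {z \<in> KK. det (charm z) = 0}"
   using False by (intro holomorphic_compact_finite_zeros[OF det_charm_holomorphic open_halfspace_Re_gt]) (auto intro: convex_connected convex_halfspace_Re_gt)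
  then show ?thesis by (rule finite_subset[OF sub])
 qed
qed

text \<open>The other roots nearby are finitely many, so the point is isolated; as a quotient of
  analytic functions by Cramer's rule, the entry cannot have an essential singularity.\<close>

lemma inv_charm_singularity:
 assumes z: "Re z > a"
 shows "isolated_singularity_at (%w. matrix_inv (charm w) $ i $ k) z" "not_essential (%w. matrix_inv (charm w) $ i $ k) z"
proof -
 define b where "b = (a + Re z) / 2"
 have b: "a < b" "b < Re z" using z by (auto simp: b_def)
 define F where "F = {z. Re z >= b & det (charm z) = 0} - {z}"
 have F: "finite F" using finite_roots[OF b(1)] by (simp add: F_def)
 define U where "U = {z. Re z > b} - F"
 have U: "open U" "z \<in> U" using F b by (auto simp: U_def F_def intro!: open_Diff open_halfspace_Re_gt finite_imp_closed)
 have nz: "det (charm w) \<noteq> 0" if "w \<in> U - {z}" for w using that by (auto simp: U_def F_def)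
 have sub: "U \<subseteq> {z. Re z > a}" using b by (auto simp: U_def)
 have "(%w. matrix_inv (charm w) $ i $ k) holomorphic_on U - {z}"
  by (rule inv_charm_holomorphic) (use U sub nz in auto)
 then show iso: "isolated_singularity_at (%w. matrix_inv (charm w) $ i $ k) z"
  by (rule isolated_singularity_at_holomorphic[OF _ U])
 define N where "N w = det (\<chi> p q. if q = i then (if p = k then 1 else 0) else charm w $ p $ q)" for w
 have "N holomorphic_on {z. Re z > a}" unfolding N_def
 proof (rule det_holomorphic)
  fix p q
  show "(%z. (\<chi> p q. if q = i then (if p = k then 1 else 0) else charm z $ p $ q) $ p $ q) holomorphic_on {z. Re z > a}"
   using charm_holomorphic by (cases "q = i"; cases "p = k") simp_all
 qed
 then have Nan: "N analytic_on {z}" using z unfolding analytic_at by (intro exI[of _ "{z. Re z > a}"]) (auto simp: open_halfspace_Re_gt)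
 have Dan: "(%w. det (charm w)) analytic_on {z}"
  using z det_charm_holomorphic unfolding analytic_at by (intro exI[of _ "{z. Re z > a}"]) (auto simp: open_halfspace_Re_gt)
 have "not_essential (%w. N w / det (charm w)) z"
  by (intro not_essential_divide not_essential_analytic isolated_singularity_at_analytic Nan Dan)
 moreover have "\<forall>\<^sub>F w in at z. N w / det (charm w) = matrix_inv (charm w) $ i $ k"
 proof -
  have "\<forall>\<^sub>F w in at z. w \<in> U - {z}" using U by (intro eventually_at_in_open)
  then show ?thesis by eventually_elim (simp add: N_def matrix_inv_component[OF nz])
 qed
 ultimately show "not_essential (%w. matrix_inv (charm w) $ i $ k) z"
  using not_essential_cong[OF _ refl, of "%w. N w / det (charm w)" "%w. matrix_inv (charm w) $ i $ k" z] by blast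
qed

text \<open>Only finitely many roots lie to the right of \<open>b\<close>. The bound
  \<open>a1\<close> is the largest real part among them other than \<open>\<alpha>\<close>, or
  \<open>b\<close> if there is none.\<close>

lemma rightmost_gap:
 assumes "a < \<alpha>" and no: "!!z. Re z > \<alpha> ==> det (charm z) \<noteq> 0"
 obtains a1 where "a < a1" "a1 < \<alpha>" "!!z. Re z > a1 ==> det (charm z) = 0 ==> Re z = \<alpha>"
proof -
 define b where "b = (a + \<alpha>) / 2"
 have b: "a < b" "b < \<alpha>" using assms(1) by (auto simp: b_def)
 define F where "F = insert b (Re ` {z. Re z >= b & det (charm z) = 0} - {\<alpha>})"
 have F: "finite F" using finite_roots[OF b(1)] by (simp add: F_def)
 have lt: "x < \<alpha>" if "x \<in> F" for x
  using that b no by (fastforce simp: F_def not_le[symmetric])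
 show thesis
 proof (rule that[of "Max F"])
  show "a < Max F" using b F by (auto simp: Max_gr_iff F_def)
  show "Max F < \<alpha>" using lt F by (subst Max_less_iff) (auto simp: F_def)
  fix z assume z: "Re z > Max F" "det (charm z) = 0"
  have "b <= Max F" using F by (intro Max_ge) (auto simp: F_def)
  then have "Re z >= b" using z(1) by linarith
  moreover have "Re z \<notin> F" using Max_ge[OF F, of "Re z"] z(1) by linarith
  ultimately show "Re z = \<alpha>" using z(2) unfolding F_def by blast
 qed
qed

end

context delay_kernel
begin

lemma eventually_invertible:
 assumes z: "Re z > a"
 shows "\<forall>\<^sub>F w in at z. det (charm w) \<noteq> 0 & Re w > a"
proof -
 define b where "b = (a + Re z) / 2"
 have b: "a < b" "b < Re z" using z by (auto simp: b_def)
 define F where "F = {z. Re z >= b & det (charm z) = 0} - {z}"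
 have F: "finite F" using finite_roots[OF b(1)] by (simp add: F_def)
 have "open ({z. Re z > b} - F)" using F by (intro open_Diff open_halfspace_Re_gt finite_imp_closed)
 then have "\<forall>\<^sub>F w in at z. w \<in> ({z. Re z > b} - F) - {z}"
  by (rule eventually_at_in_open) (use b in \<open>auto simp: F_def\<close>)
 then show ?thesis by eventually_elim (use b in \<open>auto simp: F_def\<close>)
qed

lemma inv_charm_cnj:
 assumes "det (charm z) \<noteq> 0"
 shows "matrix_inv (charm (cnj z)) $ i $ k = cnj (matrix_inv (charm z) $ i $ k)"
proof -
 have d: "det (charm (cnj z)) \<noteq> 0" using assms by (simp add: det_charm_cnj)
 have "det (\<chi> p q. if q = i then (if p = k then 1 else 0) else charm (cnj z) $ p $ q) =
  cnj (det (\<chi> p q. if q = i then (if p = k then 1 else 0) else charm z $ p $ q))"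
  by (rule det_cnj) (simp add: charm_cnj)
 then show ?thesis unfolding matrix_inv_component[OF assms] matrix_inv_component[OF d] by (simp add: det_charm_cnj)
qed

text \<open>The sum over all roots on the line \<open>Re z = \<alpha>\<close> is folded onto those
  with \<open>Im z >= 0\<close> by conjugation. After division by
  \<open>t ^ n * exp (\<alpha> * t)\<close> the terms with \<open>m < n\<close> are of order
  \<open>1 / t\<close> and the remainder \<open>v\<close> is exponentially small.\<close>

lemma resolvent_asymptotics:
 fixes \<Delta> :: "complex => complex^'d^'d"
 assumes a: "a < \<alpha>" and no: "!!z. Re z > \<alpha> ==> det (charm z) \<noteq> 0"
  and \<Delta>: "!!z. Re z > a ==> \<Delta> z = charm z"
  and R: "rightmost_roots \<Lambda> = {z. Re z = \<alpha> & det (charm z) = 0 & Im z >= 0}"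
  and n: "n = leading_exponent \<Delta> \<Lambda>"
 obtains r C where "resolvent r" "finite (leading_roots \<Delta> \<Lambda>)"
  "!!t. t >= 0 ==> norm (r t) <= C * (1 + t) ^ n * exp (\<alpha> * t)"
  "((%t. r t /\<^sub>R (t ^ n * exp (\<alpha> * t)) -
    (\<Sum>z\<in>leading_roots \<Delta> \<Lambda>. sin (Im z * t) *\<^sub>R Q_star \<Delta> \<Lambda> z + cos (Im z * t) *\<^sub>R P_star \<Delta> \<Lambda> z)) \<longlongrightarrow> 0) at_top"
proof -
 define G where "G w = matrix_inv (\<Delta> w)" for w
 have Geq: "\<forall>\<^sub>F w in at z. G w = matrix_inv (charm w) & det (charm w) \<noteq> 0" if "Re z > a" for z
  using eventually_invertible[OF that] by eventually_elim (simp add: G_def \<Delta>)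
 have iso: "isolated_singularity_at (%w. G w $ i $ k) z" if "Re z > a" for z i k
 proof -
  have "\<forall>\<^sub>F w in at z. G w $ i $ k = matrix_inv (charm w) $ i $ k"
   using Geq[OF that] by eventually_elim simp
  then show ?thesis using isolated_singularity_at_cong[of "%w. G w $ i $ k" "%w. matrix_inv (charm w) $ i $ k" z z] inv_charm_singularity(1)[OF that] by blast
 qed
 have ness: "not_essential (%w. G w $ i $ k) z" if "Re z > a" for z i k
 proof -
  have "\<forall>\<^sub>F w in at z. G w $ i $ k = matrix_inv (charm w) $ i $ k"
   using Geq[OF that] by eventually_elim simp
  then show ?thesis using not_essential_cong[of "%w. G w $ i $ k" "%w. matrix_inv (charm w) $ i $ k" z z] inv_charm_singularity(2)[OF that] by blast
 qed
 obtain a1 where a1: "a < a1" "a1 < \<alpha>" "!!z. Re z > a1 ==> det (charm z) = 0 ==> Re z = \<alpha>"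
  by (rule rightmost_gap[OF a no]) blast+
 define S where "S = {z. Re z = \<alpha> & det (charm z) = 0}"
 have S: "finite S" "!!z. z \<in> S ==> Re z = \<alpha>"
  using finite_subset[OF _ finite_roots[OF a], of S] by (auto simp: S_def)
 define RR where "RR = rightmost_roots \<Lambda>"
 have RR: "RR = {z \<in> S. Im z >= 0}" unfolding RR_def R S_def by auto
 then have fRR: "finite RR" using S by simp
 have order: "pole_order G z <= n + 1" if "z \<in> RR" for z
 proof -
  have "pole_order G z <= (MAX z\<in>RR. pole_order G z)" using fRR that by (intro Max_ge) auto
  then show ?thesis unfolding n leading_exponent_def RR_def G_def[abs_def] by linarith
 qed
 define L where "L z = (SOME K. polar_expansion G z n K)" for z
 have L: "polar_expansion G z n (L z)" if "z \<in> RR" for z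
 proof -
  have "Re z > a" using that a S by (auto simp: RR)
  then have "\<exists>K. polar_expansion G z n K" using order[OF that] by (intro polar_expansion_exists iso ness)
  from someI_ex[OF this] show ?thesis unfolding L_def .
 qed
 have Lz: "leading_coeff_matrix \<Delta> \<Lambda> z = L z n" for z
  unfolding leading_coeff_matrix_def L_def n G_def[abs_def] Let_def by simp
 have L0: "L z n = 0" if "z \<in> RR" "z \<notin> leading_roots \<Delta> \<Lambda>" for z
 proof (rule polar_expansion_lower_order[OF L[OF that(1)] iso ness])
  show "Re z > a" "Re z > a" using that a S by (auto simp: RR)
  have "pole_order G z \<noteq> n + 1" using that unfolding leading_roots_def n G_def[abs_def] RR_def by auto
  then show "pole_order G z <= n" using order[OF that(1)] by simp
 qed
 \<comment> \<open>Expansions are chosen only at roots with \<open>Im z >= 0\<close>; below the real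
   axis the conjugate coefficients are taken, in accordance with \<open>charm_cnj\<close>.\<close>
 define K where "K i k z m = (if Im z >= 0 then L z m $ i $ k else cnj (L (cnj z) m $ i $ k))" for i k z m
 have Sc: "cnj z \<in> S" if "z \<in> S" for z using that by (simp add: S_def det_charm_cnj)
 have pol: "\<exists>q. q analytic_on {z} &
   (\<forall>\<^sub>F u in at z. matrix_inv (charm u) $ i $ k = (\<Sum>m\<le>n. fact m * K i k z m / (u - z) ^ (m + 1)) + q u)"
  if z: "z \<in> S" for z i k
 proof -
  have za: "Re z > a" "Re (cnj z) > a" using S(2)[OF z] a by auto
  have base: "\<exists>q. q analytic_on {z} & (\<forall>\<^sub>F u in at z. (matrix_inv (charm u) $ i $ k = (\<Sum>m\<le>n. fact m * L z m $ i $ k / (u - z) ^ (m + 1)) + q u) & det (charm u) \<noteq> 0)"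
   if z: "z \<in> RR" "Re z > a" for z
  proof -
   obtain q where q: "q analytic_on {z}" "\<forall>\<^sub>F w in at z. G w $ i $ k = (\<Sum>m\<le>n. fact m * L z m $ i $ k / (w - z) ^ (m + 1)) + q w"
    using L[OF z(1)] unfolding polar_expansion_def by blast
   have "\<forall>\<^sub>F u in at z. (matrix_inv (charm u) $ i $ k = (\<Sum>m\<le>n. fact m * L z m $ i $ k / (u - z) ^ (m + 1)) + q u) & det (charm u) \<noteq> 0"
    using q(2) Geq[OF z(2)] by eventually_elim simp
   then show ?thesis using q(1) by blast
  qed
  show ?thesis
  proof (cases "Im z >= 0")
   case True
   then have zR: "z \<in> RR" using z by (simp add: RR)
   obtain q where q: "q analytic_on {z}"
    and "\<forall>\<^sub>F u in at z. (matrix_inv (charm u) $ i $ k = (\<Sum>m\<le>n. fact m * L z m $ i $ k / (u - z) ^ (m + 1)) + q u) & det (charm u) \<noteq> 0"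
    using base[OF zR za(1)] by blast
   then have "\<forall>\<^sub>F u in at z. matrix_inv (charm u) $ i $ k = (\<Sum>m\<le>n. fact m * K i k z m / (u - z) ^ (m + 1)) + q u"
    using True by (elim eventually_mono) (simp add: K_def)
   then show ?thesis using q by blast
  next
   case False
   \<comment> \<open>The expansion at \<open>cnj z\<close> is reflected at the real axis; its
     analytic part becomes \<open>cnj \<circ> q \<circ> cnj\<close>, which is again
     analytic.\<close>
   then have zR: "cnj z \<in> RR" using Sc[OF z] by (simp add: RR)
   obtain q where q: "q analytic_on {cnj z}"
    and ev: "\<forall>\<^sub>F u in at (cnj z). (matrix_inv (charm u) $ i $ k = (\<Sum>m\<le>n. fact m * L (cnj z) m $ i $ k / (u - cnj z) ^ (m + 1)) + q u) & det (charm u) \<noteq> 0"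
    using base[OF zR za(2)] by blast
   obtain s where s: "open s" "cnj z \<in> s" "q holomorphic_on s" using q unfolding analytic_at by blast
   have cc: "cnj ` cnj ` s = s" by (auto simp: image_image)
   have "open (cnj ` s)" using s(1) unfolding image_cnj_conv_vimage_cnj by (intro open_vimage) auto
   moreover have "z \<in> cnj ` s" using s(2) by (metis complex_cnj_cnj imageI)
   moreover have "cnj \<circ> q \<circ> cnj holomorphic_on cnj ` s"
    by (rule holomorphic_on_compose_cnj_cnj) (use s(3) cc calculation in auto)
   ultimately have an: "(cnj \<circ> q \<circ> cnj) analytic_on {z}" unfolding analytic_at by blast
   obtain d where d: "d > 0" "!!u. u \<noteq> cnj z ==> dist u (cnj z) < d ==> (matrix_inv (charm u) $ i $ k = (\<Sum>m\<le>n. fact m * L (cnj z) m $ i $ k / (u - cnj z) ^ (m + 1)) + q u) & det (charm u) \<noteq> 0"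
    using ev unfolding eventually_at by blast
   have "matrix_inv (charm u) $ i $ k = (\<Sum>m\<le>n. fact m * K i k z m / (u - z) ^ (m + 1)) + (cnj \<circ> q \<circ> cnj) u"
    if u: "u \<noteq> z" "dist u z < d" for u
   proof -
    have "dist (cnj u) (cnj z) = dist u z" by (simp add: dist_norm flip: complex_cnj_diff)
    then have du: "matrix_inv (charm (cnj u)) $ i $ k = (\<Sum>m\<le>n. fact m * L (cnj z) m $ i $ k / (cnj u - cnj z) ^ (m + 1)) + q (cnj u)"
     "det (charm (cnj u)) \<noteq> 0" using d(2)[of "cnj u"] u by auto
    have "matrix_inv (charm u) $ i $ k = cnj (matrix_inv (charm (cnj u)) $ i $ k)"
     using inv_charm_cnj[OF du(2), of i k] by simp
    also have "... = (\<Sum>m\<le>n. fact m * K i k z m / (u - z) ^ (m + 1)) + (cnj \<circ> q \<circ> cnj) u"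
     unfolding du(1) using False by (simp add: K_def)
    finally show ?thesis .
   qed
   then have "\<forall>\<^sub>F u in at z. matrix_inv (charm u) $ i $ k = (\<Sum>m\<le>n. fact m * K i k z m / (u - z) ^ (m + 1)) + (cnj \<circ> q \<circ> cnj) u"
    unfolding eventually_at using d(1) by blast
   then show ?thesis using an by blast
  qed
 qed
 have roots: "z \<in> S" if "Re z > a1" "det (charm z) = 0" for z using a1(3)[OF that] that(2) by (simp add: S_def)
 obtain r v D a2 where r: "a2 < \<alpha>" "resolvent r"
  "!!t i k. r t $ i $ k = Re (exp_sum S n (K i k) t) + v i k t"
  "!!t i k. t >= 0 ==> \<bar>v i k t\<bar> <= D * exp (a2 * t)"
  by (rule resolvent_exists[OF a1(1,2) S roots pol]) blast+
 define c where "c t = (\<Sum>z\<in>leading_roots \<Delta> \<Lambda>. sin (Im z * t) *\<^sub>R Q_star \<Delta> \<Lambda> z + cos (Im z * t) *\<^sub>R P_star \<Delta> \<Lambda> z)" for t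
 have LR: "leading_roots \<Delta> \<Lambda> \<subseteq> RR" by (auto simp: leading_roots_def RR_def)
 have fin: "finite (leading_roots \<Delta> \<Lambda>)" using finite_subset[OF LR fRR] .
 have lead: "Re (\<Sum>z\<in>S. K i k z n * exp (z * of_real t)) = exp (\<alpha> * t) * c t $ i $ k" for i k t
 proof -
  define g where "g z = Re (K i k z n * exp (z * of_real t))" for z
  define RP where "RP = {z \<in> RR. Im z > 0}"
  have "Re (\<Sum>z\<in>S. K i k z n * exp (z * of_real t)) = sum g S" by (simp add: g_def)
  also have "sum g S = sum g (RR \<union> cnj ` RP)"
  proof (rule arg_cong[of _ _ "sum g"])
   have "z \<in> cnj ` RP" if "z \<in> S" "\<not> Im z >= 0" for z
   proof
    show "z = cnj (cnj z)" by simp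
    show "cnj z \<in> RP" using that Sc by (simp add: RP_def RR)
   qed
   then show "S = RR \<union> cnj ` RP" using Sc by (auto simp: RP_def RR)
  qed
  also have "... = sum g RR + sum g (cnj ` RP)"
  proof (rule sum.union_disjoint)
   show "finite (cnj ` RP)" using fRR by (simp add: RP_def)
  qed (use fRR in \<open>auto simp: RP_def RR\<close>)
  also have "sum g (cnj ` RP) = sum g RP"
  proof (subst sum.reindex)
   show "inj_on cnj RP" by (auto intro: inj_onI)
   have "g (cnj z) = g z" if "z \<in> RP" for z
   proof -
    have "K i k (cnj z) n * exp (cnj z * of_real t) = cnj (K i k z n * exp (z * of_real t))"
     using that by (simp add: K_def RP_def exp_cnj)
    then show ?thesis by (simp only: g_def cnj.sel)
   qed
   then show "sum (g \<circ> cnj) RP = sum g RP" by (intro sum.cong) auto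
  qed
  also have "sum g RP = (\<Sum>z\<in>RR. if Im z > 0 then g z else 0)"
   using fRR by (simp add: RP_def sum.inter_filter)
  finally have "Re (\<Sum>z\<in>S. K i k z n * exp (z * of_real t)) = (\<Sum>z\<in>RR. g z + (if Im z > 0 then g z else 0))"
   by (simp add: sum.distrib)
  also have "... = (\<Sum>z\<in>RR. exp (\<alpha> * t) * (sin (Im z * t) * Q_star \<Delta> \<Lambda> z $ i $ k + cos (Im z * t) * P_star \<Delta> \<Lambda> z $ i $ k))"
  proof (intro sum.cong refl)
   fix z assume z: "z \<in> RR"
   then have z': "Re z = \<alpha>" "Im z >= 0" using S by (auto simp: RR)
   have "g z = exp (\<alpha> * t) * (Re (L z n $ i $ k) * cos (Im z * t) - Im (L z n $ i $ k) * sin (Im z * t))"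
    using z' by (simp add: g_def K_def Re_exp Im_exp algebra_simps)
   \<comment> \<open>A root off the real axis counts twice, for itself and for its conjugate. This
     is the factor 2 in \<open>P_star\<close> and \<open>Q_star\<close>; the minus sign in
     \<open>Q_star\<close> comes from the real part of a product.\<close>
   then show "g z + (if Im z > 0 then g z else 0) = exp (\<alpha> * t) * (sin (Im z * t) * Q_star \<Delta> \<Lambda> z $ i $ k + cos (Im z * t) * P_star \<Delta> \<Lambda> z $ i $ k)"
    using z'(2) by (cases "Im z = 0") (simp_all add: P_star_def Q_star_def Lz complex_is_Real_iff algebra_simps)
  qed
  also have "... = exp (\<alpha> * t) * (\<Sum>z\<in>RR. sin (Im z * t) * Q_star \<Delta> \<Lambda> z $ i $ k + cos (Im z * t) * P_star \<Delta> \<Lambda> z $ i $ k)"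
   by (simp only: sum_distrib_left)
  also have "(\<Sum>z\<in>RR. sin (Im z * t) * Q_star \<Delta> \<Lambda> z $ i $ k + cos (Im z * t) * P_star \<Delta> \<Lambda> z $ i $ k) =
   (\<Sum>z\<in>leading_roots \<Delta> \<Lambda>. sin (Im z * t) * Q_star \<Delta> \<Lambda> z $ i $ k + cos (Im z * t) * P_star \<Delta> \<Lambda> z $ i $ k)"
   \<comment> \<open>Roots of lower order have a vanishing coefficient by \<open>L0\<close>, so they
     may be dropped from the sum.\<close>
   using fRR LR L0 by (intro sum.mono_neutral_right) (auto simp: P_star_def Q_star_def Lz)
  also have "... = c t $ i $ k" by (simp add: c_def)
  finally show ?thesis .
 qed
 have D0: "D >= 0" using order_trans[OF abs_ge_zero r(4)[of 0]] by simp
 define CK where "CK i k = (\<Sum>z\<in>S. \<Sum>m\<le>n. norm (K i k z m))" for i k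
 have CK0: "CK i k >= 0" for i k unfolding CK_def by (intro sum_nonneg) auto
 \<comment> \<open>The factor \<open>(1 + t) ^ n\<close>, in place of \<open>t ^ n\<close>,
   dominates all lower powers also for small \<open>t\<close>.\<close>
 have bd: "\<bar>r t $ i $ k\<bar> <= (CK i k + D) * ((1 + t) ^ n * exp (\<alpha> * t))" if t: "t >= 0" for t i k
 proof -
  have "\<bar>Re (exp_sum S n (K i k) t)\<bar> <= norm (exp_sum S n (K i k) t)"
   by (rule abs_Re_le_cmod)
  also have "... <= (\<Sum>z\<in>S. \<Sum>m\<le>n. norm (K i k z m) * ((1 + t) ^ n * exp (\<alpha> * t)))"
  proof (intro order_trans[OF norm_sum] sum_mono)
   fix z m assume z: "z \<in> S" and m: "m \<in> {..n}"
   have "t ^ m <= (1 + t) ^ m" using t by (intro power_mono) auto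
   also have "... <= (1 + t) ^ n" using m t by (intro power_increasing) auto
   finally show "norm (K i k z m * exp_poly m z t) <= norm (K i k z m) * ((1 + t) ^ n * exp (\<alpha> * t))"
    using t S(2)[OF z] by (simp add: norm_mult norm_power mult_left_mono mult_right_mono)
  qed
  also have "... = CK i k * ((1 + t) ^ n * exp (\<alpha> * t))" by (simp add: CK_def sum_distrib_right)
  finally have 1: "\<bar>Re (exp_sum S n (K i k) t)\<bar> <= CK i k * ((1 + t) ^ n * exp (\<alpha> * t))" .
  have "1 * exp (a2 * t) <= (1 + t) ^ n * exp (\<alpha> * t)"
   using t r(1) by (intro mult_mono) (auto intro: one_le_power mult_right_mono)
  then have "D * exp (a2 * t) <= D * ((1 + t) ^ n * exp (\<alpha> * t))" using D0 by (intro mult_left_mono) auto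
  then show ?thesis using 1 r(4)[OF t, of i k] unfolding r(3) distrib_right by linarith
 qed
 define C where "C = (\<Sum>i\<in>UNIV. \<Sum>k\<in>UNIV. CK i k + D)"
 have growth: "norm (r t) <= C * (1 + t) ^ n * exp (\<alpha> * t)" if t: "t >= 0" for t
 proof -
  have "norm (r t) <= (\<Sum>i\<in>UNIV. \<Sum>k\<in>UNIV. norm (r t $ i $ k))" by (rule matrix_norm_le_sum)
  also have "... <= (\<Sum>i\<in>UNIV. \<Sum>k\<in>UNIV. (CK i k + D) * ((1 + t) ^ n * exp (\<alpha> * t)))"
   using bd[OF t] by (intro sum_mono) simp
  finally show ?thesis by (simp add: C_def sum_distrib_right mult.assoc)
 qed
 have lim: "((%t. r t /\<^sub>R (t ^ n * exp (\<alpha> * t)) - c t) \<longlongrightarrow> 0) at_top"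
 proof (intro vec_tendstoI)
  fix i k
  have "\<forall>\<^sub>F t in at_top. norm ((r t /\<^sub>R (t ^ n * exp (\<alpha> * t)) - c t) $ i $ k) <= CK i k / t + D * exp (- (\<alpha> - a2) * t)"
   using eventually_ge_at_top[of 1]
  proof eventually_elim
   case (elim t)
   define E where "E = t ^ n * exp (\<alpha> * t)"
   have E: "E > 0" using elim by (simp add: E_def)
   \<comment> \<open>The terms with \<open>m < n\<close>: each lacks at least one factor
     \<open>t\<close>, hence is at most a multiple of \<open>E / t\<close>.\<close>
   define rest where "rest = Re (\<Sum>z\<in>S. \<Sum>m<n. K i k z m * exp_poly m z t)"
   have "Re (exp_sum S n (K i k) t) = rest + t ^ n * Re (\<Sum>z\<in>S. K i k z n * exp (z * of_real t))"
   proof -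
    have "(exp_sum S n (K i k) t) = (\<Sum>z\<in>S. \<Sum>m<n. K i k z m * exp_poly m z t) + of_real (t ^ n) * (\<Sum>z\<in>S. K i k z n * exp (z * of_real t))"
     by (simp add: lessThan_Suc_atMost[symmetric] sum.distrib sum_distrib_left mult_ac)
    moreover have "Re (of_real x * y) = x * Re y" for x y by simp
    ultimately show ?thesis by (simp only: rest_def plus_complex.sel)
   qed
   then have "r t $ i $ k = rest + E * c t $ i $ k + v i k t" unfolding r(3) lead by (simp add: E_def)
   then have eq: "(r t /\<^sub>R E - c t) $ i $ k = rest / E + v i k t / E" using E by (simp add: field_simps)
   have "\<bar>rest\<bar> <= norm (\<Sum>z\<in>S. \<Sum>m<n. K i k z m * exp_poly m z t)"
    unfolding rest_def by (rule abs_Re_le_cmod)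
   also have "... <= (\<Sum>z\<in>S. \<Sum>m<n. norm (K i k z m) * (E / t))"
   proof (intro order_trans[OF norm_sum] sum_mono)
    fix z m assume z: "z \<in> S" and m: "m \<in> {..<n}"
    have "t ^ m * t = t ^ Suc m" by simp
    also have "... <= t ^ n" using m elim by (intro power_increasing) auto
    finally have "t ^ m <= t ^ n / t" using elim by (simp add: field_simps)
    then have "t ^ m * exp (\<alpha> * t) <= t ^ n / t * exp (\<alpha> * t)" by (intro mult_right_mono) auto
    then have "t ^ m * exp (\<alpha> * t) <= E / t" by (simp add: E_def)
    then have "norm (K i k z m) * (t ^ m * exp (\<alpha> * t)) <= norm (K i k z m) * (E / t)" by (intro mult_left_mono) auto
    then show "norm (K i k z m * exp_poly m z t) <= norm (K i k z m) * (E / t)"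
     using elim S(2)[OF z] by (simp add: norm_mult norm_power)
   qed
   also have "... = (\<Sum>z\<in>S. \<Sum>m<n. norm (K i k z m)) * (E / t)" by (simp only: sum_distrib_right)
   also have "... <= CK i k * (E / t)"
    unfolding CK_def using E elim by (intro mult_right_mono sum_mono sum_mono2) auto
   finally have 1: "\<bar>rest\<bar> / E <= CK i k / t" using E elim by (simp add: field_simps)
   have "\<bar>v i k t\<bar> / E <= D * exp (a2 * t) / E" using r(4)[of t i k] elim E by (intro divide_right_mono) auto
   also have "... <= D * exp (a2 * t) / exp (\<alpha> * t)"
    using elim D0 E by (intro divide_left_mono) (auto simp: E_def one_le_power)
   also have "... = D * exp (- (\<alpha> - a2) * t)" by (simp add: exp_diff left_diff_distrib)
   finally have 2: "\<bar>v i k t\<bar> / E <= D * exp (- (\<alpha> - a2) * t)" .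
   have "norm ((r t /\<^sub>R E - c t) $ i $ k) <= \<bar>rest\<bar> / E + \<bar>v i k t\<bar> / E"
    unfolding eq using abs_triangle_ineq[of "rest / E" "v i k t / E"] E by simp
   then show ?case using 1 2 unfolding E_def by linarith
  qed
  moreover have "((%t. CK i k / t + D * exp (- (\<alpha> - a2) * t)) \<longlongrightarrow> 0) at_top"
   using r(1) by real_asymp
  ultimately show "((%t. (r t /\<^sub>R (t ^ n * exp (\<alpha> * t)) - c t) $ i $ k) \<longlongrightarrow> 0 $ i $ k) at_top"
   unfolding zero_index by (rule Lim_null_comparison)
 qed
 show thesis by (rule that[OF r(2) fin growth lim[unfolded c_def]])
qed

end

section \<open>Representation of solutions by the resolvent\<close>

lemma integrable_vec:
 fixes f :: "'a => real^'d"
 assumes "!!i. integrable M (%x. f x $ i)"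
 shows "integrable M f"
proof -
 have "integrable M (%x. \<Sum>i\<in>UNIV. (f x $ i) *\<^sub>R (axis i 1 :: real^'d))"
  by (intro bochner_isum integrable_scaleR_left assms)
 moreover have "(\<Sum>i\<in>UNIV. (f x $ i) *\<^sub>R (axis i 1 :: real^'d)) = f x" for x
  using basis_expansion[of "f x"] by (simp add: scalar_mult_eq_scaleR)
 ultimately show ?thesis by (simp only:)
qed

lemma set_integrable_vec:
 fixes f :: "'a => real^'d"
 assumes "!!i. set_integrable M A (%x. f x $ i)"
 shows "set_integrable M A f"
 using assms unfolding set_integrable_def by (intro integrable_vec) simp

lemma set_integrable_vec_nth:
 fixes f :: "'a => 'b::euclidean_space^'d"
 assumes "set_integrable M A f"
 shows "set_integrable M A (%x. f x $ i)"
 using integrable_bounded_linear[OF bounded_linear_vec_nth assms[unfolded set_integrable_def]] unfolding set_integrable_def by simp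

lemma set_integral_vec_nth:
 fixes f :: "'a => 'b::euclidean_space^'d"
 assumes "set_integrable M A f"
 shows "(LINT x:A|M. f x) $ i = (LINT x:A|M. f x $ i)"
 using integral_bounded_linear[OF bounded_linear_vec_nth assms[unfolded set_integrable_def], of i] unfolding set_lebesgue_integral_def by simp

lemma borel_measurable_vec_nth:
 fixes f :: "'a => 'b::euclidean_space^'d"
 assumes "f \<in> borel_measurable M"
 shows "(%x. f x $ i) \<in> borel_measurable M"
 by (rule measurable_compose[OF assms]) (intro borel_measurable_continuous_onI continuous_on_component continuous_on_id)

lemma (in delay_kernel) kconv_cong:
 assumes "!!u. 0 <= u ==> u <= t ==> f u = g u"
 shows "kconv f j k t = kconv g j k t"
 unfolding kconv_def
proof (rule bochner_cong[OF refl])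
 fix x
 show "indicator {..t} x * (f (t - x) * w x $ j $ k) = indicator {..t} x * (g (t - x) * w x $ j $ k)"
  using assms[of "t - x"] w_neg[of x] by (cases "x < 0") (auto simp: indicator_def)
qed

locale delayed_brownian = brownian M \<F> B + K: delay_kernel L w a
 for M :: "'a measure" and \<F> and B :: "real => 'a => real^'e" and L and w :: "real => real^'d^'d" and a
begin

text \<open>Collects what the stochastic Fubini theorem asks of the density \<open>\<rho>\<close> of
  \<open>r - mat 1\<close>.\<close>

lemma resolvent_kernel:
 assumes "K.resolvent r"
 defines "\<rho> \<equiv> %s. \<chi> i j. \<Sum>l\<in>UNIV. K.kconv (%s. r s $ i $ l) l j s"
 shows "\<rho> \<in> borel_measurable borel" "\<exists>C. \<forall>s\<in>{0..t}. norm (\<rho> s) <= C" "set_integrable lborel {0..t} \<rho>"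
  "t >= 0 ==> r t = mat 1 + (LBINT s:{0..t}. \<rho> s)"
proof -
 have rc: "continuous_on UNIV r" using assms by (simp add: K.resolvent_def)
 have rm: "(%s. r s $ i $ j) \<in> borel_measurable borel" for i j
  by (intro borel_measurable_continuous_onI continuous_on_component rc)
 have \<rho>n: "\<rho> s $ i $ j = (\<Sum>l\<in>UNIV. K.kconv (%s. r s $ i $ l) l j s)" for s i j by (simp add: \<rho>_def)
 have cm: "(%s. \<rho> s $ i $ j) \<in> borel_measurable borel" for i j
  unfolding \<rho>n by (intro borel_measurable_sum K.kconv_measurable rm)
 show m: "\<rho> \<in> borel_measurable borel"
  using cm by (subst borel_measurable_euclidean_space) (auto simp: Basis_vec_def inner_axis)
 obtain Cr where Cr: "!!s. 0 <= s ==> s <= t ==> norm (r s) <= Cr"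
  using continuous_on_Icc_bounded[OF continuous_on_subset[OF rc subset_UNIV]] by blast
 have rb: "\<bar>r s $ i $ j\<bar> <= Cr" if "0 <= s" "s <= t" for s i j
  using matrix_component_le_norm[of "r s" i j] Cr[OF that] by simp
 have cb: "\<bar>\<rho> s $ i $ j\<bar> <= (\<Sum>l\<in>(UNIV::'d set). \<bar>Cr\<bar> * exp (\<bar>a\<bar> * t) * K.W)" if s: "s \<in> {0..t}" for s i j
 proof -
  have "\<bar>\<rho> s $ i $ j\<bar> <= (\<Sum>l\<in>UNIV. \<bar>K.kconv (%s. r s $ i $ l) l j s\<bar>)" unfolding \<rho>n by (rule sum_abs)
  also have "... <= (\<Sum>l\<in>(UNIV::'d set). \<bar>Cr\<bar> * exp (\<bar>a\<bar> * t) * K.W)"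
   by (intro sum_mono K.kconv_bound_Icc rm rb) (use s in auto)
  finally show ?thesis .
 qed
 define C where "C = (\<Sum>i\<in>(UNIV::'d set). \<Sum>j\<in>(UNIV::'d set). \<Sum>l\<in>(UNIV::'d set). \<bar>Cr\<bar> * exp (\<bar>a\<bar> * t) * K.W)"
 have b: "norm (\<rho> s) <= C" if s: "s \<in> {0..t}" for s
 proof -
  have "norm (\<rho> s) <= (\<Sum>i\<in>UNIV. \<Sum>j\<in>UNIV. norm (\<rho> s $ i $ j))" by (rule matrix_norm_le_sum)
  also have "... <= C" unfolding C_def using cb[OF s] by (intro sum_mono) simp
  finally show ?thesis .
 qed
 then show "\<exists>C. \<forall>s\<in>{0..t}. norm (\<rho> s) <= C" by blast
 show i: "set_integrable lborel {0..t} \<rho>" by (rule set_integrable_bounded[OF m b])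
 show "r t = mat 1 + (LBINT s:{0..t}. \<rho> s)" if "t >= 0"
 proof -
  have "r t $ i $ j = (mat 1 + (LBINT s:{0..t}. \<rho> s)) $ i $ j" for i j
   using assms(1) that by (simp add: K.resolvent_def set_integral_vec_nth[OF i] set_integral_vec_nth[OF set_integrable_vec_nth[OF i]] \<rho>n mat_def)
  then show ?thesis by (simp add: vec_eq_iff)
 qed
qed

end

context delayed_brownian
begin

text \<open>Along a continuous path the equation is deterministic with the forcing
  \<open>X0 + F + Y\<close>, where \<open>Y\<close> stands for the stochastic integral. Variation of
  constants applies path by path, and only the contribution of \<open>Y\<close> calls for the
  stochastic Fubini theorem.\<close>

lemma solution_representation:
 fixes X :: "real => 'a => real^'d" and f :: "real => real^'d" and \<Sigma> :: "real => real^'e^'d"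
 assumes r: "K.resolvent r"
  and f: "!!t. set_integrable lborel {0..t} f" and \<Sigma>: "continuous_on {0..} \<Sigma>"
  and Xc: "AE y in M. continuous_on {0..} (%t. X t y)"
  and eq: "!!t. t >= 0 ==> AE y in M. X t y = X0 y
    + (LBINT s:{0..t}. f s + (\<chi> i. \<Sum>k\<in>UNIV. K.kconv (%u. X u y $ k) i k s))
    + ito_integral M \<F> B (%s y. indicator {0..t} s *\<^sub>R \<Sigma> s) y"
  and t: "t >= 0"
 shows "AE y in M. X t y = r t *v X0 y + (LBINT s:{0..t}. r (t - s) *v f s)
    + ito_integral M \<F> B (%s y. indicator {0..t} s *\<^sub>R (r (t - s) ** \<Sigma> s)) y"
proof -
 define X' where "X' s y = indicator {0..} s *\<^sub>R X s y" for s y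
 let ?good = "%y. continuous_on {0..} (%t. X t y)"
 have X'm: "(%s. X' s y $ k) \<in> borel_measurable borel" if "?good y" for y k
  unfolding X'_def by (intro borel_measurable_vec_nth borel_measurable_continuous_on_indicator that) simp
 have bddn: "\<exists>C. \<forall>s k. 0 <= s \<longrightarrow> s <= T \<longrightarrow> \<bar>h s $ k\<bar> <= C" if "continuous_on {0..} h" for h :: "real => real^'d" and T
 proof -
  have "continuous_on {0..T} h" by (rule continuous_on_subset[OF that]) auto
  then obtain C where C: "!!s. 0 <= s ==> s <= T ==> norm (h s) <= C" using continuous_on_Icc_bounded by blast
  have "\<bar>h s $ k\<bar> <= C" if "0 <= s" "s <= T" for s k
   using component_le_norm_cart[of "h s" k] C[OF that] by simp
  then show ?thesis by blast
 qed
 have X'b: "\<exists>C. \<forall>s k. 0 <= s \<longrightarrow> s <= T \<longrightarrow> \<bar>X' s y $ k\<bar> <= C" if "?good y" for y T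
  using bddn[OF that, of T] by (simp add: X'_def)
 define u where "u y i s = (\<Sum>k\<in>UNIV. K.kconv (%u. X' u y $ k) i k s)" for y i s
 have ui: "set_integrable lborel {0..T} (u y i)" if w: "?good y" for y i T
 proof -
  obtain C where C: "!!s k. 0 <= s ==> s <= T ==> \<bar>X' s y $ k\<bar> <= C" using X'b[OF w, of T] by blast
  have "set_integrable lborel {0..T} (K.kconv (%u. X' u y $ k) i k)" for k
   by (rule set_integrable_bounded[OF K.kconv_measurable[OF X'm[OF w]]])
    (use K.kconv_bound_Icc[OF X'm[OF w] C] in auto)
  then show ?thesis unfolding u_def[abs_def] set_integrable_def scaleR_sum_right by (intro bochner_isum)
 qed
 define U where "U T y = (\<chi> i. LBINT s:{0..T}. u y i s)" for T y
 define F where "F T = (LBINT s:{0..T}. f s)" for T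
 \<comment> \<open>A version of the stochastic integral that is continuous in time because it is
   defined through the continuous solution.\<close>
 define Y where "Y T y = X T y - X0 y - F T - U T y" for T y
 have fi: "set_integrable lborel {0..T} (%s. f s $ i)" for T i by (rule set_integrable_vec_nth[OF f])
 have Fi: "F T $ i = (LBINT s:{0..T}. f s $ i)" for T i unfolding F_def by (rule set_integral_vec_nth[OF f])
 have Fc: "continuous_on {0..} (%T. F T $ i)" for i unfolding Fi by (rule continuous_indefinite_integral[OF fi])
 have Fc': "continuous_on {0..} F" using continuous_on_vec_lambda[of "{0..}" "%i T. F T $ i", OF Fc] by simp
 have Yc: "continuous_on {0..} (%T. Y T y)" if w: "?good y" for y
  unfolding Y_def U_def
  by (intro continuous_intros w Fc' continuous_on_vec_lambda continuous_indefinite_integral ui[OF w])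
 have Yito: "AE y in M. Y s y = ito_integral M \<F> B (%u y. indicator {0..s} u *\<^sub>R \<Sigma> u) y" if s: "s >= 0" for s
  using eq[OF s] Xc
 proof eventually_elim
  case (elim y)
  have kc: "K.kconv (%u. X u y $ k) i k v = K.kconv (%u. X' u y $ k) i k v" for i k v
   by (rule K.kconv_cong) (simp add: X'_def)
  have ui': "set_integrable lborel {0..s} (%v. \<chi> i. u y i v)" using ui[OF elim(2)] by (intro set_integrable_vec) simp
  have "(LBINT v:{0..s}. f v + (\<chi> i. \<Sum>k\<in>UNIV. K.kconv (%u. X u y $ k) i k v)) = F s + (LBINT v:{0..s}. (\<chi> i. u y i v))"
   unfolding kc u_def[symmetric] F_def by (rule set_integral_add(2)[OF f ui'])
  also have "(LBINT v:{0..s}. (\<chi> i. u y i v)) = U s y"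
   by (simp add: vec_eq_iff U_def set_integral_vec_nth[OF ui'])
  finally show ?case using elim(1) by (simp add: Y_def)
 qed
 define \<rho> where "\<rho> s = (\<chi> i j. \<Sum>l\<in>UNIV. K.kconv (%s. r s $ i $ l) l j s)" for s
 have \<rho>: "\<rho> \<in> borel_measurable borel" "\<exists>C. \<forall>s\<in>{0..T}. norm (\<rho> s) <= C" "set_integrable lborel {0..T} \<rho>"
  "T >= 0 ==> r T = mat 1 + (LBINT s:{0..T}. \<rho> s)" for T
  unfolding \<rho>_def[abs_def] by (rule resolvent_kernel[OF r])+
 obtain C\<rho> where C\<rho>: "!!s. s \<in> {0..t} ==> norm (\<rho> s) <= C\<rho>" using \<rho>(2)[of t] by blast
 have C\<rho>0: "C\<rho> >= 0" using order_trans[OF norm_ge_zero C\<rho>[of 0]] t by simp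
 \<comment> \<open>The cut-off makes the density bounded on the whole line, as
   \<open>stochastic_fubini\<close> requires, without changing it on \<open>[0, t]\<close>.\<close>
 define \<rho>' where "\<rho>' s = indicator {0..t} s *\<^sub>R \<rho> s" for s
 have \<rho>'m: "\<rho>' \<in> borel_measurable borel" unfolding \<rho>'_def[abs_def] using \<rho>(1) by measurable
 have \<rho>'b: "norm (\<rho>' s) <= C\<rho>" for s using C\<rho>[of s] C\<rho>0 by (simp add: \<rho>'_def indicator_def)
 have rc: "continuous_on UNIV r" using r by (simp add: K.resolvent_def)
 have rt: "r (t - s) = mat 1 + (LBINT v:{s..t}. \<rho>' (t - v))" if "0 <= s" "s <= t" for s
 proof -
  have "(LBINT v:{s..t}. \<rho>' (t - v)) = (LBINT v:{0..t-s}. \<rho>' v)" by (rule set_lborel_reflect)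
  also have "... = (LBINT v:{0..t-s}. \<rho> v)"
   by (rule set_lebesgue_integral_cong) (use that in \<open>auto simp: \<rho>'_def\<close>)
  finally show ?thesis using \<rho>(4)[of "t - s"] that by simp
 qed
 have SF: "AE y in M. Y t y + (LBINT s:{0..t}. \<rho>' (t - s) *v Y s y) = ito_integral M \<F> B (%u y. indicator {0..t} u *\<^sub>R (r (t - u) ** \<Sigma> u)) y"
 proof (rule stochastic_fubini[OF t _ \<rho>'m \<rho>'b _ Yito])
  show "AE y in M. continuous_on {0..t} (%s. Y s y)"
   using Xc by eventually_elim (rule continuous_on_subset[OF Yc], auto)
  show "continuous_on {0..t} \<Sigma>" by (rule continuous_on_subset[OF \<Sigma>]) auto
  show "continuous_on {0..t} (%u. r (t - u))"
   by (intro continuous_on_compose2[OF rc] continuous_intros) auto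
 qed (use rt in auto)
 have main: "X t y = r t *v X0 y + (LBINT s:{0..t}. r (t - s) *v f s) + (Y t y + (LBINT s:{0..t}. \<rho>' (t - s) *v Y s y))"
  if w: "?good y" for y
 proof -
  define H where "H s = indicator {0..} s *\<^sub>R (X0 y + F s + Y s y)" for s
  have Hc: "continuous_on {0..} (%s. X0 y + F s + Y s y)" by (intro continuous_intros Fc' Yc w)
  have Hm: "(%s. H s $ k) \<in> borel_measurable borel" for k
   unfolding H_def by (intro borel_measurable_vec_nth borel_measurable_continuous_on_indicator Hc) simp
  obtain CX where CX: "!!s k. 0 <= s ==> s <= t ==> \<bar>X' s y $ k\<bar> <= CX" using X'b[OF w, of t] by blast
  obtain CH where CH0: "!!s k. 0 <= s ==> s <= t ==> \<bar>(X0 y + F s + Y s y) $ k\<bar> <= CH" using bddn[OF Hc, of t] by blast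
  have CH: "\<bar>H s $ k\<bar> <= CH" if "0 <= s" "s <= t" for s k using CH0[OF that, of k] that by (simp add: H_def)
  have voc: "X' t y $ i = H t $ i + (LBINT s:{0..t}. \<Sum>j\<in>UNIV. (\<Sum>l\<in>UNIV. K.kconv (%s. r s $ i $ l) l j (t - s)) * H s $ j)" for i
  proof (rule K.variation_of_constants[OF r t X'm[OF w] CX Hm CH])
   fix s i assume s: "0 <= s" "s <= t"
   show "X' s y $ i = H s $ i + (LBINT \<tau>:{0..s}. \<Sum>k\<in>UNIV. K.kconv (%s. X' s y $ k) i k \<tau>)"
    using s by (simp add: X'_def H_def Y_def U_def u_def)
  qed
  have \<rho>n: "\<rho> s $ i $ j = (\<Sum>l\<in>UNIV. K.kconv (%s. r s $ i $ l) l j s)" for s i j by (simp add: \<rho>_def)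
  have \<rho>nm: "(%s. \<rho> s $ i $ j) \<in> borel_measurable borel" for i j
   by (intro borel_measurable_vec_nth \<rho>(1))
  have \<rho>nb: "\<bar>\<rho> s $ i $ j\<bar> <= C\<rho>" if "s \<in> {0..t}" for s i j
   using C\<rho>[OF that] matrix_component_le_norm[of "\<rho> s" i j] by simp
  have pint: "set_integrable lborel {0..t} (%s. \<rho> (t - s) $ i $ j * h s)"
   if hm: "h \<in> borel_measurable borel" and hb: "!!s. 0 <= s ==> s <= t ==> \<bar>h s\<bar> <= C" for h :: "real => real" and C i j
  proof (rule set_integrable_bounded[where C="C\<rho> * C"])
   show "(%s. \<rho> (t - s) $ i $ j * h s) \<in> borel_measurable borel" using hm \<rho>nm[of i j] by measurable
   fix s assume "s \<in> {0..t}"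
   then show "norm (\<rho> (t - s) $ i $ j * h s) <= C\<rho> * C"
    using \<rho>nb[of "t - s" i j] hb[of s] C\<rho>0 by (auto simp: abs_mult intro!: mult_mono)
  qed
  have "X' t y $ i = (r t *v X0 y + (LBINT s:{0..t}. r (t - s) *v f s) + (Y t y + (LBINT s:{0..t}. \<rho>' (t - s) *v Y s y))) $ i" for i
  proof -
   obtain CF where CF: "!!s k. 0 <= s ==> s <= t ==> \<bar>F s $ k\<bar> <= CF" using bddn[OF Fc', of t] by blast
   obtain CY where CY: "!!s k. 0 <= s ==> s <= t ==> \<bar>Y s y $ k\<bar> <= CY" using bddn[OF Yc[OF w], of t] by blast
   define F' where "F' s = indicator {0..} s *\<^sub>R F s" for s
   have F'm: "(%s. F' s $ j) \<in> borel_measurable borel" for j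
    unfolding F'_def by (intro borel_measurable_vec_nth borel_measurable_continuous_on_indicator Fc') simp
   define Y' where "Y' s = indicator {0..} s *\<^sub>R Y s y" for s
   have Y'm: "(%s. Y' s $ j) \<in> borel_measurable borel" for j
    unfolding Y'_def by (intro borel_measurable_vec_nth borel_measurable_continuous_on_indicator Yc w) simp
   have i0: "set_integrable lborel {0..t} (%s. \<rho> (t - s) $ i $ j * X0 y $ j)" for j
    by (rule pint[of "%_. X0 y $ j" "\<bar>X0 y $ j\<bar>"]) auto
   have i1: "set_integrable lborel {0..t} (%s. \<rho> (t - s) $ i $ j * F' s $ j)" for j
    by (rule pint[of "%s. F' s $ j" CF]) (use F'm CF in \<open>auto simp: F'_def\<close>)
   have i2: "set_integrable lborel {0..t} (%s. \<rho> (t - s) $ i' $ j * Y' s $ j)" for i' j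
    by (rule pint[of "%s. Y' s $ j" CY]) (use Y'm CY in \<open>auto simp: Y'_def\<close>)
   have sum_set: "(LBINT s:{0..t}. \<Sum>j\<in>UNIV. h j s) = (\<Sum>j\<in>UNIV. LBINT s:{0..t}. h j s)"
    if "!!j. set_integrable lborel {0..t} (h j)" for h :: "'d => real => real"
    using that unfolding set_lebesgue_integral_def set_integrable_def scaleR_sum_right
    by (intro bochner_sum)
   have sum_int: "set_integrable lborel {0..t} (%s. \<Sum>j\<in>UNIV. h j s)"
    if "!!j. set_integrable lborel {0..t} (h j)" for h :: "'d => real => real"
    using that unfolding set_integrable_def scaleR_sum_right by (intro bochner_isum)
   have "(LBINT s:{0..t}. \<Sum>j\<in>UNIV. \<rho> (t - s) $ i $ j * H s $ j) =
    (LBINT s:{0..t}. (\<Sum>j\<in>UNIV. \<rho> (t - s) $ i $ j * X0 y $ j) + (\<Sum>j\<in>UNIV. \<rho> (t - s) $ i $ j * F' s $ j) + (\<Sum>j\<in>UNIV. \<rho> (t - s) $ i $ j * Y' s $ j))"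
    by (rule set_lebesgue_integral_cong) (auto simp: H_def F'_def Y'_def sum.distrib distrib_left)
   also have "... = (LBINT s:{0..t}. \<Sum>j\<in>UNIV. \<rho> (t - s) $ i $ j * X0 y $ j) + (LBINT s:{0..t}. \<Sum>j\<in>UNIV. \<rho> (t - s) $ i $ j * F' s $ j) + (LBINT s:{0..t}. \<Sum>j\<in>UNIV. \<rho> (t - s) $ i $ j * Y' s $ j)"
    by (simp only: set_integral_add set_integral_add(1) sum_int i0 i1 i2)
   finally have split: "(LBINT s:{0..t}. \<Sum>j\<in>UNIV. \<rho> (t - s) $ i $ j * H s $ j) = ..." .
   \<comment> \<open>The three parts \<open>X0\<close>, \<open>F\<close> and \<open>Y\<close> of the
     forcing are treated separately. For the constant part, \<open>r = I + 1 * \<rho>\<close> gives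
     the claim directly.\<close>
   have p0: "X0 y $ i + (LBINT s:{0..t}. \<Sum>j\<in>UNIV. \<rho> (t - s) $ i $ j * X0 y $ j) = (r t *v X0 y) $ i"
   proof -
    have "(LBINT s:{0..t}. \<rho> (t - s) $ i $ j) = (LBINT s:{0..t}. \<rho> s) $ i $ j" for j
     using set_lborel_reflect[of 0 t "%s. \<rho> s $ i $ j"]
     by (simp add: set_integral_vec_nth[OF \<rho>(3)] set_integral_vec_nth[OF set_integrable_vec_nth[OF \<rho>(3)]])
    then have "(LBINT s:{0..t}. \<Sum>j\<in>UNIV. \<rho> (t - s) $ i $ j * X0 y $ j) = ((LBINT s:{0..t}. \<rho> s) *v X0 y) $ i"
     unfolding sum_set[OF i0] by (simp add: matrix_vector_mult_def)
    then show ?thesis unfolding \<rho>(4)[OF t] by (simp add: matrix_vector_mult_add_rdistrib)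
   qed
   have rn: "r (t - s) $ i $ j = (if i = j then 1 else 0) + (LBINT v:{0..t-s}. \<rho> v $ i $ j)" if "s \<in> {0..t}" for s j
    using \<rho>(4)[of "t - s"] that
    by (simp add: mat_def set_integral_vec_nth[OF \<rho>(3)] set_integral_vec_nth[OF set_integrable_vec_nth[OF \<rho>(3)]])
   have fj: "set_integrable lborel {0..t} (%s. r (t - s) $ i $ j * f s $ j)" for i j
   proof -
    have rcc: "continuous_on {0..t} (%s. r (t - s) $ i $ j)"
     by (intro continuous_on_component continuous_on_compose2[OF rc] continuous_intros) auto
    obtain Cr where Cr: "!!s. s \<in> {0..t} ==> \<bar>r (t - s) $ i $ j\<bar> <= Cr" using continuous_on_Icc_bounded[OF rcc] by auto
    have rmm: "(%s. indicator {0..t} s *\<^sub>R r (t - s) $ i $ j) \<in> borel_measurable borel"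
     by (rule borel_measurable_continuous_on_indicator[OF _ rcc]) simp
    have fm: "(%s. indicator {0..t} s *\<^sub>R f s $ j) \<in> borel_measurable lborel" using fi[of t j] unfolding set_integrable_def by auto
    show ?thesis unfolding set_integrable_def
    proof (rule bochner_bound)
     show "integrable lborel (%s. Cr * (indicator {0..t} s *\<^sub>R f s $ j))" using fi[of t j] unfolding set_integrable_def by (rule integrable_mult_right)
     have "(%s. (indicator {0..t} s *\<^sub>R r (t - s) $ i $ j) * (indicator {0..t} s *\<^sub>R f s $ j)) \<in> borel_measurable lborel"
      using rmm fm by simp
     moreover have "(indicator {0..t} s *\<^sub>R r (t - s) $ i $ j) * (indicator {0..t} s *\<^sub>R f s $ j) = indicator {0..t} s *\<^sub>R (r (t - s) $ i $ j * f s $ j)" for s :: real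
      by (simp add: indicator_def)
     ultimately show "(%s. indicator {0..t} s *\<^sub>R (r (t - s) $ i $ j * f s $ j)) \<in> borel_measurable lborel" by (simp only:)
     show "AE s in lborel. norm (indicator {0..t} s *\<^sub>R (r (t - s) $ i $ j * f s $ j)) <= norm (Cr * (indicator {0..t} s *\<^sub>R f s $ j))" (is "AE s in _. ?bd s")
     proof (intro AE_I2)
      fix s
      show "?bd s"
       using Cr[of s] by (auto simp: indicator_def abs_mult intro!: mult_right_mono)
     qed
    qed
   qed
   have p1: "F t $ i + (LBINT s:{0..t}. \<Sum>j\<in>UNIV. \<rho> (t - s) $ i $ j * F' s $ j) = (LBINT s:{0..t}. r (t - s) *v f s) $ i"
   proof -
    \<comment> \<open>Here \<open>\<rho> * (1 * f) = (1 * \<rho>) * f\<close> by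
      \<open>conv_assoc\<close>, and \<open>1 * \<rho>\<close> is \<open>r - mat 1\<close>.\<close>
    have c: "(LBINT s:{0..t}. \<rho> (t - s) $ i $ j * F' s $ j) = (LBINT s:{0..t}. r (t - s) $ i $ j * f s $ j) - (if i = j then F t $ j else 0)" for j
    proof -
     have "(LBINT s:{0..t}. \<rho> (t - s) $ i $ j * F' s $ j) = (LBINT \<tau>:{0..t}. \<rho> (t - \<tau>) $ i $ j * (LBINT s:{0..\<tau>}. f s $ j))"
      by (rule set_lebesgue_integral_cong) (auto simp: F'_def Fi)
     also have "... = (LBINT s:{0..t}. (LBINT \<tau>:{0..t-s}. \<rho> \<tau> $ i $ j) * f s $ j)"
      by (rule conv_assoc[OF \<rho>nm \<rho>nb fi])
     also have "... = (LBINT s:{0..t}. r (t - s) $ i $ j * f s $ j - (if i = j then 1 else 0) * f s $ j)"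
      by (rule set_lebesgue_integral_cong) (auto simp: rn algebra_simps)
     also have "... = (LBINT s:{0..t}. r (t - s) $ i $ j * f s $ j) - (LBINT s:{0..t}. (if i = j then 1 else 0) * f s $ j)"
      by (intro set_integral_diff(2) fj set_integrable_mult_right) (use fi in auto)
     also have "(LBINT s:{0..t}. (if i = j then 1 else 0) * f s $ j) = (if i = j then F t $ j else 0)" by (simp add: Fi)
     finally show ?thesis .
    qed
    have "(LBINT s:{0..t}. \<Sum>j\<in>UNIV. \<rho> (t - s) $ i $ j * F' s $ j) = (\<Sum>j\<in>UNIV. LBINT s:{0..t}. r (t - s) $ i $ j * f s $ j) - F t $ i"
     unfolding sum_set[OF i1] c by (simp add: sum_subtractf)
    also have "(\<Sum>j\<in>UNIV. LBINT s:{0..t}. r (t - s) $ i $ j * f s $ j) = (LBINT s:{0..t}. (r (t - s) *v f s) $ i)"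
     unfolding sum_set[OF fj, symmetric] by (simp add: matrix_vector_mult_def)
    also have "... = (LBINT s:{0..t}. r (t - s) *v f s) $ i"
    proof (rule set_integral_vec_nth[symmetric], rule set_integrable_vec)
     fix i show "set_integrable lborel {0..t} (%s. (r (t - s) *v f s) $ i)"
      unfolding matrix_vector_mult_def using sum_int[OF fj] by simp
    qed
    finally show ?thesis by simp
   qed
   have p2: "(LBINT s:{0..t}. \<Sum>j\<in>UNIV. \<rho> (t - s) $ i $ j * Y' s $ j) = (LBINT s:{0..t}. \<rho>' (t - s) *v Y s y) $ i"
   proof -
    have "(LBINT s:{0..t}. \<rho>' (t - s) *v Y s y) = (LBINT s:{0..t}. \<rho> (t - s) *v Y' s)"
     by (rule set_lebesgue_integral_cong) (auto simp: \<rho>'_def Y'_def)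
    also have "... $ i = (LBINT s:{0..t}. (\<rho> (t - s) *v Y' s) $ i)"
    proof (rule set_integral_vec_nth, rule set_integrable_vec)
     fix i show "set_integrable lborel {0..t} (%s. (\<rho> (t - s) *v Y' s) $ i)"
      unfolding matrix_vector_mult_def using sum_int[OF i2] by simp
    qed
    finally show ?thesis by (simp add: matrix_vector_mult_def)
   qed
   show ?thesis unfolding voc[of i] \<rho>n[symmetric] split using p0 p1 p2 t by (simp add: H_def)
  qed
  then show ?thesis using t by (simp add: vec_eq_iff X'_def)
 qed
 show ?thesis using SF Xc
 proof eventually_elim
  case (elim y)
  then show ?case using main[OF elim(2)] by simp
 qed
qed

end

section \<open>Mean-square asymptotics\<close>

lemma exp_weighted_mult_integrable:
 fixes f :: "real => real^'d" and A :: "real => real^'d^'d"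
 assumes fm: "(%t. indicator {0..} t *\<^sub>R f t) \<in> borel_measurable borel"
  and fi: "set_integrable lborel {0..} (%t. exp (- \<alpha> * t) * norm (f t))"
  and Am: "A \<in> borel_measurable borel" and Ab: "!!s. s >= 0 ==> norm (A s) <= exp (- \<alpha> * s) * D"
 shows "set_integrable lborel {0..} (%s. A s *v f s)"
proof -
 obtain KV where KV: "KV > 0" "!!(A :: real^'d^'d) (x :: real^'d). norm (A *v x) <= norm A * norm x * KV"
  using bounded_bilinear.pos_bounded[OF bounded_bilinear_matrix_vector_mult] by blast
 define fw where "fw s = indicator {0..} s *\<^sub>R (exp (- \<alpha> * s) * norm (f s))" for s
 have fw: "integrable lborel fw" using fi unfolding set_integrable_def fw_def[abs_def] .
 show ?thesis
 unfolding set_integrable_def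
proof (rule bochner_bound)
 show "integrable lborel (%s. (D * KV) * fw s)" using fw by simp
 have "(%s. A s *v (indicator {0..} s *\<^sub>R f s)) \<in> borel_measurable borel" by (intro borel_measurable_matrix_vector_mult Am fm)
 moreover have "A s *v (indicator {0..} s *\<^sub>R f s) = indicator {0..} s *\<^sub>R (A s *v f s)" for s :: real by (simp add: indicator_def)
 ultimately show "(%s. indicator {0..} s *\<^sub>R (A s *v f s)) \<in> borel_measurable lborel" by simp
 show "AE s in lborel. norm (indicator {0..} s *\<^sub>R (A s *v f s)) <= norm ((D * KV) * fw s)" (is "AE s in _. ?bd s")
 proof (intro AE_I2)
  fix s :: real
  show "?bd s"
  proof (cases "s >= 0")
   case True
   have "norm (A s *v f s) <= norm (A s) * norm (f s) * KV" by (rule KV(2))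
   also have "... <= (exp (- \<alpha> * s) * D) * norm (f s) * KV" using Ab[OF True] KV(1) by (intro mult_right_mono) auto
   also have "... = (D * KV) * fw s" using True by (simp add: fw_def)
   also have "... <= norm ((D * KV) * fw s)" by simp
   finally show ?thesis using True by simp
  qed (simp add: indicator_def)
 qed
qed
qed

lemma norm_add3_square:
 fixes x y z :: "'b::real_normed_vector"
 shows "(norm (x + y + z))\<^sup>2 <= 3 * (norm x)^2 + 3 * (norm y)^2 + 3 * (norm z)^2"
proof -
 have "norm (x + y + z) <= norm x + norm y + norm z" by (intro norm_triangle_le add_right_mono norm_triangle_ineq)
 then have "(norm (x + y + z))\<^sup>2 <= (norm x + norm y + norm z)^2" by (intro power_mono) auto
 also have "... <= 3 * (norm x)^2 + 3 * (norm y)^2 + 3 * (norm z)^2"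
  using zero_le_power2[of "norm x - norm y"] zero_le_power2[of "norm x - norm z"] zero_le_power2[of "norm y - norm z"]
  by (simp add: power2_eq_square algebra_simps)
 finally show ?thesis .
qed

context delayed_brownian
begin

text \<open>By the addition formulas the \<open>M1\<close> and \<open>M2\<close> terms combine to
  integrals against \<open>exp (- \<alpha> * s) *\<^sub>R c (t - s)\<close> over the half-line. The
  whole error is then \<open>A1 + A2 + A3\<close>, from the initial value, the forcing and the
  noise; the last two are integrals against the same matrix kernel \<open>\<Phi> t\<close>.\<close>

lemma mean_square_asymptotics:
 fixes X :: "real => 'a => real^'d" and f :: "real => real^'d" and \<Sigma> :: "real => real^'e^'d"
  and P Q :: "complex => real^'d^'d"
 assumes r: "continuous_on UNIV r" and growth: "!!t. t >= 0 ==> norm (r t) <= C * (1 + t) ^ n * exp (\<alpha> * t)"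
  and fin: "finite \<Lambda>"
  and lim: "((%t. r t /\<^sub>R (t ^ n * exp (\<alpha> * t)) - (\<Sum>z\<in>\<Lambda>. sin (Im z * t) *\<^sub>R Q z + cos (Im z * t) *\<^sub>R P z)) \<longlongrightarrow> 0) at_top"
  and fm: "(%t. indicator {0..} t *\<^sub>R f t) \<in> borel_measurable borel"
  and fi: "set_integrable lborel {0..} (%t. exp (- \<alpha> * t) * norm (f t))"
  and \<Sigma>: "continuous_on {0..} \<Sigma>" and \<Sigma>i: "set_integrable lborel {0..} (%t. exp (- 2 * \<alpha> * t) * (norm (\<Sigma> t))^2)"
  and X0: "X0 \<in> borel_measurable M" and X0i: "integrable M (%y. (norm (X0 y))\<^sup>2)"
  and X: "!!t. t >= 0 ==> AE y in M. X t y = r t *v X0 y + (LBINT s:{0..t}. r (t - s) *v f s)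
    + ito_integral M \<F> B (%s y. indicator {0..t} s *\<^sub>R (r (t - s) ** \<Sigma> s)) y"
 shows "mean_square_null M (%t y. X t y /\<^sub>R (t ^ n * exp (\<alpha> * t)) -
      (\<Sum>z\<in>\<Lambda>. sin (Im z * t) *\<^sub>R (Q z *v X0 y + M1 M \<F> B f \<Sigma> \<alpha> (P z) (Q z) (Im z) y) +
          cos (Im z * t) *\<^sub>R (P z *v X0 y + M2 M \<F> B f \<Sigma> \<alpha> (P z) (Q z) (Im z) y)))"
proof -
 obtain KV where KV: "KV > 0" "!!(A :: real^'d^'d) (x :: real^'d). norm (A *v x) <= norm A * norm x * KV"
  using bounded_bilinear.pos_bounded[OF bounded_bilinear_matrix_vector_mult] by blast
 obtain KM where KM: "KM > 0" "!!(A :: real^'d^'d) (Y :: real^'e^'d). norm (A ** Y) <= norm A * norm Y * KM"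
  using bounded_bilinear.pos_bounded[OF bounded_bilinear_matrix_mult] by blast
 define E where "E t = t ^ n * exp (\<alpha> * t)" for t
 define c where "c t = (\<Sum>z\<in>\<Lambda>. sin (Im z * t) *\<^sub>R Q z + cos (Im z * t) *\<^sub>R P z)" for t
 define N1 where "N1 z s = exp (- \<alpha> * s) *\<^sub>R (sin (Im z * s) *\<^sub>R P z + cos (Im z * s) *\<^sub>R Q z)" for z s
 define N2 where "N2 z s = exp (- \<alpha> * s) *\<^sub>R (cos (Im z * s) *\<^sub>R P z - sin (Im z * s) *\<^sub>R Q z)" for z s
 define q where "q t = r t /\<^sub>R E t - c t" for t
 \<comment> \<open>The difference between the normalized resolvent and its leading part. For
   \<open>s > t\<close> only the second term is present: it accounts for the tails of the integrals
   over the half-line.\<close>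
 define \<Phi> where "\<Phi> t s = (indicator {0..t} s / E t) *\<^sub>R r (t - s) - exp (- \<alpha> * s) *\<^sub>R c (t - s)" for t s
 have E0: "E t > 0" if "t >= 1" for t using that by (simp add: E_def)
 \<comment> \<open>The addition formulas for sine and cosine separate \<open>t\<close> from
   \<open>s\<close>. This is the origin of the combinations of \<open>P\<close> and \<open>Q\<close>
   in \<open>M1\<close> and \<open>M2\<close>.\<close>
 have addition: "(\<Sum>z\<in>\<Lambda>. sin (Im z * t) *\<^sub>R N1 z s + cos (Im z * t) *\<^sub>R N2 z s) = exp (- \<alpha> * s) *\<^sub>R c (t - s)" for t s
  unfolding c_def scaleR_sum_right
 proof (intro sum.cong refl)
  fix z
  have sc: "sin (Im z * (t - s)) = sin (Im z * t) * cos (Im z * s) - cos (Im z * t) * sin (Im z * s)"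
   "cos (Im z * (t - s)) = cos (Im z * t) * cos (Im z * s) + sin (Im z * t) * sin (Im z * s)"
   by (simp_all add: right_diff_distrib sin_diff cos_diff)
  show "sin (Im z * t) *\<^sub>R N1 z s + cos (Im z * t) *\<^sub>R N2 z s = exp (- \<alpha> * s) *\<^sub>R (sin (Im z * (t - s)) *\<^sub>R Q z + cos (Im z * (t - s)) *\<^sub>R P z)"
   unfolding sc by (simp add: N1_def N2_def vec_eq_iff algebra_simps)
 qed
 define Cc where "Cc = (\<Sum>z\<in>\<Lambda>. norm (Q z) + norm (P z))"
 have cb: "norm (c t) <= Cc" for t
  unfolding c_def Cc_def
 proof (intro order_trans[OF norm_sum] sum_mono order_trans[OF norm_triangle_ineq] add_mono)
  fix z show "norm (sin (Im z * t) *\<^sub>R Q z) <= norm (Q z)" "norm (cos (Im z * t) *\<^sub>R P z) <= norm (P z)"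
   by (simp_all add: mult_left_le_one_le)
 qed
 have C0: "C >= 0" using order_trans[OF norm_ge_zero growth[of 0]] by simp
 have cc: "continuous_on UNIV c" unfolding c_def by (intro continuous_intros)
 have rm[measurable]: "r \<in> borel_measurable borel" by (rule borel_measurable_continuous_onI[OF r])
 have cm[measurable]: "c \<in> borel_measurable borel" by (rule borel_measurable_continuous_onI[OF cc])
 have \<Phi>m[measurable]: "\<Phi> t \<in> borel_measurable borel" for t unfolding \<Phi>_def[abs_def] by measurable
 \<comment> \<open>The size of \<open>\<Phi>\<close> measured against the weight
   \<open>exp (- \<alpha> * s)\<close>, under which \<open>f\<close> is integrable and \<Sigma>
   square integrable. It is bounded for \<open>t >= 1\<close> and tends to 0 for each
   \<open>s\<close>.\<close>
 define \<psi> where "\<psi> t s = indicator {0..} s * (exp (\<alpha> * s) * norm (\<Phi> t s))" for t s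
 have \<psi>m[measurable]: "\<psi> t \<in> borel_measurable borel" for t unfolding \<psi>_def[abs_def] by measurable
 have \<psi>0: "\<psi> t s >= 0" for t s by (simp add: \<psi>_def)
 \<comment> \<open>The power of 2 comes from \<open>1 + (t - s) <= 2 * t\<close> for
   \<open>s >= 0\<close> and \<open>t >= 1\<close>.\<close>
 define C\<psi> where "C\<psi> = C * 2 ^ n + Cc"
 have \<psi>b: "\<psi> t s <= C\<psi>" if t: "t >= 1" for t s
 proof (cases "s >= 0")
  case True
  have 1: "norm ((indicator {0..t} s / E t) *\<^sub>R r (t - s)) <= C * 2 ^ n * exp (- \<alpha> * s)"
  proof (cases "s <= t")
   case sT: True
   have "norm (r (t - s)) <= C * (1 + (t - s)) ^ n * exp (\<alpha> * (t - s))" using sT by (intro growth) simp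
   also have "... <= C * (2 * t) ^ n * exp (\<alpha> * (t - s))"
    using sT True t C0 by (intro mult_right_mono mult_left_mono power_mono) auto
   also have "... = C * 2 ^ n * exp (- \<alpha> * s) * E t" by (simp add: E_def power_mult_distrib right_diff_distrib exp_diff exp_minus field_simps)
   finally show ?thesis using E0[OF t] sT True by (simp add: field_simps)
  next
   case False
   then show ?thesis using C0 by simp
  qed
  have 2: "norm (exp (- \<alpha> * s) *\<^sub>R c (t - s)) <= exp (- \<alpha> * s) * Cc" using cb[of "t - s"] by simp
  have "norm (\<Phi> t s) <= norm ((indicator {0..t} s / E t) *\<^sub>R r (t - s)) + norm (exp (- \<alpha> * s) *\<^sub>R c (t - s))"
   unfolding \<Phi>_def by (rule norm_triangle_ineq4)
  also have "... <= C * 2 ^ n * exp (- \<alpha> * s) + exp (- \<alpha> * s) * Cc" using 1 2 by (rule add_mono)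
  also have "... = exp (- \<alpha> * s) * C\<psi>" by (simp add: C\<psi>_def algebra_simps)
  finally have "exp (\<alpha> * s) * norm (\<Phi> t s) <= exp (\<alpha> * s) * (exp (- \<alpha> * s) * C\<psi>)" by (intro mult_left_mono) auto
  also have "... = C\<psi>" by (simp add: mult.assoc[symmetric] exp_minus)
  finally show ?thesis using True by (simp add: \<psi>_def)
 next
  case False
  have "Cc >= 0" unfolding Cc_def by (intro sum_nonneg) simp
  then show ?thesis using False C0 by (simp add: \<psi>_def C\<psi>_def)
 qed
 have \<psi>lim: "((%t. \<psi> t s) \<longlongrightarrow> 0) at_top" for s
 proof (cases "s >= 0")
  case True
  \<comment> \<open>The resolvent at \<open>t - s\<close> is divided by \<open>E t\<close>, but its
    asymptotics refer to \<open>E (t - s)\<close>; \<open>x t\<close> is the polynomial part of the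
    correction and tends to 1.\<close>
  define x where "x t = ((t - s) / t) ^ n" for t :: real
  have xl: "(x \<longlongrightarrow> 1) at_top"
  proof -
   have "((%t::real. (t - s) / t) \<longlongrightarrow> 1) at_top" by real_asymp
   from tendsto_power[OF this, of n] show ?thesis unfolding x_def by simp
  qed
  have "((%t. norm (q (t - s))) \<longlongrightarrow> 0) at_top"
  proof -
   have "filterlim (%t::real. t - s) at_top at_top" by real_asymp
   from filterlim_compose[OF lim this] show ?thesis unfolding q_def E_def c_def by (simp add: tendsto_norm_zero_iff)
  qed
  then have l: "((%t. \<bar>x t\<bar> * norm (q (t - s)) + \<bar>x t - 1\<bar> * Cc) \<longlongrightarrow> \<bar>1\<bar> * 0 + \<bar>1 - 1\<bar> * Cc) at_top"
   by (intro tendsto_intros xl)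
  show ?thesis
  proof (rule Lim_null_comparison)
   show "((%t. \<bar>x t\<bar> * norm (q (t - s)) + \<bar>x t - 1\<bar> * Cc) \<longlongrightarrow> 0) at_top" using l by simp
   show "\<forall>\<^sub>F t in at_top. norm (\<psi> t s) <= \<bar>x t\<bar> * norm (q (t - s)) + \<bar>x t - 1\<bar> * Cc"
    using eventually_gt_at_top[of s] eventually_ge_at_top[of 1]
   proof eventually_elim
    case (elim t)
    have "exp (\<alpha> * s) *\<^sub>R \<Phi> t s = x t *\<^sub>R (r (t - s) /\<^sub>R E (t - s)) - c (t - s)"
    proof -
     have "exp (\<alpha> * s) / E t = x t / E (t - s)"
      using elim True by (simp add: E_def x_def power_divide right_diff_distrib exp_diff field_simps)
     moreover have "exp (\<alpha> * s) *\<^sub>R \<Phi> t s = (exp (\<alpha> * s) / E t) *\<^sub>R r (t - s) - c (t - s)"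
      using elim True by (simp add: \<Phi>_def scaleR_right_diff_distrib exp_minus)
     ultimately show ?thesis by (simp add: divide_inverse)
    qed
    also have "... = x t *\<^sub>R q (t - s) + (x t - 1) *\<^sub>R c (t - s)" by (simp add: q_def algebra_simps)
    finally have "norm (exp (\<alpha> * s) *\<^sub>R \<Phi> t s) <= norm (x t *\<^sub>R q (t - s)) + norm ((x t - 1) *\<^sub>R c (t - s))"
     by (metis norm_triangle_ineq)
    also have "... <= \<bar>x t\<bar> * norm (q (t - s)) + \<bar>x t - 1\<bar> * Cc"
     using cb[of "t - s"] by (simp add: mult_left_mono)
    finally show ?case using True by (simp add: \<psi>_def)
   qed
  qed
 qed (simp add: \<psi>_def)
 have weighted: "integrable lborel (%s. \<psi> t s ^ p * h s)" if t: "t >= 1" and h: "integrable lborel h" for t p and h :: "real => real"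
 proof (rule bochner_bound)
  show "integrable lborel (%s. C\<psi> ^ p * h s)" using h by simp
  show "(%s. \<psi> t s ^ p * h s) \<in> borel_measurable lborel" using borel_measurable_integrable[OF h] by measurable
  show "AE s in lborel. norm (\<psi> t s ^ p * h s) <= norm (C\<psi> ^ p * h s)" (is "AE s in _. ?bd s")
  proof (intro AE_I2)
   fix s
   have "\<psi> t s ^ p <= C\<psi> ^ p" using \<psi>b[OF t] \<psi>0 by (intro power_mono)
   then show "?bd s"
    using \<psi>0[of t s] order_trans[OF \<psi>0[of t s] \<psi>b[OF t]] by (simp add: abs_mult mult_right_mono)
  qed
 qed
 \<comment> \<open>Dominated convergence with the bound for \<open>\<psi>\<close>. The power
   \<open>p\<close> is 1 for the forcing and 2 for the squared integrand of the noise.\<close>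
 have weighted_lim: "((%t. LBINT s. \<psi> t s ^ p * h s) \<longlongrightarrow> 0) at_top" if h: "integrable lborel h" and p: "p > 0" for p and h :: "real => real"
 proof -
  have [measurable]: "h \<in> borel_measurable borel" using borel_measurable_integrable[OF h] by simp
  have "((%t. LBINT s. \<psi> t s ^ p * h s) \<longlongrightarrow> (LINT s|(lborel :: real measure). 0)) at_top"
  proof (rule integral_dominated_convergence_at_top[where w="%s. C\<psi> ^ p * \<bar>h s\<bar>"])
   show "integrable lborel (%s. C\<psi> ^ p * \<bar>h s\<bar>)" using h by simp
   show "AE s in lborel. ((%t. \<psi> t s ^ p * h s) \<longlongrightarrow> 0) at_top" (is "AE s in _. ?bd s")
   proof (intro AE_I2)
    fix s
    have "((%t. \<psi> t s ^ p * h s) \<longlongrightarrow> 0 ^ p * h s) at_top" by (intro tendsto_intros \<psi>lim)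
    then show "?bd s" using p by (simp add: zero_power)
   qed
   show "\<forall>\<^sub>F t in at_top. AE s in lborel. norm (\<psi> t s ^ p * h s) <= C\<psi> ^ p * \<bar>h s\<bar>"
    using eventually_ge_at_top[of 1]
   proof eventually_elim
    case (elim t)
    have "\<psi> t s ^ p <= C\<psi> ^ p" for s using \<psi>b[OF elim] \<psi>0 by (intro power_mono)
    then show ?case using \<psi>0 by (intro AE_I2) (simp add: abs_mult mult_right_mono)
   qed
  qed measurable
  then show ?thesis by simp
 qed
 define fw where "fw s = indicator {0..} s *\<^sub>R (exp (- \<alpha> * s) * norm (f s))" for s
 define \<Sigma>w where "\<Sigma>w s = indicator {0..} s *\<^sub>R (exp (- 2 * \<alpha> * s) * (norm (\<Sigma> s))^2)" for s
 have fw: "integrable lborel fw" using fi unfolding set_integrable_def fw_def[abs_def] .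
 have \<Sigma>w: "integrable lborel \<Sigma>w" using \<Sigma>i unfolding set_integrable_def \<Sigma>w_def[abs_def] .
 have Nb: "norm (N1 z s) <= exp (- \<alpha> * s) * (norm (P z) + norm (Q z))" "norm (N2 z s) <= exp (- \<alpha> * s) * (norm (P z) + norm (Q z))" for z s
 proof -
  have "norm (sin (Im z * s) *\<^sub>R P z + cos (Im z * s) *\<^sub>R Q z) <= norm (P z) + norm (Q z)"
   by (intro order_trans[OF norm_triangle_ineq] add_mono) (simp_all add: mult_left_le_one_le)
  then show "norm (N1 z s) <= exp (- \<alpha> * s) * (norm (P z) + norm (Q z))" by (simp add: N1_def)
  have "norm (cos (Im z * s) *\<^sub>R P z - sin (Im z * s) *\<^sub>R Q z) <= norm (P z) + norm (Q z)"
   by (intro order_trans[OF norm_triangle_ineq4] add_mono) (simp_all add: mult_left_le_one_le)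
  then show "norm (N2 z s) <= exp (- \<alpha> * s) * (norm (P z) + norm (Q z))" by (simp add: N2_def)
 qed
 have Nc: "continuous_on UNIV (N1 z)" "continuous_on UNIV (N2 z)" for z
  unfolding N1_def[abs_def] N2_def[abs_def] by (intro continuous_intros)+
 have i1: "set_integrable lborel {0..} (%s. N1 z s *v f s)" and i2: "set_integrable lborel {0..} (%s. N2 z s *v f s)" for z
  by (rule exp_weighted_mult_integrable[OF fm fi borel_measurable_continuous_onI[OF Nc(1)] Nb(1)] exp_weighted_mult_integrable[OF fm fi borel_measurable_continuous_onI[OF Nc(2)] Nb(2)])+
 have \<Phi>b: "norm (\<Phi> t s) = exp (- \<alpha> * s) * \<psi> t s" if "s >= 0" for t s
  using that by (simp add: \<psi>_def exp_minus)
 have \<Phi>i: "set_integrable lborel {0..} (%s. \<Phi> t s *v f s)" if t: "t >= 1" for t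
  by (rule exp_weighted_mult_integrable[OF fm fi \<Phi>m, of t C\<psi>]) (use \<psi>b[OF t] in \<open>simp add: \<Phi>b\<close>)
 define A2 where "A2 t = (LBINT s:{0..}. \<Phi> t s *v f s)" for t
 have A2: "(LBINT s:{0..t}. r (t - s) *v f s) /\<^sub>R E t = A2 t +
  (\<Sum>z\<in>\<Lambda>. sin (Im z * t) *\<^sub>R (LBINT s:{0..}. N1 z s *v f s) + cos (Im z * t) *\<^sub>R (LBINT s:{0..}. N2 z s *v f s))"
  if t: "t >= 1" for t
 proof -
  have pt: "indicator {0..t} s *\<^sub>R (r (t - s) *v f s) /\<^sub>R E t = indicator {0..} s *\<^sub>R (\<Phi> t s *v f s) +
   (\<Sum>z\<in>\<Lambda>. sin (Im z * t) *\<^sub>R (indicator {0..} s *\<^sub>R (N1 z s *v f s)) + cos (Im z * t) *\<^sub>R (indicator {0..} s *\<^sub>R (N2 z s *v f s)))" for s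
  proof -
   have "(\<Sum>z\<in>\<Lambda>. sin (Im z * t) *\<^sub>R (N1 z s *v f s) + cos (Im z * t) *\<^sub>R (N2 z s *v f s)) = (exp (- \<alpha> * s) *\<^sub>R c (t - s)) *v f s"
    unfolding addition[symmetric] bounded_bilinear.sum_left[OF bounded_bilinear_matrix_vector_mult]
     bounded_bilinear.add_left[OF bounded_bilinear_matrix_vector_mult] scaled_matrix_mult ..
   moreover have "\<Phi> t s *v f s = (indicator {0..t} s / E t) *\<^sub>R (r (t - s) *v f s) - (exp (- \<alpha> * s) *\<^sub>R c (t - s)) *v f s"
    unfolding \<Phi>_def bounded_bilinear.diff_left[OF bounded_bilinear_matrix_vector_mult] scaled_matrix_mult ..
   ultimately have "\<Phi> t s *v f s + (\<Sum>z\<in>\<Lambda>. sin (Im z * t) *\<^sub>R (N1 z s *v f s) + cos (Im z * t) *\<^sub>R (N2 z s *v f s)) = (indicator {0..t} s / E t) *\<^sub>R (r (t - s) *v f s)"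
    by simp
   then show ?thesis by (cases "s >= 0") (simp_all add: divide_inverse mult.commute)
  qed
  have "(LBINT s:{0..t}. r (t - s) *v f s) /\<^sub>R E t = (LBINT s. indicator {0..t} s *\<^sub>R (r (t - s) *v f s) /\<^sub>R E t)"
   unfolding set_lebesgue_integral_def by (simp only: Bochner_Integration.integral_scaleR_right)
  also have "... = A2 t + (\<Sum>z\<in>\<Lambda>. sin (Im z * t) *\<^sub>R (LBINT s:{0..}. N1 z s *v f s) + cos (Im z * t) *\<^sub>R (LBINT s:{0..}. N2 z s *v f s))"
   unfolding pt A2_def set_lebesgue_integral_def using \<Phi>i[OF t] i1 i2 unfolding set_integrable_def
   by (simp add: Bochner_Integration.integral_add bochner_sum del: scaleR_scaleR)
  finally show ?thesis .
 qed
 have A2b: "norm (A2 t) <= KV * (LBINT s. \<psi> t s ^ 1 * fw s)" if t: "t >= 1" for t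
 proof -
  have "norm (A2 t) <= (LBINT s. norm (indicator {0..} s *\<^sub>R (\<Phi> t s *v f s)))"
   unfolding A2_def set_lebesgue_integral_def by (rule integral_norm_bound)
  also have "... <= (LBINT s. KV * (\<psi> t s ^ 1 * fw s))"
  proof (rule integral_mono)
   show "integrable lborel (%s. norm (indicator {0..} s *\<^sub>R (\<Phi> t s *v f s)))" using \<Phi>i[OF t] unfolding set_integrable_def by (rule integrable_norm)
   show "integrable lborel (%s. KV * (\<psi> t s ^ 1 * fw s))" by (intro integrable_mult_right weighted t fw)
   fix s :: real
   show "norm (indicator {0..} s *\<^sub>R (\<Phi> t s *v f s)) <= KV * (\<psi> t s ^ 1 * fw s)"
    using KV(2)[of "\<Phi> t s" "f s"] by (cases "s >= 0") (simp_all add: \<Phi>b fw_def mult_ac)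
  qed
  finally show ?thesis by simp
 qed
 have Nito: "has_ito_integral M \<F> B (%s y. A s ** \<Sigma> s) (ito_integral M \<F> B (%s y. A s ** \<Sigma> s))"
  if Ac: "continuous_on UNIV A" and Ab: "!!s. norm (A s) <= exp (- \<alpha> * s) * D" for A :: "real => real^'d^'d" and D
 proof (rule ito_integral_half_line)
  show c: "continuous_on {0..} (%s. A s ** \<Sigma> s)"
   by (intro bounded_bilinear.continuous_on[OF bounded_bilinear_matrix_mult] \<Sigma> continuous_on_subset[OF Ac]) auto
  show "set_integrable lborel {0..} (%s. (norm (A s ** \<Sigma> s))\<^sup>2)" unfolding set_integrable_def
  proof (rule bochner_bound)
   show "integrable lborel (%s. (D * KM)\<^sup>2 * \<Sigma>w s)" using \<Sigma>w by simp
   have "(%s. indicator {0..} s *\<^sub>R (norm (A s ** \<Sigma> s))\<^sup>2) \<in> borel_measurable borel"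
    by (intro borel_measurable_continuous_on_indicator continuous_intros c) simp
   then show "(%s. indicator {0..} s *\<^sub>R (norm (A s ** \<Sigma> s))\<^sup>2) \<in> borel_measurable lborel" by simp
   show "AE s in lborel. norm (indicator {0..} s *\<^sub>R (norm (A s ** \<Sigma> s))\<^sup>2) <= norm ((D * KM)^2 * \<Sigma>w s)" (is "AE s in _. ?bd s")
   proof (intro AE_I2)
    fix s :: real
    show "?bd s"
    proof (cases "s >= 0")
     case True
     have "norm (A s ** \<Sigma> s) <= norm (A s) * norm (\<Sigma> s) * KM" by (rule KM(2))
     also have "... <= (exp (- \<alpha> * s) * D) * norm (\<Sigma> s) * KM" using Ab KM(1) by (intro mult_right_mono) auto
     finally have "(norm (A s ** \<Sigma> s))\<^sup>2 <= ((exp (- \<alpha> * s) * D) * norm (\<Sigma> s) * KM)^2" by (intro power_mono) auto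
     also have "... = (D * KM)^2 * \<Sigma>w s"
      using True by (simp add: \<Sigma>w_def power_mult_distrib exp_double[symmetric] mult_ac)
     finally show ?thesis using True by simp
    qed (simp add: indicator_def)
   qed
  qed
 qed
 define J1 where "J1 z = ito_integral M \<F> B (%s y. N1 z s ** \<Sigma> s)" for z
 define J2 where "J2 z = ito_integral M \<F> B (%s y. N2 z s ** \<Sigma> s)" for z
 define Jt where "Jt t = ito_integral M \<F> B (%s y. indicator {0..t} s *\<^sub>R (r (t - s) ** \<Sigma> s))" for t
 have J1: "has_ito_integral M \<F> B (%s y. N1 z s ** \<Sigma> s) (J1 z)" for z
  unfolding J1_def by (rule Nito[OF Nc(1) Nb(1)])
 have J2: "has_ito_integral M \<F> B (%s y. N2 z s ** \<Sigma> s) (J2 z)" for z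
  unfolding J2_def by (rule Nito[OF Nc(2) Nb(2)])
 have Jt: "has_ito_integral M \<F> B (%s y. indicator {0..t} s *\<^sub>R (r (t - s) ** \<Sigma> s)) (Jt t)" if "t >= 0" for t
  unfolding Jt_def using that
  by (intro ito_integral_truncated bounded_bilinear.continuous_on[OF bounded_bilinear_matrix_mult] continuous_on_subset[OF \<Sigma>]
   continuous_on_compose2[OF r] continuous_intros) auto
 define A1 where "A1 t y = q t *v X0 y" for t y
 define A3 where "A3 t y = Jt t y /\<^sub>R E t - (\<Sum>z\<in>\<Lambda>. sin (Im z * t) *\<^sub>R J1 z y + cos (Im z * t) *\<^sub>R J2 z y)" for t y
 have A3iso: "(L2sq M (A3 t)) = (\<integral>\<^sup>+s\<in>{0..}. ennreal ((norm (\<Phi> t s ** \<Sigma> s))^2) \<partial>lborel)" if t: "t >= 1" for t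
 proof -
  \<comment> \<open>The index \<open>None\<close> stands for the integral up to \<open>t\<close>,
    and \<open>Some (z, b)\<close> for the two half-line integrals that belong to the root
    \<open>z\<close>. The combination with coefficients \<open>CC\<close> has the integrand
    \<open>\<Phi> t s ** \<Sigma> s\<close>.\<close>
  define A :: "(complex \<times> bool) option set" where "A = insert None (Some ` (\<Lambda> \<times> UNIV))"
  define h where "h o' s = (case o' of None => indicator {0..t} s *\<^sub>R (r (t - s) ** \<Sigma> s) | Some (z, b) => if b then N1 z s ** \<Sigma> s else N2 z s ** \<Sigma> s)" for o' s
  define I where "I o' = (case o' of None => Jt t | Some (z, b) => if b then J1 z else J2 z)" for o'
  define CC :: "(complex \<times> bool) option => real^'d^'d" where "CC o' = (case o' of None => (1 / E t) *\<^sub>R mat 1 | Some (z, b) => (if b then - sin (Im z * t) else - cos (Im z * t)) *\<^sub>R mat 1)" for o'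
  have fA: "finite A" using fin by (simp add: A_def)
  have sumA: "(\<Sum>o'\<in>A. g o') = g None + (\<Sum>z\<in>\<Lambda>. g (Some (z, True)) + g (Some (z, False)))" for g :: "_ => 'z::comm_monoid_add"
  proof -
   have "(\<Sum>o'\<in>A. g o') = g None + (\<Sum>o'\<in>Some ` (\<Lambda> \<times> UNIV). g o')" using fin unfolding A_def by (subst sum.insert) auto
   also have "(\<Sum>o'\<in>Some ` (\<Lambda> \<times> UNIV). g o') = (\<Sum>p\<in>\<Lambda> \<times> UNIV. g (Some p))" by (subst sum.reindex) auto
   also have "... = (\<Sum>z\<in>\<Lambda>. \<Sum>b\<in>UNIV. g (Some (z, b)))" by (subst sum.cartesian_product) (simp add: split_beta')
   finally show ?thesis by (simp add: UNIV_bool add.commute)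
  qed
  have "has_ito_integral M \<F> B (%s y. h o' s) (I o')" for o'
   using J1 J2 Jt[of t] t by (auto simp: h_def I_def split: option.splits prod.splits)
  from ito_isometry[OF fA this, of CC]
  have "(L2sq M (%y. \<Sum>o'\<in>A. CC o' *v I o' y)) = (\<integral>\<^sup>+s\<in>{0..}. ennreal ((norm (\<Sum>o'\<in>A. CC o' ** h o' s))^2) \<partial>lborel)" .
  moreover have "(\<Sum>o'\<in>A. CC o' *v I o' y) = A3 t y" for y
   unfolding sumA by (simp add: CC_def I_def A3_def scaled_matrix_mult sum_subtractf sum_negf sum.distrib inverse_eq_divide
    bounded_bilinear.minus_left[OF bounded_bilinear_matrix_vector_mult])
  moreover have "(\<Sum>o'\<in>A. CC o' ** h o' s) = \<Phi> t s ** \<Sigma> s" for s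
  proof -
   have "(\<Sum>z\<in>\<Lambda>. sin (Im z * t) *\<^sub>R (N1 z s ** \<Sigma> s) + cos (Im z * t) *\<^sub>R (N2 z s ** \<Sigma> s)) = (exp (- \<alpha> * s) *\<^sub>R c (t - s)) ** \<Sigma> s"
    unfolding addition[symmetric] bounded_bilinear.sum_left[OF bounded_bilinear_matrix_mult]
     bounded_bilinear.add_left[OF bounded_bilinear_matrix_mult] scaled_matrix_mult ..
   moreover have "\<Phi> t s ** \<Sigma> s = (indicator {0..t} s / E t) *\<^sub>R (r (t - s) ** \<Sigma> s) - (exp (- \<alpha> * s) *\<^sub>R c (t - s)) ** \<Sigma> s"
    unfolding \<Phi>_def bounded_bilinear.diff_left[OF bounded_bilinear_matrix_mult] scaled_matrix_mult ..
   moreover have "CC (Some (z, True)) ** h (Some (z, True)) s + CC (Some (z, False)) ** h (Some (z, False)) s =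
    - (sin (Im z * t) *\<^sub>R (N1 z s ** \<Sigma> s) + cos (Im z * t) *\<^sub>R (N2 z s ** \<Sigma> s))" for z
    by (simp add: CC_def h_def scaled_matrix_mult bounded_bilinear.minus_left[OF bounded_bilinear_matrix_mult])
   moreover have "CC None ** h None s = (indicator {0..t} s / E t) *\<^sub>R (r (t - s) ** \<Sigma> s)"
    by (simp add: CC_def h_def scaled_matrix_mult)
   ultimately show ?thesis unfolding sumA by (simp only: sum_negf) simp
  qed
  ultimately show ?thesis by simp
 qed
 have A3b: "(L2sq M (A3 t)) <= ennreal (KM\<^sup>2 * (LBINT s. \<psi> t s ^ 2 * \<Sigma>w s))" if t: "t >= 1" for t
 proof -
  have "(\<integral>\<^sup>+s\<in>{0..}. ennreal ((norm (\<Phi> t s ** \<Sigma> s))^2) \<partial>lborel) <= (\<integral>\<^sup>+s. ennreal (KM\<^sup>2 * (\<psi> t s ^ 2 * \<Sigma>w s)) \<partial>lborel)"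
  proof (rule nn_integral_mono)
   fix s :: real
   show "ennreal ((norm (\<Phi> t s ** \<Sigma> s))^2) * indicator {0..} s <= ennreal (KM\<^sup>2 * (\<psi> t s ^ 2 * \<Sigma>w s))"
   proof (cases "s >= 0")
    case True
    have "(norm (\<Phi> t s ** \<Sigma> s))\<^sup>2 <= (norm (\<Phi> t s) * norm (\<Sigma> s) * KM)^2" by (intro power_mono KM(2)) simp
    also have "... = KM\<^sup>2 * (\<psi> t s ^ 2 * \<Sigma>w s)"
     using True by (simp add: \<Phi>b \<Sigma>w_def power_mult_distrib exp_double[symmetric] mult_ac)
    finally show ?thesis using True by (simp add: ennreal_leI)
   qed (simp add: indicator_def)
  qed
  also have "... = ennreal (LBINT s. KM\<^sup>2 * (\<psi> t s ^ 2 * \<Sigma>w s))"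
   by (rule nn_integral_eq_integral, intro integrable_mult_right weighted[OF t \<Sigma>w]) (auto simp: \<Sigma>w_def)
  finally show ?thesis unfolding A3iso[OF t] by simp
 qed
 define b1 where "b1 t = (norm (q t) * KV)^2 * (LINT y|M. (norm (X0 y))\<^sup>2)" for t
 define b2 where "b2 t = (KV * (LBINT s. \<psi> t s ^ 1 * fw s))^2" for t
 define b3 where "b3 t = KM\<^sup>2 * (LBINT s. \<psi> t s ^ 2 * \<Sigma>w s)" for t
 have A1b: "(L2sq M (A1 t)) <= ennreal (b1 t)" for t
 proof -
  have "(L2sq M (A1 t)) <= (\<integral>\<^sup>+y. ennreal ((norm (q t) * KV)^2 * (norm (X0 y))^2) \<partial>M)"
  proof (intro nn_integral_mono ennreal_leI)
   fix y
   have "(norm (A1 t y))\<^sup>2 <= (norm (q t) * norm (X0 y) * KV)^2" unfolding A1_def by (intro power_mono KV(2)) simp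
   then show "(norm (A1 t y))\<^sup>2 <= (norm (q t) * KV)^2 * (norm (X0 y))^2" by (simp add: power_mult_distrib mult_ac)
  qed
  also have "... = ennreal (LINT y|M. (norm (q t) * KV)\<^sup>2 * (norm (X0 y))^2)"
   by (rule nn_integral_eq_integral) (use X0i in auto)
  finally show ?thesis by (simp add: b1_def)
 qed
 have b3nn: "b3 t >= 0" for t unfolding b3_def by (intro mult_nonneg_nonneg integral_nonneg) (auto simp: \<Sigma>w_def)
 have b1nn: "b1 t >= 0" for t by (simp add: b1_def)
 define D where "D t y = X t y /\<^sub>R (t ^ n * exp (\<alpha> * t)) -
      (\<Sum>z\<in>\<Lambda>. sin (Im z * t) *\<^sub>R (Q z *v X0 y + M1 M \<F> B f \<Sigma> \<alpha> (P z) (Q z) (Im z) y) +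
          cos (Im z * t) *\<^sub>R (P z *v X0 y + M2 M \<F> B f \<Sigma> \<alpha> (P z) (Q z) (Im z) y))" for t y
 have DA: "AE y in M. D t y = A1 t y + A2 t + A3 t y" if t: "t >= 1" for t
 proof -
  have "AE y in M. X t y = r t *v X0 y + (LBINT s:{0..t}. r (t - s) *v f s) + Jt t y" using X[of t] t by (simp add: Jt_def)
  then show ?thesis
  proof eventually_elim
   case (elim y)
   have m1: "M1 M \<F> B f \<Sigma> \<alpha> (P z) (Q z) (Im z) y = J1 z y + (LBINT s:{0..}. N1 z s *v f s)" for z
    unfolding M1_def J1_def N1_def ..
   have m2: "M2 M \<F> B f \<Sigma> \<alpha> (P z) (Q z) (Im z) y = J2 z y + (LBINT s:{0..}. N2 z s *v f s)" for z
    unfolding M2_def J2_def N2_def ..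
   have x0: "(\<Sum>z\<in>\<Lambda>. sin (Im z * t) *\<^sub>R (Q z *v X0 y) + cos (Im z * t) *\<^sub>R (P z *v X0 y)) = c t *v X0 y"
    unfolding c_def bounded_bilinear.sum_left[OF bounded_bilinear_matrix_vector_mult]
     bounded_bilinear.add_left[OF bounded_bilinear_matrix_vector_mult] scaled_matrix_mult ..
   have "X t y /\<^sub>R E t = (r t /\<^sub>R E t) *v X0 y + (LBINT s:{0..t}. r (t - s) *v f s) /\<^sub>R E t + Jt t y /\<^sub>R E t"
    unfolding elim scaled_matrix_mult by (simp add: scaleR_add_right)
   also have "(r t /\<^sub>R E t) *v X0 y = A1 t y + c t *v X0 y"
    by (simp add: A1_def q_def bounded_bilinear.diff_left[OF bounded_bilinear_matrix_vector_mult])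
   finally have XE: "X t y /\<^sub>R E t = A1 t y + c t *v X0 y + (LBINT s:{0..t}. r (t - s) *v f s) /\<^sub>R E t + Jt t y /\<^sub>R E t" .
   show ?case
    unfolding D_def E_def[symmetric] XE A2[OF t] A3_def m1 m2 x0[symmetric]
    by (simp add: sum.distrib scaleR_add_right)
  qed
 qed
 have ub: "(L2sq M (D t)) <= ennreal (3 * b1 t + 3 * b2 t + 3 * b3 t)" if t: "t >= 1" for t
 proof -
  have A1m[measurable]: "A1 t \<in> borel_measurable M"
   unfolding A1_def[abs_def] by (intro borel_measurable_matrix_vector_mult X0 borel_measurable_const)
  have [measurable]: "J1 z \<in> borel_measurable M" "J2 z \<in> borel_measurable M" "Jt t \<in> borel_measurable M" for z
   using J1 J2 Jt[of t] t unfolding has_ito_integral_def by auto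
  have A3m[measurable]: "A3 t \<in> borel_measurable M" unfolding A3_def[abs_def] by measurable
  have "(L2sq M (D t)) <=
   (\<integral>\<^sup>+y. 3 * ennreal ((norm (A1 t y))^2) + 3 * ennreal ((norm (A2 t))^2) + 3 * ennreal ((norm (A3 t y))^2) \<partial>M)"
  proof (rule nn_integral_mono_AE)
   show "AE y in M. ennreal ((norm (D t y))^2) <= 3 * ennreal ((norm (A1 t y))^2) + 3 * ennreal ((norm (A2 t))^2) + 3 * ennreal ((norm (A3 t y))^2)"
    using DA[OF t]
   proof eventually_elim
    case (elim y)
    have "ennreal ((norm (D t y))^2) <= ennreal (3 * (norm (A1 t y))^2 + 3 * (norm (A2 t))^2 + 3 * (norm (A3 t y))^2)"
     unfolding elim by (intro ennreal_leI norm_add3_square)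
    then show ?case by (simp add: ennreal_plus ennreal_mult)
   qed
  qed
  also have "... = 3 * (L2sq M (A1 t)) + 3 * ennreal ((norm (A2 t))^2) + 3 * (L2sq M (A3 t))"
   by (simp add: nn_integral_add nn_integral_cmult emeasure_space_1)
  also have "... <= 3 * ennreal (b1 t) + 3 * ennreal (b2 t) + 3 * ennreal (b3 t)"
  proof (intro add_mono mult_left_mono)
   have "(norm (A2 t))\<^sup>2 <= b2 t" unfolding b2_def using A2b[OF t] by (intro power_mono) auto
   then show "ennreal ((norm (A2 t))^2) <= ennreal (b2 t)" by (rule ennreal_leI)
   show "(L2sq M (A3 t)) <= ennreal (b3 t)" using A3b[OF t] by (simp add: b3_def)
  qed (use A1b in auto)
  also have "... = ennreal (3 * b1 t + 3 * b2 t + 3 * b3 t)"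
   using b1nn b3nn by (simp add: ennreal_plus ennreal_mult b2_def)
  finally show ?thesis .
 qed
 have ql: "((%t. norm (q t)) \<longlongrightarrow> 0) at_top" using lim unfolding q_def E_def c_def by (simp add: tendsto_norm_zero_iff)
 have "((%t. 3 * b1 t + 3 * b2 t + 3 * b3 t) \<longlongrightarrow>
   3 * ((0 * KV)^2 * (LINT y|M. (norm (X0 y))\<^sup>2)) + 3 * (KV * 0)^2 + 3 * (KM\<^sup>2 * 0)) at_top"
  unfolding b1_def b2_def b3_def by (intro tendsto_intros ql weighted_lim fw \<Sigma>w) auto
 then have "((%t. 3 * b1 t + 3 * b2 t + 3 * b3 t) \<longlongrightarrow> 0) at_top" by simp
 from tendsto_ennrealI[OF this] have bl: "((%t. ennreal (3 * b1 t + 3 * b2 t + 3 * b3 t)) \<longlongrightarrow> 0) at_top" by simp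
 have "((%t. L2sq M (D t)) \<longlongrightarrow> 0) at_top"
 proof (rule tendsto_sandwich[OF _ _ tendsto_const bl])
  show "\<forall>\<^sub>F t in at_top. (L2sq M (D t)) <= ennreal (3 * b1 t + 3 * b2 t + 3 * b3 t)"
   using eventually_ge_at_top[of 1] by eventually_elim (rule ub)
 qed simp
 then show ?thesis unfolding mean_square_null_def D_def .
qed

end

lemma exp_weighted_integrable:
 fixes f :: "real => real^'d"
 assumes fm: "(%t. indicator {0..} t *\<^sub>R f t) \<in> borel_measurable borel"
  and fi: "set_integrable lborel {0..} (%t. exp (- \<alpha> * t) * norm (f t))"
 shows "set_integrable lborel {0..t} f"
 unfolding set_integrable_def
proof (rule bochner_bound)
 show "integrable lborel (%s. exp (\<bar>\<alpha>\<bar> * t) * (indicator {0..} s *\<^sub>R (exp (- \<alpha> * s) * norm (f s))))"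
  using fi unfolding set_integrable_def by (rule integrable_mult_right)
 have "(%s. indicator {0..t} s *\<^sub>R (indicator {0..} s *\<^sub>R f s)) \<in> borel_measurable borel" using fm by measurable
 moreover have "indicator {0..t} s *\<^sub>R (indicator {0..} s *\<^sub>R f s) = indicator {0..t} s *\<^sub>R f s" for s by (simp add: indicator_def)
 ultimately have "(%s. indicator {0..t} s *\<^sub>R f s) \<in> borel_measurable borel" by (simp only:)
 then show "(%s. indicator {0..t} s *\<^sub>R f s) \<in> borel_measurable lborel" by simp
 show "AE s in lborel. norm (indicator {0..t} s *\<^sub>R f s) <= norm (exp (\<bar>\<alpha>\<bar> * t) * (indicator {0..} s *\<^sub>R (exp (- \<alpha> * s) * norm (f s))))" (is "AE s in _. ?bd s")
 proof (intro AE_I2)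
  fix s
  show "?bd s"
  proof (cases "0 <= s & s <= t")
   case True
   have "\<alpha> * s <= \<bar>\<alpha>\<bar> * s" using True by (intro mult_right_mono) auto
   also have "... <= \<bar>\<alpha>\<bar> * t" using True by (intro mult_left_mono) auto
   finally have "0 <= \<bar>\<alpha>\<bar> * t + - \<alpha> * s" by simp
   then have "1 <= exp (\<bar>\<alpha>\<bar> * t) * exp (- \<alpha> * s)" unfolding exp_add[symmetric] by simp
   then have "1 * norm (f s) <= exp (\<bar>\<alpha>\<bar> * t) * exp (- \<alpha> * s) * norm (f s)" by (intro mult_right_mono) auto
   then show ?thesis using True by (simp add: mult.assoc)
  qed (auto simp: indicator_def)
 qed
qed

text \<open>The root \<open>z0\<close> shows that the supremum exceeds \<open>a\<close>. To the
  right of \<open>b\<close> there are only finitely many roots, so the supremum is a maximum and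
  thus finite.\<close>

lemma (in delay_kernel) rightmost_roots_attained:
 assumes \<Lambda>: "!!z. Re z > a ==> z \<in> \<Lambda> \<longleftrightarrow> det (charm z) = 0" and z0: "z0 \<in> \<Lambda>" "Re z0 > a"
 obtains \<alpha> where "a < \<alpha>" "root_abscissa \<Lambda> = ereal \<alpha>" "!!z. Re z > \<alpha> ==> det (charm z) \<noteq> 0"
  "rightmost_roots \<Lambda> = {z. Re z = \<alpha> & det (charm z) = 0 & Im z >= 0}"
proof -
 define b where "b = (a + Re z0) / 2"
 have b: "a < b" "b < Re z0" using z0 by (auto simp: b_def)
 define F where "F = {z. Re z >= b & det (charm z) = 0}"
 have F: "finite F" "z0 \<in> F" using finite_roots[OF b(1)] z0 b \<Lambda>[OF z0(2)] by (auto simp: F_def)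
 define \<alpha> where "\<alpha> = Max (Re ` F)"
 have le: "Re z <= \<alpha>" if "z \<in> F" for z using F that by (simp add: \<alpha>_def)
 have "\<alpha> \<in> Re ` F" unfolding \<alpha>_def using F by (intro Max_in) auto
 then obtain z1 where z1: "z1 \<in> F" "Re z1 = \<alpha>" by auto
 have \<alpha>: "a < \<alpha>" "b <= \<alpha>" using le[OF F(2)] b by auto
 have z1\<Lambda>: "z1 \<in> \<Lambda>" using \<Lambda>[of z1] z1 \<alpha> by (simp add: F_def)
 have ub: "Re z <= \<alpha>" if "z \<in> \<Lambda>" for z
 proof (cases "Re z >= b")
  case True
  then show ?thesis using \<Lambda>[of z] that b le[of z] by (simp add: F_def)
 next
  case False
  then show ?thesis using \<alpha> by simp
 qed
 have ra: "root_abscissa \<Lambda> = ereal \<alpha>" unfolding root_abscissa_def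
 proof (rule antisym)
  show "(SUP z\<in>\<Lambda>. ereal (Re z)) <= ereal \<alpha>" using ub by (intro SUP_least) simp
  show "ereal \<alpha> <= (SUP z\<in>\<Lambda>. ereal (Re z))" using z1\<Lambda> z1(2) by (intro SUP_upper2[of z1]) auto
 qed
 show thesis
 proof (rule that[OF \<alpha>(1) ra])
  fix z assume z: "Re z > \<alpha>"
  then show "det (charm z) \<noteq> 0" using ub[of z] \<Lambda>[of z] \<alpha> by fastforce
 next
  show "rightmost_roots \<Lambda> = {z. Re z = \<alpha> & det (charm z) = 0 & Im z >= 0}"
   unfolding rightmost_roots_def ra using \<Lambda> \<alpha> by auto
 qed
qed

context delayed_brownian
begin

text \<open>The common end of both cases. What remains for a particular equation is to identify its
  characteristic matrix with \<open>charm\<close>, its rightmost roots, and its right-hand side with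
  a convolution.\<close>

lemma solution_mean_square:
 fixes X :: "real => 'a => real^'d" and f :: "real => real^'d" and \<Sigma> :: "real => real^'e^'d" and \<Delta> :: "complex => complex^'d^'d"
 assumes a: "a < \<alpha>" and no: "!!z. Re z > \<alpha> ==> det (K.charm z) \<noteq> 0"
  and \<Delta>: "!!z. Re z > a ==> \<Delta> z = K.charm z"
  and R: "rightmost_roots \<Lambda> = {z. Re z = \<alpha> & det (K.charm z) = 0 & Im z >= 0}"
  and fm: "(%t. indicator {0..} t *\<^sub>R f t) \<in> borel_measurable borel"
  and fi: "set_integrable lborel {0..} (%t. exp (- \<alpha> * t) * norm (f t))"
  and \<Sigma>: "continuous_on {0..} \<Sigma>" and \<Sigma>i: "set_integrable lborel {0..} (%t. exp (- 2 * \<alpha> * t) * (norm (\<Sigma> t))^2)"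
  and X0: "X0 \<in> borel_measurable M" and X0i: "integrable M (%w. (norm (X0 w))\<^sup>2)"
  and Xc: "AE w in M. continuous_on {0..} (%t. X t w)"
  and eq: "!!t. t >= 0 ==> AE w in M. X t w = X0 w
    + (LBINT s:{0..t}. f s + (\<chi> i. \<Sum>k\<in>UNIV. K.kconv (%u. X u w $ k) i k s))
    + ito_integral M \<F> B (%s w. indicator {0..t} s *\<^sub>R \<Sigma> s) w"
 shows "mean_square_null M (%t w. X t w /\<^sub>R (t ^ leading_exponent \<Delta> \<Lambda> * exp (\<alpha> * t)) -
      (\<Sum>z\<in>leading_roots \<Delta> \<Lambda>.
       sin (Im z * t) *\<^sub>R (Q_star \<Delta> \<Lambda> z *v X0 w + M1 M \<F> B f \<Sigma> \<alpha> (P_star \<Delta> \<Lambda> z) (Q_star \<Delta> \<Lambda> z) (Im z) w) +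
       cos (Im z * t) *\<^sub>R (P_star \<Delta> \<Lambda> z *v X0 w + M2 M \<F> B f \<Sigma> \<alpha> (P_star \<Delta> \<Lambda> z) (Q_star \<Delta> \<Lambda> z) (Im z) w)))"
proof -
 obtain r C where r: "K.resolvent r" "finite (leading_roots \<Delta> \<Lambda>)"
  "!!t. t >= 0 ==> norm (r t) <= C * (1 + t) ^ leading_exponent \<Delta> \<Lambda> * exp (\<alpha> * t)"
  "((%t. r t /\<^sub>R (t ^ leading_exponent \<Delta> \<Lambda> * exp (\<alpha> * t)) -
    (\<Sum>z\<in>leading_roots \<Delta> \<Lambda>. sin (Im z * t) *\<^sub>R Q_star \<Delta> \<Lambda> z + cos (Im z * t) *\<^sub>R P_star \<Delta> \<Lambda> z)) \<longlongrightarrow> 0) at_top"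
  by (rule K.resolvent_asymptotics[OF a no \<Delta> R refl]) blast+
 have rc: "continuous_on UNIV r" using r(1) by (simp add: K.resolvent_def)
 show ?thesis
  by (rule mean_square_asymptotics[OF rc r(3) r(2) r(4) fm fi \<Sigma> \<Sigma>i X0 X0i
     solution_representation[OF r(1) exp_weighted_integrable[OF fm fi] \<Sigma> Xc eq]])
qed

end

section \<open>From matrix measures to kernels with a density\<close>

locale matrix_density = finite_measure L for L :: "real measure" +
 fixes J :: "real set" and \<mu> :: "real set => real^'d^'d" and h :: "'d => 'd => bool => real => real"
 assumes mm: "matrix_measure J \<mu>" and J: "J \<in> sets borel" and sets_L: "sets L = sets borel"
  and h_meas: "!!i k b. h i k b \<in> borel_measurable borel"
  and h_nonneg: "!!i k b x. 0 <= h i k b x" and h_off: "!!i k b x. x \<notin> J ==> h i k b x = 0"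
  and h_distr: "!!i k b. distr (pos_variation J (%A. if b then \<mu> A $ i $ k else - \<mu> A $ i $ k)) borel (%x. x) = density L (%x. ennreal (h i k b x))"
begin

text \<open>The density of the matrix measure \<open>\<mu>\<close> with respect to
  \<open>L\<close>.\<close>

definition w :: "real => real^'d^'d" where "w x = (\<chi> i k. h i k True x - h i k False x)"

text \<open>The density of the sum of all variations of the entries. It bounds \<open>norm w\<close>
  and every single density, so integrability against \<open>v\<close> settles all entries at
  once.\<close>

definition v :: "real => real" where "v x = (\<Sum>i\<in>UNIV. \<Sum>k\<in>UNIV. h i k True x + h i k False x)"

lemma id_meas: "(%x. x) \<in> measurable (pos_variation J m) borel"
 by (subst measurable_cong_sets[OF sets_pos_variation refl]) (simp add: measurable_restrict_space1)

lemma meas_L: "f \<in> borel_measurable borel ==> f \<in> borel_measurable L"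
 using measurable_cong_sets[OF sets_L refl] by blast

lemma w_meas: "w \<in> borel_measurable borel"
proof (subst borel_measurable_euclidean_space, rule ballI)
 fix b :: "real^'d^'d" assume "b \<in> Basis"
 then obtain i k where b: "b = axis i (axis k 1)" by (auto simp: Basis_vec_def)
 have "(%x. h i k True x - h i k False x) \<in> borel_measurable borel" using h_meas by measurable
 then show "(%x. w x \<bullet> b) \<in> borel_measurable borel" by (simp add: b w_def inner_axis)
qed

lemma v_meas: "v \<in> borel_measurable borel"
 unfolding v_def[abs_def] by (intro borel_measurable_sum borel_measurable_add h_meas)

lemma v_nonneg: "v x >= 0"
 unfolding v_def by (intro sum_nonneg add_nonneg_nonneg h_nonneg)

lemma v_off: "x \<notin> J ==> v x = 0" by (simp add: v_def h_off)

lemma w_off: "x \<notin> J ==> w x = 0" by (simp add: w_def h_off vec_eq_iff)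

lemma norm_w: "norm (w x) <= v x"
proof -
 have "norm (w x) <= (\<Sum>i\<in>UNIV. \<Sum>k\<in>UNIV. norm (w x $ i $ k))" by (rule matrix_norm_le_sum)
 also have "... <= v x" unfolding v_def
 proof (intro sum_mono)
  fix i k
  show "norm (w x $ i $ k) <= h i k True x + h i k False x"
   using h_nonneg[of i k True x] h_nonneg[of i k False x] by (simp add: w_def)
 qed
 finally show ?thesis .
qed

lemma h_le_v: "h i k b x <= v x"
proof -
 have "h i k b x <= h i k True x + h i k False x" using h_nonneg[of i k True x] h_nonneg[of i k False x] by (cases b) auto
 also have "... <= (\<Sum>k\<in>UNIV. h i k True x + h i k False x)"
  by (rule member_le_sum[of k UNIV "%k. h i k True x + h i k False x"]) (auto intro: add_nonneg_nonneg h_nonneg)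
 also have "... <= v x" unfolding v_def
  by (rule member_le_sum[of i UNIV "%i. \<Sum>k\<in>UNIV. h i k True x + h i k False x"]) (auto intro!: sum_nonneg add_nonneg_nonneg h_nonneg)
 finally show ?thesis .
qed

text \<open>Both parts of the Jordan decomposition have densities with respect to \<open>L\<close>,
  and integrability against \<open>v\<close> allows the two integrals to be subtracted.\<close>

lemma signed_integral_eq:
 fixes g :: "real => 'b::{banach, second_countable_topology}"
 assumes gm: "g \<in> borel_measurable borel" and gi: "integrable L (%x. v x * norm (g x))"
 shows "integrable L (%x. (w x $ i $ k) *\<^sub>R g x)" "signed_integral J (%A. \<mu> A $ i $ k) g = (LINT x|L. (w x $ i $ k) *\<^sub>R g x)"
proof -
 have I: "(LINT s|pos_variation J (%A. if b then \<mu> A $ i $ k else - \<mu> A $ i $ k). g s) = (LINT x|L. h i k b x *\<^sub>R g x)" for b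
 proof -
  have "(LINT s|pos_variation J (%A. if b then \<mu> A $ i $ k else - \<mu> A $ i $ k). g s) = (LINT x|density L (%x. ennreal (h i k b x)). g x)"
   unfolding h_distr[symmetric] by (rule integral_distr[symmetric, OF id_meas gm])
  also have "... = (LINT x|L. h i k b x *\<^sub>R g x)"
   by (rule integral_density) (auto intro: meas_L gm h_meas h_nonneg)
  finally show ?thesis .
 qed
 have i: "integrable L (%x. h i k b x *\<^sub>R g x)" for b
 proof (rule bochner_bound[OF gi])
  show "(%x. h i k b x *\<^sub>R g x) \<in> borel_measurable L" by (intro borel_measurable_scaleR meas_L h_meas gm)
  show "AE x in L. norm (h i k b x *\<^sub>R g x) <= norm (v x * norm (g x))"
   using h_le_v h_nonneg v_nonneg by (intro AE_I2) (simp add: mult_right_mono)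
 qed
 have wg: "(w x $ i $ k) *\<^sub>R g x = h i k True x *\<^sub>R g x - h i k False x *\<^sub>R g x" for x
  by (simp add: w_def scaleR_left_diff_distrib)
 show "integrable L (%x. (w x $ i $ k) *\<^sub>R g x)" unfolding wg by (intro Bochner_Integration.integrable_diff i)
 show "signed_integral J (%A. \<mu> A $ i $ k) g = (LINT x|L. (w x $ i $ k) *\<^sub>R g x)"
  using I[of True] I[of False] unfolding signed_integral_def wg by (simp add: i)
qed

lemma integrable_v: "integrable L v"
proof -
 have "integrable L (h i k b)" for i k b
 proof (rule integrableI_nonneg)
  show "h i k b \<in> borel_measurable L" by (intro meas_L h_meas)
  have "sigma_additive (sets (restrict_space borel J)) (%A. if b then \<mu> A $ i $ k else - \<mu> A $ i $ k)"
   using matrix_measure_component[OF mm] by (cases b) simp_all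
  then have "finite_measure (density L (%x. ennreal (h i k b x)))"
   unfolding h_distr[symmetric] by (intro finite_measure.finite_measure_distr finite_measure_pos_variation id_meas)
  then have "emeasure (density L (%x. ennreal (h i k b x))) (space L) < \<infinity>"
   using finite_measure.emeasure_finite[of "density L (%x. ennreal (h i k b x))" "space L"] by (simp add: less_top)
  then show "(\<integral>\<^sup>+x. ennreal (h i k b x) \<partial>L) < \<infinity>"
   by (subst (asm) emeasure_density) (auto intro!: meas_L measurable_compose[OF h_meas measurable_ennreal] cong: nn_integral_cong_simp)
 qed (simp add: h_nonneg)
 then show ?thesis unfolding v_def[abs_def] by (intro bochner_isum Bochner_Integration.integrable_add)
qed

text \<open>Each variation of an entry is at most the total variation. In this way finiteness of the
  integral in \<open>alpha_star\<close> becomes an exponential moment of the kernel.\<close>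

lemma integrable_v_weight:
 fixes g :: "real => real"
 assumes gm: "g \<in> borel_measurable borel" and g0: "!!x. g x >= 0" and tv: "(\<integral>\<^sup>+x. ennreal (g x) \<partial>total_variation J \<mu>) < \<infinity>"
 shows "integrable L (%x. v x * g x)"
proof -
 have "integrable L (%x. h i k b x * g x)" for i k b
 proof (rule integrableI_nonneg)
  show "(%x. h i k b x * g x) \<in> borel_measurable L" by (intro meas_L borel_measurable_times h_meas gm)
  have "(\<integral>\<^sup>+x. ennreal (h i k b x * g x) \<partial>L) = (\<integral>\<^sup>+x. ennreal (g x) \<partial>density L (%x. ennreal (h i k b x)))"
   by (subst nn_integral_density) (auto intro!: meas_L h_meas measurable_compose[OF h_meas measurable_ennreal] measurable_compose[OF gm measurable_ennreal] nn_integral_cong simp: ennreal_mult' h_nonneg)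
  also have "... = (\<integral>\<^sup>+x. ennreal (g x) \<partial>pos_variation J (%A. if b then \<mu> A $ i $ k else - \<mu> A $ i $ k))"
   unfolding h_distr[symmetric] by (rule nn_integral_distr[OF id_meas]) (use gm in measurable)
  also have "... <= (\<integral>\<^sup>+x. ennreal (g x) \<partial>total_variation J \<mu>)"
  proof (rule nn_integral_mono_measure)
   have "\<bar>\<mu> A $ i $ k\<bar> <= norm (\<mu> A)" for A using matrix_component_le_norm[of "\<mu> A" i k] by simp
   then have "(if b then \<mu> A $ i $ k else - \<mu> A $ i $ k) <= norm (\<mu> A)" for A
    using abs_le_D1[of "\<mu> A $ i $ k"] abs_le_D2[of "\<mu> A $ i $ k"] by auto
   moreover have "sigma_additive (sets (restrict_space borel J)) (%A. if b then \<mu> A $ i $ k else - \<mu> A $ i $ k)"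
    using matrix_measure_component[OF mm] by (cases b) simp_all
   ultimately show "pos_variation J (%A. if b then \<mu> A $ i $ k else - \<mu> A $ i $ k) <= total_variation J \<mu>"
    by (intro pos_variation_le_total_variation[OF mm])
  qed simp
  finally show "(\<integral>\<^sup>+x. ennreal (h i k b x * g x) \<partial>L) < \<infinity>" using tv by (rule le_less_trans)
 qed (simp add: h_nonneg g0)
 then show ?thesis unfolding v_def[abs_def] sum_distrib_right distrib_right
  by (intro bochner_isum Bochner_Integration.integrable_add)
qed

lemma integrable_v_bounded:
 fixes g :: "real => 'b::{banach, second_countable_topology}"
 assumes gm: "g \<in> borel_measurable borel" and gb: "!!x. x \<in> J ==> norm (g x) <= C"
 shows "integrable L (%x. v x * norm (g x))"
proof (rule bochner_bound)
 show "integrable L (%x. C * v x)" using integrable_v by simp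
 show "(%x. v x * norm (g x)) \<in> borel_measurable L"
  by (intro meas_L borel_measurable_times v_meas measurable_compose[OF gm borel_measurable_norm])
 show "AE x in L. norm (v x * norm (g x)) <= norm (C * v x)" (is "AE x in _. ?bd x")
 proof (intro AE_I2)
  fix x
  show "?bd x"
  proof (cases "x \<in> J")
   case True
   then have "norm (g x) * v x <= \<bar>C\<bar> * v x" using gb[OF True] v_nonneg[of x] by (intro mult_right_mono) auto
   then show ?thesis using v_nonneg[of x] by (simp add: abs_mult mult.commute)
  qed (simp add: v_off)
 qed
qed

lemma vector_integral_eq:
 fixes x :: "real => real^'d"
 assumes xm: "x \<in> borel_measurable borel" and xi: "!!s. s \<in> J ==> norm (x s) <= C"
 shows "vector_integral J \<mu> x $ i = (\<Sum>k\<in>UNIV. LINT s|L. w s $ i $ k * x s $ k)"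
proof -
 have "signed_integral J (%A. \<mu> A $ i $ k) (%s. x s $ k) = (LINT s|L. (w s $ i $ k) *\<^sub>R (x s $ k))" for k
 proof (rule signed_integral_eq(2)[OF _ integrable_v_bounded])
  show "(%s. x s $ k) \<in> borel_measurable borel" by (rule borel_measurable_vec_nth[OF xm])
  show "norm (x s $ k) <= C" if "s \<in> J" for s using component_le_norm_cart[of "x s" k] xi[OF that] by simp
 qed (rule borel_measurable_vec_nth[OF xm])
 then show ?thesis by (simp add: vector_integral_def)
qed

end

lemma vector_integral_cong:
 assumes "!!s. s \<in> J ==> x s = y s"
 shows "vector_integral J \<mu> x = vector_integral J \<mu> y"
proof -
 have "signed_integral J m (%s. x s $ k) = signed_integral J m (%s. y s $ k)" for m k
  unfolding signed_integral_def by (intro arg_cong2[of _ _ _ _ "(-)"] bochner_cong refl) (simp_all add: assms)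
 then show ?thesis by (simp add: vector_integral_def)
qed

lemma matrix_density_exists:
 fixes \<mu> :: "real set => real^'d^'d"
 assumes mm: "matrix_measure J \<mu>" and J: "J \<in> sets borel"
 obtains L h where "matrix_density L J \<mu> h"
proof (rule matrix_measure_density[OF mm J])
 fix L h
 assume Lh: "finite_measure L" "sets L = sets borel" "!!i k b. h i k b \<in> borel_measurable borel"
  "!!i k b x. 0 <= h i k b x" "!!i k b x. x \<notin> J ==> h i k b x = 0"
  "!!i k b. distr (pos_variation J (%A. if b then \<mu> A $ i $ k else - \<mu> A $ i $ k)) borel (%x. x) = density L (%x. ennreal (h i k b x))"
 show thesis
  by (rule that[of L h], intro matrix_density.intro matrix_density_axioms.intro Lh mm J)
qed

section \<open>The Volterra equation and the delay equation\<close>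

context brownian
begin

lemma volterra_mean_square:
 fixes \<mu> :: "real set => real^'d^'d" and f :: "real => real^'d" and \<Sigma> :: "real => real^'e^'d"
  and X0 :: "'a => real^'d" and X :: "real => 'a => real^'d"
 defines "\<Delta> \<equiv> volterra_char \<mu>" and "\<Lambda> \<equiv> volterra_roots \<mu>"
 defines "\<alpha> \<equiv> real_of_ereal (root_abscissa \<Lambda>)"
 assumes mm: "matrix_measure {0..} \<mu>" and less: "alpha_star \<mu> < root_abscissa \<Lambda>"
  and f: "continuous_on {0..} f" and fi: "set_integrable lborel {0..} (%t. exp (- \<alpha> * t) * norm (f t))"
  and \<Sigma>: "continuous_on {0..} \<Sigma>" and \<Sigma>i: "set_integrable lborel {0..} (%t. exp (- 2 * \<alpha> * t) * (norm (\<Sigma> t))^2)"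
  and X0: "X0 \<in> borel_measurable (\<F> 0)" and X0i: "integrable M (%y. (norm (X0 y))\<^sup>2)"
  and X: "volterra_solution M \<F> B \<mu> f \<Sigma> X0 X"
 shows "mean_square_null M (%t y. X t y /\<^sub>R (t ^ leading_exponent \<Delta> \<Lambda> * exp (\<alpha> * t)) -
      (\<Sum>z\<in>leading_roots \<Delta> \<Lambda>.
       sin (Im z * t) *\<^sub>R (Q_star \<Delta> \<Lambda> z *v X0 y + M1 M \<F> B f \<Sigma> \<alpha> (P_star \<Delta> \<Lambda> z) (Q_star \<Delta> \<Lambda> z) (Im z) y) +
       cos (Im z * t) *\<^sub>R (P_star \<Delta> \<Lambda> z *v X0 y + M2 M \<F> B f \<Sigma> \<alpha> (P_star \<Delta> \<Lambda> z) (Q_star \<Delta> \<Lambda> z) (Im z) y)))"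
proof -
 \<comment> \<open>Since \<open>alpha_star\<close> is an infimum over exponents with a finite
   integral, some such exponent lies strictly below the abscissa of the roots.\<close>
 obtain a where fa: "(\<integral>\<^sup>+s. ennreal (exp (- a * s)) \<partial>total_variation {0..} \<mu>) < \<infinity>" and a\<Lambda>: "ereal a < root_abscissa \<Lambda>"
  using less unfolding alpha_star_def INF_less_iff by blast
 have star: "alpha_star \<mu> <= ereal a" unfolding alpha_star_def by (rule INF_lower) (use fa in simp)
 have Jm: "{0..} \<in> sets (borel :: real measure)" by simp
 obtain L h where "matrix_density L {0..} \<mu> h" by (rule matrix_density_exists[OF mm Jm])
 then interpret D: matrix_density L "{0..}" \<mu> h .
 have vexp: "integrable L (%x. D.v x * exp (- a * x))"
  by (rule D.integrable_v_weight) (use fa in auto)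
 interpret delayed_brownian M \<F> B L D.w a
 proof unfold_locales
  show "integrable L (%x. norm (D.w x))"
   by (rule bochner_bound[OF D.integrable_v])
    (use D.norm_w D.v_nonneg D.w_meas in \<open>auto intro!: AE_I2 D.meas_L\<close>)
  show "integrable L (%x. exp (- a * x) * norm (D.w x))"
   by (rule bochner_bound[OF vexp])
    (use D.norm_w D.v_nonneg D.w_meas in \<open>auto intro!: AE_I2 D.meas_L simp: mult.commute\<close>)
 qed (use D.w_meas D.w_off D.sets_L in auto)
 have charm: "K.charm z = \<Delta> z" if "Re z >= a" for z
 proof -
  have m: "(%x. exp (- z * of_real x)) \<in> borel_measurable borel"
   by (intro borel_measurable_continuous_onI continuous_intros)
  have vz: "integrable L (%x. D.v x * norm (exp (- z * of_real x)))"
  proof (rule bochner_bound[OF vexp])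
   show "(%x. D.v x * norm (exp (- z * of_real x))) \<in> borel_measurable L"
    by (intro D.meas_L borel_measurable_times D.v_meas measurable_compose[OF m borel_measurable_norm])
   show "AE x in L. norm (D.v x * norm (exp (- z * of_real x))) <= norm (D.v x * exp (- a * x))" (is "AE x in _. ?bd x")
   proof (intro AE_I2)
    fix x
    show "?bd x"
    proof (cases "x >= 0")
     case True
     then have "a * x <= Re z * x" using that by (intro mult_right_mono)
     then show ?thesis using D.v_nonneg[of x] by (simp add: abs_mult mult_left_mono)
    qed (simp add: D.v_off)
   qed
  qed
  have "signed_integral {0..} (%A. \<mu> A $ i $ k) (%s. exp (- z * of_real s)) = K.lap z $ i $ k" for i k
   unfolding D.signed_integral_eq(2)[OF m vz] K.lap_def by (simp add: scaleR_conv_of_real mult.commute)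
  then show ?thesis unfolding \<Delta>_def volterra_char_def K.charm_def scalar_integral_def by (simp add: vec_eq_iff)
 qed
 \<comment> \<open>To the right of \<open>a\<close> the condition \<open>Re z > alpha_star\<close>
   in \<open>volterra_roots\<close> holds automatically, as \<open>alpha_star\<close> is at most
   \<open>a\<close>.\<close>
 have \<Lambda>: "z \<in> \<Lambda> \<longleftrightarrow> det (K.charm z) = 0" if "Re z > a" for z
 proof -
  have "alpha_star \<mu> < ereal (Re z)" using star that by (metis ereal_less_eq(3) le_less_trans less_ereal.simps(1))
  then show ?thesis using charm[of z] that by (simp add: \<Lambda>_def volterra_roots_def \<Delta>_def)
 qed
 obtain z0 where z0: "z0 \<in> \<Lambda>" "Re z0 > a" using a\<Lambda> unfolding root_abscissa_def less_SUP_iff by auto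
 obtain \<alpha>' where \<alpha>': "a < \<alpha>'" "root_abscissa \<Lambda> = ereal \<alpha>'" "!!z. Re z > \<alpha>' ==> det (K.charm z) \<noteq> 0"
  "rightmost_roots \<Lambda> = {z. Re z = \<alpha>' & det (K.charm z) = 0 & Im z >= 0}"
  by (rule K.rightmost_roots_attained[OF \<Lambda> z0]) blast+
 have \<alpha>: "\<alpha>' = \<alpha>" using \<alpha>'(2) by (simp add: \<alpha>_def)
 have Xc: "AE y in M. continuous_on {0..} (%t. X t y)" using X unfolding volterra_solution_def by blast
 show ?thesis
 proof (rule solution_mean_square[OF \<alpha>'(1)[unfolded \<alpha>] \<alpha>'(3)[unfolded \<alpha>] charm[symmetric] \<alpha>'(4)[unfolded \<alpha>] _ fi \<Sigma> \<Sigma>i _ X0i Xc])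
  show "(%t. indicator {0..} t *\<^sub>R f t) \<in> borel_measurable borel" by (rule borel_measurable_continuous_on_indicator[OF _ f]) simp
  show "X0 \<in> borel_measurable M" by (rule F_measurable[OF _ X0]) simp
  fix t :: real assume t: "t >= 0"
  have "AE y in M. X t y = X0 y
    + (LBINT s:{0..t}. f s + vector_integral {0..} \<mu> (%u. indicator {0..s} u *\<^sub>R X (s - u) y))
    + ito_integral M \<F> B (%s y. indicator {0..t} s *\<^sub>R \<Sigma> s) y"
   using X t unfolding volterra_solution_def by blast
  then show "AE y in M. X t y = X0 y
    + (LBINT s:{0..t}. f s + (\<chi> i. \<Sum>k\<in>UNIV. K.kconv (%u. X u y $ k) i k s))
    + ito_integral M \<F> B (%s y. indicator {0..t} s *\<^sub>R \<Sigma> s) y"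
   using Xc
  proof eventually_elim
   case (elim y)
   have vi: "vector_integral {0..} \<mu> (%u. indicator {0..s} u *\<^sub>R X (s - u) y) = (\<chi> i. \<Sum>k\<in>UNIV. K.kconv (%u. X u y $ k) i k s)"
    if s: "s >= 0" for s
   proof -
    have c: "continuous_on {0..s} (%u. X (s - u) y)"
     by (rule continuous_on_compose2[OF elim(2)]) (auto intro!: continuous_intros)
    then obtain C where C: "!!u. 0 <= u ==> u <= s ==> norm (X (s - u) y) <= C" using continuous_on_Icc_bounded by blast
    have m: "(%u. indicator {0..s} u *\<^sub>R X (s - u) y) \<in> borel_measurable borel"
     by (rule borel_measurable_continuous_on_indicator[OF _ c]) simp
    have b: "norm (indicator {0..s} u *\<^sub>R X (s - u) y) <= \<bar>C\<bar>" for u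
     using C[of u] by (cases "u \<in> {0..s}") auto
    have "(LINT u|L. D.w u $ i $ k * (indicator {0..s} u *\<^sub>R X (s - u) y) $ k) = K.kconv (%u. X u y $ k) i k s" for i k
     unfolding K.kconv_def
    proof (rule bochner_cong[OF refl])
     fix u
     show "D.w u $ i $ k * (indicator {0..s} u *\<^sub>R X (s - u) y) $ k = indicator {..s} u * (X (s - u) y $ k * D.w u $ i $ k)"
      using D.w_off[of u] by (cases "u >= 0") (auto simp: indicator_def)
    qed
    then show ?thesis by (simp add: vec_eq_iff D.vector_integral_eq[OF m b])
   qed
   have "(LBINT s:{0..t}. f s + vector_integral {0..} \<mu> (%u. indicator {0..s} u *\<^sub>R X (s - u) y)) =
    (LBINT s:{0..t}. f s + (\<chi> i. \<Sum>k\<in>UNIV. K.kconv (%u. X u y $ k) i k s))"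
    by (rule set_lebesgue_integral_cong) (auto simp: vi)
   then show ?case using elim(1) by simp
  qed
 qed auto
qed

text \<open>Reflection of \<nu> yields a kernel on the half-line. The part of the delay integral
  that reaches back before time 0 depends only on \<phi> and joins the forcing; the coefficients
  \<open>G1\<close> and \<open>G2\<close> are the contribution of this forcing to \<open>M1\<close>
  and \<open>M2\<close>.\<close>

lemma delay_mean_square:
 fixes \<tau> :: real and \<nu> :: "real set => real^'d^'d" and f :: "real => real^'d" and \<Sigma> :: "real => real^'e^'d"
  and \<phi> :: "real => real^'d" and X :: "real => 'a => real^'d"
 defines "\<Delta> \<equiv> delay_char \<tau> \<nu>" and "\<Lambda> \<equiv> delay_roots \<tau> \<nu>"
 defines "\<alpha> \<equiv> real_of_ereal (root_abscissa \<Lambda>)"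
 assumes \<tau>: "\<tau> >= 0" and mm: "matrix_measure {-\<tau>..0} \<nu>"
  and f: "continuous_on {0..} f" and fi: "set_integrable lborel {0..} (%t. exp (- \<alpha> * t) * norm (f t))"
  and \<Sigma>: "continuous_on {0..} \<Sigma>" and \<Sigma>i: "set_integrable lborel {0..} (%t. exp (- 2 * \<alpha> * t) * (norm (\<Sigma> t))^2)"
  and \<phi>: "continuous_on {-\<tau>..0} \<phi>"
  and X: "delay_solution M \<F> B \<tau> \<nu> f \<Sigma> \<phi> X"
 shows "mean_square_null M (%t y. X t y /\<^sub>R (t ^ leading_exponent \<Delta> \<Lambda> * exp (\<alpha> * t)) -
      (\<Sum>z\<in>leading_roots \<Delta> \<Lambda>.
       sin (Im z * t) *\<^sub>R (Q_star \<Delta> \<Lambda> z *v \<phi> 0 + G1 \<tau> \<nu> \<phi> \<alpha> (P_star \<Delta> \<Lambda> z) (Q_star \<Delta> \<Lambda> z) (Im z)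
        + M1 M \<F> B f \<Sigma> \<alpha> (P_star \<Delta> \<Lambda> z) (Q_star \<Delta> \<Lambda> z) (Im z) y) +
       cos (Im z * t) *\<^sub>R (P_star \<Delta> \<Lambda> z *v \<phi> 0 + G2 \<tau> \<nu> \<phi> \<alpha> (P_star \<Delta> \<Lambda> z) (Q_star \<Delta> \<Lambda> z) (Im z)
        + M2 M \<F> B f \<Sigma> \<alpha> (P_star \<Delta> \<Lambda> z) (Q_star \<Delta> \<Lambda> z) (Im z) y)))"
proof -
 have Jm: "{-\<tau>..0} \<in> sets (borel :: real measure)" by simp
 obtain L h where "matrix_density L {-\<tau>..0} \<nu> h" by (rule matrix_density_exists[OF mm Jm])
 then interpret D: matrix_density L "{-\<tau>..0}" \<nu> h .
 define L' where "L' = distr L borel uminus"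
 define w' where "w' x = D.w (- x)" for x
 \<comment> \<open>Any number below the abscissa will do, since a measure on a compact interval has
   all exponential moments. The case of no roots is carried along: then the abscissa is
   \<open>- \<infinity>\<close>, its \<open>real_of_ereal\<close> is 0, and \<open>- 1\<close> lies
   below it.\<close>
 define a where "a = (if \<Lambda> = {} then - 1 else Re (SOME z. z \<in> \<Lambda>) - 1)"
 have um: "uminus \<in> measurable L (borel :: real measure)" by (intro D.meas_L) simp
 have w'm: "w' \<in> borel_measurable borel" unfolding w'_def[abs_def] by (rule measurable_compose[OF _ D.w_meas]) simp
 interpret L': finite_measure L' unfolding L'_def by (rule D.finite_measure_distr[OF um])
 have tr: "(LINT x|L'. F x) = (LINT u|L. F (- u))" if "F \<in> borel_measurable borel" for F :: "real => 'z::{banach, second_countable_topology}"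
  unfolding L'_def by (rule integral_distr[OF um that])
 have tri: "integrable L' F \<longleftrightarrow> integrable L (%u. F (- u))" if "F \<in> borel_measurable borel" for F :: "real => 'z::{banach, second_countable_topology}"
  unfolding L'_def by (rule integrable_distr_eq[OF um that])
 have wb: "integrable L (%u. norm (g u) * norm (D.w u))"
  if gm: "g \<in> borel_measurable borel" and gb: "!!u. u \<in> {-\<tau>..0} ==> norm (g u) <= C" for g :: "real => 'z::{banach, second_countable_topology}" and C
 proof (rule bochner_bound[OF D.integrable_v_bounded[OF gm gb]])
  show "(%u. norm (g u) * norm (D.w u)) \<in> borel_measurable L"
   by (intro D.meas_L borel_measurable_times measurable_compose[OF gm borel_measurable_norm] measurable_compose[OF D.w_meas borel_measurable_norm])
  show "AE u in L. norm (norm (g u) * norm (D.w u)) <= norm (D.v u * norm (g u))"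
   using D.norm_w D.v_nonneg by (intro AE_I2) (simp add: mult.commute[of "norm (g _)"] mult_right_mono)
 qed auto
 have expb: "norm (exp (c * u)) <= exp (\<bar>c\<bar> * \<tau>)" if "u \<in> {-\<tau>..0}" for c u :: real
 proof -
  have "c * u <= \<bar>c\<bar> * \<bar>u\<bar>" by (metis abs_ge_self abs_mult)
  also have "... <= \<bar>c\<bar> * \<tau>" using that by (intro mult_left_mono) auto
  finally show ?thesis by simp
 qed
 interpret delayed_brownian M \<F> B L' w' a
 proof unfold_locales
  show "sets L' = sets borel" by (simp add: L'_def)
  show "w' \<in> borel_measurable borel" by (rule w'm)
  show "w' x = 0" if "x < 0" for x unfolding w'_def using that by (intro D.w_off) simp
  have "integrable L (%u. norm (D.w u))" using wb[of "%u. 1 :: real" 1] by simp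
  then show "integrable L' (%x. norm (w' x))"
   by (subst tri) (simp_all add: w'_def measurable_compose[OF w'm[unfolded w'_def[abs_def]] borel_measurable_norm])
  have "integrable L (%u. exp (a * u) * norm (D.w u))" using wb[of "%u. exp (a * u)", OF _ expb] by simp
  moreover have "(%x. exp (- a * x) * norm (w' x)) \<in> borel_measurable borel"
   by (intro borel_measurable_times measurable_compose[OF w'm borel_measurable_norm]) simp
  ultimately show "integrable L' (%x. exp (- a * x) * norm (w' x))" by (subst tri) (simp_all add: w'_def)
 qed
 have w'c: "(%x. w' x $ i $ k) \<in> borel_measurable borel" for i k by (intro borel_measurable_vec_nth w'm)
 have charm: "K.charm z = \<Delta> z" for z
 proof -
  have m: "(%x. exp (z * of_real x)) \<in> borel_measurable borel"
   by (intro borel_measurable_continuous_onI continuous_intros)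
  have "norm (exp (z * of_real u)) <= exp (\<bar>Re z\<bar> * \<tau>)" if "u \<in> {-\<tau>..0}" for u using expb[OF that, of "Re z"] by simp
  from D.integrable_v_bounded[OF m this]
  have vz: "integrable L (%x. D.v x * norm (exp (z * of_real x)))" .
  have "signed_integral {-\<tau>..0} (%A. \<nu> A $ i $ k) (%s. exp (z * of_real s)) = K.lap z $ i $ k" for i k
  proof -
   have "K.lap z $ i $ k = (LINT x|L'. exp (- z * of_real x) * of_real (w' x $ i $ k))" by (simp add: K.lap_def)
   also have "... = (LINT u|L. exp (- z * of_real (- u)) * of_real (w' (- u) $ i $ k))"
    using w'c[of i k] by (intro tr) measurable
   finally show ?thesis
    unfolding D.signed_integral_eq(2)[OF m vz] by (simp add: scaleR_conv_of_real mult.commute w'_def)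
  qed
  then show ?thesis unfolding \<Delta>_def delay_char_def K.charm_def scalar_integral_def by (simp add: vec_eq_iff)
 qed
 have \<Lambda>: "z \<in> \<Lambda> \<longleftrightarrow> det (K.charm z) = 0" for z unfolding charm by (simp add: \<Lambda>_def delay_roots_def \<Delta>_def)
 have \<alpha>: "a < \<alpha>" "!!z. Re z > \<alpha> ==> det (K.charm z) \<noteq> 0"
  "rightmost_roots \<Lambda> = {z. Re z = \<alpha> & det (K.charm z) = 0 & Im z >= 0}"
 proof -
  have "a < \<alpha> & (\<forall>z. Re z > \<alpha> \<longrightarrow> det (K.charm z) \<noteq> 0) & rightmost_roots \<Lambda> = {z. Re z = \<alpha> & det (K.charm z) = 0 & Im z >= 0}"
  proof (cases "\<Lambda> = {}")
   case True
   then have "\<alpha> = 0" by (simp add: \<alpha>_def root_abscissa_def bot_ereal_def)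
   moreover have "det (K.charm z) \<noteq> 0" for z using \<Lambda>[of z] True by simp
   ultimately show ?thesis using True by (simp add: a_def rightmost_roots_def)
  next
   case False
   then have z0: "(SOME z. z \<in> \<Lambda>) \<in> \<Lambda>" "Re (SOME z. z \<in> \<Lambda>) > a" by (simp_all add: some_in_eq a_def)
   obtain \<alpha>' where \<alpha>': "a < \<alpha>'" "root_abscissa \<Lambda> = ereal \<alpha>'" "!!z. Re z > \<alpha>' ==> det (K.charm z) \<noteq> 0"
    "rightmost_roots \<Lambda> = {z. Re z = \<alpha>' & det (K.charm z) = 0 & Im z >= 0}"
    by (rule K.rightmost_roots_attained[OF \<Lambda> z0]) blast+
   then have "\<alpha>' = \<alpha>" by (simp add: \<alpha>_def)
   then show ?thesis using \<alpha>' by blast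
  qed
  then show "a < \<alpha>" "!!z. Re z > \<alpha> ==> det (K.charm z) \<noteq> 0"
   "rightmost_roots \<Lambda> = {z. Re z = \<alpha> & det (K.charm z) = 0 & Im z >= 0}" by blast+
 qed
 define \<phi>' where "\<phi>' x = indicator {-\<tau>..0} x *\<^sub>R \<phi> x" for x
 have \<phi>'m: "\<phi>' \<in> borel_measurable borel" unfolding \<phi>'_def[abs_def] by (rule borel_measurable_continuous_on_indicator[OF _ \<phi>]) simp
 obtain C\<phi> where C\<phi>: "!!x. norm (\<phi>' x) <= C\<phi>"
 proof -
  have "bounded (\<phi> ` {-\<tau>..0})" by (intro compact_imp_bounded compact_continuous_image \<phi>) simp
  then obtain C where C: "!!x. x \<in> {-\<tau>..0} ==> norm (\<phi> x) <= C" unfolding bounded_iff by blast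
  have "norm (\<phi>' x) <= \<bar>C\<bar>" for x using C[of x] by (cases "x \<in> {-\<tau>..0}") (auto simp: \<phi>'_def)
  then show thesis by (rule that)
 qed
 \<comment> \<open>\<open>b\<close> decides whether the end point \<open>- s\<close> is included.
   The convolution \<open>kconv\<close> contains \<open>u = - s\<close>, so the forcing needs the
   open version \<open>g False\<close>, whereas \<open>G1\<close> and \<open>G2\<close> use closed
   intervals, hence \<open>g True\<close>.\<close>
 define E where "E b s = (if b then {..- s} else {..<- s})" for b and s :: real
 let ?I = "%b s u. indicator (E b s) u *\<^sub>R \<phi>' (s + u)"
 define g where "g b s = (\<chi> i. \<Sum>k\<in>UNIV. LINT u|L. D.w u $ i $ k * (?I b s u) $ k)" for b s
 have gm: "g b \<in> borel_measurable borel" for b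
 proof -
  have c: "(%s. LINT u|L. D.w u $ i $ k * (?I b s u) $ k) \<in> borel_measurable borel" for i k
  proof (rule D.borel_measurable_lebesgue_integral)
   have [measurable]: "(%x. \<phi>' x $ k) \<in> borel_measurable borel" "(%x. D.w x $ i $ k) \<in> borel_measurable borel"
    by (intro borel_measurable_vec_nth \<phi>'m D.w_meas)+
   have "(%p. D.w (snd p) $ i $ k * ((if (if b then snd p <= - fst p else snd p < - fst p) then 1 else 0) * \<phi>' (fst p + snd p) $ k)) \<in> borel_measurable (borel \<Otimes>\<^sub>M borel)"
    by (cases b) (simp_all, measurable)
   moreover have "(%p. D.w (snd p) $ i $ k * ((if (if b then snd p <= - fst p else snd p < - fst p) then 1 else 0) * \<phi>' (fst p + snd p) $ k)) =
    (%(s, u). D.w u $ i $ k * (?I b s u) $ k)"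
    by (auto simp: fun_eq_iff E_def indicator_def)
   moreover have "(borel_measurable ((borel :: real measure) \<Otimes>\<^sub>M L) :: (real \<times> real => real) set) = borel_measurable (borel \<Otimes>\<^sub>M (borel :: real measure))"
    by (intro measurable_cong_sets sets_pair_measure_cong refl D.sets_L)
   ultimately show "(%(s, u). D.w u $ i $ k * (?I b s u) $ k) \<in> borel_measurable (borel \<Otimes>\<^sub>M L)"
    by (simp only:)
  qed
  show ?thesis
  proof (subst borel_measurable_euclidean_space, rule ballI)
   fix e :: "real^'d" assume "e \<in> Basis"
   then obtain i where e: "e = axis i 1" by (auto simp: Basis_vec_def)
   show "(%s. g b s \<bullet> e) \<in> borel_measurable borel" unfolding e inner_axis g_def using c by (simp add: borel_measurable_sum)
  qed
 qed
 have pm: "(?I b s) \<in> borel_measurable borel" for b s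
 proof -
  have [measurable]: "(%u. \<phi>' (s + u)) \<in> borel_measurable borel" by (rule measurable_compose[OF _ \<phi>'m]) simp
  show ?thesis by (cases b) (simp_all add: E_def)
 qed
 have pb: "norm (?I b s u) <= C\<phi>" for b s u
  using C\<phi>[of "s + u"] order_trans[OF norm_ge_zero C\<phi>] by (simp add: indicator_def)
 have pi: "integrable L (%u. D.w u $ i $ k * (?I b s u) $ k)" for b s i k
 proof -
  have "integrable L (%u. (D.w u $ i $ k) *\<^sub>R ((?I b s u) $ k))"
  proof (rule D.signed_integral_eq(1)[OF _ D.integrable_v_bounded])
   fix u show "norm ((?I b s u) $ k) <= C\<phi>"
    using component_le_norm_cart[of "?I b s u" k] pb[of b s u] by (simp only: real_norm_def)
  qed (rule borel_measurable_vec_nth[OF pm])+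
  then show ?thesis by simp
 qed
 define Cg where "Cg = (\<Sum>i\<in>(UNIV::'d set). \<Sum>k\<in>(UNIV::'d set). C\<phi> * (LINT u|L. D.v u))"
 have gb: "norm (g b s) <= Cg" for b s
 proof -
  have "norm (g b s) <= (\<Sum>i\<in>UNIV. norm (g b s $ i))" unfolding norm_vec_def by (rule L2_set_le_sum) auto
  also have "... <= Cg" unfolding Cg_def
  proof (rule sum_mono)
   fix i
   have "norm (g b s $ i) <= (\<Sum>k\<in>UNIV. \<bar>LINT u|L. D.w u $ i $ k * (?I b s u) $ k\<bar>)"
    unfolding g_def by simp
   also have "... <= (\<Sum>k\<in>(UNIV::'d set). C\<phi> * (LINT u|L. D.v u))"
   proof (rule sum_mono)
    fix k
    have "\<bar>LINT u|L. D.w u $ i $ k * (?I b s u) $ k\<bar> <= (LINT u|L. norm (D.w u $ i $ k * (?I b s u) $ k))"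
     unfolding real_norm_def[symmetric] by (rule integral_norm_bound)
    also have "... <= (LINT u|L. C\<phi> * D.v u)"
    proof (rule integral_mono)
     show "integrable L (%u. norm (D.w u $ i $ k * (?I b s u) $ k))" by (rule integrable_norm[OF pi])
     show "integrable L (%u. C\<phi> * D.v u)" using D.integrable_v by simp
     fix u
     have "\<bar>D.w u $ i $ k\<bar> * \<bar>(?I b s u) $ k\<bar> <= D.v u * C\<phi>"
     proof (rule mult_mono)
      show "\<bar>D.w u $ i $ k\<bar> <= D.v u" using order_trans[OF matrix_component_le_norm D.norm_w, of u i k] by simp
      show "\<bar>(?I b s u) $ k\<bar> <= C\<phi>"
       using component_le_norm_cart[of "?I b s u" k] pb[of b s u] by linarith
     qed (auto simp: D.v_nonneg)
     then show "norm (D.w u $ i $ k * (?I b s u) $ k) <= C\<phi> * D.v u"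
      by (simp only: real_norm_def abs_mult mult.commute[of C\<phi>])
    qed
    finally show "\<bar>LINT u|L. D.w u $ i $ k * (?I b s u) $ k\<bar> <= C\<phi> * (LINT u|L. D.v u)" by simp
   qed
   finally show "norm (g b s $ i) <= (\<Sum>k\<in>(UNIV::'d set). C\<phi> * (LINT u|L. D.v u))" .
  qed
  finally show ?thesis .
 qed
 \<comment> \<open>After time \<open>\<tau>\<close> the delay no longer reaches the initial segment,
   so \<open>g False\<close> is integrable against any exponential weight.\<close>
 have g0: "g False s = 0" if "s > \<tau>" for s
 proof -
  have "D.w u $ i $ k * (?I False s u) $ k = 0" for u i k
   using that D.w_off[of u] by (cases "u \<in> {-\<tau>..0}") (auto simp: E_def)
  note z = this
  show ?thesis unfolding g_def by (simp only: z) (simp add: vec_eq_iff)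
 qed
 define F where "F s = f s + g False s" for s
 have fm: "(%t. indicator {0..} t *\<^sub>R f t) \<in> borel_measurable borel" by (rule borel_measurable_continuous_on_indicator[OF _ f]) simp
 have gim: "(%t. indicator {0..} t *\<^sub>R g False t) \<in> borel_measurable borel" using gm by measurable
 have Fm: "(%t. indicator {0..} t *\<^sub>R F t) \<in> borel_measurable borel"
  unfolding F_def scaleR_add_right by (intro borel_measurable_add fm gim)
 have gi: "set_integrable lborel {0..} (%t. exp (- \<alpha> * t) * norm (g False t))"
  unfolding set_integrable_def
 proof (rule bochner_bound)
  show "integrable lborel (%t. (exp (\<bar>\<alpha>\<bar> * \<tau>) * Cg) * indicator {0..\<tau>} t)" by (rule integrable_const_Icc)
  show "(%t. indicator {0..} t *\<^sub>R (exp (- \<alpha> * t) * norm (g False t))) \<in> borel_measurable lborel" using gm by measurable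
  show "AE t in lborel. norm (indicator {0..} t *\<^sub>R (exp (- \<alpha> * t) * norm (g False t))) <= norm ((exp (\<bar>\<alpha>\<bar> * \<tau>) * Cg) * indicator {0..\<tau>} t)" (is "AE t in _. ?bd t")
  proof (intro AE_I2)
   fix t
   show "?bd t"
   proof (cases "0 <= t & t <= \<tau>")
    case True
    have "exp (- \<alpha> * t) * norm (g False t) <= exp (\<bar>\<alpha>\<bar> * \<tau>) * Cg"
     using True expb[of "- t" \<alpha>] gb by (intro mult_mono) auto
    then show ?thesis using True order_trans[OF norm_ge_zero gb[of False 0]] by (simp add: abs_mult)
   qed (use g0 in \<open>auto simp: not_le\<close>)
  qed
 qed
 have Fi: "set_integrable lborel {0..} (%t. exp (- \<alpha> * t) * norm (F t))"
  unfolding set_integrable_def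
 proof (rule bochner_bound)
  show "integrable lborel (%t. indicator {0..} t *\<^sub>R (exp (- \<alpha> * t) * norm (f t)) + indicator {0..} t *\<^sub>R (exp (- \<alpha> * t) * norm (g False t)))"
   using fi gi unfolding set_integrable_def by (rule Bochner_Integration.integrable_add)
  have "(%t. exp (- \<alpha> * t) * norm (indicator {0..} t *\<^sub>R F t)) \<in> borel_measurable borel" using Fm by measurable
  moreover have "exp (- \<alpha> * t) * norm (indicator {0..} t *\<^sub>R F t) = indicator {0..} t *\<^sub>R (exp (- \<alpha> * t) * norm (F t))" for t
   by (simp add: indicator_def)
  ultimately have "(%t. indicator {0..} t *\<^sub>R (exp (- \<alpha> * t) * norm (F t))) \<in> borel_measurable borel" by (simp only:)
  then show "(%t. indicator {0..} t *\<^sub>R (exp (- \<alpha> * t) * norm (F t))) \<in> borel_measurable lborel" by simp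
  show "AE t in lborel. norm (indicator {0..} t *\<^sub>R (exp (- \<alpha> * t) * norm (F t))) <=
   norm (indicator {0..} t *\<^sub>R (exp (- \<alpha> * t) * norm (f t)) + indicator {0..} t *\<^sub>R (exp (- \<alpha> * t) * norm (g False t)))"
  proof (intro AE_I2)
   fix t
   have "norm (F t) <= norm (f t) + norm (g False t)" unfolding F_def by (rule norm_triangle_ineq)
   then have "exp (- \<alpha> * t) * norm (F t) <= exp (- \<alpha> * t) * (norm (f t) + norm (g False t))" by (intro mult_left_mono) auto
   then show "norm (indicator {0..} t *\<^sub>R (exp (- \<alpha> * t) * norm (F t))) <=
    norm (indicator {0..} t *\<^sub>R (exp (- \<alpha> * t) * norm (f t)) + indicator {0..} t *\<^sub>R (exp (- \<alpha> * t) * norm (g False t)))"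
    by (simp add: indicator_def distrib_left)
  qed
 qed
 have Xc: "AE y in M. continuous_on {-\<tau>..} (%t. X t y)" using X unfolding delay_solution_def by blast
 have Xc0: "AE y in M. continuous_on {0..} (%t. X t y)"
  using Xc by eventually_elim (erule continuous_on_subset, use \<tau> in auto)
 have X\<phi>: "AE y in M. \<forall>t\<in>{-\<tau>..0}. X t y = \<phi> t" using X unfolding delay_solution_def by blast
 have main: "mean_square_null M (%t y. X t y /\<^sub>R (t ^ leading_exponent \<Delta> \<Lambda> * exp (\<alpha> * t)) -
      (\<Sum>z\<in>leading_roots \<Delta> \<Lambda>.
       sin (Im z * t) *\<^sub>R (Q_star \<Delta> \<Lambda> z *v \<phi> 0 + M1 M \<F> B F \<Sigma> \<alpha> (P_star \<Delta> \<Lambda> z) (Q_star \<Delta> \<Lambda> z) (Im z) y) +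
       cos (Im z * t) *\<^sub>R (P_star \<Delta> \<Lambda> z *v \<phi> 0 + M2 M \<F> B F \<Sigma> \<alpha> (P_star \<Delta> \<Lambda> z) (Q_star \<Delta> \<Lambda> z) (Im z) y)))"
 proof (rule solution_mean_square[OF \<alpha>(1,2) charm[symmetric] \<alpha>(3) Fm Fi \<Sigma> \<Sigma>i _ _ Xc0])
  fix t :: real assume t: "t >= 0"
  have "AE y in M. X t y = \<phi> 0
    + (LBINT s:{0..t}. f s + vector_integral {-\<tau>..0} \<nu> (%u. X (s + u) y))
    + ito_integral M \<F> B (%s y. indicator {0..t} s *\<^sub>R \<Sigma> s) y"
   using X t unfolding delay_solution_def by blast
  then show "AE y in M. X t y = \<phi> 0
    + (LBINT s:{0..t}. F s + (\<chi> i. \<Sum>k\<in>UNIV. K.kconv (%u. X u y $ k) i k s))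
    + ito_integral M \<F> B (%s y. indicator {0..t} s *\<^sub>R \<Sigma> s) y"
   using Xc X\<phi>
  proof eventually_elim
   case (elim y)
   \<comment> \<open>The path extended by 0 to the left of \<open>-\<tau>\<close>, to have a
     function that is measurable on the whole line.\<close>
   define Z where "Z x = indicator {-\<tau>..} x *\<^sub>R X x y" for x
   have Zm: "Z \<in> borel_measurable borel" unfolding Z_def[abs_def] by (rule borel_measurable_continuous_on_indicator[OF _ elim(2)]) simp
   have Znm: "(%x. Z x $ k) \<in> borel_measurable borel" for k by (rule borel_measurable_vec_nth[OF Zm])
   have vi: "vector_integral {-\<tau>..0} \<nu> (%u. X (s + u) y) = g False s + (\<chi> i. \<Sum>k\<in>UNIV. K.kconv (%u. X u y $ k) i k s)"
    if s: "s >= 0" for s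
   proof -
    have "bounded ((%x. X x y) ` {-\<tau>..s})"
     by (intro compact_imp_bounded compact_continuous_image continuous_on_subset[OF elim(2)]) auto
    then obtain C where C: "!!x. x \<in> {-\<tau>..s} ==> norm (X x y) <= C" unfolding bounded_iff by blast
    have zb: "norm (Z (s + u)) <= C" if "u \<in> {-\<tau>..0}" for u using C[of "s + u"] that s by (simp add: Z_def)
    have zm: "(%u. Z (s + u)) \<in> borel_measurable borel" by (rule measurable_compose[OF _ Zm]) simp
    have "vector_integral {-\<tau>..0} \<nu> (%u. X (s + u) y) = vector_integral {-\<tau>..0} \<nu> (%u. Z (s + u))"
     by (rule vector_integral_cong) (use s in \<open>auto simp: Z_def\<close>)
    moreover have "(LINT u|L. D.w u $ i $ k * Z (s + u) $ k) =
      (LINT u|L. D.w u $ i $ k * (?I False s u) $ k) + K.kconv (%u. X u y $ k) i k s" for i k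
    proof -
     have "K.kconv (%u. X u y $ k) i k s = K.kconv (%u. Z u $ k) i k s"
      by (rule K.kconv_cong) (use \<tau> in \<open>simp add: Z_def\<close>)
     also have "... = (LINT u|L. indicator {..s} (- u) * (Z (s - - u) $ k * w' (- u) $ i $ k))"
      unfolding K.kconv_def
     proof (rule tr)
      have [measurable]: "(%x. Z (s - x) $ k) \<in> borel_measurable borel" by (rule measurable_compose[OF _ Znm]) simp
      show "(%x. indicator {..s} x * (Z (s - x) $ k * w' x $ i $ k)) \<in> borel_measurable borel" using w'c[of i k] by measurable
     qed
     \<comment> \<open>On \<open>u < - s\<close> the argument \<open>s + u\<close> is negative,
       where the path is the initial segment. The convolution is therefore the full delay integral
       minus the integral over the history.\<close>
     also have "... = (LINT u|L. D.w u $ i $ k * Z (s + u) $ k - D.w u $ i $ k * (?I False s u) $ k)"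
     proof (rule bochner_cong[OF refl])
      fix u
      show "indicator {..s} (- u) * (Z (s - - u) $ k * w' (- u) $ i $ k) = D.w u $ i $ k * Z (s + u) $ k - D.w u $ i $ k * (?I False s u) $ k"
      proof (cases "u \<in> {-\<tau>..0}")
       case True
       then have "Z (s + u) = \<phi>' (s + u)" if "u < - s" using that s elim(3) by (auto simp: Z_def \<phi>'_def)
       then show ?thesis by (cases "u < - s") (auto simp: w'_def E_def)
      qed (simp add: w'_def D.w_off)
     qed
     also have "... = (LINT u|L. D.w u $ i $ k * Z (s + u) $ k) - (LINT u|L. D.w u $ i $ k * (?I False s u) $ k)"
     proof (rule Bochner_Integration.integral_diff[OF _ pi])
      have "integrable L (%u. (D.w u $ i $ k) *\<^sub>R (Z (s + u) $ k))"
      proof (rule D.signed_integral_eq(1)[OF _ D.integrable_v_bounded])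
       show "norm (Z (s + u) $ k) <= C" if "u \<in> {-\<tau>..0}" for u
        using component_le_norm_cart[of "Z (s + u)" k] zb[OF that] by simp
      qed (rule borel_measurable_vec_nth[OF zm])+
      then show "integrable L (%u. D.w u $ i $ k * Z (s + u) $ k)" by simp
     qed
     finally show ?thesis by simp
    qed
    moreover have "vector_integral {-\<tau>..0} \<nu> (%u. Z (s + u)) $ i = (\<Sum>k\<in>UNIV. LINT u|L. D.w u $ i $ k * Z (s + u) $ k)" for i
     by (rule D.vector_integral_eq[OF zm, of C]) (use zb in auto)
    ultimately show ?thesis by (simp add: vec_eq_iff g_def sum.distrib)
   qed
   have "(LBINT s:{0..t}. f s + vector_integral {-\<tau>..0} \<nu> (%u. X (s + u) y)) =
    (LBINT s:{0..t}. F s + (\<chi> i. \<Sum>k\<in>UNIV. K.kconv (%u. X u y $ k) i k s))"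
    by (rule set_lebesgue_integral_cong) (auto simp: vi F_def add.assoc)
   then show ?case using elim(1) by simp
  qed
 qed auto
 \<comment> \<open>A finite measure has at most countably many atoms. For all other \<open>s\<close>
   the end point \<open>- s\<close> carries no mass and the two versions of \<open>g\<close>
   agree.\<close>
 have countable: "AE s in lborel. measure L {- s} = 0"
 proof -
  have "countable {x. measure L {x} \<noteq> 0}" by (rule D.countable_support)
  then have "countable (uminus ` {x. measure L {x} \<noteq> 0})" by (rule countable_image)
  then have "AE s in lborel. s \<notin> uminus ` {x. measure L {x} \<noteq> 0}" by (intro AE_not_in countable_imp_null_set_lborel)
  then show ?thesis
  proof eventually_elim
   case (elim s)
   then show ?case by (metis (mono_tags, lifting) imageI mem_Collect_eq minus_minus)
  qed
 qed
 \<comment> \<open>The substitution \<open>u = - s\<close> leads from forcing over positive times to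
   the integrals over \<open>[-\<tau>, 0]\<close> in \<open>G1\<close> and
   \<open>G2\<close>.\<close>
 have shift: "(LBINT s:{0..}. A s *v g False s) =
   (LBINT u:{-\<tau>..0}. A (- u) *v vector_integral {-\<tau>..0} \<nu> (%s. indicator {-\<tau>..u} s *\<^sub>R \<phi> (s - u)))"
  if Am: "A \<in> borel_measurable borel" for A
 proof -
  have v: "vector_integral {-\<tau>..0} \<nu> (%s. indicator {-\<tau>..u} s *\<^sub>R \<phi> (s - u)) = g True (- u)" if u: "u \<in> {-\<tau>..0}" for u
  proof -
   have "vector_integral {-\<tau>..0} \<nu> (%s. indicator {-\<tau>..u} s *\<^sub>R \<phi> (s - u)) = vector_integral {-\<tau>..0} \<nu> (%s. indicator (E True (- u)) s *\<^sub>R \<phi>' (- u + s))"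
    by (rule vector_integral_cong) (use u in \<open>auto simp: E_def \<phi>'_def indicator_def\<close>)
   then show ?thesis by (simp only: vec_eq_iff D.vector_integral_eq[OF pm pb] g_def vec_lambda_beta) simp
  qed
  have ae: "AE s in lborel. g True s = g False s"
   using countable
  proof eventually_elim
   case (elim s)
   have "(LINT u|L. D.w u $ i $ k * (indicator (E True s) u *\<^sub>R \<phi>' (s + u)) $ k) = (LINT u|L. D.w u $ i $ k * (?I False s u) $ k)" for i k
   proof (rule integral_cong_AE)
    have "{- s} \<in> null_sets L" using elim D.sets_L by (intro null_setsI) (simp_all add: D.emeasure_eq_measure)
    then have "AE u in L. u \<notin> {- s}" by (rule AE_not_in)
    then show "AE u in L. D.w u $ i $ k * (indicator (E True s) u *\<^sub>R \<phi>' (s + u)) $ k = D.w u $ i $ k * (?I False s u) $ k"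
     by eventually_elim (auto simp: E_def indicator_def)
   qed (use pi in \<open>simp_all add: borel_measurable_integrable\<close>)
   then show ?case by (simp add: g_def)
  qed
  have "(LBINT u:{-\<tau>..0}. A (- u) *v vector_integral {-\<tau>..0} \<nu> (%s. indicator {-\<tau>..u} s *\<^sub>R \<phi> (s - u))) =
   (LBINT u:{-\<tau>..0}. A (0 - u) *v g True (0 - u))"
   by (rule set_lebesgue_integral_cong) (auto simp: v)
  also have "... = (LBINT s:{0..\<tau>}. A s *v g True s)"
   using set_lborel_reflect[of "-\<tau>" 0 "%s. A s *v g True s"] by simp
  also have "... = (LBINT s:{0..}. A s *v g False s)"
   unfolding set_lebesgue_integral_def
  proof (rule integral_cong_AE)
   have "(%s. A s *v g b s) \<in> borel_measurable borel" for b by (intro borel_measurable_matrix_vector_mult Am gm)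
   then show "(%s. indicator {0..\<tau>} s *\<^sub>R (A s *v g True s)) \<in> borel_measurable lborel" "(%s. indicator {0..} s *\<^sub>R (A s *v g False s)) \<in> borel_measurable lborel"
    by simp_all
   show "AE s in lborel. indicator {0..\<tau>} s *\<^sub>R (A s *v g True s) = indicator {0..} s *\<^sub>R (A s *v g False s)"
    using ae
   proof eventually_elim
    case (elim s)
    then show ?case using g0[of s] by (cases "s <= \<tau>") (auto simp: indicator_def)
   qed
  qed
  finally show ?thesis by simp
 qed
 have split: "(LBINT s:{0..}. (exp (- \<alpha> * s) *\<^sub>R A s) *v F s) = (LBINT s:{0..}. (exp (- \<alpha> * s) *\<^sub>R A s) *v f s) +
   (LBINT u:{-\<tau>..0}. (exp (\<alpha> * u) *\<^sub>R A (- u)) *v vector_integral {-\<tau>..0} \<nu> (%s. indicator {-\<tau>..u} s *\<^sub>R \<phi> (s - u)))"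
  if Ac: "continuous_on UNIV A" and Ab: "!!s. norm (A s) <= C" for A :: "real => real^'d^'d" and C
 proof -
  have Am: "(%s. exp (- \<alpha> * s) *\<^sub>R A s) \<in> borel_measurable borel"
   by (intro borel_measurable_continuous_onI continuous_intros Ac)
  have Ab': "norm (exp (- \<alpha> * s) *\<^sub>R A s) <= exp (- \<alpha> * s) * C" for s using Ab[of s] by simp
  have "(LBINT s:{0..}. (exp (- \<alpha> * s) *\<^sub>R A s) *v F s) = (LBINT s:{0..}. (exp (- \<alpha> * s) *\<^sub>R A s) *v f s) + (LBINT s:{0..}. (exp (- \<alpha> * s) *\<^sub>R A s) *v g False s)"
   unfolding F_def matrix_vector_right_distrib
   by (intro set_integral_add(2) exp_weighted_mult_integrable[OF fm fi Am Ab'] exp_weighted_mult_integrable[OF gim gi Am Ab'])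
  then show ?thesis unfolding shift[OF Am] by simp
 qed
 have bdd: "norm (sin x *\<^sub>R P + cos x *\<^sub>R Q) <= norm P + norm Q" "norm (cos x *\<^sub>R P - sin x *\<^sub>R Q) <= norm P + norm Q" for x and P Q :: "real^'d^'d"
 proof -
  show "norm (sin x *\<^sub>R P + cos x *\<^sub>R Q) <= norm P + norm Q"
   by (intro order_trans[OF norm_triangle_ineq] add_mono) (simp_all add: mult_left_le_one_le)
  show "norm (cos x *\<^sub>R P - sin x *\<^sub>R Q) <= norm P + norm Q"
   by (intro order_trans[OF norm_triangle_ineq4] add_mono) (simp_all add: mult_left_le_one_le)
 qed
 \<comment> \<open>The reflection of \<open>s\<close> changes the sign of the sine. This explains
   the different signs in \<open>G1\<close> and in \<open>M1\<close>, and likewise in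
   \<open>G2\<close> and \<open>M2\<close>.\<close>
 have m1: "M1 M \<F> B F \<Sigma> \<alpha> P Q \<beta> y = G1 \<tau> \<nu> \<phi> \<alpha> P Q \<beta> + M1 M \<F> B f \<Sigma> \<alpha> P Q \<beta> y" for P Q \<beta> y
 proof -
  have "continuous_on UNIV (%s. sin (\<beta> * s) *\<^sub>R P + cos (\<beta> * s) *\<^sub>R Q)" by (intro continuous_intros)
  from split[OF this bdd(1)] show ?thesis unfolding M1_def G1_def by simp
 qed
 have m2: "M2 M \<F> B F \<Sigma> \<alpha> P Q \<beta> y = G2 \<tau> \<nu> \<phi> \<alpha> P Q \<beta> + M2 M \<F> B f \<Sigma> \<alpha> P Q \<beta> y" for P Q \<beta> y
 proof -
  have "continuous_on UNIV (%s. cos (\<beta> * s) *\<^sub>R P - sin (\<beta> * s) *\<^sub>R Q)" by (intro continuous_intros)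
  from split[OF this bdd(2)] show ?thesis unfolding M2_def G2_def by simp
 qed
 show ?thesis using main unfolding m1 m2 add.assoc .
qed

end

theorem mainTheorem3:
 fixes M :: "'a measure" and \<F> :: "real \<Rightarrow> 'a measure" and B :: "real \<Rightarrow> 'a \<Rightarrow> real^'e"
 assumes "prob_space M" and "complete_measure M" and "filtration_on M \<F>" and "brownian_motion M \<F> B"
 shows
  "(\<forall>(\<mu> :: real set \<Rightarrow> real^'d^'d) (f :: real \<Rightarrow> real^'d) (\<Sigma> :: real \<Rightarrow> real^'e^'d)
    (X0 :: 'a \<Rightarrow> real^'d) (X :: real \<Rightarrow> 'a \<Rightarrow> real^'d).
   let \<Delta> = volterra_char \<mu>; \<Lambda> = volterra_roots \<mu>;
     \<alpha> = real_of_ereal (root_abscissa \<Lambda>); n = leading_exponent \<Delta> \<Lambda>;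
     P = P_star \<Delta> \<Lambda>; Q = Q_star \<Delta> \<Lambda>
   in matrix_measure {0..} \<mu> \<longrightarrow> alpha_star \<mu> < root_abscissa \<Lambda> \<longrightarrow>
     continuous_on {0..} f \<longrightarrow> set_integrable lborel {0..} (\<lambda>t. exp (- \<alpha> * t) * norm (f t)) \<longrightarrow>
     continuous_on {0..} \<Sigma> \<longrightarrow> set_integrable lborel {0..} (\<lambda>t. exp (- 2 * \<alpha> * t) * (norm (\<Sigma> t))\<^sup>2) \<longrightarrow>
     X0 \<in> borel_measurable (\<F> 0) \<longrightarrow> integrable M (\<lambda>\<omega>. (norm (X0 \<omega>))\<^sup>2) \<longrightarrow>
     volterra_solution M \<F> B \<mu> f \<Sigma> X0 X \<longrightarrow>
     mean_square_null M (\<lambda>t \<omega>. X t \<omega> /\<^sub>R (t ^ n * exp (\<alpha> * t)) -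
      (\<Sum>z\<in>leading_roots \<Delta> \<Lambda>.
       sin (Im z * t) *\<^sub>R (Q z *v X0 \<omega> + M1 M \<F> B f \<Sigma> \<alpha> (P z) (Q z) (Im z) \<omega>) +
       cos (Im z * t) *\<^sub>R (P z *v X0 \<omega> + M2 M \<F> B f \<Sigma> \<alpha> (P z) (Q z) (Im z) \<omega>))))
  \<and>
  (\<forall>(\<tau> :: real) (\<nu> :: real set \<Rightarrow> real^'d^'d) (f :: real \<Rightarrow> real^'d) (\<Sigma> :: real \<Rightarrow> real^'e^'d)
    (\<phi> :: real \<Rightarrow> real^'d) (X :: real \<Rightarrow> 'a \<Rightarrow> real^'d).
   let \<Delta> = delay_char \<tau> \<nu>; \<Lambda> = delay_roots \<tau> \<nu>;
     \<alpha> = real_of_ereal (root_abscissa \<Lambda>); n = leading_exponent \<Delta> \<Lambda>;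
     P = P_star \<Delta> \<Lambda>; Q = Q_star \<Delta> \<Lambda>
   in \<tau> \<ge> 0 \<longrightarrow> matrix_measure {-\<tau>..0} \<nu> \<longrightarrow>
     continuous_on {0..} f \<longrightarrow> set_integrable lborel {0..} (\<lambda>t. exp (- \<alpha> * t) * norm (f t)) \<longrightarrow>
     continuous_on {0..} \<Sigma> \<longrightarrow> set_integrable lborel {0..} (\<lambda>t. exp (- 2 * \<alpha> * t) * (norm (\<Sigma> t))\<^sup>2) \<longrightarrow>
     continuous_on {-\<tau>..0} \<phi> \<longrightarrow>
     delay_solution M \<F> B \<tau> \<nu> f \<Sigma> \<phi> X \<longrightarrow>
     mean_square_null M (\<lambda>t \<omega>. X t \<omega> /\<^sub>R (t ^ n * exp (\<alpha> * t)) -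
      (\<Sum>z\<in>leading_roots \<Delta> \<Lambda>.
       sin (Im z * t) *\<^sub>R (Q z *v \<phi> 0 + G1 \<tau> \<nu> \<phi> \<alpha> (P z) (Q z) (Im z)
        + M1 M \<F> B f \<Sigma> \<alpha> (P z) (Q z) (Im z) \<omega>) +
       cos (Im z * t) *\<^sub>R (P z *v \<phi> 0 + G2 \<tau> \<nu> \<phi> \<alpha> (P z) (Q z) (Im z)
        + M2 M \<F> B f \<Sigma> \<alpha> (P z) (Q z) (Im z) \<omega>))))"
proof -
 interpret brownian M \<F> B
  using assms(1,3,4) by (intro brownian.intro brownian_axioms.intro)
 show ?thesis
  unfolding Let_def by (intro conjI allI impI volterra_mean_square delay_mean_square)
qed

end
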